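(* Let $d\in\mathbb{N}$, $\sigma\in(0,1]$ with $\sigma<d/2$ if $d\in\{1,2\}$, and $\alpha_0=\frac{d/2+\sigma}{2}$. For $\alpha\in(\sigma,d/2)$, the weight $w_{\sigma,\alpha}=\kappa_{\sigma-\alpha}/\kappa_{-\alpha}$ is a null-critical Hardy weight for $\Delta^\sigma$ on $\mathbb{Z}^d$ if and only if $\alpha=\alpha_0$.
   Context: For $f:\mathbb{Z}^d\to\mathbb{R}$ let $\Delta f(x)=\sum_{y:|y-x|=1}(f(x)-f(y))$ ($|\cdot|$ Euclidean norm), with heat semigroup $e^{-t\Delta}$ on $\ell^2(\mathbb{Z}^d)$; $1_0$ is the indicator of $\{0\}$. For $\sigma\in(0,1)$, $\Delta^\sigma$ is defined on $\ell^2$ by the spectral theorem, $\Delta^1=\Delta$. For $\beta\in(-d/2,1]$ the Riesz kernel $\kappa_\beta:\mathbb{Z}^d\to[0,\infty)$ is given by $\kappa_0=1_0$, $\kappa_1(x)=1_{\{|x|=1\}}$, $\kappa_\beta(0)=0$ if $\beta\in(0,1)$, and otherwise $\kappa_\beta(x)=\frac{1}{|\Gamma(-\beta)|}\int_0^\infty e^{-t\Delta}1_0(x)\,\frac{dt}{t^{1+\beta}}$. Let $Q^\sigma(f)=\frac12\sum_{x,y}\kappa_\sigma(x-y)(f(x)-f(y))^2$ (equal to $\langle\Delta^\sigma\varphi,\varphi\rangle$ for finitely supported $\varphi$), and let $\mathcal{D}_0^\sigma$ be the closure of finitely supported functions $C_c(\mathbb{Z}^d)$ under $\|\varphi\|=\sqrt{Q^\sigma(\varphi)+|\varphi(0)|^2}$.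 A function $w:\mathbb{Z}^d\to[0,\infty)$ is a Hardy weight if $Q^\sigma(\varphi)\ge\sum_xw(x)\varphi(x)^2$ for all $\varphi\in C_c(\mathbb{Z}^d)$ (then also for all $\varphi\in\mathcal{D}_0^\sigma$). A Hardy weight $w$ is critical if every Hardy weight $w'\ge w$ equals $w$ (subcritical otherwise). A critical Hardy weight $w$ is positive critical if there is a nonzero $v\in\mathcal{D}_0^\sigma$ with $Q^\sigma(v)=\sum_xw(x)v(x)^2$, and null-critical otherwise. *)

theory Defs
  imports "HOL-Analysis.Analysis"
begin

definition lnorm :: "int ^ 'd \<Rightarrow> real" where
  "lnorm x = sqrt (\<Sum>i\<in>UNIV. (real_of_int (x $ i))\<^sup>2)"

definition nbrs :: "int ^ 'd \<Rightarrow> (int ^ 'd) set" where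
  "nbrs x = {y. lnorm (y - x) = 1}"

definition lapl :: "(int ^ 'd \<Rightarrow> real) \<Rightarrow> (int ^ 'd \<Rightarrow> real)" where
  "lapl f x = (\<Sum>y\<in>nbrs x. f x - f y)"

definition delta0 :: "int ^ 'd \<Rightarrow> real" where
  "delta0 x = (if x = 0 then 1 else 0)"

text \<open>Heat kernel: (e^{-t Delta} 1_0)(x), Delta bounded, so given by the exponential series.\<close>
definition heat :: "real \<Rightarrow> int ^ 'd \<Rightarrow> real" where
  "heat t x = (\<Sum>n. (-t) ^ n / fact n * (lapl ^^ n) delta0 x)"

definition kappa :: "real \<Rightarrow> int ^ 'd \<Rightarrow> real" where
  "kappa \<beta> x =
     (if \<beta> \<le> - real CARD('d) / 2 \<or> \<beta> > 1 then 0
      else if \<beta> = 0 then delta0 x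
      else if \<beta> = 1 then (if lnorm x = 1 then 1 else 0)
      else if 0 < \<beta> \<and> x = 0 then 0
      else (1 / \<bar>Gamma (- \<beta>)\<bar>) * integral {0<..} (\<lambda>t. heat t x / t powr (1 + \<beta>)))"

definition Qform :: "real \<Rightarrow> (int ^ 'd \<Rightarrow> real) \<Rightarrow> ennreal" where
  "Qform \<sigma> f = (\<Sum>\<^sub>\<infinity>p\<in>UNIV.
       ennreal (1/2 * kappa \<sigma> (fst p - snd p) * (f (fst p) - f (snd p))\<^sup>2))"

definition wsum :: "(int ^ 'd \<Rightarrow> real) \<Rightarrow> (int ^ 'd \<Rightarrow> real) \<Rightarrow> ennreal" where
  "wsum w f = (\<Sum>\<^sub>\<infinity>x\<in>UNIV. ennreal (w x * (f x)\<^sup>2))"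

definition fin_supp :: "(int ^ 'd \<Rightarrow> real) \<Rightarrow> bool" where
  "fin_supp f \<longleftrightarrow> finite {x. f x \<noteq> 0}"

definition D0 :: "real \<Rightarrow> (int ^ 'd \<Rightarrow> real) set" where
  "D0 \<sigma> = {v. \<exists>\<phi>. (\<forall>n. fin_supp (\<phi> n)) \<and>
      ((\<lambda>n. Qform \<sigma> (\<lambda>x. v x - \<phi> n x) + ennreal ((v 0 - \<phi> n 0)\<^sup>2)) \<longlongrightarrow> 0) sequentially}"

definition hardy_weight :: "real \<Rightarrow> (int ^ 'd \<Rightarrow> real) \<Rightarrow> bool" where
  "hardy_weight \<sigma> w \<longleftrightarrow> (\<forall>x. 0 \<le> w x) \<and>
     (\<forall>\<phi>. fin_supp \<phi> \<longrightarrow> wsum w \<phi> \<le> Qform \<sigma> \<phi>)"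

definition critical :: "real \<Rightarrow> (int ^ 'd \<Rightarrow> real) \<Rightarrow> bool" where
  "critical \<sigma> w \<longleftrightarrow> hardy_weight \<sigma> w \<and>
     (\<forall>w'. hardy_weight \<sigma> w' \<and> (\<forall>x. w x \<le> w' x) \<longrightarrow> w' = w)"

definition positive_critical :: "real \<Rightarrow> (int ^ 'd \<Rightarrow> real) \<Rightarrow> bool" where
  "positive_critical \<sigma> w \<longleftrightarrow> critical \<sigma> w \<and>
     (\<exists>v\<in>D0 \<sigma>. v \<noteq> (\<lambda>x. 0) \<and> Qform \<sigma> v = wsum w v)"

definition null_critical :: "real \<Rightarrow> (int ^ 'd \<Rightarrow> real) \<Rightarrow> bool" where
  "null_critical \<sigma> w \<longleftrightarrow> critical \<sigma> w \<and> \<not> positive_critical \<sigma> w"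

definition wsa :: "real \<Rightarrow> real \<Rightarrow> int ^ 'd \<Rightarrow> real" where
  "wsa \<sigma> \<alpha> x = kappa (\<sigma> - \<alpha>) x / kappa (- \<alpha>) x"

end

theory Submission
  imports Defs "HOL-Probability.Characteristic_Functions" "HOL-Real_Asymp.Real_Asymp"
begin

text \<open>
  Let \<open>rmom a x\<close> be the integral of \<open>heat t x * t powr (a - 1)\<close> over \<open>t > 0\<close>, so that
  \<open>kappa (- a) = rmom a / Gamma a\<close> and \<open>wsa \<sigma> a = gamma_ratio \<sigma> a * rmom (a - \<sigma>) / rmom a\<close>. The
  semigroup property shows that \<open>u = rmom a\<close> solves \<open>\<Delta>\<^sup>\<sigma> u = wsa \<sigma> a * u\<close>, whence
  \<open>wsa \<sigma> a\<close> is a Hardy weight by the ground state representation. It also shows that the sum of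
  \<open>wsa \<sigma> a x * (rmom a x)\<^sup>2\<close> is a multiple of the moment of order \<open>2 * a - \<sigma>\<close> at the origin,
  which is finite exactly for \<open>2 * a - \<sigma> < d/2\<close>, that is below the midpoint \<open>b\<close> of \<open>\<sigma>\<close> and \<open>d/2\<close>.

  If \<open>a < b\<close>, the ground state \<open>rmom a\<close> therefore has finite energy and attains equality. If \<open>a > b\<close>,
  the local limit theorem gives \<open>wsa \<sigma> a x\<close> the leading term
  \<open>4 powr \<sigma> * gamma_ratio \<sigma> a * gamma_ratio \<sigma> (2 * b - a)\<close> times \<open>lnorm x powr (- 2 * \<sigma>)\<close>; by strict
  log-concavity of \<open>gamma_ratio \<sigma>\<close> the weight for \<open>b\<close> is larger outside a finite set, and the minimum of
  \<open>rmom a\<close> and a large multiple of \<open>rmom b\<close> is a supersolution for a weight exceeding \<open>wsa \<sigma> a\<close> at a point.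

  If \<open>a = b\<close>, the functions \<open>rmom (b - \<epsilon>)\<close> form a null sequence: their energy is of order \<open>1/\<epsilon>\<close>, but it
  exceeds their \<open>wsa \<sigma> b\<close>-norm only by a factor \<open>1 + O(\<epsilon>\<^sup>2)\<close>, because \<open>t powr (- \<epsilon>)\<close> has variance
  \<open>O(\<epsilon>\<^sup>2)\<close> under the density proportional to \<open>heat t x * t powr (b - 1)\<close>, uniformly in \<open>x\<close>. So no
  Hardy weight is larger. Equality for \<open>v\<close> forces \<open>v\<close> to be a multiple of \<open>rmom b\<close>, whose energy is
  infinite.
\<close>

section \<open>Sums over the lattice\<close>

text \<open>Sums and time integrals are taken in \<open>ennreal\<close>, so interchanges follow from
  Tonelli with no integrability conditions. The price is that nothing can be subtracted: the
  equation for \<open>u\<close> takes the form \<open>ktot * u = conv u + h\<close>, and a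
  difference is obtained by cancelling a finite summand common to both sides. Tonelli also needs a
  sign, and away from the origin \<open>heat t x - heat (s + t) x\<close> has none; this is why the
  equation is derived for the values at \<open>x\<close> and at the origin together. Positivity of
  the kernel is invisible in its defining series, whose terms have no sign. It comes from splitting
  off the diagonal part of the Laplacian, whereas the local limit theorem needs a Fourier
  representation; uniqueness for the heat equation identifies the two. At the midpoint the functions
  \<open>rmom (b - \<epsilon>)\<close> are preferred to spatial cutoffs of \<open>rmom b\<close>
  because the semigroup property expresses their energy exactly by a moment at the origin.\<close>

lemma infsum_ennreal_eq_nn_integral:
  fixes f :: "'a :: countable \<Rightarrow> ennreal"
  shows "infsum f UNIV = (\<integral>\<^sup>+x. f x \<partial>count_space UNIV)"
proof -
  have 1: "infsum f UNIV = (SUP F\<in>{F. finite F}. sum f F)"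
    by (subst nonneg_infsum_complete) auto
  have le: "sum f F \<le> (\<integral>\<^sup>+x. f x \<partial>count_space UNIV)" if "finite F" for F
  proof -
    have "sum f F = (\<integral>\<^sup>+x. f x \<partial>count_space F)"
      using that by (simp add: nn_integral_count_space_finite)
    also have "\<dots> \<le> (\<integral>\<^sup>+x. f x \<partial>count_space UNIV)"
      by (subst nn_integral_count_space_indicator)
         (auto intro!: nn_integral_mono simp: indicator_def)
    finally show ?thesis .
  qed
  define F where "F n = {x::'a. to_nat x < n}" for n
  have finF: "finite (F n)" for n
  proof -
    have "finite (to_nat -` {..<n} :: 'a set)" by (rule finite_vimageI) auto
    thus ?thesis by (simp add: F_def vimage_def)
  qed
  have "(\<integral>\<^sup>+x. f x \<partial>count_space UNIV) = (\<integral>\<^sup>+x. (SUP n. f x * indicator (F n) x) \<partial>count_space UNIV)"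
  proof (rule nn_integral_cong)
    fix x :: 'a
    have "f x \<le> (SUP n. f x * indicator (F n) x)"
      by (rule SUP_upper2[of "Suc (to_nat x)"]) (auto simp: F_def)
    moreover have "(SUP n. f x * indicator (F n) x) \<le> f x"
      by (rule SUP_least) (auto simp: indicator_def)
    ultimately show "f x = (SUP n. f x * indicator (F n) x)" by (rule antisym)
  qed
  also have "\<dots> = (SUP n. \<integral>\<^sup>+x. f x * indicator (F n) x \<partial>count_space UNIV)"
    by (rule nn_integral_monotone_convergence_SUP)
       (auto simp: incseq_def le_fun_def F_def indicator_def)
  also have "\<dots> = (SUP n. sum f (F n))"
  proof (rule SUP_cong)
    fix n
    have "(\<integral>\<^sup>+x. f x * indicator (F n) x \<partial>count_space UNIV) = (\<integral>\<^sup>+x. f x \<partial>count_space (F n))"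
      by (subst nn_integral_count_space_indicator) auto
    thus "(\<integral>\<^sup>+x. f x * indicator (F n) x \<partial>count_space UNIV) = sum f (F n)"
      using finF by (simp add: nn_integral_count_space_finite)
  qed auto
  also have "\<dots> \<le> (SUP F\<in>{F. finite F}. sum f F)"
    using finF by (intro SUP_mono) auto
  finally have 2: "(\<integral>\<^sup>+x. f x \<partial>count_space UNIV) \<le> (SUP F\<in>{F. finite F}. sum f F)" .
  have 3: "(SUP F\<in>{F. finite F}. sum f F) \<le> (\<integral>\<^sup>+x. f x \<partial>count_space UNIV)"
    using le by (intro SUP_least) auto
  show ?thesis unfolding 1 using 2 3 by (rule antisym[rotated])
qed

lemma nn_integral_count_space_bij:
  assumes "bij g"
  shows "(\<integral>\<^sup>+x. f (g x) \<partial>count_space UNIV) = (\<integral>\<^sup>+x. f x \<partial>count_space UNIV)"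
  using assms by (rule nn_integral_bij_count_space)

lemma nn_integral_count_space_shift:
  fixes c :: "'a :: ab_group_add"
  shows "(\<integral>\<^sup>+x. f (x + c) \<partial>count_space UNIV) = (\<integral>\<^sup>+x. f x \<partial>count_space UNIV)"
    and "(\<integral>\<^sup>+x. f (x - c) \<partial>count_space UNIV) = (\<integral>\<^sup>+x. f x \<partial>count_space UNIV)"
    and "(\<integral>\<^sup>+x. f (c - x) \<partial>count_space UNIV) = (\<integral>\<^sup>+x. f x \<partial>count_space UNIV)"
proof -
  have "bij (\<lambda>x. x + c)" "bij (\<lambda>x. x - c)" "bij (\<lambda>x. c - x)"
    by (auto intro: o_bij[of "\<lambda>x. x - c"] o_bij[of "\<lambda>x. x + c"] o_bij[of "\<lambda>x. c - x"] simp: fun_eq_iff)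
  thus "(\<integral>\<^sup>+x. f (x + c) \<partial>count_space UNIV) = (\<integral>\<^sup>+x. f x \<partial>count_space UNIV)"
    "(\<integral>\<^sup>+x. f (x - c) \<partial>count_space UNIV) = (\<integral>\<^sup>+x. f x \<partial>count_space UNIV)"
    "(\<integral>\<^sup>+x. f (c - x) \<partial>count_space UNIV) = (\<integral>\<^sup>+x. f x \<partial>count_space UNIV)"
    by (auto intro: nn_integral_count_space_bij)
qed

lemma nn_integral_count_space_pair:
  fixes f :: "'a :: countable \<Rightarrow> 'a \<Rightarrow> ennreal"
  shows "(\<integral>\<^sup>+p. f (fst p) (snd p) \<partial>count_space UNIV)
     = (\<integral>\<^sup>+x. \<integral>\<^sup>+y. f x y \<partial>count_space UNIV \<partial>count_space UNIV)"
  by (subst nn_integral_fst_count_space[symmetric]) simp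

lemma nn_integral_count_space_swap:
  fixes f :: "'a :: countable \<Rightarrow> 'a \<Rightarrow> ennreal"
  shows "(\<integral>\<^sup>+x. \<integral>\<^sup>+y. f x y \<partial>count_space UNIV \<partial>count_space UNIV)
    = (\<integral>\<^sup>+y. \<integral>\<^sup>+x. f x y \<partial>count_space UNIV \<partial>count_space UNIV)"
proof -
  have "(\<integral>\<^sup>+x. \<integral>\<^sup>+y. (\<lambda>(x, y). f x y) (x, y) \<partial>count_space UNIV \<partial>count_space UNIV)
    = (\<integral>\<^sup>+y. \<integral>\<^sup>+x. (\<lambda>(x, y). f x y) (x, y) \<partial>count_space UNIV \<partial>count_space UNIV)"
    by (subst nn_integral_fst_count_space, subst nn_integral_snd_count_space) rule
  thus ?thesis by simp
qed

text \<open>Tonelli with one counting factor. Measurability in the other variable alone suffices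
  because the counting factor is countable.\<close>

lemma nn_integral_swap_count_space:
  fixes f :: "'a \<Rightarrow> 'b :: countable \<Rightarrow> ennreal"
  assumes "sigma_finite_measure M" "\<And>y. (\<lambda>x. f x y) \<in> borel_measurable M"
  shows "(\<integral>\<^sup>+x. (\<integral>\<^sup>+y. f x y \<partial>count_space UNIV) \<partial>M) = (\<integral>\<^sup>+y. (\<integral>\<^sup>+x. f x y \<partial>M) \<partial>count_space UNIV)"
proof -
  interpret pair_sigma_finite "count_space (UNIV :: 'b set)" M
    using assms(1) by (intro pair_sigma_finite.intro sigma_finite_measure_count_space)
  have "(\<lambda>(y, x). f x y) \<in> borel_measurable (count_space UNIV \<Otimes>\<^sub>M M)"
    by (rule measurable_pair_measure_countable1) (use assms(2) in auto)
  from Fubini'[OF this] show ?thesis .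
qed

section \<open>Nearest neighbours on the lattice\<close>

text \<open>The adjacency operator, so that \<open>lapl\<close> is \<open>2 * CARD('d)\<close> times
  the identity minus \<open>adj\<close>. Unlike \<open>lapl\<close> it preserves nonnegative
  functions, and \<open>(adj ^^ n) delta0 x\<close> counts the walks of \<open>n\<close> steps from
  the origin to \<open>x\<close>.\<close>

definition adj :: "(int ^ 'd \<Rightarrow> real) \<Rightarrow> int ^ 'd \<Rightarrow> real" where
  "adj f x = (\<Sum>i\<in>UNIV. f (x + axis i 1) + f (x - axis i 1))"

lemma lnorm_eq_1_iff: "lnorm z = 1 \<longleftrightarrow> (\<exists>i. z = axis i 1 \<or> z = - axis i 1)"
proof
  assume "lnorm z = 1"
  hence "(\<Sum>i\<in>UNIV. (real_of_int (z $ i))\<^sup>2) = 1"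
    unfolding lnorm_def by simp
  hence "real_of_int (\<Sum>i\<in>UNIV. (z $ i)\<^sup>2) = 1" by simp
  hence s: "(\<Sum>i\<in>UNIV. (z $ i)\<^sup>2) = 1" by linarith
  obtain i where i: "z $ i \<noteq> 0"
  proof (rule ccontr)
    assume "\<not> thesis"
    hence "\<forall>i. z $ i = 0" using that by blast
    thus False using s by simp
  qed
  have s2: "(z $ i)\<^sup>2 + (\<Sum>j\<in>UNIV - {i}. (z $ j)\<^sup>2) = 1"
    using s by (subst (asm) sum.remove[of _ i]) auto
  have ge: "(\<Sum>j\<in>UNIV - {i}. (z $ j)\<^sup>2) \<ge> 0" by (rule sum_nonneg) auto
  have "(z $ i)\<^sup>2 > 0" using i by simp
  hence zi: "(z $ i)\<^sup>2 = 1" and z0: "(\<Sum>j\<in>UNIV - {i}. (z $ j)\<^sup>2) = 0" using s2 ge by linarith+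
  have "z $ j = 0" if "j \<noteq> i" for j
    using z0 that by (subst (asm) sum_nonneg_eq_0_iff) auto
  moreover have "z $ i = 1 \<or> z $ i = -1" using zi by (simp add: power2_eq_1_iff)
  ultimately show "\<exists>i. z = axis i 1 \<or> z = - axis i 1"
    by (intro exI[of _ i]) (auto simp: vec_eq_iff axis_def)
next
  assume "\<exists>i. z = axis i 1 \<or> z = - axis i 1"
  then obtain i where "z = axis i 1 \<or> z = - axis i 1" by blast
  hence "(real_of_int (z $ j))\<^sup>2 = (if j = i then 1 else 0)" for j by (auto simp: axis_def)
  thus "lnorm z = 1" by (simp add: lnorm_def)
qed

lemma axis_1_neq: "(axis i 1 :: int ^ 'd::finite) \<noteq> - axis j 1"
proof
  assume "(axis i 1 :: int ^ 'd) = - axis j 1"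
  hence "(axis i 1 :: int ^ 'd) $ i = (- axis j 1) $ i" by simp
  thus False by (simp add: axis_def split: if_splits)
qed

lemma axis_1_eq_iff: "(axis i 1 :: int ^ 'd::finite) = axis j 1 \<longleftrightarrow> i = j"
  by (simp add: axis_eq_axis)

lemma sum_nbrs:
  fixes f :: "int ^ 'd::finite \<Rightarrow> real"
  shows "(\<Sum>y\<in>nbrs x. f y) = adj f x"
proof -
  have n: "nbrs x = range (\<lambda>i. x + axis i 1) \<union> range (\<lambda>i. x - axis i 1)"
    (is "_ = ?A \<union> ?B")
    unfolding nbrs_def lnorm_eq_1_iff
    by (auto simp: algebra_simps image_iff)
  have disj: "?A \<inter> ?B = {}"
  proof (rule ccontr)
    assume "?A \<inter> ?B \<noteq> {}"
    then obtain i j where "x + axis i 1 = x - axis j 1" by blast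
    hence "axis i 1 = - (axis j 1 :: int ^ 'd)"
      by (metis add_left_imp_eq diff_conv_add_uminus)
    thus False using axis_1_neq by blast
  qed
  have "(\<Sum>y\<in>nbrs x. f y) = sum f ?A + sum f ?B"
    unfolding n by (rule sum.union_disjoint) (use disj in auto)
  also have "sum f ?A = (\<Sum>i\<in>UNIV. f (x + axis i 1))"
    by (subst sum.reindex) (auto simp: inj_on_def axis_1_eq_iff)
  also have "sum f ?B = (\<Sum>i\<in>UNIV. f (x - axis i 1))"
    by (subst sum.reindex) (auto simp: inj_on_def axis_1_eq_iff)
  finally show ?thesis by (simp add: adj_def sum.distrib)
qed

lemma lapl_eq:
  fixes f :: "int ^ 'd::finite \<Rightarrow> real"
  shows "lapl f x = 2 * CARD('d) * f x - adj f x"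
proof -
  have "lapl f x = (\<Sum>y\<in>nbrs x. f x) - (\<Sum>y\<in>nbrs x. f y)"
    by (simp add: lapl_def sum_subtractf)
  thus ?thesis by (simp only: sum_nbrs) (simp add: adj_def)
qed

lemma adj_nonneg: "(\<And>x. 0 \<le> f x) \<Longrightarrow> 0 \<le> adj f x"
  unfolding adj_def by (intro sum_nonneg add_nonneg_nonneg) auto

lemma adj_pow_nonneg: "(\<And>x. 0 \<le> f x) \<Longrightarrow> 0 \<le> (adj ^^ n) f x"
  by (induction n arbitrary: x) (auto intro: adj_nonneg)

lemma delta0_nonneg: "0 \<le> delta0 x"
  by (simp add: delta0_def)

lemma adj_pow_delta0_nonneg: "0 \<le> (adj ^^ n) delta0 x"
  by (rule adj_pow_nonneg) (rule delta0_nonneg)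

lemma adj_pow_delta0_le: "(adj ^^ n) delta0 (x :: int ^ 'd::finite) \<le> (2 * real CARD('d)) ^ n"
proof (induction n arbitrary: x)
  case 0
  thus ?case by (simp add: delta0_def)
next
  case (Suc n)
  have "(adj ^^ Suc n) delta0 x \<le> (\<Sum>i\<in>(UNIV::'d set). (2 * real CARD('d)) ^ n + (2 * real CARD('d)) ^ n)"
    unfolding funpow.simps o_def adj_def[of "(adj ^^ n) delta0"]
    by (intro sum_mono add_mono Suc)
  thus ?case by (simp add: mult_ac power_mult_distrib)
qed

lemma adj_even: "(\<And>x. f (- x) = f x) \<Longrightarrow> adj f (- x) = adj f x"
proof -
  assume e: "\<And>x. f (- x) = f x"
  have "f (- x + axis i 1) = f (x - axis i 1)" "f (- x - axis i 1) = f (x + axis i 1)" for i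
    using e[of "x - axis i 1"] e[of "x + axis i 1"] by (simp_all add: algebra_simps)
  thus ?thesis by (simp add: adj_def add.commute)
qed

lemma adj_pow_delta0_even: "(adj ^^ n) delta0 (- x) = (adj ^^ n) delta0 x"
  by (induction n arbitrary: x) (auto simp: delta0_def intro: adj_even)

text \<open>Pascal's rule for the expansion of (c - A)^(n+1), with \<open>a k\<close> in the role of
  A^k applied to a function; it is the induction step of \<open>lapl_pow_binomial\<close>.\<close>

lemma binomial_shift:
  fixes c :: real
  shows "(\<Sum>k\<le>Suc n. real (Suc n choose k) * c ^ (Suc n - k) * (-1) ^ k * a k)
     = c * (\<Sum>k\<le>n. real (n choose k) * c ^ (n - k) * (-1) ^ k * a k)
       - (\<Sum>k\<le>n. real (n choose k) * c ^ (n - k) * (-1) ^ k * a (Suc k))"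
proof -
  have "(\<Sum>k\<le>Suc n. real (Suc n choose k) * c ^ (Suc n - k) * (-1) ^ k * a k)
     = c ^ Suc n * a 0 + (\<Sum>k\<le>n. real (Suc n choose Suc k) * c ^ (n - k) * (-1) ^ Suc k * a (Suc k))"
    by (subst sum.atMost_Suc_shift) simp
  also have "(\<Sum>k\<le>n. real (Suc n choose Suc k) * c ^ (n - k) * (-1) ^ Suc k * a (Suc k))
     = (\<Sum>k\<le>n. real (n choose Suc k) * c ^ (n - k) * (-1) ^ Suc k * a (Suc k))
       - (\<Sum>k\<le>n. real (n choose k) * c ^ (n - k) * (-1) ^ k * a (Suc k))"
    by (subst sum_subtractf[symmetric], rule sum.cong) (auto simp: algebra_simps)
  also have "c ^ Suc n * a 0 + ((\<Sum>k\<le>n. real (n choose Suc k) * c ^ (n - k) * (-1) ^ Suc k * a (Suc k)) - X)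
     = (\<Sum>k\<le>Suc n. real (n choose k) * c ^ (Suc n - k) * (-1) ^ k * a k) - X" for X
    by (subst sum.atMost_Suc_shift) simp
  also have "(\<Sum>k\<le>Suc n. real (n choose k) * c ^ (Suc n - k) * (-1) ^ k * a k)
     = (\<Sum>k\<le>n. real (n choose k) * c ^ (Suc n - k) * (-1) ^ k * a k)"
    by (simp add: binomial_eq_0)
  also have "\<dots> = c * (\<Sum>k\<le>n. real (n choose k) * c ^ (n - k) * (-1) ^ k * a k)"
    by (subst sum_distrib_left, rule sum.cong) (auto simp: Suc_diff_le)
  finally show ?thesis .
qed

lemma adj_sum: "adj (\<lambda>x. \<Sum>k\<in>A. c k * g k x) x = (\<Sum>k\<in>A. c k * adj (g k) x)"
proof -
  have "adj (\<lambda>x. \<Sum>k\<in>A. c k * g k x) x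
    = (\<Sum>i\<in>UNIV. \<Sum>k\<in>A. c k * (g k (x + axis i 1) + g k (x - axis i 1)))"
    by (simp add: adj_def sum.distrib[symmetric] distrib_left)
  also have "\<dots> = (\<Sum>k\<in>A. \<Sum>i\<in>UNIV. c k * (g k (x + axis i 1) + g k (x - axis i 1)))"
    by (rule sum.swap)
  finally show ?thesis by (simp add: adj_def sum_distrib_left)
qed

lemma lapl_pow_binomial:
  fixes f :: "int ^ 'd::finite \<Rightarrow> real"
  shows "(lapl ^^ n) f x
    = (\<Sum>k\<le>n. real (n choose k) * (2 * real CARD('d)) ^ (n - k) * (-1) ^ k * (adj ^^ k) f x)"
proof (induction n arbitrary: x)
  case (Suc n)
  have "(lapl ^^ Suc n) f x = 2 * real CARD('d) * (lapl ^^ n) f x - adj ((lapl ^^ n) f) x"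
    by (simp add: lapl_eq)
  also have "adj ((lapl ^^ n) f) x
    = adj (\<lambda>x. \<Sum>k\<le>n. (real (n choose k) * (2 * real CARD('d)) ^ (n - k) * (-1) ^ k) * (adj ^^ k) f x) x"
    by (subst Suc[abs_def]) simp
  also have "\<dots> = (\<Sum>k\<le>n. real (n choose k) * (2 * real CARD('d)) ^ (n - k) * (-1) ^ k * (adj ^^ Suc k) f x)"
    by (subst adj_sum) simp
  finally have e: "(lapl ^^ Suc n) f x = 2 * real CARD('d) * (lapl ^^ n) f x
      - (\<Sum>k\<le>n. real (n choose k) * (2 * real CARD('d)) ^ (n - k) * (-1) ^ k * (adj ^^ Suc k) f x)" .
  show ?case
    by (rule trans[OF e], subst Suc, rule binomial_shift[symmetric])
qed simp

section \<open>Power series, positivity and semigroup property of the heat kernel\<close>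

lemma summable_adj_series:
  fixes x :: "int ^ 'd::finite"
  shows "summable (\<lambda>n. norm (t ^ n / fact n * (adj ^^ n) delta0 x))"
proof (rule summable_comparison_test')
  show "summable (\<lambda>n. norm ((2 * CARD('d) * t) ^ n /\<^sub>R fact n))"
    by (rule summable_norm_exp)
  fix n :: nat
  have "\<bar>t\<bar> ^ n / fact n * (adj ^^ n) delta0 x \<le> \<bar>t\<bar> ^ n / fact n * (2 * real CARD('d)) ^ n"
    by (intro mult_left_mono adj_pow_delta0_le) auto
  thus "norm (norm (t ^ n / fact n * (adj ^^ n) delta0 x)) \<le> norm ((2 * CARD('d) * t) ^ n /\<^sub>R fact n)"
    using adj_pow_delta0_nonneg[of n x]
    by (simp add: abs_mult power_abs power_mult_distrib divide_inverse mult_ac)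
qed

text \<open>The scalar part of the Laplacian commutes with \<open>adj\<close>, so the exponential
  factors; for the series this is a Cauchy product whose coefficients are recognised by
  \<open>lapl_pow_binomial\<close>. In this form all terms are nonnegative for
  \<open>t \<ge> 0\<close>.\<close>

lemma heat_eq:
  fixes x :: "int ^ 'd::finite"
  shows "heat t x = exp (- (2 * real CARD('d) * t)) * (\<Sum>n. t ^ n / fact n * (adj ^^ n) delta0 x)"
proof -
  let ?a = "\<lambda>n. t ^ n / fact n * (adj ^^ n) delta0 x"
  let ?b = "\<lambda>n. (- (2 * real CARD('d) * t)) ^ n /\<^sub>R fact n"
  have "(\<lambda>n. \<Sum>k\<le>n. ?a k * ?b (n - k)) sums ((\<Sum>n. ?a n) * (\<Sum>n. ?b n))"
    by (rule Cauchy_product_sums) (rule summable_adj_series, rule summable_norm_exp)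
  moreover have "(\<Sum>k\<le>n. ?a k * ?b (n - k)) = (- t) ^ n / fact n * (lapl ^^ n) delta0 x" for n
  proof -
    have "?a k * ?b (n - k) = (- t) ^ n / fact n *
        (real (n choose k) * (2 * real CARD('d)) ^ (n - k) * (-1) ^ k * (adj ^^ k) delta0 x)"
      if "k \<le> n" for k
    proof -
      have "(- t) ^ n = (- t) ^ k * (- t) ^ (n - k)"
        using that by (simp flip: power_add)
      moreover have "(- t) ^ k = t ^ k * (-1) ^ k"
        by (subst power_mult_distrib[symmetric]) simp
      ultimately have 1: "(- t) ^ n = t ^ k * (-1) ^ k * (- t) ^ (n - k)"
        by (simp only:)
      have 2: "(- (2 * real CARD('d) * t)) ^ (n - k) = (2 * real CARD('d)) ^ (n - k) * (- t) ^ (n - k)"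
        by (subst power_mult_distrib[symmetric]) simp
      have 3: "real (n choose k) = fact n / (fact k * fact (n - k))"
        using that by (rule binomial_fact)
      have 4: "((-1::real) ^ k) * (-1) ^ k = 1" by (subst power_mult_distrib[symmetric]) simp
      have 5: "tk / fk * N * ((D * T) /\<^sub>R fnk) = (tk * m * T) / fn * (fn / (fk * fnk) * D * m * N)"
        if "m * m = 1" "fn \<noteq> 0" for tk fk N D T fnk m fn :: real
      proof -
        have "(tk * m * T) / fn * (fn / (fk * fnk) * D * m * N) = (m * m) * (tk / fk * N * ((D * T) /\<^sub>R fnk))"
          using that(2) by (simp add: divide_inverse mult_ac)
        thus ?thesis using that(1) by simp
      qed
      show ?thesis unfolding 1 2 3 by (rule 5[OF 4]) simp
    qed
    thus ?thesis unfolding lapl_pow_binomial sum_distrib_left by (intro sum.cong) auto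
  qed
  ultimately have "(\<lambda>n. (- t) ^ n / fact n * (lapl ^^ n) delta0 x) sums ((\<Sum>n. ?a n) * (\<Sum>n. ?b n))"
    by simp
  hence "heat t x = (\<Sum>n. ?a n) * (\<Sum>n. ?b n)"
    unfolding heat_def by (rule sums_unique[symmetric])
  also have "(\<Sum>n. ?b n) = exp (- (2 * real CARD('d) * t))" by (simp add: exp_def)
  finally show ?thesis by (simp add: mult.commute)
qed

lemma adj_series_term_nonneg: "0 \<le> t \<Longrightarrow> 0 \<le> t ^ n / fact n * (adj ^^ n) delta0 x"
  using adj_pow_delta0_nonneg[of n x] by simp

lemma heat_nonneg: "0 \<le> t \<Longrightarrow> 0 \<le> heat t x"
  unfolding heat_eq
  by (intro mult_nonneg_nonneg suminf_nonneg adj_series_term_nonneg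
        summable_norm_cancel[OF summable_adj_series]) auto

lemma heat_even: "heat t (- x) = heat t x"
  unfolding heat_eq by (simp add: adj_pow_delta0_even)

text \<open>Only the term of index 0 is kept: it is the probability that the walk has not jumped up
  to time \<open>t\<close>. It later bounds the jump rate at short times.\<close>

lemma heat_0_ge: "0 \<le> t \<Longrightarrow> exp (- (2 * real CARD('d) * t)) \<le> heat t (0 :: int ^ 'd::finite)"
proof -
  assume t: "0 \<le> t"
  let ?a = "\<lambda>n. t ^ n / fact n * (adj ^^ n) delta0 (0 :: int ^ 'd)"
  have "sum ?a {..<1} \<le> suminf ?a"
    using t by (intro sum_le_suminf adj_series_term_nonneg summable_norm_cancel[OF summable_adj_series]) auto
  hence "1 \<le> suminf ?a" by (simp add: delta0_def)
  thus ?thesis unfolding heat_eq by simp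
qed

lemma ennreal_heat:
  fixes x :: "int ^ 'd::finite"
  assumes "0 \<le> t"
  shows "ennreal (heat t x) = ennreal (exp (- (2 * real CARD('d) * t))) *
    (\<Sum>n. ennreal (t ^ n / fact n) * ennreal ((adj ^^ n) delta0 x))"
proof -
  have "(\<Sum>n. ennreal (t ^ n / fact n * (adj ^^ n) delta0 x))
    = ennreal (\<Sum>n. t ^ n / fact n * (adj ^^ n) delta0 x)"
    using assms
    by (intro suminf_ennreal2 adj_series_term_nonneg summable_norm_cancel[OF summable_adj_series]) auto
  moreover have "ennreal (t ^ n / fact n * (adj ^^ n) delta0 x)
      = ennreal (t ^ n / fact n) * ennreal ((adj ^^ n) delta0 x)" for n
    using assms by (intro ennreal_mult) (auto simp: adj_pow_delta0_nonneg)
  ultimately have "(\<Sum>n. ennreal (t ^ n / fact n) * ennreal ((adj ^^ n) delta0 x))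
    = ennreal (\<Sum>n. t ^ n / fact n * (adj ^^ n) delta0 x)" by (simp only:)
  thus ?thesis unfolding heat_eq by (simp only: ennreal_mult'[OF exp_ge_zero])
qed

lemma adj_selfadjoint:
  fixes f C :: "int ^ 'd::finite \<Rightarrow> real"
  assumes "\<And>x. 0 \<le> f x" "\<And>x. 0 \<le> C x"
  shows "(\<integral>\<^sup>+x. ennreal (adj f x * C x) \<partial>count_space UNIV)
    = (\<integral>\<^sup>+x. ennreal (f x * adj C x) \<partial>count_space UNIV)"
proof -
  have 1: "ennreal (adj f x * C x)
    = (\<Sum>i\<in>UNIV. ennreal (f (x + axis i 1) * C x) + ennreal (f (x - axis i 1) * C x))" for x
    using assms by (simp add: adj_def sum_distrib_right distrib_right sum_ennreal flip: ennreal_plus)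
  have 2: "ennreal (f x * adj C x)
    = (\<Sum>i\<in>UNIV. ennreal (f x * C (x - axis i 1)) + ennreal (f x * C (x + axis i 1)))" for x
    using assms by (simp add: adj_def sum_distrib_left distrib_left sum_ennreal add.commute flip: ennreal_plus)
  have 3: "(\<integral>\<^sup>+x. ennreal (f (x + c) * C x) \<partial>count_space UNIV)
     = (\<integral>\<^sup>+x. ennreal (f x * C (x - c)) \<partial>count_space UNIV)"
    "(\<integral>\<^sup>+x. ennreal (f (x - c) * C x) \<partial>count_space UNIV)
     = (\<integral>\<^sup>+x. ennreal (f x * C (x + c)) \<partial>count_space UNIV)" for c
    using nn_integral_count_space_shift(1)[of "\<lambda>x. ennreal (f x * C (x - c))" c]
      nn_integral_count_space_shift(2)[of "\<lambda>x. ennreal (f x * C (x + c))" c] by simp_all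
  show ?thesis
    unfolding 1 2 by (simp add: nn_integral_sum nn_integral_add 3)
qed

lemma adj_pow_selfadjoint:
  fixes f C :: "int ^ 'd::finite \<Rightarrow> real"
  assumes "\<And>x. 0 \<le> f x" "\<And>x. 0 \<le> C x"
  shows "(\<integral>\<^sup>+x. ennreal ((adj ^^ n) f x * C x) \<partial>count_space UNIV)
    = (\<integral>\<^sup>+x. ennreal (f x * (adj ^^ n) C x) \<partial>count_space UNIV)"
  using assms(2)
proof (induction n arbitrary: C)
  case (Suc n)
  have "(\<integral>\<^sup>+x. ennreal ((adj ^^ Suc n) f x * C x) \<partial>count_space UNIV)
    = (\<integral>\<^sup>+x. ennreal ((adj ^^ n) f x * adj C x) \<partial>count_space UNIV)"
    using Suc.prems by (simp add: adj_selfadjoint adj_pow_nonneg assms(1))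
  also have "\<dots> = (\<integral>\<^sup>+x. ennreal (f x * (adj ^^ n) (adj C) x) \<partial>count_space UNIV)"
    using Suc.prems by (intro Suc.IH adj_nonneg)
  finally show ?case by (simp add: funpow_swap1)
qed simp

lemma nn_integral_delta0:
  "(\<integral>\<^sup>+x. ennreal (delta0 x * C x) \<partial>count_space UNIV) = ennreal (C (0 :: int ^ 'd::finite))"
proof -
  have "(\<integral>\<^sup>+x. ennreal (delta0 x * C x) \<partial>count_space UNIV)
      = (\<integral>\<^sup>+x. ennreal (C 0) * indicator {0 :: int ^ 'd} x \<partial>count_space UNIV)"
    by (intro nn_integral_cong) (auto simp: delta0_def indicator_def)
  thus ?thesis by (simp add: nn_integral_cmult_indicator)
qed

lemma nn_integral_adj_pow_delta0:
  fixes C :: "int ^ 'd::finite \<Rightarrow> real"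
  assumes "\<And>x. 0 \<le> C x"
  shows "(\<integral>\<^sup>+x. ennreal ((adj ^^ n) delta0 x * C x) \<partial>count_space UNIV) = ennreal ((adj ^^ n) C 0)"
  using adj_pow_selfadjoint[of delta0 C n] assms by (simp add: nn_integral_delta0 delta0_nonneg)

text \<open>\<open>adj\<close> is self-adjoint for the counting measure, so pairing
  \<open>(adj ^^ n) delta0\<close> with an eigenfunction gives \<open>\<mu> ^ n * C 0\<close>, and
  the exponential series is resummed. The eigenfunctions used are constants, for conservation of
  mass, and hyperbolic cosines, for exponential moments.\<close>

lemma nn_integral_heat_eigen:
  fixes C :: "int ^ 'd::finite \<Rightarrow> real"
  assumes C: "\<And>x. 0 \<le> C x" and eig: "\<And>x. adj C x = \<mu> * C x" and t: "0 \<le> t" and mu: "0 \<le> \<mu>"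
  shows "(\<integral>\<^sup>+x. ennreal (heat t x * C x) \<partial>count_space UNIV)
    = ennreal (exp (t * (\<mu> - 2 * real CARD('d))) * C 0)"
proof -
  have pw: "(adj ^^ n) C x = \<mu> ^ n * C x" for n x
  proof (induction n arbitrary: x)
    case (Suc n)
    have "(adj ^^ Suc n) C x = adj (\<lambda>x. \<mu> ^ n * C x) x" by (simp add: Suc[abs_def])
    also have "\<dots> = \<mu> ^ n * adj C x"
      using adj_sum[of "\<lambda>_. \<mu> ^ n" "\<lambda>_. C" "{()}" x] by simp
    finally show ?case by (simp add: eig)
  qed simp
  have "(\<integral>\<^sup>+x. ennreal (heat t x * C x) \<partial>count_space UNIV)
    = (\<integral>\<^sup>+x. ennreal (exp (- (2 * real CARD('d) * t))) * (\<Sum>n. ennreal (t ^ n / fact n) *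
          ennreal ((adj ^^ n) delta0 x * C x)) \<partial>count_space UNIV)"
  proof (rule nn_integral_cong)
    fix x :: "int ^ 'd"
    have "ennreal (heat t x * C x) = ennreal (heat t x) * ennreal (C x)"
      using heat_nonneg[OF t] C by (intro ennreal_mult) auto
    also have "\<dots> = ennreal (exp (- (2 * real CARD('d) * t))) *
       (\<Sum>n. ennreal (t ^ n / fact n) * ennreal ((adj ^^ n) delta0 x) * ennreal (C x))"
      unfolding ennreal_heat[OF t] by (simp only: mult.assoc ennreal_suminf_multc[symmetric])
    also have "\<dots> = ennreal (exp (- (2 * real CARD('d) * t))) *
       (\<Sum>n. ennreal (t ^ n / fact n) * ennreal ((adj ^^ n) delta0 x * C x))"
      by (simp add: mult.assoc ennreal_mult adj_pow_delta0_nonneg C)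
    finally show "ennreal (heat t x * C x) = \<dots>" .
  qed
  also have "\<dots> = ennreal (exp (- (2 * real CARD('d) * t))) *
     (\<Sum>n. ennreal (t ^ n / fact n) * ennreal (\<mu> ^ n * C 0))"
    by (simp add: nn_integral_cmult nn_integral_suminf nn_integral_adj_pow_delta0 C pw)
  also have "(\<Sum>n. ennreal (t ^ n / fact n) * ennreal (\<mu> ^ n * C 0))
     = (\<Sum>n. ennreal ((t * \<mu>) ^ n /\<^sub>R fact n * C 0))"
    using t mu C by (simp add: power_mult_distrib divide_inverse mult_ac flip: ennreal_mult)
  also have "\<dots> = ennreal (\<Sum>n. (t * \<mu>) ^ n /\<^sub>R fact n * C 0)"
    using t mu C by (intro suminf_ennreal2 summable_mult2 summable_exp_generic) auto
  also have "(\<Sum>n. (t * \<mu>) ^ n /\<^sub>R fact n * C 0) = exp (t * \<mu>) * C 0"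
    unfolding exp_def by (rule suminf_mult2[symmetric]) (rule summable_exp_generic)
  also have "ennreal (exp (- (2 * real CARD('d) * t))) * ennreal (exp (t * \<mu>) * C 0)
      = ennreal (exp (- (2 * real CARD('d) * t)) * (exp (t * \<mu>) * C 0))"
    using C by (intro ennreal_mult[symmetric]) auto
  also have "exp (- (2 * real CARD('d) * t)) * (exp (t * \<mu>) * C 0) = exp (t * (\<mu> - 2 * real CARD('d))) * C 0"
    unfolding mult.assoc[symmetric] exp_add[symmetric] by (simp add: algebra_simps)
  finally show ?thesis .
qed

lemma nn_integral_heat: 
  assumes "0 \<le> t"
  shows "(\<integral>\<^sup>+x. ennreal (heat t (x :: int ^ 'd::finite)) \<partial>count_space UNIV) = 1"
  using nn_integral_heat_eigen[of "\<lambda>_ :: int ^ 'd. 1" "2 * real CARD('d)" t] assms by (simp add: adj_def)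

text \<open>Of the \<open>2 * CARD('d)\<close> steps the two along \<open>i\<close> contribute the
  factor \<open>2 * cosh l\<close> and each of the others leaves the function alone, so it is an
  eigenfunction. \<open>cosh\<close> rather than \<open>exp\<close> controls
  \<open>\<bar>x $ i\<bar>\<close>, that is both tails at once.\<close>

lemma nn_integral_heat_cosh:
  fixes i :: "'d::finite"
  assumes "0 \<le> t"
  shows "(\<integral>\<^sup>+x. ennreal (heat t x * cosh (l * real_of_int (x $ i))) \<partial>count_space UNIV)
    = ennreal (exp (2 * t * (cosh l - 1)))"
proof -
  let ?C = "\<lambda>x :: int ^ 'd. cosh (l * real_of_int (x $ i))"
  have "adj ?C x = (2 * real CARD('d) - 2 + 2 * cosh l) * ?C x" for x
  proof -
    have "adj ?C x = (\<Sum>j\<in>UNIV. if j = i then 2 * cosh l * ?C x else 2 * ?C x)"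
      unfolding adj_def
    proof (intro sum.cong refl)
      fix j
      have "cosh (l * real_of_int (x $ i) + l) + cosh (l * real_of_int (x $ i) - l) = 2 * cosh l * ?C x"
        by (simp add: cosh_add cosh_diff)
      thus "?C (x + axis j 1) + ?C (x - axis j 1) = (if j = i then 2 * cosh l * ?C x else 2 * ?C x)"
        by (simp add: axis_def algebra_simps)
    qed
    also have "\<dots> = 2 * cosh l * ?C x + (\<Sum>j\<in>UNIV - {i}. 2 * ?C x)"
      by (subst sum.remove[of _ i]) auto
    also have "\<dots> = (2 * real CARD('d) - 2 + 2 * cosh l) * ?C x"
      by (simp add: card_Diff_singleton of_nat_diff Suc_leI algebra_simps)
    finally show ?thesis .
  qed
  moreover have "0 \<le> 2 * real CARD('d) - 2 + 2 * cosh l"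
    using cosh_real_ge_1[of l] by simp
  ultimately have "(\<integral>\<^sup>+x. ennreal (heat t x * ?C x) \<partial>count_space UNIV)
    = ennreal (exp (t * (2 * real CARD('d) - 2 + 2 * cosh l - 2 * real CARD('d))) * ?C 0)"
    using assms by (intro nn_integral_heat_eigen) (auto intro: cosh_real_nonneg)
  also have "t * (2 * real CARD('d) - 2 + 2 * cosh l - 2 * real CARD('d)) = 2 * t * (cosh l - 1)"
    by (simp add: algebra_simps)
  finally show ?thesis by simp
qed

lemma adj_reflect: "adj (\<lambda>y. f (x - y)) y = adj f (x - y)"
proof -
  have "x - (y + c) = x - y - c" "x - (y - c) = x - y + c" for c by simp_all
  hence "f (x - (y + c)) + f (x - (y - c)) = f (x - y + c) + f (x - y - c)" for c
    by (simp only: add.commute)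
  thus ?thesis by (simp only: adj_def)
qed

text \<open>Walks of \<open>n + m\<close> steps are sorted by their position after \<open>m\<close>
  steps.\<close>

lemma nn_integral_adj_pow_convolution:
  fixes x :: "int ^ 'd::finite"
  shows "(\<integral>\<^sup>+y. ennreal ((adj ^^ n) delta0 (x - y) * (adj ^^ m) delta0 y) \<partial>count_space UNIV)
    = ennreal ((adj ^^ (n + m)) delta0 x)"
proof -
  have r: "(adj ^^ m) (\<lambda>y. f (x - y)) y = (adj ^^ m) f (x - y)" for m f and y :: "int ^ 'd"
  proof (induction m arbitrary: y)
    case (Suc m)
    have "(adj ^^ Suc m) (\<lambda>y. f (x - y)) y = adj (\<lambda>y. (adj ^^ m) f (x - y)) y"
      by (simp add: Suc[abs_def])
    thus ?case by (simp add: adj_reflect)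
  qed simp
  have "(\<integral>\<^sup>+y. ennreal ((adj ^^ m) delta0 y * (adj ^^ n) delta0 (x - y)) \<partial>count_space UNIV)
    = ennreal ((adj ^^ m) (\<lambda>y. (adj ^^ n) delta0 (x - y)) 0)"
    by (rule nn_integral_adj_pow_delta0) (rule adj_pow_delta0_nonneg)
  also have "\<dots> = ennreal ((adj ^^ (m + n)) delta0 x)"
    by (simp add: r funpow_add)
  finally show ?thesis by (simp add: mult.commute add.commute)
qed

lemma ennreal_Cauchy_product:
  fixes a b :: "nat \<Rightarrow> real"
  assumes "summable (\<lambda>n. norm (a n))" "summable (\<lambda>n. norm (b n))" "\<And>n. 0 \<le> a n" "\<And>n. 0 \<le> b n"
  shows "ennreal ((\<Sum>n. a n) * (\<Sum>n. b n)) = (\<Sum>n. ennreal (\<Sum>k\<le>n. a k * b (n - k)))"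
proof -
  have "(\<lambda>n. \<Sum>k\<le>n. a k * b (n - k)) sums ((\<Sum>n. a n) * (\<Sum>n. b n))"
    using assms by (intro Cauchy_product_sums)
  thus ?thesis
    using assms(3,4) by (subst suminf_ennreal2) (auto simp: sums_iff intro!: sum_nonneg)
qed

text \<open>Expanding both kernels, the lattice sum of the terms of indices \<open>k\<close> and
  \<open>n - k\<close> is a convolution of walk counts and depends on \<open>n\<close> only; the
  coefficients add up to \<open>(s + t) ^ n / fact n\<close> by the binomial theorem.\<close>

lemma heat_semigroup:
  fixes x :: "int ^ 'd::finite"
  assumes s: "0 \<le> s" and t: "0 \<le> t"
  shows "(\<integral>\<^sup>+y. ennreal (heat s (x - y) * heat t y) \<partial>count_space UNIV) = ennreal (heat (s + t) x)"
proof -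
  define c where "c = 2 * real CARD('d)"
  let ?N = "\<lambda>n x. (adj ^^ n) delta0 (x :: int ^ 'd)"
  let ?g = "\<lambda>y n. \<Sum>k\<le>n. (s ^ k / fact k * ?N k (x - y)) * (t ^ (n - k) / fact (n - k) * ?N (n - k) y)"
  have g0: "0 \<le> ?g y n" for y n
    using s t by (intro sum_nonneg mult_nonneg_nonneg adj_series_term_nonneg)
  have prod: "ennreal (heat s (x - y) * heat t y)
    = ennreal (exp (- (c * (s + t)))) * (\<Sum>n. ennreal (?g y n))" for y
  proof -
    let ?A = "\<Sum>n. s ^ n / fact n * ?N n (x - y)" and ?B = "\<Sum>n. t ^ n / fact n * ?N n y"
    have e: "ennreal (?A * ?B) = (\<Sum>n. ennreal (?g y n))"
      using s t by (intro ennreal_Cauchy_product summable_adj_series adj_series_term_nonneg)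
    have m: "(a * u) * (b * v) = (a * b) * (u * v)" for a b u v :: real by simp
    have "heat s (x - y) * heat t y = (exp (- (c * s)) * ?A) * (exp (- (c * t)) * ?B)"
      unfolding heat_eq c_def by (rule refl)
    also have "\<dots> = exp (- (c * (s + t))) * (?A * ?B)"
      unfolding m exp_add[symmetric] by (simp only: distrib_left minus_add_distrib)
    finally show ?thesis unfolding e[symmetric] by (simp only: ennreal_mult'[OF exp_ge_zero])
  qed
  have conv: "(\<integral>\<^sup>+y. ennreal (?g y n) \<partial>count_space UNIV) = ennreal ((s + t) ^ n / fact n * ?N n x)" for n
  proof -
    have "(\<integral>\<^sup>+y. ennreal (?g y n) \<partial>count_space UNIV)
      = (\<integral>\<^sup>+y. (\<Sum>k\<le>n. ennreal (s ^ k / fact k * (t ^ (n - k) / fact (n - k))) *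
           ennreal (?N k (x - y) * ?N (n - k) y)) \<partial>count_space UNIV)"
      using s t
      by (intro nn_integral_cong, subst sum_ennreal[symmetric])
         (auto simp: adj_pow_delta0_nonneg mult_ac simp flip: ennreal_mult intro!: sum.cong)
    also have "\<dots> = (\<Sum>k\<le>n. ennreal (s ^ k / fact k * (t ^ (n - k) / fact (n - k))) * ennreal (?N n x))"
      by (simp add: nn_integral_sum nn_integral_cmult nn_integral_adj_pow_convolution)
    also have "\<dots> = ennreal (\<Sum>k\<le>n. s ^ k / fact k * (t ^ (n - k) / fact (n - k)) * ?N n x)"
      using s t by (simp add: adj_pow_delta0_nonneg sum_ennreal flip: ennreal_mult)
    also have "(\<Sum>k\<le>n. s ^ k / fact k * (t ^ (n - k) / fact (n - k)) * ?N n x)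
      = (\<Sum>k\<le>n. real (n choose k) * s ^ k * t ^ (n - k)) / fact n * ?N n x"
      unfolding sum_divide_distrib sum_distrib_right
      by (intro sum.cong) (auto simp: binomial_fact field_simps)
    also have "(\<Sum>k\<le>n. real (n choose k) * s ^ k * t ^ (n - k)) = (s + t) ^ n"
      by (simp add: binomial_ring)
    finally show ?thesis .
  qed
  have "(\<integral>\<^sup>+y. ennreal (heat s (x - y) * heat t y) \<partial>count_space UNIV)
    = ennreal (exp (- (c * (s + t)))) * (\<Sum>n. ennreal ((s + t) ^ n / fact n * ?N n x))"
    unfolding prod
    by (subst nn_integral_cmult, simp, subst nn_integral_suminf, simp) (simp only: conv)
  also have "(\<Sum>n. ennreal ((s + t) ^ n / fact n * ?N n x))
    = (\<Sum>n. ennreal ((s + t) ^ n / fact n) * ennreal (?N n x))"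
    using s t by (intro suminf_cong ennreal_mult) (auto simp: adj_pow_delta0_nonneg)
  finally show ?thesis
    unfolding ennreal_heat[OF add_nonneg_nonneg[OF s t]] c_def .
qed

section \<open>The one-dimensional heat kernel\<close>

text \<open>Fourier integral of the heat kernel on the integers; \<open>2 - 2 * cos \<theta>\<close>
  is the symbol of the one-dimensional Laplacian. Negative \<open>t\<close> is included because
  \<open>heat_unique\<close> works with two-sided derivatives at all real times.\<close>

definition heat1 :: "real \<Rightarrow> int \<Rightarrow> real" where
  "heat1 t n = integral {-pi..pi} (\<lambda>\<theta>. cos (of_int n * \<theta>) * exp (- (t * (2 - 2 * cos \<theta>)))) / (2 * pi)"

lemma integrable_heat1:
  "(\<lambda>\<theta>. cos (of_int n * \<theta>) * exp (- (t * (2 - 2 * cos \<theta>)))) integrable_on {-pi..pi}"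
  by (intro integrable_continuous_real continuous_intros)

text \<open>Minus the time derivative of \<open>heat1\<close>; the sign makes the Fourier multiplier
  nonnegative.\<close>

definition heat1' :: "real \<Rightarrow> int \<Rightarrow> real" where
  "heat1' t n = integral {-pi..pi} (\<lambda>\<theta>. cos (of_int n * \<theta>) * (2 - 2 * cos \<theta>) * exp (- (t * (2 - 2 * cos \<theta>)))) / (2 * pi)"

lemma integrable_heat1':
  "(\<lambda>\<theta>. cos (of_int n * \<theta>) * (2 - 2 * cos \<theta>) * exp (- (t * (2 - 2 * cos \<theta>)))) integrable_on {-pi..pi}"
  by (intro integrable_continuous_real continuous_intros)

lemma heat1'_eq: "heat1' t n = 2 * heat1 t n - heat1 t (n + 1) - heat1 t (n - 1)"
proof -
  let ?e = "\<lambda>\<theta>. exp (- (t * (2 - 2 * cos \<theta>)))"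
  have "integral {-pi..pi} (\<lambda>\<theta>. cos (of_int n * \<theta>) * (2 - 2 * cos \<theta>) * ?e \<theta>)
    = integral {-pi..pi} (\<lambda>\<theta>. 2 * (cos (of_int n * \<theta>) * ?e \<theta>) - cos (of_int (n + 1) * \<theta>) * ?e \<theta>
        - cos (of_int (n - 1) * \<theta>) * ?e \<theta>)"
  proof (rule Henstock_Kurzweil_Integration.integral_cong)
    fix \<theta> :: real
    have "cos (of_int (n + 1) * \<theta>) + cos (of_int (n - 1) * \<theta>) = 2 * cos \<theta> * cos (of_int n * \<theta>)"
      by (simp add: distrib_right left_diff_distrib cos_add cos_diff)
    hence "cos (of_int n * \<theta>) * (2 - 2 * cos \<theta>)
      = 2 * cos (of_int n * \<theta>) - cos (of_int (n + 1) * \<theta>) - cos (of_int (n - 1) * \<theta>)"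
      by (simp add: algebra_simps)
    thus "cos (of_int n * \<theta>) * (2 - 2 * cos \<theta>) * ?e \<theta>
      = 2 * (cos (of_int n * \<theta>) * ?e \<theta>) - cos (of_int (n + 1) * \<theta>) * ?e \<theta>
        - cos (of_int (n - 1) * \<theta>) * ?e \<theta>"
      by (simp only: left_diff_distrib mult.assoc)
  qed
  also have "\<dots> = 2 * integral {-pi..pi} (\<lambda>\<theta>. cos (of_int n * \<theta>) * ?e \<theta>)
     - integral {-pi..pi} (\<lambda>\<theta>. cos (of_int (n + 1) * \<theta>) * ?e \<theta>)
     - integral {-pi..pi} (\<lambda>\<theta>. cos (of_int (n - 1) * \<theta>) * ?e \<theta>)"
    by (subst Henstock_Kurzweil_Integration.integral_diff,
        intro integrable_continuous_real continuous_intros, rule integrable_heat1,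
        subst Henstock_Kurzweil_Integration.integral_diff,
        intro integrable_continuous_real continuous_intros, rule integrable_heat1, simp)
  finally show ?thesis
    unfolding heat1'_def heat1_def by (simp add: diff_divide_distrib)
qed

lemma DERIV_heat1: "((\<lambda>t. heat1 t n) has_real_derivative - heat1' t n) (at t)"
proof -
  have "((\<lambda>t. integral (cbox (-pi) pi) (\<lambda>\<theta>. cos (of_int n * \<theta>) * exp (- (t * (2 - 2 * cos \<theta>)))))
     has_field_derivative integral (cbox (-pi) pi)
       (\<lambda>\<theta>. - (cos (of_int n * \<theta>) * (2 - 2 * cos \<theta>) * exp (- (t * (2 - 2 * cos \<theta>)))))) (at t within UNIV)"
  proof (rule leibniz_rule_field_derivative)
    show "continuous_on (UNIV \<times> cbox (- pi) pi) (\<lambda>(t, \<theta>). - (cos (of_int n * \<theta>) * (2 - 2 * cos \<theta>) * exp (- (t * (2 - 2 * cos \<theta>)))))"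
      unfolding split_beta by (intro continuous_intros)
    show "(\<lambda>\<theta>. cos (of_int n * \<theta>) * exp (- (t * (2 - 2 * cos \<theta>)))) integrable_on cbox (- pi) pi" for t
      using integrable_heat1 by simp
  qed (auto intro!: derivative_eq_intros simp: algebra_simps)
  hence "((\<lambda>t. integral {-pi..pi} (\<lambda>\<theta>. cos (of_int n * \<theta>) * exp (- (t * (2 - 2 * cos \<theta>)))))
     has_field_derivative - integral {-pi..pi}
       (\<lambda>\<theta>. (cos (of_int n * \<theta>) * (2 - 2 * cos \<theta>) * exp (- (t * (2 - 2 * cos \<theta>)))))) (at t)"
    by simp
  from DERIV_cdivide[OF this, of "2 * pi"] show ?thesis
    unfolding heat1_def heat1'_def by simp
qed

lemma abs_heat1_le: "\<bar>heat1 t n\<bar> \<le> heat1 t 0"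
proof -
  have "norm (integral {-pi..pi} (\<lambda>\<theta>. cos (of_int n * \<theta>) * exp (- (t * (2 - 2 * cos \<theta>)))))
    \<le> integral {-pi..pi} (\<lambda>\<theta>. cos (of_int 0 * \<theta>) * exp (- (t * (2 - 2 * cos \<theta>))))"
    by (rule integral_norm_bound_integral[OF integrable_heat1 integrable_heat1])
       (auto simp: abs_mult intro!: mult_left_le_one_le)
  thus ?thesis unfolding heat1_def by (simp add: divide_right_mono)
qed

lemma heat1_0_nonneg: "0 \<le> heat1 t 0"
  using abs_heat1_le[of t 0] by linarith

lemma abs_heat1'_le: "\<bar>heat1' t n\<bar> \<le> heat1' t 0"
proof -
  have "norm (integral {-pi..pi} (\<lambda>\<theta>. cos (of_int n * \<theta>) * (2 - 2 * cos \<theta>) * exp (- (t * (2 - 2 * cos \<theta>)))))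
    \<le> integral {-pi..pi} (\<lambda>\<theta>. cos (of_int 0 * \<theta>) * (2 - 2 * cos \<theta>) * exp (- (t * (2 - 2 * cos \<theta>))))"
  proof (rule integral_norm_bound_integral[OF integrable_heat1' integrable_heat1'])
    fix \<theta> :: real
    have "\<bar>cos (of_int n * \<theta>)\<bar> * ((2 - 2 * cos \<theta>) * exp (- (t * (2 - 2 * cos \<theta>))))
       \<le> (2 - 2 * cos \<theta>) * exp (- (t * (2 - 2 * cos \<theta>)))"
      by (intro mult_left_le_one_le) auto
    thus "norm (cos (of_int n * \<theta>) * (2 - 2 * cos \<theta>) * exp (- (t * (2 - 2 * cos \<theta>))))
       \<le> cos (of_int 0 * \<theta>) * (2 - 2 * cos \<theta>) * exp (- (t * (2 - 2 * cos \<theta>)))"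
      by (simp add: abs_mult mult.assoc)
  qed
  thus ?thesis unfolding heat1'_def by (simp add: divide_right_mono)
qed

lemma heat1'_0_nonneg: "0 \<le> heat1' t 0"
  using abs_heat1'_le[of t 0] by linarith

lemma heat1_0: "heat1 0 n = (if n = 0 then 1 else 0)"
proof (cases "n = 0")
  case True
  thus ?thesis by (simp add: heat1_def)
next
  case False
  have "((\<lambda>\<theta>. cos (of_int n * \<theta>)) has_integral (sin (of_int n * pi) / of_int n - sin (of_int n * (-pi)) / of_int n)) {-pi..pi}"
    using False
    by (intro fundamental_theorem_of_calculus)
       (auto intro!: derivative_eq_intros simp: has_real_derivative_iff_has_vector_derivative[symmetric])
  hence "((\<lambda>\<theta>. cos (of_int n * \<theta>)) has_integral 0) {-pi..pi}"
    using sin_times_pi_eq_0[of "of_int n"] by simp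
  hence "integral {-pi..pi} (\<lambda>\<theta>. cos (of_int n * \<theta>)) = 0" by (rule integral_unique)
  thus ?thesis using False by (simp add: heat1_def)
qed

lemma heat1_0_le_exp: "heat1 t 0 \<le> exp (4 * \<bar>t\<bar>)"
proof -
  have "integral {-pi..pi} (\<lambda>\<theta>. cos (of_int 0 * \<theta>) * exp (- (t * (2 - 2 * cos \<theta>))))
    \<le> integral {-pi..pi} (\<lambda>\<theta>::real. exp (4 * \<bar>t\<bar>))"
  proof (rule integral_le[OF integrable_heat1])
    fix \<theta> :: real
    have "\<bar>t * (2 - 2 * cos \<theta>)\<bar> \<le> \<bar>t\<bar> * 4"
    proof -
      have "\<bar>2 - 2 * cos \<theta>\<bar> \<le> 4"
        using cos_le_one[of \<theta>] cos_ge_minus_one[of \<theta>] by linarith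
      thus ?thesis unfolding abs_mult by (rule mult_left_mono) simp
    qed
    thus "cos (of_int 0 * \<theta>) * exp (- (t * (2 - 2 * cos \<theta>))) \<le> exp (4 * \<bar>t\<bar>)" by simp
  qed auto
  thus ?thesis unfolding heat1_def by (simp add: field_simps)
qed

section \<open>Product formula for the heat kernel\<close>

lemma lapl_pow_bound:
  fixes f :: "int ^ 'd::finite \<Rightarrow> real"
  assumes "\<And>x. \<bar>f x\<bar> \<le> M"
  shows "\<bar>(lapl ^^ n) f x\<bar> \<le> (4 * real CARD('d)) ^ n * M"
proof (induction n arbitrary: x)
  case (Suc n)
  let ?g = "(lapl ^^ n) f" and ?B = "(4 * real CARD('d)) ^ n * M"
  have "\<bar>adj ?g x\<bar> \<le> (\<Sum>i\<in>(UNIV :: 'd set). \<bar>?g (x + axis i 1)\<bar> + \<bar>?g (x - axis i 1)\<bar>)"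
    unfolding adj_def by (rule order_trans[OF sum_abs]) (intro sum_mono abs_triangle_ineq)
  also have "\<dots> \<le> (\<Sum>i\<in>(UNIV :: 'd set). ?B + ?B)"
    by (intro sum_mono add_mono Suc)
  also have "\<dots> = 2 * real CARD('d) * ?B" by (simp add: mult_ac)
  finally have "\<bar>adj ?g x\<bar> \<le> 2 * real CARD('d) * ?B" .
  moreover have "\<bar>2 * real CARD('d) * ?g x\<bar> \<le> 2 * real CARD('d) * ?B"
    unfolding abs_mult using Suc[of x] by (intro mult_mono) auto
  moreover have "(lapl ^^ Suc n) f x = 2 * real CARD('d) * ?g x - adj ?g x"
    by (simp add: lapl_eq)
  ultimately have "\<bar>(lapl ^^ Suc n) f x\<bar> \<le> 4 * real CARD('d) * ?B" by linarith
  thus ?case by (simp add: mult.assoc)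
qed (use assms in auto)

text \<open>The equation turns every time derivative into an iterated Laplacian, so the Taylor
  coefficients at time 0 are those of the series defining \<open>heat\<close>. The remainder is
  controlled by boundedness in space, since the Laplacian has norm at most
  \<open>4 * CARD('d)\<close> for the supremum norm.\<close>

lemma heat_unique:
  fixes F :: "real \<Rightarrow> int ^ 'd::finite \<Rightarrow> real"
  assumes D: "\<And>t x. ((\<lambda>t. F t x) has_real_derivative - lapl (F t) x) (at t)"
    and F0: "\<And>x. F 0 x = delta0 x"
    and bd: "\<And>T. \<exists>M. \<forall>t x. \<bar>t\<bar> \<le> T \<longrightarrow> \<bar>F t x\<bar> \<le> M"
  shows "F t x = heat t x"
proof -
  define D where "D m s = (-1) ^ m * (lapl ^^ m) (F s) x" for m s
  have dl: "((\<lambda>t. (lapl ^^ m) (F t) x) has_real_derivative - (lapl ^^ Suc m) (F t) x) (at t)" for m t x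
  proof (induction m arbitrary: x)
    case (Suc m)
    have S: "(lapl ^^ Suc m) g x = 2 * real CARD('d) * (lapl ^^ m) g x
            - (\<Sum>i\<in>UNIV. (lapl ^^ m) g (x + axis i 1) + (lapl ^^ m) g (x - axis i 1))" for m g
      by (simp add: lapl_eq adj_def)
    have "(\<Sum>i\<in>UNIV. - g (x + axis i 1) + - g (x - axis i 1))
        = - (\<Sum>i\<in>UNIV. g (x + axis i 1) + g (x - axis i 1))" for g :: "int ^ 'd \<Rightarrow> real"
      unfolding sum_negf[symmetric] by (rule sum.cong) auto
    hence neg: "2 * real CARD('d) * - (lapl ^^ Suc m) (F t) x
            - (\<Sum>i\<in>UNIV. - (lapl ^^ Suc m) (F t) (x + axis i 1) + - (lapl ^^ Suc m) (F t) (x - axis i 1))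
        = - (lapl ^^ Suc (Suc m)) (F t) x"
      unfolding S[of "Suc m"] by simp
    have e: "(\<lambda>t. (lapl ^^ Suc m) (F t) x) = (\<lambda>t. 2 * real CARD('d) * (lapl ^^ m) (F t) x
            - (\<Sum>i\<in>UNIV. (lapl ^^ m) (F t) (x + axis i 1) + (lapl ^^ m) (F t) (x - axis i 1)))"
      by (rule ext) (rule S)
    show ?case
      unfolding e neg[symmetric] by (intro DERIV_diff DERIV_cmult DERIV_sum DERIV_add Suc)
  qed (use D in simp)
  have der: "DERIV (D m) s :> D (Suc m) s" for m s
    unfolding D_def using DERIV_cmult[OF dl[of m x s], of "(-1) ^ m"] by simp
  have D0: "D 0 = (\<lambda>t. F t x)" by (rule ext) (simp add: D_def)
  obtain M where M: "\<And>s y. \<bar>s\<bar> \<le> \<bar>t\<bar> \<Longrightarrow> \<bar>F s y\<bar> \<le> M" using bd[of "\<bar>t\<bar>"] by blast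
  have tm: "D m 0 / fact m * t ^ m = (- t) ^ m / fact m * (lapl ^^ m) delta0 x" for m
  proof -
    have "F 0 = delta0" using F0 by (rule ext)
    moreover have "(- t) ^ m = (-1) ^ m * t ^ m" by (rule power_minus)
    ultimately show ?thesis by (simp add: D_def)
  qed
  have "(\<lambda>n. \<Sum>m<n. D m 0 / fact m * t ^ m) \<longlonglongrightarrow> F t x"
  proof (rule LIM_zero_cancel, rule Lim_null_comparison)
    show "\<forall>\<^sub>F n in sequentially. norm ((\<Sum>m<n. D m 0 / fact m * t ^ m) - F t x)
       \<le> M * ((4 * real CARD('d) * \<bar>t\<bar>) ^ n /\<^sub>R fact n)"
    proof (intro always_eventually allI)
      fix n
      obtain s where s: "\<bar>s\<bar> \<le> \<bar>t\<bar>"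
        "F t x = (\<Sum>m<n. D m 0 / fact m * t ^ m) + D n s / fact n * t ^ n"
        using Maclaurin_all_le[of D "\<lambda>t. F t x" t n, OF D0] der by blast
      have "\<bar>D n s\<bar> \<le> (4 * real CARD('d)) ^ n * M"
        unfolding D_def using lapl_pow_bound[of "F s" M n x] M[OF s(1)] by (simp add: abs_mult power_abs)
      hence "\<bar>D n s\<bar> * (\<bar>t\<bar> ^ n / fact n) \<le> (4 * real CARD('d)) ^ n * M * (\<bar>t\<bar> ^ n / fact n)"
        by (rule mult_right_mono) auto
      moreover have "norm ((\<Sum>m<n. D m 0 / fact m * t ^ m) - F t x) = \<bar>D n s\<bar> * (\<bar>t\<bar> ^ n / fact n)"
        unfolding s(2) by (simp add: abs_mult power_abs)
      moreover have "(4 * real CARD('d)) ^ n * M * (\<bar>t\<bar> ^ n / fact n)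
          = M * ((4 * real CARD('d) * \<bar>t\<bar>) ^ n /\<^sub>R fact n)"
        by (simp add: power_mult_distrib divide_inverse mult_ac)
      ultimately show "norm ((\<Sum>m<n. D m 0 / fact m * t ^ m) - F t x)
         \<le> M * ((4 * real CARD('d) * \<bar>t\<bar>) ^ n /\<^sub>R fact n)" by linarith
    qed
    show "(\<lambda>n. M * ((4 * real CARD('d) * \<bar>t\<bar>) ^ n /\<^sub>R fact n)) \<longlonglongrightarrow> 0"
      by (rule tendsto_mult_right_zero) (rule summable_LIMSEQ_zero[OF summable_exp_generic])
  qed
  hence "(\<lambda>m. D m 0 / fact m * t ^ m) sums F t x" by (simp add: sums_def)
  thus ?thesis unfolding tm heat_def by (simp add: sums_iff)
qed

text \<open>The Laplacian is a sum over coordinates and the initial datum is a product, so the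
  product of one-dimensional kernels solves the same initial value problem as
  \<open>heat\<close>.\<close>

lemma heat_prod: "heat t x = (\<Prod>i\<in>UNIV. heat1 t ((x :: int ^ 'd::finite) $ i))"
proof (rule heat_unique[symmetric])
  fix t and x :: "int ^ 'd"
  let ?P = "\<lambda>i. \<Prod>j\<in>UNIV - {i}. heat1 t (x $ j)"
  have sh: "(\<Prod>j\<in>UNIV. heat1 t ((x + axis i c) $ j)) = heat1 t (x $ i + c) * ?P i" for i c
    by (subst prod.remove[of _ i]) (auto simp: axis_def intro!: prod.cong)
  have sh2: "(\<Prod>j\<in>UNIV. heat1 t ((x - axis i 1) $ j)) = heat1 t (x $ i - 1) * ?P i" for i
  proof -
    have e: "x - axis i 1 = x + axis i (-1)" by (simp add: axis_def vec_eq_iff)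
    show ?thesis unfolding e sh by simp
  qed
  have sh0: "(\<Prod>j\<in>UNIV. heat1 t (x $ j)) = heat1 t (x $ i) * ?P i" for i
    by (subst prod.remove[of _ i]) auto
  have "((\<lambda>t. \<Prod>i\<in>UNIV. heat1 t (x $ i)) has_real_derivative
     (\<Sum>i\<in>UNIV. - heat1' t (x $ i) * ?P i)) (at t)"
    by (rule has_field_derivative_prod) (rule DERIV_heat1)
  moreover have "(\<Sum>i\<in>UNIV. - heat1' t (x $ i) * ?P i) = - lapl (\<lambda>x. \<Prod>i\<in>UNIV. heat1 t (x $ i)) x"
  proof -
    have "lapl (\<lambda>x. \<Prod>i\<in>UNIV. heat1 t (x $ i)) x
      = (\<Sum>i\<in>(UNIV :: 'd set). 2 * (\<Prod>j\<in>UNIV. heat1 t (x $ j))) - adj (\<lambda>x. \<Prod>i\<in>UNIV. heat1 t (x $ i)) x"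
      by (simp add: lapl_eq)
    also have "\<dots> = (\<Sum>i\<in>UNIV. 2 * (heat1 t (x $ i) * ?P i) - (heat1 t (x $ i + 1) * ?P i + heat1 t (x $ i - 1) * ?P i))"
      unfolding adj_def sh sh2 by (subst sum_subtractf[symmetric]) (intro sum.cong refl arg_cong2[of _ _ _ _ "(-)"], simp_all add: sh0[symmetric])
    also have "\<dots> = (\<Sum>i\<in>UNIV. heat1' t (x $ i) * ?P i)"
      by (intro sum.cong refl) (simp add: heat1'_eq algebra_simps)
    finally show ?thesis by (simp add: sum_negf)
  qed
  ultimately show "((\<lambda>t. \<Prod>i\<in>UNIV. heat1 t (x $ i)) has_real_derivative
     - lapl (\<lambda>x. \<Prod>i\<in>UNIV. heat1 t (x $ i)) x) (at t)" by simp
next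
  fix x :: "int ^ 'd"
  show "(\<Prod>i\<in>UNIV. heat1 0 (x $ i)) = delta0 x"
  proof (cases "x = 0")
    case False
    then obtain i where "x $ i \<noteq> 0" by (auto simp: vec_eq_iff)
    thus ?thesis using False by (auto simp: heat1_0 delta0_def intro!: prod_zero)
  qed (simp add: heat1_0 delta0_def)
next
  fix T :: real
  have "\<bar>\<Prod>i\<in>UNIV. heat1 t ((x :: int ^ 'd) $ i)\<bar> \<le> exp (4 * T) ^ CARD('d)" if "\<bar>t\<bar> \<le> T" for t x
  proof -
    have "\<bar>heat1 t n\<bar> \<le> exp (4 * T)" for n
    proof -
      have "exp (4 * \<bar>t\<bar>) \<le> exp (4 * T)" using that by simp
      thus ?thesis using abs_heat1_le[of t n] heat1_0_le_exp[of t] by linarith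
    qed
    hence "(\<Prod>i\<in>UNIV. \<bar>heat1 t (x $ i)\<bar>) \<le> (\<Prod>i\<in>(UNIV :: 'd set). exp (4 * T))"
      by (intro prod_mono) auto
    thus ?thesis by (simp add: abs_prod)
  qed
  thus "\<exists>M. \<forall>t x. \<bar>t\<bar> \<le> T \<longrightarrow> \<bar>\<Prod>i\<in>UNIV. heat1 t ((x :: int ^ 'd) $ i)\<bar> \<le> M" by blast
qed

text \<open>Minus the time derivative of the kernel, as \<open>DERIV_heat\<close> shows, written as
  a Laplacian so that it can be compared with neighbour sums.\<close>

definition heat' :: "real \<Rightarrow> int ^ 'd::finite \<Rightarrow> real" where
  "heat' t x = lapl (heat t) x"

lemma heat'_eq:
  "heat' t x = (\<Sum>i\<in>UNIV. heat1' t (x $ i) * (\<Prod>j\<in>UNIV - {i}. heat1 t ((x :: int ^ 'd::finite) $ j)))"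
  and DERIV_heat: "((\<lambda>t. heat t x) has_real_derivative - heat' t x) (at t)"
proof -
  let ?P = "\<lambda>i. \<Prod>j\<in>UNIV - {i}. heat1 t (x $ j)"
  have sh: "(\<Prod>j\<in>UNIV. heat1 t ((x + axis i c) $ j)) = heat1 t (x $ i + c) * ?P i" for i c
    by (subst prod.remove[of _ i]) (auto simp: axis_def intro!: prod.cong)
  have sh2: "(\<Prod>j\<in>UNIV. heat1 t ((x - axis i 1) $ j)) = heat1 t (x $ i - 1) * ?P i" for i
  proof -
    have e: "x - axis i 1 = x + axis i (-1)" by (simp add: axis_def vec_eq_iff)
    show ?thesis unfolding e sh by simp
  qed
  have sh0: "(\<Prod>j\<in>UNIV. heat1 t (x $ j)) = heat1 t (x $ i) * ?P i" for i
    by (subst prod.remove[of _ i]) auto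
  have hp: "heat t = (\<lambda>x. \<Prod>i\<in>UNIV. heat1 t ((x :: int ^ 'd) $ i))" by (rule ext) (rule heat_prod)
  have d: "((\<lambda>t. heat t x) has_real_derivative (\<Sum>i\<in>UNIV. - heat1' t (x $ i) * ?P i)) (at t)"
    unfolding heat_prod by (rule has_field_derivative_prod) (rule DERIV_heat1)
  show *: "heat' t x = (\<Sum>i\<in>UNIV. heat1' t (x $ i) * ?P i)"
  proof -
    have "heat' t x = (\<Sum>i\<in>(UNIV :: 'd set). 2 * (\<Prod>j\<in>UNIV. heat1 t (x $ j))) - adj (\<lambda>x. \<Prod>i\<in>UNIV. heat1 t (x $ i)) x"
      unfolding heat'_def hp by (simp add: lapl_eq)
    also have "\<dots> = (\<Sum>i\<in>UNIV. 2 * (heat1 t (x $ i) * ?P i) - (heat1 t (x $ i + 1) * ?P i + heat1 t (x $ i - 1) * ?P i))"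
      unfolding adj_def sh sh2 by (subst sum_subtractf[symmetric]) (intro sum.cong refl arg_cong2[of _ _ _ _ "(-)"], simp_all add: sh0[symmetric])
    also have "\<dots> = (\<Sum>i\<in>UNIV. heat1' t (x $ i) * ?P i)"
      by (intro sum.cong refl) (simp add: heat1'_eq algebra_simps)
    finally show ?thesis .
  qed
  show "((\<lambda>t. heat t x) has_real_derivative - heat' t x) (at t)"
    using d unfolding * by (simp add: sum_negf)
qed

lemma abs_heat_le: "\<bar>heat t (x :: int ^ 'd::finite)\<bar> \<le> heat t (0 :: int ^ 'd)"
  unfolding heat_prod abs_prod zero_index by (intro prod_mono) (auto simp: abs_heat1_le)

text \<open>In each coordinate the multiplier is nonnegative and the oscillating factor has modulus
  at most 1, so the value at the origin dominates. This bound on the time derivative is what makes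
  \<open>heat t 0 + heat t x\<close> decrease in time.\<close>

lemma abs_heat'_le: "\<bar>heat' t (x :: int ^ 'd::finite)\<bar> \<le> heat' t (0 :: int ^ 'd)"
proof -
  have "\<bar>heat' t x\<bar> \<le> (\<Sum>i\<in>UNIV. \<bar>heat1' t (x $ i)\<bar> * (\<Prod>j\<in>UNIV - {i}. \<bar>heat1 t (x $ j)\<bar>))"
    unfolding heat'_eq by (rule order_trans[OF sum_abs]) (simp add: abs_mult abs_prod)
  also have "\<dots> \<le> heat' t (0 :: int ^ 'd)"
    unfolding heat'_eq zero_index
    by (intro sum_mono mult_mono prod_mono) (auto simp: abs_heat1_le abs_heat1'_le heat1'_0_nonneg prod_nonneg)
  finally show ?thesis .
qed

lemma heat'_0_nonneg: "0 \<le> heat' t (0 :: int ^ 'd::finite)"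
  by (rule order_trans[OF abs_ge_zero abs_heat'_le[of t 0]])

section \<open>Gaussian asymptotics in one dimension\<close>

text \<open>The characteristic function of the standard normal distribution, rescaled by
  \<open>sqrt 2\<close> to the weight \<open>exp (- x\<^sup>2)\<close>.\<close>

lemma gaussian_cos:
  "has_bochner_integral lborel (\<lambda>x. cos (y * x) * exp (- x\<^sup>2)) (sqrt pi * exp (- y\<^sup>2 / 4))"
proof -
  define t where "t = y / sqrt 2"
  interpret N: prob_space std_normal_distribution by (rule prob_space_normal_density) simp
  have int: "integrable lborel (\<lambda>x. std_normal_density x * cos (t * x))"
    by (rule Bochner_Integration.integrable_bound[where f = std_normal_density])
       (auto intro!: AE_I2 simp: abs_mult mult_left_le)
  have "(CLINT x|std_normal_distribution. iexp (t * x)) = complex_of_real (exp (- (t^2) / 2))"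
    using char_std_normal_distribution unfolding char_def by meson
  hence "Re (CLINT x|std_normal_distribution. iexp (t * x)) = exp (- (t^2) / 2)" by simp
  moreover have "Re (CLINT x|std_normal_distribution. iexp (t * x))
     = (LINT x|std_normal_distribution. Re (iexp (t * x)))"
    by (rule integral_Re[symmetric]) (auto intro!: N.integrable_const_bound[where B = 1] AE_I2)
  ultimately have "(LINT x|std_normal_distribution. cos (t * x)) = exp (- (t^2) / 2)"
    by (simp add: Re_exp)
  hence "(LINT x|lborel. std_normal_density x * cos (t * x)) = exp (- (t^2) / 2)"
    by (subst (asm) integral_density) auto
  hence h: "has_bochner_integral lborel (\<lambda>x. std_normal_density x * cos (t * x)) (exp (- (t^2) / 2))"
    using int by (simp add: has_bochner_integral_iff)
  have "has_bochner_integral lborel (\<lambda>x. std_normal_density (0 + sqrt 2 * x) * cos (t * (0 + sqrt 2 * x)))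
     (exp (- (t^2) / 2) /\<^sub>R \<bar>sqrt 2\<bar>)"
    by (rule lborel_has_bochner_integral_real_affine_iff[where c = "sqrt 2" and t = 0
        and f = "\<lambda>x. std_normal_density x * cos (t * x)" and x = "exp (- (t^2) / 2)",
        THEN iffD1, OF _ h]) simp
  hence "has_bochner_integral lborel (\<lambda>x. sqrt (2 * pi) *
        (std_normal_density (0 + sqrt 2 * x) * cos (t * (0 + sqrt 2 * x))))
      (sqrt (2 * pi) * (exp (- (t^2) / 2) /\<^sub>R \<bar>sqrt 2\<bar>))"
    by (rule has_bochner_integral_mult_right)
  moreover have "t * sqrt 2 = y" by (simp add: t_def)
  hence "t * (0 + sqrt 2 * x) = y * x" for x by (simp only: add_0 mult.assoc[symmetric])
  moreover have "exp (- (t^2) / 2) /\<^sub>R \<bar>sqrt 2\<bar> = exp (- (t^2) / 2) / sqrt 2"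
    unfolding divide_inverse real_scaleR_def by (simp only: abs_of_nonneg real_sqrt_ge_zero zero_le_numeral mult.commute)
  ultimately have "has_bochner_integral lborel (\<lambda>x. sqrt (2 * pi) * (std_normal_density (sqrt 2 * x) * cos (y * x)))
     (sqrt (2 * pi) * (exp (- (t^2) / 2) / sqrt 2))"
    by (simp only: add_0)
  moreover have "sqrt (2 * pi) * (std_normal_density (sqrt 2 * x) * cos (y * x)) = cos (y * x) * exp (- x\<^sup>2)" for x
    by (simp add: std_normal_density_def power_mult_distrib)
  moreover have "sqrt (2 * pi) * (exp (- (t^2) / 2) / sqrt 2) = sqrt pi * exp (- y\<^sup>2 / 4)"
    by (simp add: t_def real_sqrt_mult power_divide)
  ultimately show ?thesis by simp
qed

text \<open>The constant 1/8 is generous so as to hold up to \<open>pi\<close>: for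
  \<open>\<bar>x\<bar> \<le> 2\<close> by the Taylor polynomial of degree four, beyond by
  \<open>cos x \<le> 0\<close> and \<open>x\<^sup>2 \<le> 16\<close>.\<close>

lemma cos_quadratic_bound:
  fixes x :: real
  assumes "\<bar>x\<bar> \<le> pi"
  shows "x\<^sup>2 / 8 \<le> 2 - 2 * cos x"
proof (cases "\<bar>x\<bar> \<le> 2")
  case True
  obtain t where "cos x = (\<Sum>m<4. cos_coeff m * x ^ m) + (cos (t + 1/2 * real 4 * pi) / fact 4) * x ^ 4"
    using Maclaurin_cos_expansion[of x 4] by blast
  moreover have "{..<4::nat} = {0, 1, 2, 3}" by auto
  moreover have "cos_coeff 0 = 1" "cos_coeff 1 = 0" "cos_coeff 2 = - 1 / 2" "cos_coeff 3 = 0"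
    by (simp_all add: cos_coeff_def)
  moreover have "fact 4 = (24 :: real)" by (simp add: fact_numeral)
  ultimately have "cos x = 1 - x\<^sup>2 / 2 + cos (t + 1/2 * real 4 * pi) / 24 * x ^ 4"
    by simp
  also have "\<dots> \<le> 1 - x\<^sup>2 / 2 + 1 / 24 * x ^ 4"
    by (intro add_left_mono mult_right_mono divide_right_mono) auto
  finally have c: "cos x \<le> 1 - x\<^sup>2 / 2 + x ^ 4 / 24" by simp
  have "x\<^sup>2 \<le> 2\<^sup>2" using True by (intro abs_le_square_iff[THEN iffD1]) auto
  hence "x\<^sup>2 \<le> 4" by simp
  hence "x\<^sup>2 * x\<^sup>2 \<le> 4 * x\<^sup>2" by (intro mult_right_mono) auto
  moreover have "x ^ 4 = x\<^sup>2 * x\<^sup>2" by (simp add: power4_eq_xxxx power2_eq_square mult.assoc)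
  ultimately show ?thesis using c zero_le_power2[of x] by linarith
next
  case False
  have "cos \<bar>x\<bar> \<le> cos 2" using False assms by (intro cos_monotone_0_pi_le) auto
  hence "cos x \<le> 0" using cos_two_less_zero unfolding cos_abs_real by linarith
  moreover have "x\<^sup>2 \<le> 4\<^sup>2" using assms pi_less_4 by (intro abs_le_square_iff[THEN iffD1]) auto
  ultimately show ?thesis by simp
qed

text \<open>The exponential factor of \<open>heat1\<close> after the substitution
  \<open>\<theta> = u / sqrt t\<close>, cut off to the rescaled period. Its pointwise limit for
  large \<open>t\<close> is \<open>exp (- u\<^sup>2)\<close>.\<close>

definition heat1_window :: "real \<Rightarrow> real \<Rightarrow> real" where
  "heat1_window t u = indicator {- (pi * sqrt t)..pi * sqrt t} u * exp (- (t * (2 - 2 * cos (u / sqrt t))))"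

lemma heat1_window_measurable [measurable]: "heat1_window t \<in> borel_measurable borel"
  unfolding heat1_window_def[abs_def] by measurable

lemma heat1_window_nonneg: "0 \<le> heat1_window t u"
  by (simp add: heat1_window_def)

lemma heat1_window_le:
  assumes "0 < t"
  shows "heat1_window t u \<le> exp (- u\<^sup>2 / 8)"
proof (cases "u \<in> {- (pi * sqrt t)..pi * sqrt t}")
  case True
  hence "\<bar>u / sqrt t\<bar> \<le> pi" using assms by (auto simp: abs_le_iff field_simps)
  from cos_quadratic_bound[OF this] have "t * ((u / sqrt t)\<^sup>2 / 8) \<le> t * (2 - 2 * cos (u / sqrt t))"
    using assms by (intro mult_left_mono) auto
  moreover have "t * ((u / sqrt t)\<^sup>2 / 8) = u\<^sup>2 / 8" using assms by (simp add: power_divide)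
  ultimately show ?thesis using True by (simp add: heat1_window_def)
qed (simp add: heat1_window_def)

lemma integrable_gaussian_8: "integrable lborel (\<lambda>u::real. exp (- u\<^sup>2 / 8))"
proof -
  have "integrable lborel (\<lambda>x::real. exp (- x\<^sup>2))"
    using gaussian_cos[of 0] by (simp add: has_bochner_integral_iff)
  hence "integrable lborel (\<lambda>x::real. exp (- (0 + (1 / sqrt 8) * x)\<^sup>2))"
    by (intro lborel_integrable_real_affine) auto
  thus ?thesis by (simp add: power_divide)
qed

lemma integrable_heat1_window:
  assumes "0 < t"
  shows "integrable lborel (\<lambda>u. cos (y * u) * heat1_window t u)" "integrable lborel (heat1_window t)"
proof -
  show *: "integrable lborel (\<lambda>u. cos (y * u) * heat1_window t u)" for y
  proof (rule Bochner_Integration.integrable_bound[OF integrable_gaussian_8])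
    show "AE u in lborel. norm (cos (y * u) * heat1_window t u) \<le> norm (exp (- u\<^sup>2 / 8))"
    proof (rule AE_I2)
      fix u
      have "\<bar>cos (y * u)\<bar> * heat1_window t u \<le> heat1_window t u"
        by (intro mult_left_le_one_le heat1_window_nonneg) auto
      thus "norm (cos (y * u) * heat1_window t u) \<le> norm (exp (- u\<^sup>2 / 8))"
        using heat1_window_le[OF assms, of u] heat1_window_nonneg[of t u] by (simp add: abs_mult)
    qed
  qed simp
  show "integrable lborel (heat1_window t)" using *[of 0] by simp
qed

lemma sqrt_heat1_eq:
  assumes t: "0 < t"
  shows "sqrt t * heat1 t n = (LINT u|lborel. cos (of_int n / sqrt t * u) * heat1_window t u) / (2 * pi)"
proof -
  let ?f = "\<lambda>\<theta>. cos (of_int n * \<theta>) * exp (- (t * (2 - 2 * cos \<theta>)))"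
  have "set_integrable lborel {-pi..pi} ?f"
    by (rule borel_integrable_atLeastAtMost') (intro continuous_intros)
  from set_borel_integral_eq_integral(2)[OF this]
  have "integral {-pi..pi} ?f = (LINT \<theta>|lborel. indicator {-pi..pi} \<theta> * ?f \<theta>)"
    by (simp add: set_lebesgue_integral_def)
  also have "\<dots> = \<bar>1 / sqrt t\<bar> *\<^sub>R (LINT u|lborel. indicator {-pi..pi} (0 + 1 / sqrt t * u) * ?f (0 + 1 / sqrt t * u))"
    using t by (intro lborel_integral_real_affine) auto
  also have "(\<lambda>u. indicator {-pi..pi} (0 + 1 / sqrt t * u) * ?f (0 + 1 / sqrt t * u))
     = (\<lambda>u. cos (of_int n / sqrt t * u) * heat1_window t u)"
  proof (rule ext)
    fix u
    have "0 + 1 / sqrt t * u \<in> {-pi..pi} \<longleftrightarrow> u \<in> {- (pi * sqrt t)..pi * sqrt t}"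
      using t by (auto simp: field_simps)
    hence "indicator {-pi..pi} (0 + 1 / sqrt t * u) = (indicator {- (pi * sqrt t)..pi * sqrt t} u :: real)"
      by (simp add: indicator_def)
    thus "indicator {-pi..pi} (0 + 1 / sqrt t * u) * ?f (0 + 1 / sqrt t * u)
       = cos (of_int n / sqrt t * u) * heat1_window t u"
      by (simp add: heat1_window_def)
  qed
  finally show ?thesis using t by (simp add: heat1_def)
qed

text \<open>Up to the factor \<open>2 * pi\<close>, the L1 distance between the rescaled integrand
  and its Gaussian limit. It does not involve the lattice point, which makes the local limit theorem
  uniform in space.\<close>

definition lclt_error :: "real \<Rightarrow> real" where
  "lclt_error t = (LINT u|lborel. \<bar>heat1_window t u - exp (- u\<^sup>2)\<bar>) / (2 * pi)"

text \<open>Both quantities are cosine transforms at the same frequency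
  \<open>of_int n / sqrt t\<close>, so their difference is at most the L1 distance of the
  transformed functions.\<close>

lemma local_clt_1:
  assumes t: "0 < t"
  shows "\<bar>sqrt t * heat1 t n - exp (- (of_int n)\<^sup>2 / (4 * t)) / (2 * sqrt pi)\<bar> \<le> lclt_error t"
proof -
  let ?y = "of_int n / sqrt t"
  have g: "integrable lborel (\<lambda>u. cos (?y * u) * exp (- u\<^sup>2))"
    "(LINT u|lborel. cos (?y * u) * exp (- u\<^sup>2)) = sqrt pi * exp (- ?y\<^sup>2 / 4)"
    using gaussian_cos[of ?y] by (auto simp: has_bochner_integral_iff)
  have g0: "integrable lborel (\<lambda>u::real. exp (- u\<^sup>2))"
    using gaussian_cos[of 0] by (simp add: has_bochner_integral_iff)
  have "sqrt pi * exp (- ?y\<^sup>2 / 4) / (2 * pi) = exp (- (of_int n)\<^sup>2 / (4 * t)) / (2 * sqrt pi)"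
  proof -
    have "- ?y\<^sup>2 / 4 = - (of_int n)\<^sup>2 / (4 * t)" using t by (simp add: power_divide)
    moreover have "sqrt pi * E / (2 * pi) = E / (2 * sqrt pi)" for E
    proof -
      have "sqrt pi * E / (2 * pi) = (sqrt pi / pi) * E / 2" by simp
      also have "sqrt pi / pi = inverse (sqrt pi)" by (rule sqrt_divide_self_eq) simp
      finally show ?thesis by (simp only: divide_inverse inverse_mult_distrib mult_ac)
    qed
    ultimately show ?thesis by (simp only:)
  qed
  hence "sqrt t * heat1 t n - exp (- (of_int n)\<^sup>2 / (4 * t)) / (2 * sqrt pi)
    = ((LINT u|lborel. cos (?y * u) * heat1_window t u) - (LINT u|lborel. cos (?y * u) * exp (- u\<^sup>2))) / (2 * pi)"
    unfolding sqrt_heat1_eq[OF t] g(2) diff_divide_distrib by (simp only:)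
  also have "\<dots> = (LINT u|lborel. cos (?y * u) * heat1_window t u - cos (?y * u) * exp (- u\<^sup>2)) / (2 * pi)"
    by (simp only: Bochner_Integration.integral_diff[OF integrable_heat1_window(1)[OF t] g(1)])
  finally have eq: "sqrt t * heat1 t n - exp (- (of_int n)\<^sup>2 / (4 * t)) / (2 * sqrt pi)
     = (LINT u|lborel. cos (?y * u) * heat1_window t u - cos (?y * u) * exp (- u\<^sup>2)) / (2 * pi)" .
  have "\<bar>LINT u|lborel. cos (?y * u) * heat1_window t u - cos (?y * u) * exp (- u\<^sup>2)\<bar>
     \<le> (LINT u|lborel. \<bar>cos (?y * u) * heat1_window t u - cos (?y * u) * exp (- u\<^sup>2)\<bar>)"
    by (rule integral_abs_bound)
  also have "\<dots> \<le> (LINT u|lborel. \<bar>heat1_window t u - exp (- u\<^sup>2)\<bar>)"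
  proof (rule integral_mono)
    show "integrable lborel (\<lambda>u. \<bar>cos (?y * u) * heat1_window t u - cos (?y * u) * exp (- u\<^sup>2)\<bar>)"
      using integrable_heat1_window[OF t] g(1) by (intro integrable_abs Bochner_Integration.integrable_diff)
    show "integrable lborel (\<lambda>u. \<bar>heat1_window t u - exp (- u\<^sup>2)\<bar>)"
      using integrable_heat1_window[OF t] g0 by (intro integrable_abs Bochner_Integration.integrable_diff)
    fix u
    have "\<bar>cos (?y * u) * (heat1_window t u - exp (- u\<^sup>2))\<bar> \<le> \<bar>heat1_window t u - exp (- u\<^sup>2)\<bar>"
      unfolding abs_mult by (intro mult_left_le_one_le) auto
    thus "\<bar>cos (?y * u) * heat1_window t u - cos (?y * u) * exp (- u\<^sup>2)\<bar> \<le> \<bar>heat1_window t u - exp (- u\<^sup>2)\<bar>"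
      by (simp add: right_diff_distrib)
  qed
  finally show ?thesis unfolding eq lclt_error_def by (simp add: divide_right_mono)
qed

text \<open>Dominated convergence: \<open>t * (2 - 2 * cos (u / sqrt t))\<close> tends to
  \<open>u\<^sup>2\<close>, and \<open>heat1_window_le\<close> supplies the Gaussian
  majorant.\<close>

lemma lclt_error_tendsto: "(lclt_error \<longlongrightarrow> 0) at_top"
proof -
  have g0: "integrable lborel (\<lambda>u::real. exp (- u\<^sup>2))"
    using gaussian_cos[of 0] by (simp add: has_bochner_integral_iff)
  have "((\<lambda>t. LINT u|lborel. \<bar>heat1_window t u - exp (- u\<^sup>2)\<bar>) \<longlongrightarrow> (LINT u::real|lborel. 0)) at_top"
  proof (rule integral_dominated_convergence_at_top[where w = "\<lambda>u. exp (- u\<^sup>2 / 8) + exp (- u\<^sup>2)"])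
    show "integrable lborel (\<lambda>u::real. exp (- u\<^sup>2 / 8) + exp (- u\<^sup>2))"
      by (intro Bochner_Integration.integrable_add integrable_gaussian_8 g0)
    show "\<forall>\<^sub>F t in at_top. AE u in lborel. norm \<bar>heat1_window t u - exp (- u\<^sup>2)\<bar> \<le> exp (- u\<^sup>2 / 8) + exp (- u\<^sup>2)"
      using eventually_gt_at_top[of 0]
    proof eventually_elim
      case (elim t)
      show ?case
      proof (rule AE_I2)
        fix u :: real
        show "norm \<bar>heat1_window t u - exp (- u\<^sup>2)\<bar> \<le> exp (- u\<^sup>2 / 8) + exp (- u\<^sup>2)"
          using heat1_window_le[OF elim, of u] heat1_window_nonneg[of t u] exp_ge_zero[of "- u\<^sup>2"]
          unfolding real_norm_def abs_abs by linarith
      qed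
    qed
    show "AE u in lborel. ((\<lambda>t. \<bar>heat1_window t u - exp (- u\<^sup>2)\<bar>) \<longlongrightarrow> 0) at_top"
    proof (rule AE_I2)
      fix u :: real
      have "((\<lambda>t. t * (2 - 2 * cos (u / sqrt t))) \<longlongrightarrow> u\<^sup>2) at_top"
        by (real_asymp simp: power2_eq_square)
      hence "((\<lambda>t. exp (- (t * (2 - 2 * cos (u / sqrt t))))) \<longlongrightarrow> exp (- u\<^sup>2)) at_top"
        by (intro tendsto_intros)
      moreover have "\<forall>\<^sub>F t in at_top. \<bar>u\<bar> \<le> pi * sqrt t" by real_asymp
      hence "\<forall>\<^sub>F t in at_top. exp (- (t * (2 - 2 * cos (u / sqrt t)))) = heat1_window t u"
        by eventually_elim (auto simp: heat1_window_def indicator_def abs_le_iff)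
      ultimately have "((\<lambda>t. heat1_window t u) \<longlongrightarrow> exp (- u\<^sup>2)) at_top"
        by (rule Lim_transform_eventually)
      from tendsto_rabs[OF LIM_zero[OF this]] show "((\<lambda>t. \<bar>heat1_window t u - exp (- u\<^sup>2)\<bar>) \<longlongrightarrow> 0) at_top" by simp
    qed
  qed auto
  hence "((\<lambda>t. (LINT u|lborel. \<bar>heat1_window t u - exp (- u\<^sup>2)\<bar>) / (2 * pi)) \<longlongrightarrow> 0 / (2 * pi)) at_top"
    by (intro tendsto_intros) auto
  thus ?thesis by (simp add: lclt_error_def[abs_def])
qed

lemma heat1_0_bound: "\<exists>C>0. \<forall>t>0. sqrt t * heat1 t 0 \<le> C"
proof (intro exI conjI allI impI)
  let ?C = "(LINT u::real|lborel. exp (- u\<^sup>2 / 8)) / (2 * pi) + 1"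
  have "0 \<le> (LINT u::real|lborel. exp (- u\<^sup>2 / 8))" by (rule Bochner_Integration.integral_nonneg) auto
  thus "0 < ?C" by (intro add_nonneg_pos divide_nonneg_pos) auto
  fix t :: real assume t: "0 < t"
  have "(LINT u|lborel. heat1_window t u) \<le> (LINT u|lborel. exp (- u\<^sup>2 / 8))"
    by (intro integral_mono integrable_heat1_window integrable_gaussian_8 heat1_window_le t)
  hence "sqrt t * heat1 t 0 \<le> (LINT u::real|lborel. exp (- u\<^sup>2 / 8)) / (2 * pi)"
    unfolding sqrt_heat1_eq[OF t] by (simp add: divide_right_mono)
  thus "sqrt t * heat1 t 0 \<le> ?C" by simp
qed

section \<open>Bounds for the heat kernel\<close>

lemma heat_mono_0: "0 \<le> t \<Longrightarrow> heat t (x :: int ^ 'd::finite) \<le> heat t (0 :: int ^ 'd)"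
  using abs_heat_le[of t x] by linarith

lemma continuous_heat: "isCont (\<lambda>t. heat t (x :: int ^ 'd::finite)) t"
  by (rule DERIV_isCont) (rule DERIV_heat)

lemma measurable_heat [measurable]: "(\<lambda>t. heat t (x :: int ^ 'd::finite)) \<in> borel_measurable borel"
  by (rule borel_measurable_continuous_onI) (simp add: continuous_heat continuous_on_eq_continuous_at)

lemma heat_le_1:
  assumes "0 \<le> t"
  shows "heat t (x :: int ^ 'd::finite) \<le> 1"
proof -
  have "ennreal (heat t x) = (\<integral>\<^sup>+y. ennreal (heat t y) * indicator {x} y \<partial>count_space UNIV)"
    by simp
  also have "\<dots> \<le> (\<integral>\<^sup>+y. ennreal (heat t (y :: int ^ 'd)) \<partial>count_space UNIV)"
    by (intro nn_integral_mono) (auto simp: indicator_def)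
  also have "\<dots> = 1" by (rule nn_integral_heat[OF assms])
  finally show ?thesis by simp
qed

lemma heat_0_bound: "\<exists>C\<ge>1. \<forall>t>0. sqrt t ^ CARD('d) * heat t (0 :: int ^ 'd::finite) \<le> C"
proof -
  obtain C where C: "C > 0" "\<And>t. t > 0 \<Longrightarrow> sqrt t * heat1 t 0 \<le> C" using heat1_0_bound by blast
  have "sqrt t ^ CARD('d) * heat t (0 :: int ^ 'd) \<le> max 1 (C ^ CARD('d))" if "t > 0" for t
  proof -
    have "sqrt t ^ CARD('d) * heat t (0 :: int ^ 'd) = (sqrt t * heat1 t 0) ^ CARD('d)"
      unfolding heat_prod by (simp add: power_mult_distrib)
    also have "\<dots> \<le> C ^ CARD('d)"
      using C(2)[OF that] that heat1_0_nonneg[of t] by (intro power_mono) auto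
    finally show ?thesis by simp
  qed
  thus ?thesis by (intro exI[of _ "max 1 (C ^ CARD('d))"]) auto
qed

section \<open>Off-diagonal decay by Chernoff's method\<close>

lemma cosh_le_quadratic:
  fixes l :: real
  assumes "0 \<le> l" "l \<le> 1"
  shows "cosh l - 1 \<le> l\<^sup>2"
proof -
  have "exp (- l) \<le> 1 / (1 + l)"
    using exp_ge_add_one_self[of l] assms by (simp add: exp_minus divide_inverse le_imp_inverse_le)
  also have "\<dots> \<le> 1 - l + l\<^sup>2"
  proof -
    have "(1 - l + l\<^sup>2) * (1 + l) = 1 + l * l\<^sup>2" by (simp add: algebra_simps power2_eq_square)
    hence "1 \<le> (1 - l + l\<^sup>2) * (1 + l)" using assms by simp
    thus ?thesis using assms by (simp add: pos_divide_le_eq)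
  qed
  finally have "exp (- l) \<le> 1 - l + l\<^sup>2" .
  moreover have "exp l \<le> 1 + l + l\<^sup>2" using assms by (rule exp_bound)
  ultimately have "exp l + exp (- l) \<le> (1 + l + l\<^sup>2) + (1 - l + l\<^sup>2)"
    by (intro add_mono)
  hence "exp l + exp (- l) \<le> 2 + 2 * l\<^sup>2" by simp
  hence "(exp l + exp (- l)) / 2 \<le> (2 + 2 * l\<^sup>2) / 2" by (rule divide_right_mono) simp
  moreover have "cosh l = (exp l + exp (- l)) / 2" by (simp add: cosh_field_def)
  ultimately show ?thesis by simp
qed

text \<open>Chernoff's bound with the exponential moment of one coordinate. The conditions on
  \<open>l\<close> keep that moment below \<open>exp 2\<close>, because
  \<open>cosh l - 1 \<le> l\<^sup>2\<close> for \<open>l \<le> 1\<close>.\<close>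

lemma heat_tail:
  fixes i :: "'d::finite"
  assumes t: "0 \<le> t" and l: "0 \<le> l" "l \<le> 1" "t * l\<^sup>2 \<le> 1" and r: "0 \<le> r"
  shows "(\<integral>\<^sup>+y. ennreal (heat t y) * indicator {y. r \<le> \<bar>real_of_int (y $ i)\<bar>} y \<partial>count_space UNIV)
    \<le> ennreal (exp 2 / cosh (l * r))"
proof -
  have "(\<integral>\<^sup>+y. ennreal (heat t y) * indicator {y. r \<le> \<bar>real_of_int (y $ i)\<bar>} y \<partial>count_space UNIV)
    \<le> (\<integral>\<^sup>+y. ennreal (heat t y * cosh (l * real_of_int (y $ i))) * ennreal (1 / cosh (l * r)) \<partial>count_space UNIV)"
  proof (rule nn_integral_mono)
    fix y :: "int ^ 'd"
    have "heat t y * 1 \<le> heat t y * (cosh (l * real_of_int (y $ i)) / cosh (l * r))"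
      if "r \<le> \<bar>real_of_int (y $ i)\<bar>"
    proof (intro mult_left_mono heat_nonneg t)
      have "cosh (l * r) \<le> cosh (l * \<bar>real_of_int (y $ i)\<bar>)"
        using that l r by (subst cosh_real_nonneg_le_iff) (auto intro: mult_left_mono)
      also have "\<dots> = cosh \<bar>l * real_of_int (y $ i)\<bar>" using l by (simp add: abs_mult)
      also have "\<dots> = cosh (l * real_of_int (y $ i))" by (rule cosh_real_abs)
      finally show "1 \<le> cosh (l * real_of_int (y $ i)) / cosh (l * r)"
        using cosh_real_pos[of "l * r"] by (subst pos_le_divide_eq) auto
    qed
    hence "ennreal (heat t y) * indicator {y. r \<le> \<bar>real_of_int (y $ i)\<bar>} y
       \<le> ennreal (heat t y * (cosh (l * real_of_int (y $ i)) / cosh (l * r)))"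
      by (auto simp: indicator_def intro!: ennreal_leI)
    also have "\<dots> = ennreal (heat t y * cosh (l * real_of_int (y $ i)) * (1 / cosh (l * r)))" by simp
    also have "\<dots> = ennreal (heat t y * cosh (l * real_of_int (y $ i))) * ennreal (1 / cosh (l * r))"
      using heat_nonneg[OF t, of y] by (intro ennreal_mult) (auto intro: mult_nonneg_nonneg less_imp_le cosh_real_pos)
    finally show "ennreal (heat t y) * indicator {y. r \<le> \<bar>real_of_int (y $ i)\<bar>} y \<le> \<dots>" .
  qed
  also have "\<dots> = ennreal (exp (2 * t * (cosh l - 1))) * ennreal (1 / cosh (l * r))"
    by (subst nn_integral_multc) (simp_all only: nn_integral_heat_cosh[OF t], simp)
  also have "\<dots> = ennreal (exp (2 * t * (cosh l - 1)) * (1 / cosh (l * r)))"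
    by (intro ennreal_mult[symmetric]) (auto intro: less_imp_le cosh_real_pos)
  also have "\<dots> \<le> ennreal (exp 2 * (1 / cosh (l * r)))"
  proof (intro ennreal_leI mult_right_mono)
    have "t * (cosh l - 1) \<le> t * l\<^sup>2" using cosh_le_quadratic l t by (intro mult_left_mono) auto
    thus "exp (2 * t * (cosh l - 1)) \<le> exp 2" using l by simp
  qed (auto intro: less_imp_le cosh_real_pos)
  finally show ?thesis by simp
qed

lemma nn_integral_heat_reflect:
  "(\<integral>\<^sup>+y. ennreal (heat t (x - y)) * f (x - y) \<partial>count_space UNIV)
     = (\<integral>\<^sup>+y. ennreal (heat t y) * f y \<partial>count_space UNIV)"
  by (rule nn_integral_count_space_shift(3)[of "\<lambda>y. ennreal (heat t y) * f y"])

text \<open>The semigroup splits \<open>t\<close> into two halves. Whatever the intermediate point,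
  one of the two displacements has \<open>i\<close>-th coordinate at least
  \<open>\<bar>x $ i\<bar> / 2\<close> in modulus; it is estimated by the tail and the other factor
  by its value at the origin. Decay in time and decay in space thus appear in the same
  bound.\<close>

lemma heat_chernoff:
  fixes x :: "int ^ 'd::finite"
  assumes t: "0 \<le> t" and l: "0 \<le> l" "l \<le> 1" "t / 2 * l\<^sup>2 \<le> 1"
  shows "heat t x \<le> heat (t / 2) (0 :: int ^ 'd) * (2 * exp 2 / cosh (l * (\<bar>real_of_int (x $ i)\<bar> / 2)))"
proof -
  define r where "r = \<bar>real_of_int (x $ i)\<bar> / 2"
  define S where "S = {y :: int ^ 'd. r \<le> \<bar>real_of_int (y $ i)\<bar>}"
  let ?h = "\<lambda>y. heat (t / 2) (y :: int ^ 'd)"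
  have t2: "0 \<le> t / 2" using t by simp
  have r: "0 \<le> r" by (simp add: r_def)
  have "ennreal (heat t x) = (\<integral>\<^sup>+y. ennreal (?h (x - y) * ?h y) \<partial>count_space UNIV)"
    using heat_semigroup[OF t2 t2, of x] by simp
  also have "\<dots> \<le> (\<integral>\<^sup>+y. ennreal (?h 0) * (ennreal (?h y) * indicator S y)
      + ennreal (?h 0) * (ennreal (?h (x - y)) * indicator S (x - y)) \<partial>count_space UNIV)"
  proof (rule nn_integral_mono)
    fix y
    have "y \<in> S \<or> x - y \<in> S" unfolding S_def r_def by (auto simp: abs_if)
    moreover have "ennreal (?h (x - y) * ?h y) \<le> ennreal (?h 0) * ennreal (?h y)"
    proof -
      have "?h (x - y) * ?h y \<le> ?h 0 * ?h y"
        by (intro mult_right_mono heat_mono_0 heat_nonneg t2)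
      thus ?thesis unfolding ennreal_mult[OF heat_nonneg[OF t2] heat_nonneg[OF t2], symmetric] by (rule ennreal_leI)
    qed
    moreover have "ennreal (?h (x - y) * ?h y) \<le> ennreal (?h 0) * ennreal (?h (x - y))"
    proof -
      have "?h (x - y) * ?h y \<le> ?h 0 * ?h (x - y)"
        by (subst mult.commute, intro mult_right_mono heat_mono_0 heat_nonneg t2)
      thus ?thesis unfolding ennreal_mult[OF heat_nonneg[OF t2] heat_nonneg[OF t2], symmetric] by (rule ennreal_leI)
    qed
    ultimately show "ennreal (?h (x - y) * ?h y) \<le> ennreal (?h 0) * (ennreal (?h y) * indicator S y)
      + ennreal (?h 0) * (ennreal (?h (x - y)) * indicator S (x - y))"
      by (auto simp: add_increasing add_increasing2)
  qed
  also have "\<dots> = ennreal (?h 0) * (\<integral>\<^sup>+y. ennreal (?h y) * indicator S y \<partial>count_space UNIV)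
      + ennreal (?h 0) * (\<integral>\<^sup>+y. ennreal (?h (x - y)) * indicator S (x - y) \<partial>count_space UNIV)"
    by (simp add: nn_integral_add nn_integral_cmult)
  also have "\<dots> = ennreal (?h 0) * (2 * (\<integral>\<^sup>+y. ennreal (?h y) * indicator S y \<partial>count_space UNIV))"
    unfolding nn_integral_heat_reflect[of "t / 2" x "indicator S"] by (simp add: distrib_left mult_2)
  also have "\<dots> \<le> ennreal (?h 0) * (2 * ennreal (exp 2 / cosh (l * r)))"
    unfolding S_def using l by (intro mult_left_mono heat_tail t2 r) auto
  also have "\<dots> = ennreal (?h 0 * (2 * exp 2 / cosh (l * r)))"
  proof -
    have "ennreal (a * (2 * q)) = ennreal a * (2 * ennreal q)" if "0 \<le> a" "0 \<le> q" for a q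
      using that ennreal_mult[of a "2 * q"] ennreal_mult[of 2 q] by simp
    from this[OF heat_nonneg[OF t2], of "exp 2 / cosh (l * r)" "0 :: int ^ 'd"] show ?thesis
      by (simp add: less_imp_le[OF cosh_real_pos])
  qed
  finally show ?thesis
    using heat_nonneg[OF t2, of "0 :: int ^ 'd"] unfolding r_def
    by (subst (asm) ennreal_le_iff) (auto intro!: mult_nonneg_nonneg divide_nonneg_pos cosh_real_pos)
qed

lemma power_le_exp:
  fixes z :: real
  assumes "0 \<le> z" "0 < n"
  shows "z ^ n \<le> real n ^ n * exp z"
proof -
  have "z / n \<le> exp (z / n)" using exp_ge_add_one_self[of "z / n"] by linarith
  hence "(z / n) ^ n \<le> exp (z / n) ^ n" using assms by (intro power_mono) auto
  also have "\<dots> = exp z" using assms by (simp flip: exp_of_nat_mult)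
  finally show ?thesis using assms by (simp add: power_divide divide_le_eq mult.commute)
qed

lemma power_div_cosh_bound:
  fixes z a :: real
  assumes "0 \<le> z" "0 < a" "0 < n"
  shows "z ^ n / cosh (a * z) \<le> 2 * (real n / a) ^ n"
proof -
  have "(a * z) ^ n \<le> real n ^ n * exp (a * z)" using assms by (intro power_le_exp) auto
  also have "\<dots> \<le> real n ^ n * (2 * cosh (a * z))"
    by (intro mult_left_mono) (auto simp: cosh_field_def)
  finally have "z ^ n \<le> 2 * (real n / a) ^ n * cosh (a * z)"
    using assms by (simp add: power_mult_distrib power_divide field_simps)
  thus ?thesis by (simp add: divide_le_eq cosh_real_pos)
qed

lemma lnorm_nonneg: "0 \<le> lnorm x"
  by (simp add: lnorm_def sum_nonneg)

lemma lnorm_le_max: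
  fixes x :: "int ^ 'd::finite"
  shows "\<exists>i. lnorm x \<le> sqrt CARD('d) * \<bar>real_of_int (x $ i)\<bar>"
proof -
  let ?A = "range (\<lambda>i. \<bar>real_of_int (x $ i)\<bar>)"
  have "Max ?A \<in> ?A" by (rule Max_in) auto
  then obtain i where i: "Max ?A = \<bar>real_of_int (x $ i)\<bar>" by blast
  have "(real_of_int (x $ j))\<^sup>2 \<le> (real_of_int (x $ i))\<^sup>2" for j
  proof -
    have "\<bar>real_of_int (x $ j)\<bar> \<le> Max ?A" by (rule Max_ge) auto
    thus ?thesis unfolding i by (rule abs_le_square_iff[THEN iffD1])
  qed
  hence "(\<Sum>j\<in>UNIV. (real_of_int (x $ j))\<^sup>2) \<le> (\<Sum>j\<in>(UNIV :: 'd set). (real_of_int (x $ i))\<^sup>2)"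
    by (intro sum_mono) auto
  hence "lnorm x \<le> sqrt (real CARD('d) * (real_of_int (x $ i))\<^sup>2)"
    unfolding lnorm_def by simp
  thus ?thesis by (intro exI[of _ i]) (simp add: real_sqrt_mult)
qed

text \<open>A bound uniform in time: it controls \<open>heat t x\<close> when \<open>t\<close> is
  small against \<open>(lnorm x)\<^sup>2\<close>, where \<open>heat_0_bound\<close> is too weak. In
  \<open>rmom_asymptotics\<close> it dominates the part of the integral near time 0.\<close>

lemma lnorm_power_heat_bound:
  "\<exists>C. \<forall>t\<ge>0. \<forall>x :: int ^ 'd::finite. lnorm x ^ CARD('d) * heat t x \<le> C"
proof -
  obtain C where C: "1 \<le> C" "\<And>t. t > 0 \<Longrightarrow> sqrt t ^ CARD('d) * heat t (0 :: int ^ 'd) \<le> C"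
    using heat_0_bound by blast
  let ?n = "CARD('d)"
  \<comment> \<open>The factor \<open>sqrt ?n\<close> comes from comparing \<open>lnorm x\<close>
    with the largest coordinate, the factor 2 from the halved coordinate in
    \<open>heat_chernoff\<close>.\<close>
  define a where "a = 1 / (2 * sqrt ?n)"
  have a: "a > 0" by (simp add: a_def)
  let ?K = "2 * exp 2 * C * (2 * (real ?n / a) ^ ?n)"
  have "lnorm x ^ ?n * heat t x \<le> ?K" if t: "0 \<le> t" for t and x :: "int ^ 'd"
  proof -
    \<comment> \<open>The inverse diffusive length, capped at 1. It merges
      \<open>heat_0_bound\<close> and \<open>heat_le_1\<close> into the single bound
      \<open>C * l ^ ?n\<close>, after which everything depends on \<open>l * lnorm x\<close>
      alone.\<close>
    define l where "l = 1 / max 1 (sqrt (t / 2))"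
    have l: "0 < l" "l \<le> 1" by (auto simp: l_def)
    have tl: "t / 2 * l\<^sup>2 \<le> 1"
    proof -
      have "sqrt (t / 2) * l \<le> 1" by (simp add: l_def)
      hence "(sqrt (t / 2) * l)\<^sup>2 \<le> 1\<^sup>2" using l t by (intro power_mono) auto
      thus ?thesis using t by (simp add: power_mult_distrib)
    qed
    have h0: "heat (t / 2) (0 :: int ^ 'd) \<le> C * l ^ ?n"
    proof (cases "sqrt (t / 2) \<le> 1")
      case True
      thus ?thesis using heat_le_1[of "t / 2" "0 :: int ^ 'd"] C(1) t by (simp add: l_def)
    next
      case False
      hence t0: "t / 2 > 0" using t by (cases "t = 0") auto
      have "sqrt (t / 2) ^ ?n > 0" using t0 by simp
      moreover have "l = 1 / sqrt (t / 2)" using False by (simp add: l_def)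
      ultimately show ?thesis using C(2)[OF t0] by (simp add: power_one_over field_simps)
    qed
    obtain i where i: "lnorm x \<le> sqrt ?n * \<bar>real_of_int (x $ i)\<bar>" using lnorm_le_max by blast
    have ch: "cosh (a * (l * lnorm x)) \<le> cosh (l * (\<bar>real_of_int (x $ i)\<bar> / 2))"
    proof (subst cosh_real_nonneg_le_iff)
      have "a * lnorm x \<le> a * (sqrt ?n * \<bar>real_of_int (x $ i)\<bar>)" using a i by (intro mult_left_mono) auto
      also have "\<dots> = \<bar>real_of_int (x $ i)\<bar> / 2" by (simp add: a_def)
      finally have "l * (a * lnorm x) \<le> l * (\<bar>real_of_int (x $ i)\<bar> / 2)" using l by (intro mult_left_mono) auto
      thus "a * (l * lnorm x) \<le> l * (\<bar>real_of_int (x $ i)\<bar> / 2)" by (simp only: mult.left_commute)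
    qed (use a l lnorm_nonneg[of x] in auto)
    have "heat t x \<le> heat (t / 2) (0 :: int ^ 'd) * (2 * exp 2 / cosh (l * (\<bar>real_of_int (x $ i)\<bar> / 2)))"
      using l t tl by (intro heat_chernoff) auto
    also have "\<dots> \<le> C * l ^ ?n * (2 * exp 2 / cosh (a * (l * lnorm x)))"
      using h0 ch C(1) l
      by (intro mult_mono divide_left_mono mult_pos_pos cosh_real_pos mult_nonneg_nonneg divide_nonneg_pos) auto
    finally have "lnorm x ^ ?n * heat t x \<le> lnorm x ^ ?n * (C * l ^ ?n * (2 * exp 2 / cosh (a * (l * lnorm x))))"
      using lnorm_nonneg[of x] by (intro mult_left_mono) auto
    also have "\<dots> = 2 * exp 2 * C * ((l * lnorm x) ^ ?n / cosh (a * (l * lnorm x)))"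
      by (simp add: power_mult_distrib divide_inverse mult_ac)
    also have "\<dots> \<le> ?K"
      using a l lnorm_nonneg[of x] C(1) by (intro mult_left_mono power_div_cosh_bound) auto
    finally show ?thesis .
  qed
  thus ?thesis by blast
qed

section \<open>The local limit theorem\<close>

text \<open>After division by \<open>K\<close> all factors lie in the unit ball, where the
  telescoping estimate \<open>norm_prod_diff\<close> applies; \<open>K ^ card I / K\<close> restores
  the scale.\<close>

lemma prod_diff_bound:
  fixes a b :: "'i \<Rightarrow> real"
  assumes "finite I" "0 < K" "\<And>i. i \<in> I \<Longrightarrow> \<bar>a i\<bar> \<le> K" "\<And>i. i \<in> I \<Longrightarrow> \<bar>b i\<bar> \<le> K"
  shows "\<bar>(\<Prod>i\<in>I. a i) - (\<Prod>i\<in>I. b i)\<bar> \<le> K ^ card I / K * (\<Sum>i\<in>I. \<bar>a i - b i\<bar>)"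
proof -
  have e: "(\<Prod>i\<in>I. f i) = K ^ card I * (\<Prod>i\<in>I. f i / K)" for f
    using assms(2) by (simp add: prod_dividef)
  have "norm ((\<Prod>i\<in>I. a i / K) - (\<Prod>i\<in>I. b i / K)) \<le> (\<Sum>i\<in>I. norm (a i / K - b i / K))"
    using assms by (intro norm_prod_diff) auto
  also have "\<dots> = (\<Sum>i\<in>I. \<bar>a i - b i\<bar>) / K"
    using assms(2) by (simp add: sum_divide_distrib abs_divide flip: diff_divide_distrib)
  finally have "K ^ card I * \<bar>(\<Prod>i\<in>I. a i / K) - (\<Prod>i\<in>I. b i / K)\<bar> \<le> K ^ card I * ((\<Sum>i\<in>I. \<bar>a i - b i\<bar>) / K)"
    using assms(2) by (intro mult_left_mono) auto
  thus ?thesis unfolding e[of a] e[of b]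
    using assms(2) by (simp add: abs_mult flip: right_diff_distrib)
qed

text \<open>\<open>local_clt_1\<close> in each coordinate, combined by
  \<open>prod_diff_bound\<close>. The error is uniform in \<open>x\<close>, so that \<open>x\<close>
  may go to infinity at the same rate as \<open>sqrt t\<close>; this is the regime of the integrals
  in \<open>rmom_asymptotics\<close>.\<close>

lemma local_clt:
  "\<exists>K. \<forall>t>0. \<forall>x :: int ^ 'd::finite.
     \<bar>sqrt t ^ CARD('d) * heat t x - exp (- (lnorm x)\<^sup>2 / (4 * t)) / (2 * sqrt pi) ^ CARD('d)\<bar> \<le> K * lclt_error t"
proof -
  obtain C where C: "C > 0" "\<And>t. t > 0 \<Longrightarrow> sqrt t * heat1 t 0 \<le> C" using heat1_0_bound by blast
  define K where "K = max C (1 / (2 * sqrt pi))"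
  have K: "K > 0" using C by (simp add: K_def)
  have "\<bar>sqrt t ^ CARD('d) * heat t x - exp (- (lnorm x)\<^sup>2 / (4 * t)) / (2 * sqrt pi) ^ CARD('d)\<bar>
      \<le> K ^ CARD('d) / K * CARD('d) * lclt_error t" if t: "0 < t" for t and x :: "int ^ 'd"
  proof -
    let ?a = "\<lambda>i. sqrt t * heat1 t (x $ i)"
    let ?b = "\<lambda>i. exp (- (real_of_int (x $ i))\<^sup>2 / (4 * t)) / (2 * sqrt pi)"
    have "\<bar>?a i\<bar> \<le> K" for i
    proof -
      have "\<bar>?a i\<bar> \<le> sqrt t * heat1 t 0"
        using t abs_heat1_le[of t "x $ i"] by (auto simp: abs_mult intro: mult_left_mono)
      thus ?thesis using C(2)[OF t] by (simp add: K_def)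
    qed
    moreover have "\<bar>?b i\<bar> \<le> K" for i
    proof -
      have "?b i \<le> 1 / (2 * sqrt pi)" using t by (intro divide_right_mono) auto
      moreover have "0 \<le> ?b i" by simp
      ultimately show ?thesis unfolding K_def by linarith
    qed
    ultimately have "\<bar>(\<Prod>i\<in>UNIV. ?a i) - (\<Prod>i\<in>UNIV. ?b i)\<bar> \<le> K ^ CARD('d) / K * (\<Sum>i\<in>UNIV. \<bar>?a i - ?b i\<bar>)"
      using K by (intro prod_diff_bound) auto
    also have "\<dots> \<le> K ^ CARD('d) / K * (\<Sum>i\<in>(UNIV :: 'd set). lclt_error t)"
      using K by (intro mult_left_mono sum_mono local_clt_1 t) auto
    also have "\<dots> = K ^ CARD('d) / K * CARD('d) * lclt_error t" by simp
    also have "(\<Prod>i\<in>UNIV. ?a i) = sqrt t ^ CARD('d) * heat t x"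
      by (simp add: heat_prod prod.distrib)
    also have "(\<Prod>i\<in>UNIV. ?b i) = exp (- (lnorm x)\<^sup>2 / (4 * t)) / (2 * sqrt pi) ^ CARD('d)"
    proof -
      have "(\<Prod>i\<in>UNIV. ?b i) = (\<Prod>i\<in>UNIV. exp (- (real_of_int (x $ i))\<^sup>2 / (4 * t))) / (2 * sqrt pi) ^ CARD('d)"
        by (simp only: prod_dividef prod_constant)
      also have "(\<Prod>i\<in>UNIV. exp (- (real_of_int (x $ i))\<^sup>2 / (4 * t))) = exp (\<Sum>i\<in>UNIV. - (real_of_int (x $ i))\<^sup>2 / (4 * t))"
        by (rule exp_sum[symmetric]) simp
      also have "(\<Sum>i\<in>UNIV. - (real_of_int (x $ i))\<^sup>2 / (4 * t)) = - (\<Sum>i\<in>UNIV. (real_of_int (x $ i))\<^sup>2) / (4 * t)"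
        by (simp only: sum_divide_distrib[symmetric] sum_negf)
      also have "(\<Sum>i\<in>UNIV. (real_of_int (x $ i))\<^sup>2) = (lnorm x)\<^sup>2"
        unfolding lnorm_def by (subst real_sqrt_pow2) (auto intro: sum_nonneg)
      finally show ?thesis .
    qed
    finally show ?thesis .
  qed
  thus ?thesis by blast
qed

lemma heat_tendsto:
  fixes x :: "int ^ 'd::finite"
  shows "((\<lambda>t. sqrt t ^ CARD('d) * heat t x) \<longlongrightarrow> 1 / (2 * sqrt pi) ^ CARD('d)) at_top"
proof -
  obtain K where K: "\<And>t x. t > 0 \<Longrightarrow>
     \<bar>sqrt t ^ CARD('d) * heat t (x :: int ^ 'd) - exp (- (lnorm x)\<^sup>2 / (4 * t)) / (2 * sqrt pi) ^ CARD('d)\<bar> \<le> K * lclt_error t"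
    using local_clt by blast
  have "((\<lambda>t. sqrt t ^ CARD('d) * heat t x - exp (- (lnorm x)\<^sup>2 / (4 * t)) / (2 * sqrt pi) ^ CARD('d)) \<longlongrightarrow> 0) at_top"
  proof (rule Lim_null_comparison)
    show "\<forall>\<^sub>F t in at_top. norm (sqrt t ^ CARD('d) * heat t x - exp (- (lnorm x)\<^sup>2 / (4 * t)) / (2 * sqrt pi) ^ CARD('d)) \<le> K * lclt_error t"
      using eventually_gt_at_top[of 0] by eventually_elim (simp only: real_norm_def K)
    show "((\<lambda>t. K * lclt_error t) \<longlongrightarrow> 0) at_top"
      by (rule tendsto_mult_right_zero) (rule lclt_error_tendsto)
  qed
  moreover have "((\<lambda>t. exp (- (lnorm x)\<^sup>2 / (4 * t))) \<longlongrightarrow> exp 0) at_top"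
    by (intro tendsto_exp) real_asymp
  hence "((\<lambda>t. exp (- (lnorm x)\<^sup>2 / (4 * t)) / (2 * sqrt pi) ^ CARD('d)) \<longlongrightarrow> exp 0 / (2 * sqrt pi) ^ CARD('d)) at_top"
    by (intro tendsto_divide tendsto_const) auto
  ultimately have "((\<lambda>t. (sqrt t ^ CARD('d) * heat t x - exp (- (lnorm x)\<^sup>2 / (4 * t)) / (2 * sqrt pi) ^ CARD('d))
     + exp (- (lnorm x)\<^sup>2 / (4 * t)) / (2 * sqrt pi) ^ CARD('d)) \<longlongrightarrow> 0 + exp 0 / (2 * sqrt pi) ^ CARD('d)) at_top"
    by (rule tendsto_add)
  thus ?thesis by (simp only: diff_add_cancel add_0 exp_zero)
qed

section \<open>The lattice near infinity\<close>

lemma finite_lnorm_le: "finite {x :: int ^ 'd::finite. lnorm x \<le> R}"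
proof -
  let ?A = "{- \<lceil>R\<rceil>..\<lceil>R\<rceil>}"
  have "{x :: int ^ 'd. lnorm x \<le> R} \<subseteq> vec_lambda ` (PiE UNIV (\<lambda>_. ?A))"
  proof
    fix x :: "int ^ 'd" assume "x \<in> {x. lnorm x \<le> R}"
    hence x: "lnorm x \<le> R" by simp
    have "x $ i \<in> ?A" for i
    proof -
      have "(real_of_int (x $ i))\<^sup>2 \<le> (\<Sum>j\<in>UNIV. (real_of_int (x $ j))\<^sup>2)"
        by (rule member_le_sum) auto
      hence "sqrt ((real_of_int (x $ i))\<^sup>2) \<le> lnorm x"
        unfolding lnorm_def by (rule real_sqrt_le_mono)
      hence "\<bar>real_of_int (x $ i)\<bar> \<le> R" using x by simp
      thus ?thesis by (auto simp: abs_le_iff) linarith+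
    qed
    hence "vec_nth x \<in> PiE UNIV (\<lambda>_. ?A)" by auto
    thus "x \<in> vec_lambda ` (PiE UNIV (\<lambda>_. ?A))" by (metis image_eqI vec_nth_inverse)
  qed
  moreover have "finite (vec_lambda ` (PiE (UNIV :: 'd set) (\<lambda>_. ?A)))"
    by (intro finite_imageI finite_PiE) auto
  ultimately show ?thesis by (rule finite_subset)
qed

lemma infinite_lattice: "infinite (UNIV :: (int ^ 'd::finite) set)"
proof
  assume f: "finite (UNIV :: (int ^ 'd) set)"
  have "inj (\<lambda>n::int. (\<chi> i. n) :: int ^ 'd)" by (auto simp: inj_on_def vec_eq_iff)
  hence "finite (UNIV :: int set)" using f by (metis finite_imageD finite_subset subset_UNIV)
  thus False by (simp add: infinite_UNIV_int)
qed

text \<open>Statements about spatial infinity are made along a bijective sequence: dominated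
  convergence for sequences is then available, and an eventual property holds off a finite set of
  lattice points.\<close>

lemma lattice_enumeration:
  obtains e :: "nat \<Rightarrow> int ^ 'd::finite" where "bij e" "filterlim (\<lambda>n. lnorm (e n)) at_top sequentially"
proof -
  obtain g :: "int ^ 'd \<Rightarrow> nat" where g: "bij_betw g UNIV UNIV"
    using countableE_infinite[of "UNIV :: (int ^ 'd) set"] infinite_lattice by (metis countableI_type)
  define e where "e = inv g"
  have e: "bij e" using g unfolding e_def by (simp add: bij_imp_bij_inv)
  have "filterlim (\<lambda>n. lnorm (e n)) at_top sequentially"
    unfolding filterlim_at_top
  proof
    fix Z :: real
    have "finite (e -` {x. lnorm x \<le> Z})"
      using finite_lnorm_le bij_is_inj[OF e] by (rule finite_vimageI)
    hence "finite {n. \<not> Z \<le> lnorm (e n)}" by (rule finite_subset[rotated]) auto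
    thus "\<forall>\<^sub>F n in sequentially. Z \<le> lnorm (e n)"
      by (simp add: cofinite_eq_sequentially[symmetric] eventually_cofinite)
  qed
  thus ?thesis using that e by blast
qed

section \<open>Moments of the heat kernel in time\<close>

definition mom :: "real \<Rightarrow> int ^ 'd::finite \<Rightarrow> ennreal" where
  "mom a x = (\<integral>\<^sup>+t. ennreal (heat t x * t powr (a - 1)) * indicator {0<..} t \<partial>lborel)"

definition rmom :: "real \<Rightarrow> int ^ 'd::finite \<Rightarrow> real" where
  "rmom a x = enn2real (mom a x)"

lemma nn_integral_powr_0_1:
  assumes "0 < a"
  shows "(\<integral>\<^sup>+t. ennreal (t powr (a - 1)) * indicator {0<..1} t \<partial>lborel) = ennreal (1 / a)"
proof -
  have "((\<lambda>x. x powr (a - 1)) has_integral (1 powr (a - 1 + 1) / (a - 1 + 1))) {0..1}"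
    using assms by (intro has_integral_powr_from_0) auto
  hence "((\<lambda>x. x powr (a - 1)) has_integral (1 / a)) {0..1}" by simp
  from nn_integral_has_integral_lebesgue[OF _ this]
  have "(\<integral>\<^sup>+t. ennreal (indicator {0..1} t * t powr (a - 1)) \<partial>lborel) = ennreal (1 / a)" by simp
  moreover have "ennreal (indicator {0..1} t * t powr (a - 1)) = ennreal (t powr (a - 1)) * indicator {0<..1} t" for t :: real
    by (cases "t = 0") (auto simp: indicator_def)
  ultimately show ?thesis by simp
qed

lemma nn_integral_powr_atLeast:
  assumes "0 < c" "0 < T"
  shows "(\<integral>\<^sup>+t. ennreal (t powr (- c - 1)) * indicator {T..} t \<partial>lborel) = ennreal (T powr (- c) / c)"
proof -
  have "((\<lambda>x. x powr (- c - 1)) has_integral (- (T powr (- c - 1 + 1)) / (- c - 1 + 1))) {T..}"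
    using assms by (intro has_integral_powr_to_inf) auto
  hence "((\<lambda>x. x powr (- c - 1)) has_integral (T powr (- c) / c)) {T..}" by simp
  from nn_integral_has_integral_lebesgue[OF _ this]
  have "(\<integral>\<^sup>+t. ennreal (indicator {T..} t * t powr (- c - 1)) \<partial>lborel) = ennreal (T powr (- c) / c)" by simp
  moreover have "ennreal (indicator {T..} t * t powr (- c - 1)) = ennreal (t powr (- c - 1)) * indicator {T..} t" for t :: real
    by (auto simp: indicator_def)
  ultimately show ?thesis by simp
qed

lemma sqrt_power_eq_powr: "0 < t \<Longrightarrow> sqrt t ^ n = t powr (real n / 2)"
proof -
  assume t: "0 < t"
  have "sqrt t ^ n = sqrt t powr real n" using t by (simp add: powr_realpow)
  also have "\<dots> = t powr (1 / 2 * real n)" using t by (simp only: powr_half_sqrt[symmetric] powr_powr less_imp_le)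
  finally show ?thesis by simp
qed

lemma mom_mono_0: "mom a (x :: int ^ 'd::finite) \<le> mom a (0 :: int ^ 'd)"
  unfolding mom_def
  by (intro nn_integral_mono) (auto simp: indicator_def intro!: ennreal_leI mult_right_mono heat_mono_0)

text \<open>Split at time 1, with \<open>heat_le_1\<close> below and \<open>heat_0_bound\<close>
  above. \<open>C\<close> does not depend on \<open>a\<close>: the growth like the inverse of
  \<open>CARD('d) / 2 - a\<close> is used quantitatively in \<open>critical_wsa\<close>.\<close>

lemma mom_0_bound:
  "\<exists>C\<ge>1. \<forall>a. 0 < a \<longrightarrow> a < real CARD('d) / 2 \<longrightarrow>
     mom a (0 :: int ^ 'd::finite) \<le> ennreal (1 / a + C / (real CARD('d) / 2 - a))"
proof -
  obtain C where C: "1 \<le> C" "\<And>t. t > 0 \<Longrightarrow> sqrt t ^ CARD('d) * heat t (0 :: int ^ 'd) \<le> C"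
    using heat_0_bound by blast
  have "mom a (0 :: int ^ 'd) \<le> ennreal (1 / a + C / (real CARD('d) / 2 - a))"
    if a: "0 < a" "a < real CARD('d) / 2" for a
  proof -
    let ?c = "real CARD('d) / 2 - a"
    have "mom a (0 :: int ^ 'd) \<le> (\<integral>\<^sup>+t. ennreal (t powr (a - 1)) * indicator {0<..1} t
        + ennreal C * (ennreal (t powr (- ?c - 1)) * indicator {1..} t) \<partial>lborel)"
      unfolding mom_def
    proof (rule nn_integral_mono)
      fix t :: real
      have 1: "ennreal (heat t (0 :: int ^ 'd) * t powr (a - 1)) \<le> ennreal (t powr (a - 1))" if "0 < t"
        using heat_le_1[of t "0 :: int ^ 'd"] that by (intro ennreal_leI mult_left_le_one_le) (auto intro: heat_nonneg)
      have 2: "ennreal (heat t (0 :: int ^ 'd) * t powr (a - 1)) \<le> ennreal C * ennreal (t powr (- ?c - 1))" if t: "0 < t"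
      proof -
        have "heat t (0 :: int ^ 'd) \<le> C * t powr (- (real CARD('d) / 2))"
          using C(2)[OF t] t by (simp add: sqrt_power_eq_powr powr_minus field_simps)
        hence "heat t (0 :: int ^ 'd) * t powr (a - 1) \<le> C * t powr (- (real CARD('d) / 2)) * t powr (a - 1)"
          by (intro mult_right_mono) auto
        also have "\<dots> = C * t powr (- (real CARD('d) / 2) + (a - 1))" by (simp only: mult.assoc powr_add)
        also have "- (real CARD('d) / 2) + (a - 1) = - ?c - 1" by simp
        finally show ?thesis using C(1) by (simp add: ennreal_leI flip: ennreal_mult)
      qed
      consider "t \<le> 0" | "0 < t" "t \<le> 1" | "1 < t" by linarith
      thus "ennreal (heat t (0 :: int ^ 'd) * t powr (a - 1)) * indicator {0<..} t
        \<le> ennreal (t powr (a - 1)) * indicator {0<..1} t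
          + ennreal C * (ennreal (t powr (- ?c - 1)) * indicator {1..} t)"
        using 1 2 by cases (auto simp: indicator_def add_increasing2)
    qed
    also have "\<dots> = ennreal (1 / a) + ennreal C * ennreal (1 powr (- ?c) / ?c)"
      using a by (subst nn_integral_add, simp, simp, subst nn_integral_cmult, simp)
        (simp only: nn_integral_powr_0_1 nn_integral_powr_atLeast diff_gt_0_iff_gt zero_less_one)
    also have "\<dots> = ennreal (1 / a + C / ?c)"
      using a C(1) by (simp add: ennreal_plus flip: ennreal_mult)
    finally show ?thesis .
  qed
  thus ?thesis using C(1) by blast
qed

lemma mom_finite:
  assumes "0 < a" "a < real CARD('d) / 2"
  shows "mom a (x :: int ^ 'd::finite) < top"
proof -
  obtain C where "\<And>a. 0 < a \<Longrightarrow> a < real CARD('d) / 2 \<Longrightarrow>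
     mom a (0 :: int ^ 'd) \<le> ennreal (1 / a + C / (real CARD('d) / 2 - a))"
    using mom_0_bound by blast
  thus ?thesis using mom_mono_0[of a x] assms
    by (meson ennreal_less_top le_less_trans order_trans)
qed

lemma ennreal_rmom:
  assumes "0 < a" "a < real CARD('d) / 2"
  shows "ennreal (rmom a (x :: int ^ 'd::finite)) = mom a x"
  unfolding rmom_def using mom_finite[OF assms] by (rule ennreal_enn2real)

text \<open>Half of the positive limit in \<open>heat_tendsto\<close> serves as constant. Positivity
  of every moment and divergence at the borderline order both rest on this tail.\<close>

lemma heat_lower:
  fixes x :: "int ^ 'd::finite"
  shows "\<exists>c>0. \<exists>T\<ge>1. \<forall>t\<ge>T. c * t powr (- (real CARD('d) / 2)) \<le> heat t x"
proof -
  define m where "m = 1 / (2 * sqrt pi) ^ CARD('d)"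
  define c where "c = m / 2"
  have c: "c > 0" by (simp add: c_def m_def)
  hence "c < 1 / (2 * sqrt pi) ^ CARD('d)" unfolding c_def m_def[symmetric] by simp
  from order_tendstoD(1)[OF heat_tendsto[of x] this]
  obtain T where T: "\<And>t. t \<ge> T \<Longrightarrow> c < sqrt t ^ CARD('d) * heat t x"
    by (auto simp: eventually_at_top_linorder)
  have "c * t powr (- (real CARD('d) / 2)) \<le> heat t x" if t: "t \<ge> max 1 T" for t
  proof -
    have "c < t powr (real CARD('d) / 2) * heat t x" using T[of t] t by (simp add: sqrt_power_eq_powr)
    moreover have "t powr (real CARD('d) / 2) > 0" using t by simp
    ultimately show ?thesis using t by (simp add: powr_minus field_simps)
  qed
  thus ?thesis using c by (intro exI[of _ c] conjI exI[of _ "max 1 T"]) auto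
qed

lemma mom_pos: "0 < mom a (x :: int ^ 'd::finite)"
proof -
  obtain c T where cT: "c > 0" "T \<ge> 1" "\<And>t. t \<ge> T \<Longrightarrow> c * t powr (- (real CARD('d) / 2)) \<le> heat t x"
    using heat_lower by metis
  \<comment> \<open>The comparison power \<open>t powr (- b - 1)\<close> has to be integrable at
    infinity and to lie below the integrand up to a constant for every real \<open>a\<close>; the
    maximum guarantees both.\<close>
  define b where "b = max 1 (real CARD('d) / 2 - a)"
  have b: "b > 0" "- b \<le> a - real CARD('d) / 2" by (auto simp: b_def)
  have "0 < ennreal c * ennreal (T powr (- b) / b)"
    using cT b by (simp add: ennreal_zero_less_mult_iff)
  also have "\<dots> = (\<integral>\<^sup>+t. ennreal c * (ennreal (t powr (- b - 1)) * indicator {T..} t) \<partial>lborel)"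
    using b cT by (subst nn_integral_cmult) (auto simp: nn_integral_powr_atLeast)
  also have "\<dots> \<le> mom a x"
    unfolding mom_def
  proof (rule nn_integral_mono)
    fix t :: real
    have "ennreal c * ennreal (t powr (- b - 1)) \<le> ennreal (heat t x * t powr (a - 1))" if t: "t \<ge> T"
    proof -
      have "c * t powr (- b - 1) \<le> c * t powr (- (real CARD('d) / 2) + (a - 1))"
        using t cT b by (intro mult_left_mono powr_mono) auto
      also have "\<dots> = c * t powr (- (real CARD('d) / 2)) * t powr (a - 1)" by (simp only: powr_add mult.assoc)
      also have "\<dots> \<le> heat t x * t powr (a - 1)" using cT(3)[OF t] by (intro mult_right_mono) auto
      finally show ?thesis using cT(1) by (simp add: ennreal_leI flip: ennreal_mult)
    qed
    thus "ennreal c * (ennreal (t powr (- b - 1)) * indicator {T..} t)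
      \<le> ennreal (heat t x * t powr (a - 1)) * indicator {0<..} t"
      using cT(2) by (auto simp: indicator_def)
  qed
  finally show ?thesis .
qed

lemma rmom_pos:
  assumes "0 < a" "a < real CARD('d) / 2"
  shows "0 < rmom a (x :: int ^ 'd::finite)"
  using mom_pos[of a x] mom_finite[OF assms, of x] unfolding rmom_def
  by (simp add: enn2real_positive_iff)

text \<open>On the tail the integrand is at least a multiple of \<open>1 / t\<close>. Divergence is
  read off from the integrable powers \<open>t powr (- b - 1)\<close> below it, whose integrals grow
  like \<open>1 / b\<close> as \<open>b\<close> tends to 0.\<close>

lemma mom_critical_infinite: "mom (real CARD('d) / 2) (0 :: int ^ 'd::finite) = top"
proof -
  obtain c T where cT: "c > 0" "T \<ge> 1"
      "\<And>t. t \<ge> T \<Longrightarrow> c * t powr (- (real CARD('d) / 2)) \<le> heat t (0 :: int ^ 'd)"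
    using heat_lower by metis
  have *: "ennreal (c * (T powr (- b) / b)) \<le> mom (real CARD('d) / 2) (0 :: int ^ 'd)" if b: "b > 0" for b
  proof -
    have "ennreal (c * (T powr (- b) / b)) = ennreal c * ennreal (T powr (- b) / b)"
      using cT b by (intro ennreal_mult) auto
    also have "\<dots> = (\<integral>\<^sup>+t. ennreal c * (ennreal (t powr (- b - 1)) * indicator {T..} t) \<partial>lborel)"
      using b cT by (subst nn_integral_cmult) (auto simp: nn_integral_powr_atLeast)
    also have "\<dots> \<le> mom (real CARD('d) / 2) (0 :: int ^ 'd)"
      unfolding mom_def
    proof (rule nn_integral_mono)
      fix t :: real
      have "ennreal c * ennreal (t powr (- b - 1)) \<le> ennreal (heat t (0 :: int ^ 'd) * t powr (real CARD('d) / 2 - 1))"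
        if t: "t \<ge> T"
      proof -
        have "c * t powr (- b - 1) \<le> c * t powr (- (real CARD('d) / 2) + (real CARD('d) / 2 - 1))"
          using t cT b by (intro mult_left_mono powr_mono) auto
        also have "\<dots> = c * t powr (- (real CARD('d) / 2)) * t powr (real CARD('d) / 2 - 1)"
          by (simp only: powr_add mult.assoc)
        also have "\<dots> \<le> heat t (0 :: int ^ 'd) * t powr (real CARD('d) / 2 - 1)"
          using cT(3)[OF t] by (intro mult_right_mono) auto
        finally show ?thesis using cT(1) by (simp add: ennreal_leI flip: ennreal_mult)
      qed
      thus "ennreal c * (ennreal (t powr (- b - 1)) * indicator {T..} t)
        \<le> ennreal (heat t (0 :: int ^ 'd) * t powr (real CARD('d) / 2 - 1)) * indicator {0<..} t"
        using cT(2) by (auto simp: indicator_def)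
    qed
    finally show ?thesis .
  qed
  show ?thesis
  proof (rule ccontr)
    assume "mom (real CARD('d) / 2) (0 :: int ^ 'd) \<noteq> top"
    then obtain r where r: "mom (real CARD('d) / 2) (0 :: int ^ 'd) = ennreal r" "0 \<le> r"
      by (cases "mom (real CARD('d) / 2) (0 :: int ^ 'd)" rule: ennreal_cases) auto
    \<comment> \<open>With \<open>b \<le> 1\<close> the factor \<open>T powr (- b)\<close> is at
      least \<open>1 / T\<close>, and the second entry makes the lower bound
      \<open>c / T / b\<close> at least \<open>r + 1\<close>.\<close>
    define b where "b = min 1 (c / T / (r + 1))"
    have b: "b > 0" "b \<le> 1" "b \<le> c / T / (r + 1)" using cT r by (auto simp: b_def)
    have "c * (T powr (- b) / b) \<le> r" using *[OF b(1)] r by simp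
    moreover have "1 / T \<le> T powr (- b)"
    proof -
      have "T powr (- 1) \<le> T powr (- b)" using b cT by (intro powr_mono) auto
      moreover have "T powr (- 1) = 1 / T" using cT by (subst powr_minus_divide) simp
      ultimately show ?thesis by (simp only:)
    qed
    hence "c * (1 / T / b) \<le> c * (T powr (- b) / b)"
      using cT b by (intro mult_left_mono divide_right_mono) auto
    moreover have "r + 1 \<le> c * (1 / T / b)"
    proof -
      have "b * (r + 1) \<le> c / T" using b(3) r(2) by (subst (asm) pos_le_divide_eq) auto
      hence "r + 1 \<le> c / T / b" using b(1) by (subst pos_le_divide_eq) (auto simp: mult.commute)
      thus ?thesis by simp
    qed
    ultimately show False by linarith
  qed
qed

text \<open>Passage from the gauge integral in \<open>kappa\<close> to the nonnegative Lebesgue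
  integral in \<open>mom\<close>.\<close>

lemma integral_pos_half_line:
  fixes f :: "real \<Rightarrow> real"
  assumes [measurable]: "f \<in> borel_measurable borel" and nonneg: "\<And>t. 0 < t \<Longrightarrow> 0 \<le> f t"
    and fin: "(\<integral>\<^sup>+t. ennreal (f t) * indicator {0<..} t \<partial>lborel) < top"
  shows "integral {0<..} f = enn2real (\<integral>\<^sup>+t. ennreal (f t) * indicator {0<..} t \<partial>lborel)"
proof -
  have e: "ennreal (f t) * indicator {0<..} t = ennreal (indicator {0<..} t *\<^sub>R f t)" for t
    by (auto simp: indicator_def)
  have "integrable lborel (\<lambda>t. indicator {0<..} t *\<^sub>R f t)"
  proof (rule integrableI_nonneg)
    show "AE t in lborel. 0 \<le> indicator {0<..} t *\<^sub>R f t"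
      by (rule AE_I2) (auto simp: indicator_def nonneg)
    show "(\<integral>\<^sup>+ t. ennreal (indicator {0<..} t *\<^sub>R f t) \<partial>lborel) < \<infinity>"
      using fin unfolding e by simp
  qed simp
  hence "set_integrable lborel {0<..} f" by (simp add: set_integrable_def)
  hence "integral {0<..} f = (LINT t:{0<..}|lborel. f t)"
    by (rule set_borel_integral_eq_integral(2)[symmetric])
  also have "\<dots> = (LINT t|lborel. indicator {0<..} t *\<^sub>R f t)" by (simp add: set_lebesgue_integral_def)
  also have "\<dots> = enn2real (\<integral>\<^sup>+t. ennreal (indicator {0<..} t *\<^sub>R f t) \<partial>lborel)"
    by (rule integral_eq_nn_integral) (auto intro!: AE_I2 simp: indicator_def nonneg)
  finally show ?thesis unfolding e .
qed

lemma kappa_uminus: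
  assumes "0 < a" "a < real CARD('d) / 2"
  shows "kappa (- a) (x :: int ^ 'd::finite) = rmom a x / Gamma a"
proof -
  have "integral {0<..} (\<lambda>t. heat t x * t powr (a - 1)) = rmom a x"
    unfolding rmom_def mom_def
    by (rule integral_pos_half_line)
       (use mom_finite[OF assms, of x] in \<open>auto simp: mom_def intro!: mult_nonneg_nonneg heat_nonneg\<close>)
  moreover have "integral {0<..} (\<lambda>t. heat t x / t powr (1 + - a)) = integral {0<..} (\<lambda>t. heat t x * t powr (a - 1))"
    by (rule Henstock_Kurzweil_Integration.integral_cong)
       (simp add: divide_inverse flip: powr_minus)
  moreover have "Gamma a > 0" using assms by (intro Gamma_real_pos)
  ultimately show ?thesis using assms by (simp add: kappa_def)
qed

section \<open>Asymptotics of the moments\<close>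

lemma rmom_eq_integral:
  "rmom a (x :: int ^ 'd::finite) = (LINT t|lborel. indicator {0<..} t * (heat t x * t powr (a - 1)))"
proof -
  have "(LINT t|lborel. indicator {0<..} t * (heat t x * t powr (a - 1)))
    = enn2real (\<integral>\<^sup>+t. ennreal (indicator {0<..} t * (heat t x * t powr (a - 1))) \<partial>lborel)"
    by (rule integral_eq_nn_integral) (auto intro!: AE_I2 simp: indicator_def mult_nonneg_nonneg heat_nonneg)
  also have "(\<lambda>t. ennreal (indicator {0<..} t * (heat t x * t powr (a - 1))))
     = (\<lambda>t. ennreal (heat t x * t powr (a - 1)) * indicator {0<..} t)"
    by (auto simp: indicator_def fun_eq_iff)
  finally show ?thesis by (simp add: rmom_def mom_def)
qed

text \<open>Substitution \<open>t = (lnorm x)\<^sup>2 * s\<close>, the diffusive scaling under which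
  the integrand converges as \<open>x\<close> tends to infinity.\<close>

lemma rmom_scaling:
  fixes x :: "int ^ 'd::finite"
  assumes R: "0 < lnorm x"
  shows "lnorm x powr (real CARD('d) - 2 * a) * rmom a x
    = (LINT s|lborel. indicator {0<..} s * (lnorm x ^ CARD('d) * heat ((lnorm x)\<^sup>2 * s) x * s powr (a - 1)))"
proof -
  let ?R = "lnorm x" and ?n = "CARD('d)"
  have "rmom a x = \<bar>?R\<^sup>2\<bar> *\<^sub>R (LINT s|lborel. indicator {0<..} (0 + ?R\<^sup>2 * s) * (heat (0 + ?R\<^sup>2 * s) x * (0 + ?R\<^sup>2 * s) powr (a - 1)))"
    unfolding rmom_eq_integral using R by (intro lborel_integral_real_affine) auto
  hence "?R powr (real ?n - 2 * a) * rmom a x = (LINT s|lborel. ?R powr (real ?n - 2 * a) * ?R\<^sup>2 *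
      (indicator {0<..} (?R\<^sup>2 * s) * (heat (?R\<^sup>2 * s) x * (?R\<^sup>2 * s) powr (a - 1))))"
    by simp
  also have "\<dots> = (LINT s|lborel. indicator {0<..} s * (?R ^ ?n * heat (?R\<^sup>2 * s) x * s powr (a - 1)))"
  proof (rule Bochner_Integration.integral_cong[OF refl])
    fix s :: real
    have "?R powr (real ?n - 2 * a) * ?R\<^sup>2 * (?R\<^sup>2 * s) powr (a - 1) = ?R ^ ?n * s powr (a - 1)" if "s > 0"
    proof -
      have r2: "?R\<^sup>2 = ?R powr 2" using R by (simp add: powr_numeral)
      have "(?R\<^sup>2 * s) powr (a - 1) = ?R powr (2 * (a - 1)) * s powr (a - 1)"
        unfolding r2 using R that by (simp only: powr_mult powr_ge_zero less_imp_le powr_powr)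
      hence "?R powr (real ?n - 2 * a) * ?R\<^sup>2 * (?R\<^sup>2 * s) powr (a - 1)
         = (?R powr (real ?n - 2 * a) * ?R powr 2 * ?R powr (2 * (a - 1))) * s powr (a - 1)"
        unfolding r2 by (simp only: mult.assoc)
      also have "?R powr (real ?n - 2 * a) * ?R powr 2 * ?R powr (2 * (a - 1)) = ?R powr real ?n"
        by (simp only: powr_add[symmetric]) simp
      also have "\<dots> = ?R ^ ?n" using R by (rule powr_realpow)
      finally show ?thesis .
    qed
    moreover have "?R\<^sup>2 * s > 0 \<longleftrightarrow> s > 0" using R by (simp add: zero_less_mult_iff)
    ultimately show "?R powr (real ?n - 2 * a) * ?R\<^sup>2 * (indicator {0<..} (?R\<^sup>2 * s) * (heat (?R\<^sup>2 * s) x * (?R\<^sup>2 * s) powr (a - 1)))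
        = indicator {0<..} s * (?R ^ ?n * heat (?R\<^sup>2 * s) x * s powr (a - 1))"
      by (cases "s > 0") (simp_all add: indicator_def mult_ac)
  qed
  finally show ?thesis .
qed

text \<open>\<open>Gamma a\<close> times the constant of the Riesz kernel of order
  \<open>2 * a\<close> on Euclidean space: the integral of the Gaussian heat kernel at distance 1
  against \<open>t powr (a - 1)\<close>.\<close>

definition riesz_const :: "real \<Rightarrow> 'd::finite itself \<Rightarrow> real" where
  "riesz_const a (_ :: 'd itself) =
     4 powr (real CARD('d) / 2 - a) * Gamma (real CARD('d) / 2 - a) / (2 * sqrt pi) ^ CARD('d)"

text \<open>The substitution \<open>u = 1 / (4 * s)\<close> turns this into Euler's
  integral.\<close>

lemma integral_inverse_gamma:
  fixes b :: real
  assumes b: "0 < b"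
  shows "(LINT s|lborel. indicator {0<..} s * (s powr (- b - 1) * exp (- 1 / (4 * s)))) = 4 powr b * Gamma b"
proof -
  let ?f = "\<lambda>s. s powr (- b - 1) * exp (- 1 / (4 * s))"
  let ?g = "\<lambda>u::real. 1 / (4 * u)" and ?g' = "\<lambda>u::real. - 1 / (4 * u\<^sup>2)"
  have eq: "\<bar>?g' u\<bar> * ?f (?g u) = 4 powr b * (u powr (b - 1) / exp u)" if u: "u \<in> {0<..}" for u
  proof -
    have u: "u > 0" using that by simp
    have "(1 / (4 * u)) powr (- b - 1) = (4 * u) powr (b + 1)"
    proof -
      have "1 / (4 * u) = (4 * u) powr (- 1)" using u by (simp add: powr_minus_divide)
      moreover have "- 1 * (- b - 1) = b + 1" by simp
      ultimately show ?thesis by (simp only: powr_powr)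
    qed
    also have "\<dots> = 4 powr (b + 1) * u powr (b + 1)" by (rule powr_mult)
    also have "\<dots> = 4 * 4 powr b * (u\<^sup>2 * u powr (b - 1))"
    proof -
      have "u powr (b + 1) = u powr (2 + (b - 1))" by (simp add: add.commute)
      also have "\<dots> = u\<^sup>2 * u powr (b - 1)" unfolding powr_add using u by (simp add: powr_numeral)
      finally show ?thesis by (simp add: powr_add)
    qed
    finally have "?f (?g u) = 4 * 4 powr b * (u\<^sup>2 * u powr (b - 1)) * exp (- u)" using u by simp
    moreover have "\<bar>?g' u\<bar> = 1 / (4 * u\<^sup>2)" by simp
    moreover have "1 / (4 * q) * (4 * F * (q * p) * inverse X) = F * (p / X)" if "q \<noteq> 0" for q F p X :: real
      using that by (simp add: field_simps)
    moreover have "u\<^sup>2 \<noteq> 0" using u by simp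
    ultimately show ?thesis by (simp only: exp_minus)
  qed
  have im: "?g ` {0<..} = {0<..}"
  proof
    show "{0<..} \<subseteq> ?g ` {0<..}"
    proof
      fix s :: real assume "s \<in> {0<..}"
      thus "s \<in> ?g ` {0<..}" by (intro image_eqI[of _ _ "1 / (4 * s)"]) auto
    qed
  qed auto
  have G: "((\<lambda>t. t powr (b - 1) / exp t) has_integral Gamma b) {0<..}"
    using Gamma_integral_real[OF b]
    by (subst has_integral_spike_set_eq[of _ "{0..}"])
       (auto intro: negligible_subset[of "{0::real}"] empty_imp_negligible simp: set_eq_iff)
  from has_integral_mult_right[OF this, of "4 powr b"]
  have G2: "((\<lambda>u. \<bar>?g' u\<bar> * ?f (?g u)) has_integral 4 powr b * Gamma b) {0<..}"
    by (rule has_integral_eq[rotated]) (rule eq[symmetric])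
  have "(\<lambda>u. \<bar>?g' u\<bar> * ?f (?g u)) absolutely_integrable_on {0<..}"
    using G2 by (intro nonnegative_absolutely_integrable_1) (auto simp: integrable_on_def)
  hence "(\<lambda>u. \<bar>?g' u\<bar> * ?f (?g u)) absolutely_integrable_on {0<..} \<and>
       integral {0<..} (\<lambda>u. \<bar>?g' u\<bar> * ?f (?g u)) = 4 powr b * Gamma b"
    using G2 by (simp only: integral_unique)
  moreover have "(?g has_field_derivative ?g' u) (at u within {0<..})" if "u \<in> {0<..}" for u
    using that by (auto intro!: derivative_eq_intros simp: power2_eq_square field_simps)
  ultimately have "?f absolutely_integrable_on (?g ` {0<..}) \<and> integral (?g ` {0<..}) ?f = 4 powr b * Gamma b"
    by (subst (asm) has_absolute_integral_change_of_variables_1') (auto simp: inj_on_def)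
  hence h: "?f absolutely_integrable_on {0<..}" "integral {0<..} ?f = 4 powr b * Gamma b"
    unfolding im by auto
  have "(?f has_integral 4 powr b * Gamma b) {0<..}"
    using h by (metis integrable_integral set_lebesgue_integral_eq_integral(1))
  from nn_integral_has_integral_lebesgue[OF _ this]
  have "(\<integral>\<^sup>+s. ennreal (indicator {0<..} s * ?f s) \<partial>lborel) = ennreal (4 powr b * Gamma b)" by simp
  moreover have "(LINT s|lborel. indicator {0<..} s * ?f s) = enn2real (\<integral>\<^sup>+s. ennreal (indicator {0<..} s * ?f s) \<partial>lborel)"
    by (rule integral_eq_nn_integral) (auto intro!: AE_I2)
  moreover have "Gamma b > 0" using b by (rule Gamma_real_pos)
  ultimately show ?thesis by simp
qed

text \<open>Dominated convergence in the scaled integral. Pointwise, \<open>local_clt\<close> is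
  applied at time \<open>(lnorm (e n))\<^sup>2 * s\<close>, where the Gaussian becomes
  \<open>exp (- 1 / (4 * s))\<close> independently of \<open>n\<close>.\<close>

lemma rmom_asymptotics:
  fixes e :: "nat \<Rightarrow> int ^ 'd::finite"
  assumes e: "filterlim (\<lambda>n. lnorm (e n)) at_top sequentially" and a: "0 < a" "a < real CARD('d) / 2"
  shows "(\<lambda>n. lnorm (e n) powr (real CARD('d) - 2 * a) * rmom a (e n)) \<longlonglongrightarrow> riesz_const a TYPE('d)"
proof -
  let ?n = "CARD('d)"
  define b where "b = real ?n / 2 - a"
  have b: "b > 0" using a by (simp add: b_def)
  obtain C1 where C1: "1 \<le> C1" "\<And>t. t > 0 \<Longrightarrow> sqrt t ^ ?n * heat t (0 :: int ^ 'd) \<le> C1"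
    using heat_0_bound by blast
  obtain C2 where C2: "\<And>t x. t \<ge> 0 \<Longrightarrow> lnorm x ^ ?n * heat t (x :: int ^ 'd) \<le> C2"
    using lnorm_power_heat_bound by blast
  obtain K where K: "\<And>t x. t > 0 \<Longrightarrow>
     \<bar>sqrt t ^ ?n * heat t (x :: int ^ 'd) - exp (- (lnorm x)\<^sup>2 / (4 * t)) / (2 * sqrt pi) ^ ?n\<bar> \<le> K * lclt_error t"
    using local_clt by blast
  \<comment> \<open>The majorant uses \<open>lnorm_power_heat_bound\<close> for
    \<open>s \<le> 1\<close> and \<open>heat_0_bound\<close> for larger \<open>s\<close>;
    integrability at 0 needs \<open>0 < a\<close> and at infinity \<open>0 < b\<close>.\<close>
  define w where "w s = \<bar>C2\<bar> * (indicator {0<..1} s * s powr (a - 1)) + C1 * (indicator {1..} s * s powr (- b - 1))" for s :: real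
  define F where "F n s = indicator {0<..} s * (lnorm (e n) ^ ?n * heat ((lnorm (e n))\<^sup>2 * s) (e n) * s powr (a - 1))" for n s
  define f where "f s = indicator {0<..} s * (s powr (- b - 1) * exp (- 1 / (4 * s))) / (2 * sqrt pi) ^ ?n" for s :: real
  have hs: "lnorm x ^ ?n * heat ((lnorm x)\<^sup>2 * s) x = sqrt ((lnorm x)\<^sup>2 * s) ^ ?n * heat ((lnorm x)\<^sup>2 * s) x / sqrt s ^ ?n"
    if "s > 0" for s and x :: "int ^ 'd"
    using that lnorm_nonneg[of x] by (simp add: real_sqrt_mult power_mult_distrib)
  have sb: "s powr (a - 1) / sqrt s ^ ?n = s powr (- b - 1)" if "s > 0" for s
  proof -
    have "- b - 1 = (a - 1) - real ?n / 2" by (simp add: b_def)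
    thus ?thesis using that by (simp only: sqrt_power_eq_powr powr_diff[symmetric])
  qed
  have "(\<lambda>n. LINT s|lborel. F n s) \<longlonglongrightarrow> (LINT s|lborel. f s)"
  proof (rule integral_dominated_convergence[where w = w])
    show "integrable lborel w"
      unfolding w_def
    proof (intro Bochner_Integration.integrable_add integrable_mult_right)
      show "integrable lborel (\<lambda>s::real. indicator {0<..1} s * s powr (a - 1))"
      proof (rule integrableI_nonneg)
        have "(\<integral>\<^sup>+s. ennreal (indicator {0<..1} s * s powr (a - 1)) \<partial>lborel) = ennreal (1 / a)"
          using nn_integral_powr_0_1[OF a(1)] by (simp add: ennreal_mult' ennreal_indicator mult.commute)
        thus "(\<integral>\<^sup>+s. ennreal (indicator {0<..1} s * s powr (a - 1)) \<partial>lborel) < \<infinity>" by simp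
      qed (auto intro!: AE_I2)
      show "integrable lborel (\<lambda>s::real. indicator {1..} s * s powr (- b - 1))"
      proof (rule integrableI_nonneg)
        have "(\<integral>\<^sup>+s. ennreal (indicator {1..} s * s powr (- b - 1)) \<partial>lborel) = ennreal (1 powr (- b) / b)"
          using nn_integral_powr_atLeast[OF b zero_less_one] by (simp add: ennreal_mult' ennreal_indicator mult.commute)
        thus "(\<integral>\<^sup>+s. ennreal (indicator {1..} s * s powr (- b - 1)) \<partial>lborel) < \<infinity>" by simp
      qed (auto intro!: AE_I2)
    qed
    show "AE s in lborel. norm (F n s) \<le> w s" for n
    proof (rule AE_I2)
      fix s :: real
      show "norm (F n s) \<le> w s"
      proof (cases "s > 0")
        case False
        thus ?thesis using C1 by (simp add: F_def w_def)
      next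
        case s: True
        let ?q = "lnorm (e n) ^ ?n * heat ((lnorm (e n))\<^sup>2 * s) (e n)"
        have q0: "0 \<le> ?q" using s lnorm_nonneg[of "e n"] by (intro mult_nonneg_nonneg heat_nonneg) auto
        have F: "norm (F n s) = ?q * s powr (a - 1)"
          unfolding F_def real_norm_def abs_mult[of "indicator {0<..} s"] abs_mult[of ?q] abs_of_nonneg[OF q0] using s by simp
        show ?thesis
        proof (cases "s \<le> 1")
          case True
          have "?q \<le> \<bar>C2\<bar>" using C2[of "(lnorm (e n))\<^sup>2 * s" "e n"] s by simp
          hence "?q * s powr (a - 1) \<le> \<bar>C2\<bar> * s powr (a - 1)" by (intro mult_right_mono) auto
          thus ?thesis unfolding F w_def using True s C1(1) by (simp add: add_increasing2)
        next
          case False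
          have "sqrt ((lnorm (e n))\<^sup>2 * s) ^ ?n * heat ((lnorm (e n))\<^sup>2 * s) (e n) \<le> C1"
          proof (cases "lnorm (e n) = 0")
            case True
            thus ?thesis using C1(1) by (simp add: power_0_left)
          next
            case False
            hence t: "(lnorm (e n))\<^sup>2 * s > 0" using s by simp
            have "sqrt ((lnorm (e n))\<^sup>2 * s) ^ ?n * heat ((lnorm (e n))\<^sup>2 * s) (e n)
              \<le> sqrt ((lnorm (e n))\<^sup>2 * s) ^ ?n * heat ((lnorm (e n))\<^sup>2 * s) (0 :: int ^ 'd)"
              using t by (intro mult_left_mono heat_mono_0) auto
            thus ?thesis using C1(2)[OF t] by linarith
          qed
          hence "?q \<le> C1 / sqrt s ^ ?n" unfolding hs[OF s] using s by (intro divide_right_mono) auto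
          hence "?q * s powr (a - 1) \<le> C1 / sqrt s ^ ?n * s powr (a - 1)" by (intro mult_right_mono) auto
          also have "\<dots> = C1 * s powr (- b - 1)" unfolding sb[OF s, symmetric] by simp
          finally show ?thesis unfolding F w_def using False by (simp add: add_increasing)
        qed
      qed
    qed
    show "AE s in lborel. (\<lambda>n. F n s) \<longlonglongrightarrow> f s"
    proof (rule AE_I2)
      fix s :: real
      show "(\<lambda>n. F n s) \<longlonglongrightarrow> f s"
      proof (cases "s > 0")
        case False
        thus ?thesis by (simp add: F_def f_def)
      next
        case s: True
        let ?t = "\<lambda>n. (lnorm (e n))\<^sup>2 * s"
        let ?L = "exp (- 1 / (4 * s)) / (2 * sqrt pi) ^ ?n"
        have t: "filterlim ?t at_top sequentially"
          using s by (intro filterlim_at_top_mult_tendsto_pos[OF tendsto_const] filterlim_pow_at_top e) auto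
        have "(\<lambda>n. sqrt (?t n) ^ ?n * heat (?t n) (e n) - ?L) \<longlonglongrightarrow> 0"
        proof (rule Lim_null_comparison)
          show "(\<lambda>n. K * lclt_error (?t n)) \<longlonglongrightarrow> 0"
            by (rule tendsto_mult_right_zero) (rule filterlim_compose[OF lclt_error_tendsto t])
          have "\<forall>\<^sub>F n in sequentially. lnorm (e n) > 0"
            using e by (simp add: filterlim_at_top_dense)
          thus "\<forall>\<^sub>F n in sequentially. norm (sqrt (?t n) ^ ?n * heat (?t n) (e n) - ?L) \<le> K * lclt_error (?t n)"
          proof eventually_elim
            case (elim n)
            have "(lnorm (e n))\<^sup>2 / (4 * ?t n) = 1 / (4 * s)" using elim by simp
            hence "- (lnorm (e n))\<^sup>2 / (4 * ?t n) = - 1 / (4 * s)" by simp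
            thus ?case using K[of "?t n" "e n"] elim s by (simp only: real_norm_def) simp
          qed
        qed
        hence "(\<lambda>n. sqrt (?t n) ^ ?n * heat (?t n) (e n)) \<longlonglongrightarrow> ?L" by (rule LIM_zero_cancel)
        hence "(\<lambda>n. sqrt (?t n) ^ ?n * heat (?t n) (e n) * s powr (- b - 1)) \<longlonglongrightarrow> ?L * s powr (- b - 1)"
          by (intro tendsto_intros)
        moreover have "F n s = sqrt (?t n) ^ ?n * heat (?t n) (e n) * s powr (- b - 1)" for n
          unfolding F_def hs[OF s] sb[OF s, symmetric] using s by simp
        moreover have "f s = ?L * s powr (- b - 1)" unfolding f_def using s by simp
        ultimately show ?thesis by simp
      qed
    qed
  qed (auto simp: F_def[abs_def] f_def[abs_def])
  moreover have "(LINT s|lborel. f s) = riesz_const a TYPE('d)"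
    unfolding f_def using integral_inverse_gamma[OF b] by (simp add: riesz_const_def b_def)
  moreover have "\<forall>\<^sub>F n in sequentially. (LINT s|lborel. F n s) = lnorm (e n) powr (real ?n - 2 * a) * rmom a (e n)"
  proof -
    have "\<forall>\<^sub>F n in sequentially. lnorm (e n) > 0"
      using e by (simp add: filterlim_at_top_dense)
    thus ?thesis by eventually_elim (simp add: F_def rmom_scaling)
  qed
  ultimately show ?thesis by (simp add: Lim_transform_eventually)
qed

lemma riesz_const_pos: "a < real CARD('d::finite) / 2 \<Longrightarrow> 0 < riesz_const a TYPE('d)"
  unfolding riesz_const_def by (intro divide_pos_pos mult_pos_pos Gamma_real_pos) auto

section \<open>Convolution of powers\<close>

text \<open>The weight of the moment integrals, restricted to positive times. Up to Beta factors the
  weights of positive order form a convolution semigroup; negative orders serve for the jump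
  kernel.\<close>

definition pw :: "real \<Rightarrow> real \<Rightarrow> ennreal" where
  "pw a t = ennreal (t powr (a - 1)) * indicator {0<..} t"

lemma pw_measurable [measurable]: "pw a \<in> borel_measurable borel"
  unfolding pw_def[abs_def] by measurable

lemma mom_eq_pw: "mom a (x :: int ^ 'd::finite) = (\<integral>\<^sup>+t. ennreal (heat t x) * pw a t \<partial>lborel)"
  unfolding mom_def pw_def
  by (intro nn_integral_cong) (auto simp: indicator_def ennreal_mult heat_nonneg)

lemma lborel_swap:
  assumes "(\<lambda>(x, y). f x y) \<in> borel_measurable (lborel \<Otimes>\<^sub>M lborel)"
  shows "(\<integral>\<^sup>+ x. (\<integral>\<^sup>+ y. f x y \<partial>lborel) \<partial>lborel) = (\<integral>\<^sup>+ y. (\<integral>\<^sup>+ x. f x y \<partial>(lborel :: real measure)) \<partial>(lborel :: real measure))"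
  using lborel_pair.Fubini'[OF assms] by simp

lemma beta_convolution:
  assumes a: "0 < a" and b: "0 < b"
  shows "(\<integral>\<^sup>+s. pw a s * pw b (\<tau> - s) \<partial>lborel) = ennreal (Beta a b) * pw (a + b) \<tau>"
proof (cases "\<tau> > 0")
  case False
  have z: "pw a s * pw b (\<tau> - s) = 0" for s using False by (auto simp: pw_def indicator_def)
  show ?thesis unfolding z using False by (simp add: pw_def)
next
  case t: True
  have "(\<integral>\<^sup>+s. pw a s * pw b (\<tau> - s) \<partial>lborel)
    = ennreal \<bar>\<tau>\<bar> * (\<integral>\<^sup>+u. pw a (0 + \<tau> * u) * pw b (\<tau> - (0 + \<tau> * u)) \<partial>lborel)"
    using t by (intro nn_integral_real_affine) auto
  also have "(\<integral>\<^sup>+u. pw a (0 + \<tau> * u) * pw b (\<tau> - (0 + \<tau> * u)) \<partial>lborel)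
    = (\<integral>\<^sup>+u. ennreal (\<tau> powr (a + b - 2)) * ennreal (indicator {0..1} u * (u powr (a - 1) * (1 - u) powr (b - 1))) \<partial>lborel)"
  proof (rule nn_integral_cong)
    fix u :: real
    consider "u \<le> 0" | "u \<ge> 1" | "0 < u" "u < 1" by linarith
    thus "pw a (0 + \<tau> * u) * pw b (\<tau> - (0 + \<tau> * u))
      = ennreal (\<tau> powr (a + b - 2)) * ennreal (indicator {0..1} u * (u powr (a - 1) * (1 - u) powr (b - 1)))"
    proof cases
      case 1
      thus ?thesis using t by (auto simp: pw_def indicator_def mult_le_0_iff not_less zero_less_mult_iff)
    next
      case 2
      hence "\<not> \<tau> - \<tau> * u > 0" using t by simp
      thus ?thesis using t 2 by (auto simp: pw_def indicator_def)
    next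
      case 3
      have e1: "\<tau> - (0 + \<tau> * u) = \<tau> * (1 - u)" by (simp add: algebra_simps)
      have "(\<tau> * u) powr (a - 1) * (\<tau> * (1 - u)) powr (b - 1)
        = (\<tau> powr (a - 1) * \<tau> powr (b - 1)) * (u powr (a - 1) * (1 - u) powr (b - 1))"
        unfolding powr_mult by (simp only: mult_ac)
      also have "\<tau> powr (a - 1) * \<tau> powr (b - 1) = \<tau> powr (a + b - 2)"
        by (subst powr_add[symmetric]) (simp add: algebra_simps)
      finally have e2: "(\<tau> * u) powr (a - 1) * (\<tau> * (1 - u)) powr (b - 1)
        = \<tau> powr (a + b - 2) * (u powr (a - 1) * (1 - u) powr (b - 1))" .
      have "\<tau> * u > 0" "\<tau> * (1 - u) > 0" using 3 t by auto
      thus ?thesis unfolding e1 pw_def using 3 by (simp add: e2 flip: ennreal_mult)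
    qed
  qed
  also have "\<dots> = ennreal (\<tau> powr (a + b - 2)) * (\<integral>\<^sup>+u. ennreal (indicator {0..1} u * (u powr (a - 1) * (1 - u) powr (b - 1))) \<partial>lborel)"
    by (rule nn_integral_cmult) simp
  also have "(\<integral>\<^sup>+u. ennreal (indicator {0..1} u * (u powr (a - 1) * (1 - u) powr (b - 1))) \<partial>lborel) = ennreal (Beta a b)"
    by (rule nn_integral_has_integral_lebesgue[OF _ has_integral_Beta_real[OF a b]]) auto
  finally have "(\<integral>\<^sup>+s. pw a s * pw b (\<tau> - s) \<partial>lborel)
     = ennreal \<tau> * (ennreal (\<tau> powr (a + b - 2)) * ennreal (Beta a b))" using t by simp
  also have "ennreal \<tau> * (ennreal (\<tau> powr (a + b - 2)) * ennreal (Beta a b))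
     = ennreal (Beta a b) * (ennreal \<tau> * ennreal (\<tau> powr (a + b - 2)))" by (simp only: mult_ac)
  also have "ennreal \<tau> * ennreal (\<tau> powr (a + b - 2)) = ennreal (\<tau> powr 1 * \<tau> powr (a + b - 2))"
    using t by (simp add: ennreal_mult)
  also have "\<tau> powr 1 * \<tau> powr (a + b - 2) = \<tau> powr (a + b - 1)"
    by (subst powr_add[symmetric]) (simp add: algebra_simps)
  finally show ?thesis using t by (simp add: pw_def)
qed

lemma nn_integral_pw_shift:
  assumes [measurable]: "G \<in> borel_measurable borel"
  shows "(\<integral>\<^sup>+t. G (s + t) * pw b t \<partial>lborel) = (\<integral>\<^sup>+\<tau>. G \<tau> * pw b (\<tau> - s) \<partial>lborel)"
proof -
  have "(\<integral>\<^sup>+\<tau>. G \<tau> * pw b (\<tau> - s) \<partial>lborel) = ennreal \<bar>1\<bar> * (\<integral>\<^sup>+t. G (s + 1 * t) * pw b (s + 1 * t - s) \<partial>lborel)"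
    by (rule nn_integral_real_affine) auto
  thus ?thesis by simp
qed

lemma nn_integral_pw_convolution:
  assumes [measurable]: "G \<in> borel_measurable borel" and ab: "0 < a" "0 < b"
  shows "(\<integral>\<^sup>+s. \<integral>\<^sup>+t. G (s + t) * pw a s * pw b t \<partial>lborel \<partial>lborel)
    = ennreal (Beta a b) * (\<integral>\<^sup>+\<tau>. G \<tau> * pw (a + b) \<tau> \<partial>lborel)"
proof -
  have "(\<integral>\<^sup>+t. G (s + t) * pw a s * pw b t \<partial>lborel) = (\<integral>\<^sup>+\<tau>. G \<tau> * (pw a s * pw b (\<tau> - s)) \<partial>lborel)" for s
  proof -
    have "(\<integral>\<^sup>+t. G (s + t) * pw a s * pw b t \<partial>lborel) = (\<integral>\<^sup>+t. pw a s * (G (s + t) * pw b t) \<partial>lborel)"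
      by (simp only: mult_ac)
    also have "\<dots> = pw a s * (\<integral>\<^sup>+t. G (s + t) * pw b t \<partial>lborel)" by (rule nn_integral_cmult) simp
    also have "\<dots> = pw a s * (\<integral>\<^sup>+\<tau>. G \<tau> * pw b (\<tau> - s) \<partial>lborel)" by (subst nn_integral_pw_shift) simp_all
    also have "\<dots> = (\<integral>\<^sup>+\<tau>. pw a s * (G \<tau> * pw b (\<tau> - s)) \<partial>lborel)" by (rule nn_integral_cmult[symmetric]) simp
    finally show ?thesis by (simp only: mult_ac)
  qed
  hence "(\<integral>\<^sup>+s. \<integral>\<^sup>+t. G (s + t) * pw a s * pw b t \<partial>lborel \<partial>lborel)
     = (\<integral>\<^sup>+s. \<integral>\<^sup>+\<tau>. G \<tau> * (pw a s * pw b (\<tau> - s)) \<partial>lborel \<partial>lborel)" by simp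
  also have "\<dots> = (\<integral>\<^sup>+\<tau>. \<integral>\<^sup>+s. G \<tau> * (pw a s * pw b (\<tau> - s)) \<partial>lborel \<partial>lborel)"
    by (rule lborel_swap) measurable
  also have "\<dots> = (\<integral>\<^sup>+\<tau>. ennreal (Beta a b) * (G \<tau> * pw (a + b) \<tau>) \<partial>lborel)"
  proof (rule nn_integral_cong)
    fix \<tau>
    have "(\<integral>\<^sup>+s. G \<tau> * (pw a s * pw b (\<tau> - s)) \<partial>lborel) = G \<tau> * (\<integral>\<^sup>+s. pw a s * pw b (\<tau> - s) \<partial>lborel)"
      by (rule nn_integral_cmult) simp
    thus "(\<integral>\<^sup>+s. G \<tau> * (pw a s * pw b (\<tau> - s)) \<partial>lborel) = ennreal (Beta a b) * (G \<tau> * pw (a + b) \<tau>)"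
      by (simp only: beta_convolution[OF ab] mult_ac)
  qed
  also have "\<dots> = ennreal (Beta a b) * (\<integral>\<^sup>+\<tau>. G \<tau> * pw (a + b) \<tau> \<partial>lborel)"
    by (rule nn_integral_cmult) simp
  finally show ?thesis .
qed

lemma nn_integral_heat_heat:
  fixes x :: "int ^ 'd::finite"
  assumes "0 \<le> s" "0 \<le> t"
  shows "(\<integral>\<^sup>+y. ennreal (heat s (x - y)) * ennreal (heat t y) \<partial>count_space UNIV) = ennreal (heat (s + t) x)"
  using heat_semigroup[OF assms, of x] assms by (simp add: ennreal_mult heat_nonneg)

text \<open>Tonelli moves the lattice sum inside both time integrals, where the semigroup property
  evaluates it. \<open>f\<close> and \<open>g\<close> are kept general because the jump kernel
  requires the heat kernel with its diagonal removed.\<close>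

lemma mom_convolution_integrand:
  fixes f g :: "int ^ 'd::finite \<Rightarrow> real \<Rightarrow> ennreal"
  assumes [measurable]: "\<And>y. f y \<in> borel_measurable borel" "\<And>y. g y \<in> borel_measurable borel"
  shows "(\<integral>\<^sup>+y. (\<integral>\<^sup>+s. f y s * pw a s \<partial>lborel) * (\<integral>\<^sup>+t. g y t * pw b t \<partial>lborel) \<partial>count_space UNIV)
    = (\<integral>\<^sup>+s. \<integral>\<^sup>+t. (\<integral>\<^sup>+y. f y s * g y t \<partial>count_space UNIV) * pw a s * pw b t \<partial>lborel \<partial>lborel)"
proof -
  have "(\<integral>\<^sup>+s. f y s * pw a s \<partial>lborel) * (\<integral>\<^sup>+t. g y t * pw b t \<partial>lborel)
    = (\<integral>\<^sup>+s. \<integral>\<^sup>+t. f y s * g y t * pw a s * pw b t \<partial>lborel \<partial>lborel)" for y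
  proof -
    have "(\<integral>\<^sup>+t. f y s * g y t * pw a s * pw b t \<partial>lborel) = (f y s * pw a s) * (\<integral>\<^sup>+t. g y t * pw b t \<partial>lborel)" for s
      by (subst nn_integral_cmult[symmetric]) (simp_all add: mult_ac)
    thus ?thesis by (simp add: nn_integral_multc)
  qed
  hence "(\<integral>\<^sup>+y. (\<integral>\<^sup>+s. f y s * pw a s \<partial>lborel) * (\<integral>\<^sup>+t. g y t * pw b t \<partial>lborel) \<partial>count_space UNIV)
    = (\<integral>\<^sup>+y. (\<integral>\<^sup>+s. \<integral>\<^sup>+t. f y s * g y t * pw a s * pw b t \<partial>lborel \<partial>lborel) \<partial>count_space UNIV)" by simp
  also have "\<dots> = (\<integral>\<^sup>+s. (\<integral>\<^sup>+y. \<integral>\<^sup>+t. f y s * g y t * pw a s * pw b t \<partial>lborel \<partial>count_space UNIV) \<partial>lborel)"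
    by (rule nn_integral_swap_count_space[symmetric]) (auto intro: lborel.sigma_finite_measure_axioms)
  also have "\<dots> = (\<integral>\<^sup>+s. \<integral>\<^sup>+t. (\<integral>\<^sup>+y. f y s * g y t * pw a s * pw b t \<partial>count_space UNIV) \<partial>lborel \<partial>lborel)"
    by (intro nn_integral_cong nn_integral_swap_count_space[symmetric]) (auto intro: lborel.sigma_finite_measure_axioms)
  also have "\<dots> = (\<integral>\<^sup>+s. \<integral>\<^sup>+t. (\<integral>\<^sup>+y. f y s * g y t \<partial>count_space UNIV) * pw a s * pw b t \<partial>lborel \<partial>lborel)"
    by (simp add: nn_integral_multc)
  finally show ?thesis .
qed

lemma pw_eq_0: "t \<le> 0 \<Longrightarrow> pw a t = 0"
  by (simp add: pw_def)

text \<open>The kernel is even, so the lattice sum is a convolution evaluated at the origin and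
  yields \<open>heat (s + t) 0\<close>; the two time integrals then merge by
  \<open>beta_convolution\<close>.\<close>

lemma nn_integral_mom_mom:
  assumes "0 < a" "0 < b"
  shows "(\<integral>\<^sup>+x. mom a x * mom b (x :: int ^ 'd::finite) \<partial>count_space UNIV)
    = ennreal (Beta a b) * mom (a + b) (0 :: int ^ 'd)"
proof -
  have "(\<integral>\<^sup>+x. mom a x * mom b (x :: int ^ 'd) \<partial>count_space UNIV)
    = (\<integral>\<^sup>+s. \<integral>\<^sup>+t. (\<integral>\<^sup>+y. ennreal (heat s y) * ennreal (heat t (y :: int ^ 'd)) \<partial>count_space UNIV) * pw a s * pw b t \<partial>lborel \<partial>lborel)"
    unfolding mom_eq_pw by (rule mom_convolution_integrand) auto
  also have "\<dots> = (\<integral>\<^sup>+s. \<integral>\<^sup>+t. ennreal (heat (s + t) (0 :: int ^ 'd)) * pw a s * pw b t \<partial>lborel \<partial>lborel)"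
  proof (intro nn_integral_cong)
    fix s t :: real
    show "(\<integral>\<^sup>+y. ennreal (heat s y) * ennreal (heat t (y :: int ^ 'd)) \<partial>count_space UNIV) * pw a s * pw b t
      = ennreal (heat (s + t) (0 :: int ^ 'd)) * pw a s * pw b t"
    proof (cases "0 < s \<and> 0 < t")
      case True
      thus ?thesis using nn_integral_heat_heat[of s t "0 :: int ^ 'd"] by (simp add: heat_even)
    next
      case False
      thus ?thesis by (auto simp: pw_eq_0 not_less)
    qed
  qed
  also have "\<dots> = ennreal (Beta a b) * (\<integral>\<^sup>+\<tau>. ennreal (heat \<tau> (0 :: int ^ 'd)) * pw (a + b) \<tau> \<partial>lborel)"
    using assms by (intro nn_integral_pw_convolution) auto
  finally show ?thesis unfolding mom_eq_pw .
qed

section \<open>Decreasing functions of time\<close>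

text \<open>Indicators of intervals with moving endpoints, made available to the measurability
  prover for the Tonelli arguments below.\<close>

lemma measurable_indicator_intervals [measurable (raw)]:
  fixes f g h :: "'a \<Rightarrow> real"
  assumes [measurable]: "f \<in> borel_measurable M" "g \<in> borel_measurable M" "h \<in> borel_measurable M"
  shows "(\<lambda>x. indicator {f x..} (g x) :: ennreal) \<in> borel_measurable M"
    and "(\<lambda>x. indicator {f x..h x} (g x) :: ennreal) \<in> borel_measurable M"
  unfolding indicator_def atLeast_iff atLeastAtMost_iff by measurable

text \<open>A function of time decreasing to 0 with rate \<open>R\<close>. Values and increments of
  \<open>P\<close> are integrals of the nonnegative \<open>R\<close>, so identities for moments of
  \<open>P\<close> follow by Tonelli with no boundary terms.\<close>

locale decreasing_profile =
  fixes P R :: "real \<Rightarrow> real"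
  assumes P_measurable [measurable]: "P \<in> borel_measurable borel"
    and R_measurable [measurable]: "R \<in> borel_measurable borel"
    and DERIV_P: "\<And>t. (P has_real_derivative - R t) (at t)"
    and R_nonneg: "\<And>t. 0 \<le> R t"
    and P_lim: "(P \<longlongrightarrow> 0) at_top"
begin

lemma P_eq: "ennreal (P t) = (\<integral>\<^sup>+\<tau>. ennreal (R \<tau>) * indicator {t..} \<tau> \<partial>lborel)"
proof -
  have "((\<lambda>t. - P t) has_real_derivative R t) (at t)" for t
    using DERIV_minus[OF DERIV_P[of t]] by simp
  moreover have "((\<lambda>t. - P t) \<longlongrightarrow> 0) at_top" using tendsto_minus[OF P_lim] by simp
  ultimately have "(\<integral>\<^sup>+\<tau>. ennreal (R \<tau>) * indicator {t..} \<tau> \<partial>lborel) = ennreal (0 - (- P t))"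
    using R_nonneg by (intro nn_integral_FTC_atLeast[where F = "\<lambda>t. - P t"]) auto
  thus ?thesis by simp
qed

lemma P_antimono: "t \<le> t' \<Longrightarrow> P t' \<le> P t"
proof (erule DERIV_nonpos_imp_nonincreasing)
  fix u
  have "- R u \<le> 0" using R_nonneg[of u] by simp
  thus "\<exists>y. (P has_real_derivative y) (at u) \<and> y \<le> 0" using DERIV_P[of u] by blast
qed

lemma P_diff: "0 \<le> s \<Longrightarrow> ennreal (P t - P (t + s)) = (\<integral>\<^sup>+\<tau>. ennreal (R \<tau>) * indicator {t..t + s} \<tau> \<partial>lborel)"
proof -
  assume s: "0 \<le> s"
  have "((\<lambda>t. - P t) has_real_derivative R t) (at t)" for t
    using DERIV_minus[OF DERIV_P[of t]] by simp
  hence "(\<integral>\<^sup>+\<tau>. ennreal (R \<tau>) * indicator {t..t + s} \<tau> \<partial>lborel) = ennreal (- P (t + s) - (- P t))"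
    using R_nonneg s by (intro nn_integral_FTC_Icc[where F = "\<lambda>t. - P t"]) auto
  thus ?thesis by simp
qed

text \<open>Integration by parts in the form of Tonelli: the integral of
  \<open>t powr (a - 1)\<close> up to \<open>\<tau>\<close> is \<open>\<tau> powr a / a\<close>. It
  is obtained from \<open>beta_convolution\<close> with \<open>pw 1\<close>, the indicator of the
  positive half-line.\<close>

lemma nn_integral_R:
  assumes a: "0 < a"
  shows "(\<integral>\<^sup>+\<tau>. ennreal (R \<tau>) * pw (a + 1) \<tau> \<partial>lborel) = ennreal a * (\<integral>\<^sup>+t. ennreal (P t) * pw a t \<partial>lborel)"
proof -
  have inner: "(\<integral>\<^sup>+t. pw a t * indicator {t..} \<tau> \<partial>lborel) = ennreal (1 / a) * pw (a + 1) \<tau>" for \<tau>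
  proof -
    have "Gamma (a + 1) = a * Gamma a" using a by (intro Gamma_plus1) (auto elim!: nonpos_Ints_cases)
    hence "Beta a 1 = 1 / a" using Gamma_real_pos[OF a] by (simp add: Beta_def)
    moreover have "(\<integral>\<^sup>+t. pw a t * indicator {t..} \<tau> \<partial>lborel) = (\<integral>\<^sup>+t. pw a t * pw 1 (\<tau> - t) \<partial>lborel)"
    proof (rule nn_integral_cong_AE)
      show "AE t in lborel. pw a t * indicator {t..} \<tau> = pw a t * pw 1 (\<tau> - t)"
        using AE_lborel_singleton[of \<tau>] by eventually_elim (auto simp: pw_def indicator_def)
    qed
    ultimately show ?thesis using beta_convolution[of a 1 \<tau>] a by simp
  qed
  have "(\<integral>\<^sup>+t. ennreal (P t) * pw a t \<partial>lborel)
    = (\<integral>\<^sup>+t. \<integral>\<^sup>+\<tau>. ennreal (R \<tau>) * (pw a t * indicator {t..} \<tau>) \<partial>lborel \<partial>lborel)"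
    unfolding P_eq by (subst nn_integral_multc[symmetric]) (simp_all add: mult_ac)
  also have "\<dots> = (\<integral>\<^sup>+\<tau>. \<integral>\<^sup>+t. ennreal (R \<tau>) * (pw a t * indicator {t..} \<tau>) \<partial>lborel \<partial>lborel)"
    by (rule lborel_swap) measurable
  also have "\<dots> = (\<integral>\<^sup>+\<tau>. ennreal (1 / a) * (ennreal (R \<tau>) * pw (a + 1) \<tau>) \<partial>lborel)"
    by (subst nn_integral_cmult) (simp_all add: inner mult_ac)
  also have "\<dots> = ennreal (1 / a) * (\<integral>\<^sup>+\<tau>. ennreal (R \<tau>) * pw (a + 1) \<tau> \<partial>lborel)"
    by (rule nn_integral_cmult) simp
  finally have "ennreal a * (\<integral>\<^sup>+t. ennreal (P t) * pw a t \<partial>lborel)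
     = (ennreal a * ennreal (1 / a)) * (\<integral>\<^sup>+\<tau>. ennreal (R \<tau>) * pw (a + 1) \<tau> \<partial>lborel)"
    by (simp only: mult.assoc)
  moreover have "ennreal a * ennreal (1 / a) = 1" using a by (simp flip: ennreal_mult)
  ultimately show ?thesis by simp
qed

text \<open>The increment of \<open>P\<close> is the integral of \<open>R\<close> over
  \<open>{t..s + t}\<close>. Integrating \<open>s\<close> first leaves the power
  \<open>(\<tau> - t) powr (- \<sigma>) / \<sigma>\<close>, then \<open>t\<close> gives a Beta
  function and \<open>nn_integral_R\<close> returns to \<open>P\<close>. This is how a fractional
  power of the operator lowers the order of a moment from \<open>a\<close> to
  \<open>a - \<sigma>\<close>.\<close>

lemma nn_integral_increments:
  assumes \<sigma>: "0 < \<sigma>" "\<sigma> < 1" and a: "\<sigma> < a"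
  shows "(\<integral>\<^sup>+s. \<integral>\<^sup>+t. ennreal (P t - P (s + t)) * pw (- \<sigma>) s * pw a t \<partial>lborel \<partial>lborel)
    = ennreal (Beta a (1 - \<sigma>) / \<sigma> * (a - \<sigma>)) * (\<integral>\<^sup>+t. ennreal (P t) * pw (a - \<sigma>) t \<partial>lborel)"
proof -
  \<comment> \<open>At \<open>\<tau> = t\<close> the left side is infinite, since
    \<open>s powr (- \<sigma> - 1)\<close> is not integrable at 0, while the right side is 0; this
    null set is discarded below.\<close>
  have inner: "(\<integral>\<^sup>+s. pw (- \<sigma>) s * indicator {t..s + t} \<tau> \<partial>lborel) = ennreal (1 / \<sigma>) * pw (1 - \<sigma>) (\<tau> - t)"
    if "\<tau> \<noteq> t" for t \<tau>
  proof (cases "t < \<tau>")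
    case True
    have "(\<integral>\<^sup>+s. pw (- \<sigma>) s * indicator {t..s + t} \<tau> \<partial>lborel)
       = (\<integral>\<^sup>+s. ennreal (s powr (- \<sigma> - 1)) * indicator {\<tau> - t..} s \<partial>lborel)"
      using True by (intro nn_integral_cong) (auto simp: pw_def indicator_def)
    also have "\<dots> = ennreal ((\<tau> - t) powr (- \<sigma>) / \<sigma>)"
      using True \<sigma> by (intro nn_integral_powr_atLeast) auto
    also have "\<dots> = ennreal (1 / \<sigma>) * ennreal ((\<tau> - t) powr (- \<sigma>))"
      using \<sigma> by (simp flip: ennreal_mult)
    finally show ?thesis using True by (simp add: pw_def)
  next
    case False
    hence "(\<integral>\<^sup>+s. pw (- \<sigma>) s * indicator {t..s + t} \<tau> \<partial>lborel) = (\<integral>\<^sup>+(s::real). 0 \<partial>lborel)"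
      using that by (intro nn_integral_cong) (auto simp: indicator_def)
    thus ?thesis using False by (simp add: pw_def)
  qed
  have "(\<integral>\<^sup>+s. \<integral>\<^sup>+t. ennreal (P t - P (s + t)) * pw (- \<sigma>) s * pw a t \<partial>lborel \<partial>lborel)
    = (\<integral>\<^sup>+s. \<integral>\<^sup>+t. \<integral>\<^sup>+\<tau>. ennreal (R \<tau>) * (pw a t * (pw (- \<sigma>) s * indicator {t..s + t} \<tau>)) \<partial>lborel \<partial>lborel \<partial>lborel)"
  proof (intro nn_integral_cong)
    fix s t :: real
    show "ennreal (P t - P (s + t)) * pw (- \<sigma>) s * pw a t
      = (\<integral>\<^sup>+\<tau>. ennreal (R \<tau>) * (pw a t * (pw (- \<sigma>) s * indicator {t..s + t} \<tau>)) \<partial>lborel)"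
    proof (cases "0 < s")
      case True
      have "ennreal (P t - P (s + t)) = (\<integral>\<^sup>+\<tau>. ennreal (R \<tau>) * indicator {t..s + t} \<tau> \<partial>lborel)"
        using P_diff[of s t] True by (simp add: add.commute)
      hence "ennreal (P t - P (s + t)) * pw (- \<sigma>) s * pw a t
         = (pw a t * pw (- \<sigma>) s) * (\<integral>\<^sup>+\<tau>. ennreal (R \<tau>) * indicator {t..s + t} \<tau> \<partial>lborel)"
        by (simp only: mult_ac)
      also have "\<dots> = (\<integral>\<^sup>+\<tau>. (pw a t * pw (- \<sigma>) s) * (ennreal (R \<tau>) * indicator {t..s + t} \<tau>) \<partial>lborel)"
        by (rule nn_integral_cmult[symmetric]) simp
      finally show ?thesis by (simp only: mult_ac)
    qed (simp add: pw_eq_0)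
  qed
  also have "\<dots> = (\<integral>\<^sup>+s. \<integral>\<^sup>+\<tau>. \<integral>\<^sup>+t. ennreal (R \<tau>) * (pw a t * (pw (- \<sigma>) s * indicator {t..s + t} \<tau>)) \<partial>lborel \<partial>lborel \<partial>lborel)"
    by (intro nn_integral_cong lborel_swap) measurable
  also have "\<dots> = (\<integral>\<^sup>+\<tau>. \<integral>\<^sup>+s. \<integral>\<^sup>+t. ennreal (R \<tau>) * (pw a t * (pw (- \<sigma>) s * indicator {t..s + t} \<tau>)) \<partial>lborel \<partial>lborel \<partial>lborel)"
    by (rule lborel_swap) measurable
  also have "\<dots> = (\<integral>\<^sup>+\<tau>. \<integral>\<^sup>+t. \<integral>\<^sup>+s. ennreal (R \<tau>) * (pw a t * (pw (- \<sigma>) s * indicator {t..s + t} \<tau>)) \<partial>lborel \<partial>lborel \<partial>lborel)"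
    by (intro nn_integral_cong lborel_swap) measurable
  also have "\<dots> = (\<integral>\<^sup>+\<tau>. ennreal (Beta a (1 - \<sigma>) / \<sigma>) * (ennreal (R \<tau>) * pw (a - \<sigma> + 1) \<tau>) \<partial>lborel)"
  proof (rule nn_integral_cong)
    fix \<tau> :: real
    have "(\<integral>\<^sup>+t. \<integral>\<^sup>+s. ennreal (R \<tau>) * (pw a t * (pw (- \<sigma>) s * indicator {t..s + t} \<tau>)) \<partial>lborel \<partial>lborel)
      = (\<integral>\<^sup>+t. (ennreal (R \<tau>) * ennreal (1 / \<sigma>)) * (pw a t * pw (1 - \<sigma>) (\<tau> - t)) \<partial>lborel)"
    proof (rule nn_integral_cong_AE)
      show "AE t in lborel. (\<integral>\<^sup>+s. ennreal (R \<tau>) * (pw a t * (pw (- \<sigma>) s * indicator {t..s + t} \<tau>)) \<partial>lborel)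
        = (ennreal (R \<tau>) * ennreal (1 / \<sigma>)) * (pw a t * pw (1 - \<sigma>) (\<tau> - t))"
        using AE_lborel_singleton[of \<tau>]
      proof eventually_elim
        case (elim t)
        have "(\<integral>\<^sup>+s. ennreal (R \<tau>) * (pw a t * (pw (- \<sigma>) s * indicator {t..s + t} \<tau>)) \<partial>lborel)
          = ennreal (R \<tau>) * (pw a t * (\<integral>\<^sup>+s. pw (- \<sigma>) s * indicator {t..s + t} \<tau> \<partial>lborel))"
          by (simp add: nn_integral_cmult)
        also have "\<dots> = ennreal (R \<tau>) * (pw a t * (ennreal (1 / \<sigma>) * pw (1 - \<sigma>) (\<tau> - t)))"
          using elim by (subst inner) auto
        finally show ?case by (simp only: mult_ac)
      qed
    qed
    also have "\<dots> = (ennreal (R \<tau>) * ennreal (1 / \<sigma>)) * (\<integral>\<^sup>+t. pw a t * pw (1 - \<sigma>) (\<tau> - t) \<partial>lborel)"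
      by (rule nn_integral_cmult) simp
    also have "\<dots> = (ennreal (R \<tau>) * ennreal (1 / \<sigma>)) * (ennreal (Beta a (1 - \<sigma>)) * pw (a + (1 - \<sigma>)) \<tau>)"
      using \<sigma> a by (subst beta_convolution) auto
    also have "a + (1 - \<sigma>) = a - \<sigma> + 1" by simp
    also have "(ennreal (R \<tau>) * ennreal (1 / \<sigma>)) * (ennreal (Beta a (1 - \<sigma>)) * pw (a - \<sigma> + 1) \<tau>)
      = (ennreal (Beta a (1 - \<sigma>)) * ennreal (1 / \<sigma>)) * (ennreal (R \<tau>) * pw (a - \<sigma> + 1) \<tau>)" by (simp only: mult_ac)
    also have "ennreal (Beta a (1 - \<sigma>)) * ennreal (1 / \<sigma>) = ennreal (Beta a (1 - \<sigma>) / \<sigma>)"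
      using \<sigma> by (subst ennreal_mult''[symmetric]) auto
    finally show "(\<integral>\<^sup>+t. \<integral>\<^sup>+s. ennreal (R \<tau>) * (pw a t * (pw (- \<sigma>) s * indicator {t..s + t} \<tau>)) \<partial>lborel \<partial>lborel)
      = ennreal (Beta a (1 - \<sigma>) / \<sigma>) * (ennreal (R \<tau>) * pw (a - \<sigma> + 1) \<tau>)" .
  qed
  also have "\<dots> = ennreal (Beta a (1 - \<sigma>) / \<sigma>) * (\<integral>\<^sup>+\<tau>. ennreal (R \<tau>) * pw (a - \<sigma> + 1) \<tau> \<partial>lborel)"
    by (rule nn_integral_cmult) simp
  also have "(\<integral>\<^sup>+\<tau>. ennreal (R \<tau>) * pw (a - \<sigma> + 1) \<tau> \<partial>lborel)
     = ennreal (a - \<sigma>) * (\<integral>\<^sup>+t. ennreal (P t) * pw (a - \<sigma>) t \<partial>lborel)"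
    using a by (intro nn_integral_R) auto
  finally show ?thesis
    using a by (simp only: ennreal_mult''[of "a - \<sigma>"] mult.assoc diff_ge_0_iff_ge less_imp_le)
qed

end

lemma measurable_heat' [measurable]: "(\<lambda>t. heat' t (x :: int ^ 'd::finite)) \<in> borel_measurable borel"
  unfolding heat'_def lapl_eq adj_def by measurable

lemma heat_tendsto_0: "((\<lambda>t. heat t (x :: int ^ 'd::finite)) \<longlongrightarrow> 0) at_top"
proof -
  obtain C where C: "\<And>t. t > 0 \<Longrightarrow> sqrt t ^ CARD('d) * heat t (0 :: int ^ 'd) \<le> C"
    using heat_0_bound by blast
  show ?thesis
  proof (rule Lim_null_comparison)
    show "\<forall>\<^sub>F t in at_top. norm (heat t x) \<le> C * inverse (sqrt t ^ CARD('d))"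
      using eventually_gt_at_top[of 0]
    proof eventually_elim
      case (elim t)
      have "sqrt t ^ CARD('d) * \<bar>heat t x\<bar> \<le> sqrt t ^ CARD('d) * heat t (0 :: int ^ 'd)"
        using elim by (intro mult_left_mono abs_heat_le) auto
      hence "sqrt t ^ CARD('d) * \<bar>heat t x\<bar> \<le> C" using C[OF elim] by linarith
      thus ?case using elim by (simp add: field_simps)
    qed
    have "filterlim (\<lambda>t. sqrt t ^ CARD('d)) at_top at_top"
      by (intro filterlim_pow_at_top sqrt_at_top) simp
    thus "((\<lambda>t. C * inverse (sqrt t ^ CARD('d))) \<longlongrightarrow> 0) at_top"
      by (intro tendsto_mult_right_zero tendsto_inverse_0_at_top)
  qed
qed

lemma profile_0: "decreasing_profile (\<lambda>t. heat t (0 :: int ^ 'd::finite)) (\<lambda>t. heat' t (0 :: int ^ 'd))"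
  by unfold_locales (auto intro: DERIV_heat heat'_0_nonneg heat_tendsto_0)

text \<open>
  Away from the origin \<open>heat t x\<close> is not monotone in \<open>t\<close>, but adding \<open>heat t 0\<close> makes it so.
\<close>

lemma profile_sum:
  fixes x :: "int ^ 'd::finite"
  shows "decreasing_profile (\<lambda>t. heat t (0 :: int ^ 'd) + heat t x) (\<lambda>t. heat' t (0 :: int ^ 'd) + heat' t x)"
proof
  show "((\<lambda>t. heat t (0 :: int ^ 'd) + heat t x) has_real_derivative - (heat' t (0 :: int ^ 'd) + heat' t x)) (at t)" for t
    using DERIV_add[OF DERIV_heat[of "0 :: int ^ 'd" t] DERIV_heat[of x t]] by simp
  show "0 \<le> heat' t (0 :: int ^ 'd) + heat' t x" for t using abs_heat'_le[of t x] by linarith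
  show "((\<lambda>t. heat t (0 :: int ^ 'd) + heat t x) \<longlongrightarrow> 0) at_top"
    using tendsto_add[OF heat_tendsto_0[of "0 :: int ^ 'd"] heat_tendsto_0[of x]] by simp
qed auto

section \<open>The jump kernel\<close>

lemma ennreal_eq_sum2: "u = v + w \<Longrightarrow> 0 \<le> v \<Longrightarrow> 0 \<le> w \<Longrightarrow> ennreal u = ennreal v + ennreal w"
  by simp

lemma ennreal_sum2_eq_sum3:
  assumes "a + b = c + d + e" "0 \<le> a" "0 \<le> b" "0 \<le> c" "0 \<le> d" "0 \<le> e"
  shows "ennreal a + ennreal b = (ennreal c + ennreal d) + ennreal e"
proof -
  have "ennreal (a + b) = ennreal (c + d + e)" using assms(1) by simp
  thus ?thesis using assms(2-) by simp
qed

lemma nn_integral_heat_off_diagonal: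
  assumes s: "0 \<le> s"
  shows "(\<integral>\<^sup>+y. ennreal (heat s y) * indicator (- {0}) (y :: int ^ 'd::finite) \<partial>count_space UNIV)
     = ennreal (1 - heat s (0 :: int ^ 'd))"
proof -
  let ?A = "\<integral>\<^sup>+y. ennreal (heat s y) * indicator (- {0}) (y :: int ^ 'd) \<partial>count_space UNIV"
  let ?h = "heat s (0 :: int ^ 'd)"
  have "1 = (\<integral>\<^sup>+y. ennreal (heat s (y :: int ^ 'd)) \<partial>count_space UNIV)"
    by (rule nn_integral_heat[OF s, symmetric])
  also have "\<dots> = (\<integral>\<^sup>+y. ennreal (heat s y) * indicator (- {0}) (y :: int ^ 'd)
      + ennreal (heat s y) * indicator {0} (y :: int ^ 'd) \<partial>count_space UNIV)"
    by (intro nn_integral_cong) (auto simp: indicator_def)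
  also have "\<dots> = ?A + ennreal ?h"
    by (simp add: nn_integral_add)
  finally have "1 = ?A + ennreal ?h" .
  moreover have "?A = (?A + ennreal ?h) - ennreal ?h" by simp
  ultimately have "?A = 1 - ennreal ?h" by (simp only:)
  also have "\<dots> = ennreal (1 - ?h)" using heat_nonneg[OF s, of "0 :: int ^ 'd"] by (simp add: ennreal_minus flip: ennreal_1)
  finally show ?thesis .
qed

text \<open>By conservation of mass a single site carries at most what has left the origin, which is
  of order \<open>s\<close> for small \<open>s\<close>.\<close>

lemma heat_off_diagonal_le:
  assumes "0 \<le> s" "z \<noteq> 0"
  shows "heat s (z :: int ^ 'd::finite) \<le> 1 - heat s (0 :: int ^ 'd)"
proof -
  have "ennreal (heat s z) = (\<integral>\<^sup>+y. ennreal (heat s y) * indicator {z} y \<partial>count_space UNIV)" by simp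
  also have "\<dots> \<le> (\<integral>\<^sup>+y. ennreal (heat s y) * indicator (- {0}) (y :: int ^ 'd) \<partial>count_space UNIV)"
    using assms(2) by (intro nn_integral_mono) (auto simp: indicator_def)
  also have "\<dots> = ennreal (1 - heat s (0 :: int ^ 'd))" by (rule nn_integral_heat_off_diagonal[OF assms(1)])
  finally show ?thesis using heat_le_1[OF assms(1), of "0 :: int ^ 'd"] by (simp add: ennreal_le_iff)
qed

text \<open>\<open>1 - heat s 0\<close> is at most \<open>2 * CARD('d) * s\<close> and at most 1;
  the first bound gives convergence at 0 because \<open>\<sigma> < 1\<close>, the second at infinity
  because \<open>0 < \<sigma>\<close>.\<close>

lemma jump_rate_finite:
  assumes \<sigma>: "0 < \<sigma>" "\<sigma> < 1"
  shows "(\<integral>\<^sup>+s. ennreal (1 - heat s (0 :: int ^ 'd::finite)) * pw (- \<sigma>) s \<partial>lborel) < \<infinity>"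
proof -
  let ?c = "2 * real CARD('d)"
  have "(\<integral>\<^sup>+s. ennreal (1 - heat s (0 :: int ^ 'd)) * pw (- \<sigma>) s \<partial>lborel)
     \<le> (\<integral>\<^sup>+s. ennreal ?c * (ennreal (s powr ((1 - \<sigma>) - 1)) * indicator {0<..1} s)
          + ennreal (s powr (- \<sigma> - 1)) * indicator {1..} s \<partial>lborel)"
  proof (rule nn_integral_mono)
    fix s :: real
    have 1: "ennreal (1 - heat s (0 :: int ^ 'd)) * ennreal (s powr (- \<sigma> - 1)) \<le> ennreal ?c * ennreal (s powr (- \<sigma>))"
      if "0 < s"
    proof -
      have "1 - ?c * s \<le> heat s (0 :: int ^ 'd)"
        using heat_0_ge[of s, where 'd = 'd] exp_ge_add_one_self[of "- (?c * s)"] that by linarith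
      hence "(1 - heat s (0 :: int ^ 'd)) * s powr (- \<sigma> - 1) \<le> (?c * s) * s powr (- \<sigma> - 1)"
        by (intro mult_right_mono) auto
      also have "\<dots> = ?c * (s powr 1 * s powr (- \<sigma> - 1))" using that by simp
      also have "s powr 1 * s powr (- \<sigma> - 1) = s powr (- \<sigma>)" by (subst powr_add[symmetric]) simp
      finally show ?thesis using heat_le_1[of s "0 :: int ^ 'd"] that
        by (simp add: ennreal_leI flip: ennreal_mult)
    qed
    have 2: "ennreal (1 - heat s (0 :: int ^ 'd)) * ennreal (s powr (- \<sigma> - 1)) \<le> ennreal (s powr (- \<sigma> - 1))"
      if "0 < s"
    proof -
      have "ennreal (1 - heat s (0 :: int ^ 'd)) \<le> 1"
        using heat_nonneg[of s "0 :: int ^ 'd"] that by (simp add: ennreal_le_1)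
      from mult_right_mono[OF this, of "ennreal (s powr (- \<sigma> - 1))"] show ?thesis by simp
    qed
    consider "s \<le> 0" | "0 < s" "s \<le> 1" | "1 < s" by linarith
    thus "ennreal (1 - heat s (0 :: int ^ 'd)) * pw (- \<sigma>) s
       \<le> ennreal ?c * (ennreal (s powr ((1 - \<sigma>) - 1)) * indicator {0<..1} s)
          + ennreal (s powr (- \<sigma> - 1)) * indicator {1..} s"
      using 1 2 by cases (auto simp: pw_def indicator_def add_increasing2)
  qed
  also have "\<dots> = ennreal ?c * ennreal (1 / (1 - \<sigma>)) + ennreal (1 powr (- \<sigma>) / \<sigma>)"
    using \<sigma> by (subst nn_integral_add, simp, simp, subst nn_integral_cmult, simp)
      (simp only: nn_integral_powr_0_1 nn_integral_powr_atLeast diff_gt_0_iff_gt zero_less_one)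
  also have "\<dots> < \<infinity>" by (simp add: ennreal_mult_less_top)
  finally show ?thesis .
qed

lemma mom_neg_finite:
  assumes \<sigma>: "0 < \<sigma>" "\<sigma> < 1" and z: "z \<noteq> 0"
  shows "mom (- \<sigma>) (z :: int ^ 'd::finite) < \<infinity>"
proof -
  have "mom (- \<sigma>) z \<le> (\<integral>\<^sup>+s. ennreal (1 - heat s (0 :: int ^ 'd)) * pw (- \<sigma>) s \<partial>lborel)"
    unfolding mom_eq_pw
  proof (rule nn_integral_mono)
    fix s :: real
    show "ennreal (heat s z) * pw (- \<sigma>) s \<le> ennreal (1 - heat s (0 :: int ^ 'd)) * pw (- \<sigma>) s"
    proof (cases "0 < s")
      case True
      thus ?thesis using z by (intro mult_right_mono ennreal_leI heat_off_diagonal_le) auto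
    qed (simp add: pw_eq_0)
  qed
  thus ?thesis using jump_rate_finite[OF \<sigma>, where 'd = 'd] by (rule le_less_trans)
qed

lemma abs_Gamma_uminus:
  assumes "0 < \<sigma>" "\<sigma> < (1 :: real)"
  shows "\<bar>Gamma (- \<sigma>)\<bar> = Gamma (1 - \<sigma>) / \<sigma>"
proof -
  have "- \<sigma> \<notin> \<int>\<^sub>\<le>\<^sub>0"
  proof
    assume "- \<sigma> \<in> \<int>\<^sub>\<le>\<^sub>0"
    then obtain n where "- \<sigma> = real_of_int n" by (elim nonpos_Ints_cases)
    hence "real_of_int (- 1) < real_of_int n" "real_of_int n < real_of_int 0" using assms by auto
    hence "- 1 < n" "n < 0" unfolding of_int_less_iff .
    thus False by simp
  qed
  hence "Gamma (- \<sigma> + 1) = - \<sigma> * Gamma (- \<sigma>)" by (rule Gamma_plus1)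
  hence "Gamma (- \<sigma>) = - (Gamma (1 - \<sigma>) / \<sigma>)" using assms by (simp add: field_simps)
  moreover have "Gamma (1 - \<sigma>) > 0" using assms by (intro Gamma_real_pos) simp
  ultimately show ?thesis using assms by simp
qed

lemma kappa_frac:
  assumes \<sigma>: "0 < \<sigma>" "\<sigma> < 1" and z: "z \<noteq> 0"
  shows "kappa \<sigma> (z :: int ^ 'd::finite) = \<sigma> / Gamma (1 - \<sigma>) * rmom (- \<sigma>) z"
proof -
  have "integral {0<..} (\<lambda>t. heat t z * t powr (- \<sigma> - 1)) = rmom (- \<sigma>) z"
    unfolding rmom_def mom_def
    by (rule integral_pos_half_line)
       (use mom_neg_finite[OF assms] in \<open>auto simp: mom_def intro!: mult_nonneg_nonneg heat_nonneg\<close>)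
  moreover have "integral {0<..} (\<lambda>t. heat t z / t powr (1 + \<sigma>)) = integral {0<..} (\<lambda>t. heat t z * t powr (- \<sigma> - 1))"
  proof (rule Henstock_Kurzweil_Integration.integral_cong)
    fix t :: real
    have "- \<sigma> - 1 = - (1 + \<sigma>)" by simp
    thus "heat t z / t powr (1 + \<sigma>) = heat t z * t powr (- \<sigma> - 1)"
      by (simp only: divide_inverse powr_minus)
  qed
  moreover have "\<not> \<sigma> \<le> - real CARD('d) / 2" using \<sigma> by (simp add: not_le add_strict_increasing2)
  ultimately show ?thesis using \<sigma> z by (simp add: kappa_def abs_Gamma_uminus)
qed

lemma kappa_frac_0: "0 < \<sigma> \<Longrightarrow> \<sigma> < 1 \<Longrightarrow> kappa \<sigma> (0 :: int ^ 'd::finite) = 0"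
  by (simp add: kappa_def)

lemma kappa_1: "kappa 1 (z :: int ^ 'd::finite) = (if lnorm z = 1 then 1 else 0)"
proof -
  have "\<not> 1 \<le> - real CARD('d) / 2" by (simp add: not_le add_strict_increasing2)
  thus ?thesis by (simp add: kappa_def)
qed

text \<open>The indicator expresses that \<open>kappa \<sigma>\<close> vanishes at the origin by
  definition, where the integral itself would diverge.\<close>

lemma ennreal_kappa_frac:
  assumes \<sigma>: "0 < \<sigma>" "\<sigma> < 1"
  shows "ennreal (kappa \<sigma> (z :: int ^ 'd::finite)) = ennreal (\<sigma> / Gamma (1 - \<sigma>)) *
    (\<integral>\<^sup>+s. (ennreal (heat s z) * indicator (- {0}) z) * pw (- \<sigma>) s \<partial>lborel)"
proof (cases "z = 0")
  case True
  thus ?thesis using kappa_frac_0[OF \<sigma>, where 'd = 'd] by simp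
next
  case False
  have "Gamma (1 - \<sigma>) > 0" using \<sigma> by (intro Gamma_real_pos) simp
  hence "ennreal (kappa \<sigma> z) = ennreal (\<sigma> / Gamma (1 - \<sigma>)) * ennreal (rmom (- \<sigma>) z)"
    unfolding kappa_frac[OF \<sigma> False] using \<sigma> by (intro ennreal_mult) (auto simp: rmom_def)
  also have "ennreal (rmom (- \<sigma>) z) = mom (- \<sigma>) z"
    unfolding rmom_def using mom_neg_finite[OF \<sigma> False] by simp
  finally show ?thesis using False by (simp add: mom_eq_pw)
qed

lemma kappa_nonneg:
  assumes "0 < \<sigma>" "\<sigma> \<le> 1"
  shows "0 \<le> kappa \<sigma> (z :: int ^ 'd::finite)"
proof (cases "\<sigma> = 1")
  case True
  thus ?thesis by (simp add: kappa_1)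
next
  case False
  hence \<sigma>: "\<sigma> < 1" using assms by simp
  have "Gamma (1 - \<sigma>) > 0" using \<sigma> by (intro Gamma_real_pos) simp
  thus ?thesis using kappa_frac_0[OF assms(1) \<sigma>, where 'd = 'd] kappa_frac[OF assms(1) \<sigma>, of z] assms
    by (cases "z = 0") (auto simp: rmom_def)
qed

lemma lnorm_uminus: "lnorm (- x) = lnorm x"
  by (simp add: lnorm_def)

lemma kappa_even: "0 < \<sigma> \<Longrightarrow> \<sigma> \<le> 1 \<Longrightarrow> kappa \<sigma> (- z) = kappa \<sigma> (z :: int ^ 'd::finite)"
  by (simp add: kappa_def lnorm_uminus heat_even)

text \<open>Edges to the nearest neighbours suffice to connect the lattice, in the local case
  \<open>\<sigma> = 1\<close> and in the nonlocal case alike.\<close>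

lemma kappa_neighbour_pos:
  assumes "0 < \<sigma>" "\<sigma> \<le> 1"
  shows "0 < kappa \<sigma> (axis i 1 :: int ^ 'd::finite)"
proof (cases "\<sigma> = 1")
  case True
  have "lnorm (axis i 1 :: int ^ 'd) = 1" by (subst lnorm_eq_1_iff) blast
  thus ?thesis using True by (simp add: kappa_1)
next
  case False
  hence \<sigma>: "\<sigma> < 1" using assms by simp
  have z: "(axis i 1 :: int ^ 'd) \<noteq> 0" by (simp add: axis_eq_0_iff)
  have "Gamma (1 - \<sigma>) > 0" using \<sigma> by (intro Gamma_real_pos) simp
  moreover have "rmom (- \<sigma>) (axis i 1 :: int ^ 'd) > 0"
    using mom_pos[of "- \<sigma>" "axis i 1 :: int ^ 'd"] mom_neg_finite[OF assms(1) \<sigma> z]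
    by (simp add: rmom_def enn2real_positive_iff)
  ultimately show ?thesis unfolding kappa_frac[OF assms(1) \<sigma> z] using assms by simp
qed

section \<open>Fractional Laplacian of the Riesz kernel\<close>

text \<open>Formally, the fractional Laplacian of \<open>mom \<alpha>\<close> is a constant times
  the double integral of \<open>heat t x - heat (s + t) x\<close> against
  \<open>pw (- \<sigma>) s * pw \<alpha> t\<close>, and \<open>nn_integral_increments\<close>
  evaluates it. Since this difference has no sign for \<open>x \<noteq> 0\<close>, the identity is
  proved for the sum of the values at \<open>x\<close> and at the origin, from which the one at the
  origin is cancelled.\<close>

lemma kappa_equation_frac:
  fixes x :: "int ^ 'd::finite"
  assumes \<sigma>: "0 < \<sigma>" "\<sigma> < 1" and \<alpha>: "\<sigma> < \<alpha>" "\<alpha> < real CARD('d) / 2"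
  shows "(\<integral>\<^sup>+z. ennreal (kappa \<sigma> z) \<partial>count_space (UNIV :: (int ^ 'd) set)) < \<infinity>"
    and "(\<integral>\<^sup>+z. ennreal (kappa \<sigma> z) \<partial>count_space (UNIV :: (int ^ 'd) set)) * mom \<alpha> x
     = (\<integral>\<^sup>+y. ennreal (kappa \<sigma> (x - y)) * mom \<alpha> y \<partial>count_space UNIV)
       + ennreal (Gamma \<alpha> / Gamma (\<alpha> - \<sigma>)) * mom (\<alpha> - \<sigma>) x"
proof -
  define c where "c = \<sigma> / Gamma (1 - \<sigma>)"
  have G1: "Gamma (1 - \<sigma>) > 0" using \<sigma> by (intro Gamma_real_pos) simp
  hence c: "c > 0" using \<sigma> by (simp add: c_def)
  let ?h = "\<lambda>s. heat s (0 :: int ^ 'd)"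
  define J where "J = (\<integral>\<^sup>+s. ennreal (1 - ?h s) * pw (- \<sigma>) s \<partial>lborel)"
  have J: "J < \<infinity>" unfolding J_def by (rule jump_rate_finite[OF \<sigma>])
  define I where "I f = (\<integral>\<^sup>+s. \<integral>\<^sup>+t. f s t * pw (- \<sigma>) s * pw \<alpha> t \<partial>lborel \<partial>lborel)" for f
  have Icong: "I f = I g" if "\<And>s t. 0 < s \<Longrightarrow> 0 < t \<Longrightarrow> f s t = g s t" for f g
    unfolding I_def
  proof (intro nn_integral_cong)
    fix s t
    show "f s t * pw (- \<sigma>) s * pw \<alpha> t = g s t * pw (- \<sigma>) s * pw \<alpha> t"
      using that[of s t] by (cases "0 < s"; cases "0 < t") (auto simp: pw_eq_0 not_less)
  qed
  have Iadd: "I (\<lambda>s t. f s t + g s t) = I f + I g"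
    if [measurable]: "(\<lambda>(s, t). f s t) \<in> borel_measurable (borel \<Otimes>\<^sub>M borel)"
      "(\<lambda>(s, t). g s t) \<in> borel_measurable (borel \<Otimes>\<^sub>M borel)" for f g
  proof -
    have [measurable]: "f s \<in> borel_measurable borel" "g s \<in> borel_measurable borel" for s
      using measurable_compose[OF measurable_Pair1' that(1), of s] measurable_compose[OF measurable_Pair1' that(2), of s] by auto
    have "I (\<lambda>s t. f s t + g s t) = (\<integral>\<^sup>+s. (\<integral>\<^sup>+t. f s t * pw (- \<sigma>) s * pw \<alpha> t \<partial>lborel)
        + (\<integral>\<^sup>+t. g s t * pw (- \<sigma>) s * pw \<alpha> t \<partial>lborel) \<partial>lborel)"
      unfolding I_def distrib_right by (intro nn_integral_cong nn_integral_add) simp_all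
    also have "\<dots> = I f + I g" unfolding I_def by (rule nn_integral_add) measurable
    finally show ?thesis .
  qed
  have sumk: "(\<integral>\<^sup>+z. ennreal (kappa \<sigma> z) \<partial>count_space (UNIV :: (int ^ 'd) set)) = ennreal c * J"
  proof -
    have "(\<integral>\<^sup>+z. ennreal (kappa \<sigma> z) \<partial>count_space (UNIV :: (int ^ 'd) set))
      = ennreal c * (\<integral>\<^sup>+z. (\<integral>\<^sup>+s. (ennreal (heat s z) * indicator (- {0}) z) * pw (- \<sigma>) s \<partial>lborel) \<partial>count_space (UNIV :: (int ^ 'd) set))"
      unfolding ennreal_kappa_frac[OF \<sigma>] c_def by (rule nn_integral_cmult) simp
    also have "(\<integral>\<^sup>+z. (\<integral>\<^sup>+s. (ennreal (heat s z) * indicator (- {0}) z) * pw (- \<sigma>) s \<partial>lborel) \<partial>count_space (UNIV :: (int ^ 'd) set))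
      = (\<integral>\<^sup>+s. (\<integral>\<^sup>+z. (ennreal (heat s z) * indicator (- {0}) z) * pw (- \<sigma>) s \<partial>count_space (UNIV :: (int ^ 'd) set)) \<partial>lborel)"
      by (rule nn_integral_swap_count_space[symmetric]) (auto intro: lborel.sigma_finite_measure_axioms)
    also have "\<dots> = J"
      unfolding J_def
    proof (rule nn_integral_cong)
      fix s :: real
      show "(\<integral>\<^sup>+z. (ennreal (heat s z) * indicator (- {0}) z) * pw (- \<sigma>) s \<partial>count_space (UNIV :: (int ^ 'd) set))
         = ennreal (1 - ?h s) * pw (- \<sigma>) s"
        by (cases "0 < s") (simp_all add: nn_integral_multc nn_integral_heat_off_diagonal pw_eq_0)
    qed
    finally show ?thesis .
  qed
  thus fin: "(\<integral>\<^sup>+z. ennreal (kappa \<sigma> z) \<partial>count_space (UNIV :: (int ^ 'd) set)) < \<infinity>"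
    using J by (simp add: ennreal_mult_less_top)
  \<comment> \<open>\<open>A\<close> and \<open>B\<close> are the outgoing and the incoming part:
    formally \<open>A x s t - B x s t\<close> is \<open>heat t x - heat (s + t) x\<close>. The term
    \<open>heat s 0 * heat t x\<close> is removed from both so that the singularity of
    \<open>pw (- \<sigma>)\<close> at 0 becomes integrable.\<close>
  define A where "A x s t = ennreal ((1 - ?h s) * heat t x)" for x :: "int ^ 'd" and s t
  define B where "B x s t = ennreal (heat (s + t) x - ?h s * heat t x)" for x :: "int ^ 'd" and s t
  have [measurable]: "(\<lambda>(s, t). A x s t) \<in> borel_measurable (borel \<Otimes>\<^sub>M borel)"
    "(\<lambda>(s, t). B x s t) \<in> borel_measurable (borel \<Otimes>\<^sub>M borel)" for x
    unfolding A_def B_def by measurable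
  have IA: "I (A x) = J * mom \<alpha> x" for x
  proof -
    have "I (A x) = I (\<lambda>s t. ennreal (1 - ?h s) * ennreal (heat t x))"
      by (rule Icong) (auto simp: A_def heat_le_1 heat_nonneg intro!: ennreal_mult)
    also have "\<dots> = (\<integral>\<^sup>+s. \<integral>\<^sup>+t. (ennreal (1 - ?h s) * pw (- \<sigma>) s) * (ennreal (heat t x) * pw \<alpha> t) \<partial>lborel \<partial>lborel)"
      unfolding I_def by (simp only: mult_ac)
    also have "\<dots> = J * mom \<alpha> x"
      unfolding J_def mom_eq_pw by (simp add: nn_integral_cmult nn_integral_multc)
    finally show ?thesis .
  qed
  have conv_inner: "(\<integral>\<^sup>+y. (ennreal (heat s (x - y)) * indicator (- {0}) (x - y)) * ennreal (heat t y) \<partial>count_space UNIV)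
      = B x s t" if st: "0 < s" "0 < t" for s t and x :: "int ^ 'd"
  proof -
    let ?C = "\<integral>\<^sup>+y. (ennreal (heat s (x - y)) * indicator (- {0}) (x - y)) * ennreal (heat t y) \<partial>count_space UNIV"
    have "ennreal (heat (s + t) x) = (\<integral>\<^sup>+y. ennreal (heat s (x - y)) * ennreal (heat t y) \<partial>count_space UNIV)"
      using st by (intro nn_integral_heat_heat[symmetric]) auto
    also have "\<dots> = (\<integral>\<^sup>+y. (ennreal (heat s (x - y)) * indicator (- {0}) (x - y)) * ennreal (heat t y)
        + (ennreal (?h s) * ennreal (heat t x)) * indicator {x} y \<partial>count_space UNIV)"
      by (intro nn_integral_cong) (auto simp: indicator_def)
    also have "\<dots> = ?C + ennreal (?h s) * ennreal (heat t x)"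
      by (simp add: nn_integral_add nn_integral_cmult_indicator)
    also have "ennreal (?h s) * ennreal (heat t x) = ennreal (?h s * heat t x)"
      using st by (simp add: ennreal_mult heat_nonneg)
    finally have "ennreal (heat (s + t) x) - ennreal (?h s * heat t x) = ?C" by simp
    thus ?thesis using st by (simp add: B_def ennreal_minus heat_nonneg)
  qed
  have B_nonneg: "0 \<le> heat (s + t) x - ?h s * heat t x" if st: "0 < s" "0 < t" for s t and x :: "int ^ 'd"
  proof -
    have "ennreal (?h s * heat t x) = ennreal (heat s (x - x)) * ennreal (heat t x)"
      using st by (simp add: ennreal_mult heat_nonneg)
    also have "\<dots> = (\<integral>\<^sup>+y. (ennreal (heat s (x - y)) * ennreal (heat t y)) * indicator {x} y \<partial>count_space UNIV)" by simp
    also have "\<dots> \<le> (\<integral>\<^sup>+y. ennreal (heat s (x - y)) * ennreal (heat t y) \<partial>count_space UNIV)"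
      by (intro nn_integral_mono) (auto simp: indicator_def)
    also have "\<dots> = ennreal (heat (s + t) x)" using st by (intro nn_integral_heat_heat) auto
    finally show ?thesis using st by (simp add: ennreal_le_iff heat_nonneg)
  qed
  have IB: "(\<integral>\<^sup>+y. ennreal (kappa \<sigma> (x - y)) * mom \<alpha> y \<partial>count_space UNIV) = ennreal c * I (B x)" for x
  proof -
    have "(\<integral>\<^sup>+y. ennreal (kappa \<sigma> (x - y)) * mom \<alpha> y \<partial>count_space UNIV)
      = (\<integral>\<^sup>+y. ennreal c * ((\<integral>\<^sup>+s. (ennreal (heat s (x - y)) * indicator (- {0}) (x - y)) * pw (- \<sigma>) s \<partial>lborel)
          * (\<integral>\<^sup>+t. ennreal (heat t y) * pw \<alpha> t \<partial>lborel)) \<partial>count_space UNIV)"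
      unfolding ennreal_kappa_frac[OF \<sigma>] c_def mom_eq_pw by (simp only: mult.assoc)
    also have "\<dots> = ennreal c * (\<integral>\<^sup>+y. (\<integral>\<^sup>+s. (ennreal (heat s (x - y)) * indicator (- {0}) (x - y)) * pw (- \<sigma>) s \<partial>lborel)
          * (\<integral>\<^sup>+t. ennreal (heat t y) * pw \<alpha> t \<partial>lborel) \<partial>count_space UNIV)"
      by (rule nn_integral_cmult) simp
    also have "(\<integral>\<^sup>+y. (\<integral>\<^sup>+s. (ennreal (heat s (x - y)) * indicator (- {0}) (x - y)) * pw (- \<sigma>) s \<partial>lborel)
          * (\<integral>\<^sup>+t. ennreal (heat t y) * pw \<alpha> t \<partial>lborel) \<partial>count_space UNIV)
       = I (\<lambda>s t. \<integral>\<^sup>+y. (ennreal (heat s (x - y)) * indicator (- {0}) (x - y)) * ennreal (heat t y) \<partial>count_space UNIV)"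
      unfolding I_def by (rule mom_convolution_integrand) auto
    also have "\<dots> = I (B x)" by (rule Icong) (rule conv_inner)
    finally show ?thesis .
  qed
  define C where "C = Beta \<alpha> (1 - \<sigma>) / \<sigma> * (\<alpha> - \<sigma>)"
  interpret P0: decreasing_profile "\<lambda>t. ?h t" "\<lambda>t. heat' t (0 :: int ^ 'd)" by (rule profile_0)
  interpret Px: decreasing_profile "\<lambda>t. ?h t + heat t x" "\<lambda>t. heat' t (0 :: int ^ 'd) + heat' t x" by (rule profile_sum)
  have D0: "I (\<lambda>s t. ennreal (?h t - ?h (s + t))) = ennreal C * mom (\<alpha> - \<sigma>) (0 :: int ^ 'd)"
    unfolding I_def C_def mom_eq_pw using \<sigma> \<alpha>(1) by (rule P0.nn_integral_increments)
  have Dx: "I (\<lambda>s t. ennreal (?h t + heat t x - (?h (s + t) + heat (s + t) x)))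
     = ennreal C * (mom (\<alpha> - \<sigma>) (0 :: int ^ 'd) + mom (\<alpha> - \<sigma>) x)"
  proof -
    have "I (\<lambda>s t. ennreal (?h t + heat t x - (?h (s + t) + heat (s + t) x)))
      = ennreal C * (\<integral>\<^sup>+t. ennreal (?h t + heat t x) * pw (\<alpha> - \<sigma>) t \<partial>lborel)"
      unfolding I_def C_def using \<sigma> \<alpha>(1) by (rule Px.nn_integral_increments)
    also have "(\<integral>\<^sup>+t. ennreal (?h t + heat t x) * pw (\<alpha> - \<sigma>) t \<partial>lborel)
      = (\<integral>\<^sup>+t. ennreal (?h t) * pw (\<alpha> - \<sigma>) t + ennreal (heat t x) * pw (\<alpha> - \<sigma>) t \<partial>lborel)"
    proof (rule nn_integral_cong)
      fix t :: real
      show "ennreal (?h t + heat t x) * pw (\<alpha> - \<sigma>) t = ennreal (?h t) * pw (\<alpha> - \<sigma>) t + ennreal (heat t x) * pw (\<alpha> - \<sigma>) t"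
        by (cases "0 < t") (simp_all add: pw_eq_0 heat_nonneg distrib_right)
    qed
    also have "\<dots> = mom (\<alpha> - \<sigma>) (0 :: int ^ 'd) + mom (\<alpha> - \<sigma>) x"
      unfolding mom_eq_pw by (rule nn_integral_add) simp_all
    finally show ?thesis .
  qed
  have e0: "I (A 0) = I (B 0) + ennreal C * mom (\<alpha> - \<sigma>) (0 :: int ^ 'd)"
  proof -
    have "I (A 0) = I (\<lambda>s t. B 0 s t + ennreal (?h t - ?h (s + t)))"
    proof (rule Icong)
      fix s t :: real assume st: "0 < s" "0 < t"
      have "?h (s + t) \<le> ?h t" using P0.P_antimono[of t "s + t"] st by simp
      moreover have "(1 - ?h s) * ?h t = (?h (s + t) - ?h s * ?h t) + (?h t - ?h (s + t))" by (simp add: algebra_simps)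
      ultimately show "A 0 s t = B 0 s t + ennreal (?h t - ?h (s + t))"
        unfolding A_def B_def by (intro ennreal_eq_sum2 B_nonneg st) auto
    qed
    also have "\<dots> = I (B 0) + I (\<lambda>s t. ennreal (?h t - ?h (s + t)))" by (rule Iadd) measurable
    finally show ?thesis unfolding D0 .
  qed
  have ex: "I (A x) + I (A 0) = I (B x) + I (B 0) + ennreal C * (mom (\<alpha> - \<sigma>) (0 :: int ^ 'd) + mom (\<alpha> - \<sigma>) x)"
  proof -
    have "I (A x) + I (A 0) = I (\<lambda>s t. A x s t + A 0 s t)" by (rule Iadd[symmetric]) measurable
    also have "\<dots> = I (\<lambda>s t. (B x s t + B 0 s t) + ennreal (?h t + heat t x - (?h (s + t) + heat (s + t) x)))"
    proof (rule Icong)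
      fix s t :: real assume st: "0 < s" "0 < t"
      have 1: "0 \<le> ?h t + heat t x - (?h (s + t) + heat (s + t) x)" using Px.P_antimono[of t "s + t"] st by simp
      have 2: "0 \<le> (1 - ?h s) * heat t x" "0 \<le> (1 - ?h s) * ?h t"
        using st by (auto intro!: mult_nonneg_nonneg simp: heat_nonneg heat_le_1)
      have "(1 - ?h s) * heat t x + (1 - ?h s) * ?h t = (heat (s + t) x - ?h s * heat t x) + (?h (s + t) - ?h s * ?h t)
         + (?h t + heat t x - (?h (s + t) + heat (s + t) x))" by (simp add: algebra_simps)
      thus "A x s t + A 0 s t = (B x s t + B 0 s t) + ennreal (?h t + heat t x - (?h (s + t) + heat (s + t) x))"
        unfolding A_def B_def by (intro ennreal_sum2_eq_sum3 1 2 B_nonneg st)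
    qed
    also have "\<dots> = I (\<lambda>s t. B x s t + B 0 s t) + I (\<lambda>s t. ennreal (?h t + heat t x - (?h (s + t) + heat (s + t) x)))"
      by (rule Iadd) measurable
    also have "I (\<lambda>s t. B x s t + B 0 s t) = I (B x) + I (B 0)" by (rule Iadd) measurable
    finally show ?thesis unfolding Dx .
  qed
  \<comment> \<open>Finiteness of the moment at the origin is what allows the identity
    \<open>e0\<close> to be cancelled from \<open>ex\<close>.\<close>
  have "I (A 0) < top"
    unfolding IA using J mom_finite[of \<alpha> "0 :: int ^ 'd"] \<sigma> \<alpha> by (simp add: ennreal_mult_less_top)
  hence "I (A 0) \<noteq> top" by simp
  moreover have "I (A 0) + I (A x) = I (A 0) + (I (B x) + ennreal C * mom (\<alpha> - \<sigma>) x)"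
    using ex unfolding e0 by (simp add: distrib_left add_ac)
  ultimately have main: "I (A x) = I (B x) + ennreal C * mom (\<alpha> - \<sigma>) x"
    by (simp only: ennreal_add_left_cancel infinity_ennreal_def simp_thms)
  \<comment> \<open>The normalising factor \<open>Gamma (1 - \<sigma>)\<close> of the kernel cancels
    against the Beta function, leaving the quotient of Gamma values that later appears in the
    weight.\<close>
  have cC: "c * C = Gamma \<alpha> / Gamma (\<alpha> - \<sigma>)"
  proof -
    have "Gamma (\<alpha> - \<sigma> + 1) = (\<alpha> - \<sigma>) * Gamma (\<alpha> - \<sigma>)"
      using \<alpha> by (intro Gamma_plus1) (auto elim!: nonpos_Ints_cases)
    moreover have "\<alpha> + (1 - \<sigma>) = \<alpha> - \<sigma> + 1" by simp
    ultimately have B: "Beta \<alpha> (1 - \<sigma>) = Gamma \<alpha> * Gamma (1 - \<sigma>) / ((\<alpha> - \<sigma>) * Gamma (\<alpha> - \<sigma>))"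
      unfolding Beta_def by (simp only:)
    have e: "s / g * (A * g / (b * B) / s * b) = A / B" if "s \<noteq> 0" "g \<noteq> 0" "b \<noteq> 0" for s g A B b :: real
      using that by simp
    show ?thesis unfolding c_def C_def B by (rule e) (use \<alpha>(1) \<sigma>(1) less_imp_neq[OF G1] in auto)
  qed
  have C0: "0 \<le> C"
  proof -
    have "Gamma \<alpha> > 0" "Gamma (\<alpha> - \<sigma>) > 0" using \<alpha> \<sigma> by (auto intro!: Gamma_real_pos)
    hence "0 \<le> c * C" unfolding cC by simp
    thus ?thesis using c by (simp add: zero_le_mult_iff)
  qed
  have "ennreal c * J * mom \<alpha> x = ennreal c * I (A x)" unfolding IA by (simp only: mult.assoc)
  also have "\<dots> = ennreal c * I (B x) + ennreal (c * C) * mom (\<alpha> - \<sigma>) x"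
    unfolding main using c C0 by (simp add: distrib_left ennreal_mult mult.assoc)
  finally show "(\<integral>\<^sup>+z. ennreal (kappa \<sigma> z) \<partial>count_space (UNIV :: (int ^ 'd) set)) * mom \<alpha> x
     = (\<integral>\<^sup>+y. ennreal (kappa \<sigma> (x - y)) * mom \<alpha> y \<partial>count_space UNIV)
       + ennreal (Gamma \<alpha> / Gamma (\<alpha> - \<sigma>)) * mom (\<alpha> - \<sigma>) x"
    unfolding sumk IB cC .
qed

lemma finite_nbrs: "finite (nbrs (x :: int ^ 'd::finite))"
proof -
  have "nbrs x \<subseteq> (\<lambda>z. z + x) ` {z. lnorm z \<le> 1}"
    unfolding nbrs_def by (auto intro!: image_eqI[of _ _ "_ - x"])
  thus ?thesis using finite_lnorm_le[of 1] by (auto intro: finite_subset)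
qed

lemma nn_integral_kappa_1:
  "(\<integral>\<^sup>+y. ennreal (kappa 1 (x - y)) * f y \<partial>count_space UNIV) = (\<Sum>y\<in>nbrs (x :: int ^ 'd::finite). f y)"
proof -
  have "lnorm (x - y) = 1 \<longleftrightarrow> y \<in> nbrs x" for y
    using lnorm_uminus[of "y - x"] by (simp add: nbrs_def)
  hence "(\<integral>\<^sup>+y. ennreal (kappa 1 (x - y)) * f y \<partial>count_space UNIV)
    = (\<integral>\<^sup>+y. f y * indicator (nbrs x) y \<partial>count_space UNIV)"
    by (intro nn_integral_cong) (auto simp: kappa_1 indicator_def)
  also have "\<dots> = (\<integral>\<^sup>+y. f y \<partial>count_space (nbrs x))"
    by (subst nn_integral_count_space_indicator) auto
  also have "\<dots> = (\<Sum>y\<in>nbrs x. f y)" by (rule nn_integral_count_space_finite[OF finite_nbrs])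
  finally show ?thesis .
qed

lemma card_nbrs: "card (nbrs (x :: int ^ 'd::finite)) = 2 * CARD('d)"
proof -
  have "real (card (nbrs x)) = real (2 * CARD('d))"
    using sum_nbrs[of "\<lambda>_. 1" x] by (simp add: adj_def)
  thus ?thesis by (simp only: of_nat_eq_iff)
qed

lemma nn_integral_kappa_1_total:
  "(\<integral>\<^sup>+z. ennreal (kappa 1 z) \<partial>count_space (UNIV :: (int ^ 'd::finite) set)) = ennreal (2 * real CARD('d))"
proof -
  have "(\<integral>\<^sup>+z. ennreal (kappa 1 z) \<partial>count_space (UNIV :: (int ^ 'd) set))
     = (\<integral>\<^sup>+y. ennreal (kappa 1 (0 - y)) * 1 \<partial>count_space (UNIV :: (int ^ 'd) set))"
    by (simp add: kappa_even)
  also have "\<dots> = ennreal (2 * real CARD('d))"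
    unfolding nn_integral_kappa_1 by (simp add: card_nbrs ennreal_of_nat_eq_real_of_nat)
  finally show ?thesis .
qed

text \<open>The local counterpart of \<open>kappa_equation_frac\<close>: \<open>heat'\<close>
  replaces the increments and \<open>nn_integral_R\<close> replaces
  \<open>nn_integral_increments\<close>. The value at the origin is added and cancelled for the same
  reason.\<close>

lemma kappa_equation_1:
  fixes x :: "int ^ 'd::finite"
  assumes \<alpha>: "1 < \<alpha>" "\<alpha> < real CARD('d) / 2"
  shows "(\<integral>\<^sup>+z. ennreal (kappa 1 z) \<partial>count_space (UNIV :: (int ^ 'd) set)) * mom \<alpha> x
     = (\<integral>\<^sup>+y. ennreal (kappa 1 (x - y)) * mom \<alpha> y \<partial>count_space UNIV)
       + ennreal (Gamma \<alpha> / Gamma (\<alpha> - 1)) * mom (\<alpha> - 1) x"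
proof -
  let ?h = "\<lambda>s. heat s (0 :: int ^ 'd)"
  interpret P0: decreasing_profile "\<lambda>t. ?h t" "\<lambda>t. heat' t (0 :: int ^ 'd)" by (rule profile_0)
  interpret Px: decreasing_profile "\<lambda>t. ?h t + heat t x" "\<lambda>t. heat' t (0 :: int ^ 'd) + heat' t x" by (rule profile_sum)
  define S where "S x = (\<Sum>y\<in>nbrs x. mom \<alpha> y)" for x :: "int ^ 'd"
  let ?c = "2 * real CARD('d)"
  have S: "S x = (\<integral>\<^sup>+t. ennreal (\<Sum>y\<in>nbrs x. heat t y) * pw \<alpha> t \<partial>lborel)" for x
  proof -
    have "S x = (\<integral>\<^sup>+t. (\<Sum>y\<in>nbrs x. ennreal (heat t y) * pw \<alpha> t) \<partial>lborel)"
      unfolding S_def mom_eq_pw by (rule nn_integral_sum[symmetric]) simp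
    also have "\<dots> = (\<integral>\<^sup>+t. ennreal (\<Sum>y\<in>nbrs x. heat t y) * pw \<alpha> t \<partial>lborel)"
    proof (rule nn_integral_cong)
      fix t :: real
      show "(\<Sum>y\<in>nbrs x. ennreal (heat t y) * pw \<alpha> t) = ennreal (\<Sum>y\<in>nbrs x. heat t y) * pw \<alpha> t"
        by (cases "0 < t") (simp_all add: pw_eq_0 heat_nonneg sum_ennreal flip: sum_distrib_right)
    qed
    finally show ?thesis .
  qed
  have M: "ennreal ?c * mom \<alpha> x = (\<integral>\<^sup>+t. ennreal (?c * heat t x) * pw \<alpha> t \<partial>lborel)" for x :: "int ^ 'd"
    unfolding mom_eq_pw by (subst nn_integral_cmult[symmetric]) (simp_all add: ennreal_mult' mult.assoc)
  have lap: "?c * heat t x = (\<Sum>y\<in>nbrs x. heat t y) + heat' t x" for t and x :: "int ^ 'd"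
    unfolding heat'_def lapl_eq sum_nbrs by simp
  have R0: "(\<integral>\<^sup>+t. ennreal (heat' t (0 :: int ^ 'd)) * pw \<alpha> t \<partial>lborel) = ennreal (\<alpha> - 1) * mom (\<alpha> - 1) (0 :: int ^ 'd)"
    using P0.nn_integral_R[of "\<alpha> - 1"] \<alpha> by (simp add: mom_eq_pw)
  have Rx: "(\<integral>\<^sup>+t. ennreal (heat' t (0 :: int ^ 'd) + heat' t x) * pw \<alpha> t \<partial>lborel)
    = ennreal (\<alpha> - 1) * (mom (\<alpha> - 1) (0 :: int ^ 'd) + mom (\<alpha> - 1) x)"
  proof -
    have "(\<integral>\<^sup>+t. ennreal (heat' t (0 :: int ^ 'd) + heat' t x) * pw \<alpha> t \<partial>lborel)
      = ennreal (\<alpha> - 1) * (\<integral>\<^sup>+t. ennreal (?h t + heat t x) * pw (\<alpha> - 1) t \<partial>lborel)"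
      using Px.nn_integral_R[of "\<alpha> - 1"] \<alpha> by simp
    also have "(\<integral>\<^sup>+t. ennreal (?h t + heat t x) * pw (\<alpha> - 1) t \<partial>lborel)
      = (\<integral>\<^sup>+t. ennreal (?h t) * pw (\<alpha> - 1) t + ennreal (heat t x) * pw (\<alpha> - 1) t \<partial>lborel)"
    proof (rule nn_integral_cong)
      fix t :: real
      show "ennreal (?h t + heat t x) * pw (\<alpha> - 1) t = ennreal (?h t) * pw (\<alpha> - 1) t + ennreal (heat t x) * pw (\<alpha> - 1) t"
        by (cases "0 < t") (simp_all add: pw_eq_0 heat_nonneg distrib_right)
    qed
    also have "\<dots> = mom (\<alpha> - 1) (0 :: int ^ 'd) + mom (\<alpha> - 1) x"
      unfolding mom_eq_pw by (rule nn_integral_add) simp_all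
    finally show ?thesis .
  qed
  have e0: "ennreal ?c * mom \<alpha> (0 :: int ^ 'd) = S 0 + ennreal (\<alpha> - 1) * mom (\<alpha> - 1) (0 :: int ^ 'd)"
  proof -
    have "ennreal ?c * mom \<alpha> (0 :: int ^ 'd)
       = (\<integral>\<^sup>+t. ennreal (\<Sum>y\<in>nbrs (0 :: int ^ 'd). heat t y) * pw \<alpha> t + ennreal (heat' t (0 :: int ^ 'd)) * pw \<alpha> t \<partial>lborel)"
      unfolding M lap
    proof (rule nn_integral_cong)
      fix t :: real
      show "ennreal ((\<Sum>y\<in>nbrs (0 :: int ^ 'd). heat t y) + heat' t (0 :: int ^ 'd)) * pw \<alpha> t
        = ennreal (\<Sum>y\<in>nbrs (0 :: int ^ 'd). heat t y) * pw \<alpha> t + ennreal (heat' t (0 :: int ^ 'd)) * pw \<alpha> t"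
        by (cases "0 < t") (simp_all add: pw_eq_0 heat_nonneg heat'_0_nonneg distrib_right sum_nonneg)
    qed
    also have "\<dots> = S 0 + (\<integral>\<^sup>+t. ennreal (heat' t (0 :: int ^ 'd)) * pw \<alpha> t \<partial>lborel)"
      unfolding S by (rule nn_integral_add) simp_all
    finally show ?thesis unfolding R0 .
  qed
  have ex: "ennreal ?c * mom \<alpha> x + ennreal ?c * mom \<alpha> (0 :: int ^ 'd)
     = S x + S 0 + ennreal (\<alpha> - 1) * (mom (\<alpha> - 1) (0 :: int ^ 'd) + mom (\<alpha> - 1) x)"
  proof -
    let ?f = "\<lambda>x t. \<Sum>y\<in>nbrs (x :: int ^ 'd). heat t y"
    have "ennreal ?c * mom \<alpha> x + ennreal ?c * mom \<alpha> (0 :: int ^ 'd)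
      = (\<integral>\<^sup>+t. ennreal (?c * heat t x) * pw \<alpha> t + ennreal (?c * ?h t) * pw \<alpha> t \<partial>lborel)"
      unfolding M by (rule nn_integral_add[symmetric]) simp_all
    also have "\<dots> = (\<integral>\<^sup>+t. (ennreal (?f x t) * pw \<alpha> t + ennreal (?f 0 t) * pw \<alpha> t)
        + ennreal (heat' t (0 :: int ^ 'd) + heat' t x) * pw \<alpha> t \<partial>lborel)"
    proof (rule nn_integral_cong)
      fix t :: real
      show "ennreal (?c * heat t x) * pw \<alpha> t + ennreal (?c * ?h t) * pw \<alpha> t
        = (ennreal (?f x t) * pw \<alpha> t + ennreal (?f 0 t) * pw \<alpha> t) + ennreal (heat' t (0 :: int ^ 'd) + heat' t x) * pw \<alpha> t"
      proof (cases "0 < t")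
        case True
        have "?c * heat t x + ?c * ?h t = (?f x t + ?f 0 t) + (heat' t (0 :: int ^ 'd) + heat' t x)"
          unfolding lap by simp
        moreover have "0 \<le> ?c * heat t x" "0 \<le> ?c * ?h t" "0 \<le> ?f x t" "0 \<le> ?f 0 t"
          using True by (auto intro!: mult_nonneg_nonneg sum_nonneg heat_nonneg)
        ultimately have "ennreal (?c * heat t x) + ennreal (?c * ?h t)
           = (ennreal (?f x t) + ennreal (?f 0 t)) + ennreal (heat' t (0 :: int ^ 'd) + heat' t x)"
          using Px.R_nonneg[of t] by (intro ennreal_sum2_eq_sum3)
        thus ?thesis by (simp only: distrib_right[symmetric])
      qed (simp add: pw_eq_0)
    qed
    also have "\<dots> = (\<integral>\<^sup>+t. ennreal (?f x t) * pw \<alpha> t + ennreal (?f 0 t) * pw \<alpha> t \<partial>lborel)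
        + (\<integral>\<^sup>+t. ennreal (heat' t (0 :: int ^ 'd) + heat' t x) * pw \<alpha> t \<partial>lborel)"
      by (rule nn_integral_add) simp_all
    also have "(\<integral>\<^sup>+t. ennreal (?f x t) * pw \<alpha> t + ennreal (?f 0 t) * pw \<alpha> t \<partial>lborel) = S x + S 0"
      unfolding S by (rule nn_integral_add) simp_all
    finally show ?thesis unfolding Rx .
  qed
  have "ennreal ?c * mom \<alpha> (0 :: int ^ 'd) < top"
    using mom_finite[of \<alpha> "0 :: int ^ 'd"] \<alpha> by (simp add: ennreal_mult_less_top)
  hence "ennreal ?c * mom \<alpha> (0 :: int ^ 'd) \<noteq> top" by simp
  moreover have "ennreal ?c * mom \<alpha> (0 :: int ^ 'd) + ennreal ?c * mom \<alpha> x
    = ennreal ?c * mom \<alpha> (0 :: int ^ 'd) + (S x + ennreal (\<alpha> - 1) * mom (\<alpha> - 1) x)"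
    using ex unfolding e0 by (simp only: distrib_left add_ac)
  ultimately have main: "ennreal ?c * mom \<alpha> x = S x + ennreal (\<alpha> - 1) * mom (\<alpha> - 1) x"
    by (simp only: ennreal_add_left_cancel infinity_ennreal_def simp_thms)
  have "Gamma (\<alpha> - 1 + 1) = (\<alpha> - 1) * Gamma (\<alpha> - 1)"
    using \<alpha> by (intro Gamma_plus1) (auto elim!: nonpos_Ints_cases)
  moreover have "Gamma (\<alpha> - 1) > 0" using \<alpha> by (intro Gamma_real_pos) simp
  ultimately have g: "Gamma \<alpha> / Gamma (\<alpha> - 1) = \<alpha> - 1" by simp
  show ?thesis
    unfolding nn_integral_kappa_1_total nn_integral_kappa_1 g using main unfolding S_def .
qed

text \<open>The total jump rate, which is the diagonal coefficient of the operator. It depends on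
  the dimension, whence the type argument.\<close>

definition ktot :: "real \<Rightarrow> 'd::finite itself \<Rightarrow> ennreal" where
  "ktot \<sigma> (_ :: 'd itself) = (\<integral>\<^sup>+z. ennreal (kappa \<sigma> z) \<partial>count_space (UNIV :: (int ^ 'd) set))"

lemma ktot_finite:
  assumes \<sigma>: "0 < \<sigma>" "\<sigma> \<le> 1" and \<alpha>: "\<sigma> < \<alpha>" "\<alpha> < real CARD('d) / 2"
  shows "ktot \<sigma> TYPE('d::finite) < \<infinity>"
  using kappa_equation_frac(1)[of \<sigma> \<alpha>, where 'd = 'd] assms
  by (cases "\<sigma> = 1") (auto simp: ktot_def nn_integral_kappa_1_total)

section \<open>Quadratic forms and supersolutions\<close>

text \<open>Induction along nearest-neighbour steps, by the sum of the moduli of the coordinates; it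
  expresses that the lattice graph is connected.\<close>

lemma lattice_induct:
  fixes x :: "int ^ 'd::finite"
  assumes "P 0" and step: "\<And>x i. P x \<Longrightarrow> P (x + axis i 1) \<and> P (x - axis i 1)"
  shows "P x"
proof (induction "nat (\<Sum>i\<in>UNIV. \<bar>x $ i\<bar>)" arbitrary: x rule: less_induct)
  case less
  show ?case
  proof (cases "x = 0")
    case False
    then obtain i where i: "x $ i \<noteq> 0" by (auto simp: vec_eq_iff)
    define y where "y = x - axis i (sgn (x $ i))"
    have yi: "\<bar>y $ i\<bar> = \<bar>x $ i\<bar> - 1" using i by (auto simp: y_def axis_def sgn_if)
    have yj: "y $ j = x $ j" if "j \<noteq> i" for j using that by (simp add: y_def axis_def)
    have "(\<Sum>j\<in>UNIV. \<bar>y $ j\<bar>) = \<bar>y $ i\<bar> + (\<Sum>j\<in>UNIV - {i}. \<bar>y $ j\<bar>)" by (rule sum.remove) auto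
    also have "(\<Sum>j\<in>UNIV - {i}. \<bar>y $ j\<bar>) = (\<Sum>j\<in>UNIV - {i}. \<bar>x $ j\<bar>)"
      by (rule sum.cong) (auto simp: yj)
    finally have ys: "(\<Sum>j\<in>UNIV. \<bar>y $ j\<bar>) = \<bar>x $ i\<bar> - 1 + (\<Sum>j\<in>UNIV - {i}. \<bar>x $ j\<bar>)" unfolding yi .
    have xs: "(\<Sum>j\<in>UNIV. \<bar>x $ j\<bar>) = \<bar>x $ i\<bar> + (\<Sum>j\<in>UNIV - {i}. \<bar>x $ j\<bar>)" by (rule sum.remove) auto
    have "0 \<le> (\<Sum>j\<in>UNIV. \<bar>y $ j\<bar>)" by (rule sum_nonneg) auto
    hence "nat (\<Sum>j\<in>UNIV. \<bar>y $ j\<bar>) < nat (\<Sum>j\<in>UNIV. \<bar>x $ j\<bar>)" using xs ys by linarith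
    hence Py: "P y" by (rule less)
    show ?thesis
    proof (cases "x $ i > 0")
      case True
      hence "x = y + axis i 1" by (simp add: y_def)
      thus ?thesis using step[OF Py] by simp
    next
      case False
      hence "x = y - axis i 1" using i by (simp add: y_def vec_eq_iff axis_def)
      thus ?thesis using step[OF Py] by simp
    qed
  qed (use assms(1) in simp)
qed

lemma wsum_nn: "wsum w f = (\<integral>\<^sup>+x. ennreal (w x * (f x)\<^sup>2) \<partial>count_space UNIV)"
  unfolding wsum_def by (rule infsum_ennreal_eq_nn_integral)

lemma Qform_nn:
  "Qform \<sigma> f = (\<integral>\<^sup>+p. ennreal (1/2 * kappa \<sigma> (fst p - snd p) * (f (fst p) - f (snd p))\<^sup>2) \<partial>count_space UNIV)"
  unfolding Qform_def by (rule infsum_ennreal_eq_nn_integral)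

lemma nn_integral_fin_supp:
  assumes "finite {x. f x \<noteq> (0 :: real)}"
  shows "(\<integral>\<^sup>+x. ennreal (f x) \<partial>count_space UNIV) < top"
proof -
  have "(\<integral>\<^sup>+x. ennreal (f x) \<partial>count_space UNIV) = (\<integral>\<^sup>+x. ennreal (f x) * indicator {x. f x \<noteq> 0} x \<partial>count_space UNIV)"
    by (intro nn_integral_cong) (auto simp: indicator_def)
  also have "\<dots> = (\<integral>\<^sup>+x. ennreal (f x) \<partial>count_space {x. f x \<noteq> 0})"
    by (subst nn_integral_count_space_indicator) auto
  also have "\<dots> = (\<Sum>x\<in>{x. f x \<noteq> 0}. ennreal (f x))" using assms by (rule nn_integral_count_space_finite)
  also have "\<dots> < top" by (simp add: assms)
  finally show ?thesis .
qed

locale jump_kernel =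
  fixes \<sigma> :: real and dimension :: "'d::finite itself"
  assumes \<sigma>_pos: "0 < \<sigma>" and \<sigma>_le_1: "\<sigma> \<le> 1" and ktot_less_top: "ktot \<sigma> TYPE('d) < top"
begin

abbreviation k :: "int ^ 'd \<Rightarrow> real" where "k \<equiv> kappa \<sigma>"

text \<open>The off-diagonal part of the operator. The equation with right-hand side
  \<open>h\<close> reads \<open>ktot * s = conv s + h\<close>, and a supersolution has
  \<open>\<ge>\<close> in place of equality; neither involves a difference.\<close>

definition conv :: "(int ^ 'd \<Rightarrow> real) \<Rightarrow> int ^ 'd \<Rightarrow> ennreal" where
  "conv s x = (\<integral>\<^sup>+y. ennreal (k (x - y)) * ennreal (s y) \<partial>count_space UNIV)"

lemma k_nonneg: "0 \<le> k z" by (rule kappa_nonneg[OF \<sigma>_pos \<sigma>_le_1])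

lemma k_even: "k (- z) = k z" by (rule kappa_even[OF \<sigma>_pos \<sigma>_le_1])

lemma k_minus: "k (x - y) = k (y - x)"
  using k_even[of "x - y"] by simp

lemma Qform_double:
  "Qform \<sigma> f = (\<integral>\<^sup>+x. \<integral>\<^sup>+y. ennreal (1/2 * k (x - y) * (f x - f y)\<^sup>2) \<partial>count_space UNIV \<partial>count_space UNIV)"
  unfolding Qform_nn by (rule nn_integral_count_space_pair)

lemma k_sum: "(\<integral>\<^sup>+y. ennreal (k (x - y)) \<partial>count_space UNIV) = ktot \<sigma> TYPE('d)"
  unfolding ktot_def by (rule nn_integral_count_space_shift(3))

lemma symmetric_sum:
  "(\<integral>\<^sup>+x. \<integral>\<^sup>+y. ennreal (1/2 * k (x - y)) * (G x y + G y x) \<partial>count_space UNIV \<partial>count_space UNIV)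
    = (\<integral>\<^sup>+x. \<integral>\<^sup>+y. ennreal (k (x - y)) * G x y \<partial>count_space UNIV \<partial>count_space UNIV)"
    (is "?L = ?R")
proof -
  have h: "ennreal (1/2 * k z) = ennreal (1/2) * ennreal (k z)" for z
    using k_nonneg by (intro ennreal_mult) auto
  have "?L = ennreal (1/2) * ?R
     + ennreal (1/2) * (\<integral>\<^sup>+x. \<integral>\<^sup>+y. ennreal (k (x - y)) * G y x \<partial>count_space UNIV \<partial>count_space UNIV)"
    unfolding h by (simp add: distrib_left nn_integral_add nn_integral_cmult mult.assoc)
  also have "(\<integral>\<^sup>+x. \<integral>\<^sup>+y. ennreal (k (x - y)) * G y x \<partial>count_space UNIV \<partial>count_space UNIV)
     = (\<integral>\<^sup>+y. \<integral>\<^sup>+x. ennreal (k (x - y)) * G y x \<partial>count_space UNIV \<partial>count_space UNIV)"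
    by (rule nn_integral_count_space_swap)
  also have "\<dots> = ?R"
    by (intro nn_integral_cong) (simp only: k_minus)
  also have "ennreal (1/2) * ?R + ennreal (1/2) * ?R = (ennreal (1/2) + ennreal (1/2)) * ?R"
    by (rule distrib_right[symmetric])
  also have "ennreal (1/2) + ennreal (1/2) = ennreal (1/2 + 1/2)" by (rule ennreal_plus[symmetric]) auto
  finally show ?thesis by simp
qed

lemma symmetric_sum_diag:
  "(\<integral>\<^sup>+x. \<integral>\<^sup>+y. ennreal (1/2 * k (x - y)) * (F x + F y) \<partial>count_space UNIV \<partial>count_space UNIV)
    = ktot \<sigma> TYPE('d) * (\<integral>\<^sup>+x. F x \<partial>count_space UNIV)"
proof -
  have "(\<integral>\<^sup>+x. \<integral>\<^sup>+y. ennreal (1/2 * k (x - y)) * (F x + F y) \<partial>count_space UNIV \<partial>count_space UNIV)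
    = (\<integral>\<^sup>+x. \<integral>\<^sup>+y. ennreal (k (x - y)) * F x \<partial>count_space UNIV \<partial>count_space UNIV)"
    by (rule symmetric_sum)
  thus ?thesis by (simp add: nn_integral_multc k_sum nn_integral_cmult)
qed

lemma Qform_le_l2:
  fixes f :: "int ^ 'd \<Rightarrow> real"
  shows "Qform \<sigma> f \<le> ktot \<sigma> TYPE('d) * (\<integral>\<^sup>+x. ennreal (2 * (f x)\<^sup>2) \<partial>count_space UNIV)"
  unfolding Qform_double symmetric_sum_diag[of "\<lambda>x. ennreal (2 * (f x)\<^sup>2)", symmetric]
proof (intro nn_integral_mono)
  fix x y
  have "0 \<le> (f x + f y)\<^sup>2" by simp
  hence "(f x - f y)\<^sup>2 \<le> 2 * (f x)\<^sup>2 + 2 * (f y)\<^sup>2" by (simp add: power2_eq_square algebra_simps)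
  hence "1/2 * k (x - y) * (f x - f y)\<^sup>2 \<le> 1/2 * k (x - y) * (2 * (f x)\<^sup>2 + 2 * (f y)\<^sup>2)"
    using k_nonneg by (intro mult_left_mono) auto
  hence "ennreal (1/2 * k (x - y) * (f x - f y)\<^sup>2) \<le> ennreal (1/2 * k (x - y) * (2 * (f x)\<^sup>2 + 2 * (f y)\<^sup>2))"
    by (rule ennreal_leI)
  also have "\<dots> = ennreal (1/2 * k (x - y)) * ennreal (2 * (f x)\<^sup>2 + 2 * (f y)\<^sup>2)"
    using k_nonneg by (intro ennreal_mult) auto
  finally show "ennreal (1/2 * k (x - y) * (f x - f y)\<^sup>2)
    \<le> ennreal (1/2 * k (x - y)) * (ennreal (2 * (f x)\<^sup>2) + ennreal (2 * (f y)\<^sup>2))" by simp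
qed

lemma Qform_fin_supp: "fin_supp (\<phi> :: int ^ 'd \<Rightarrow> real) \<Longrightarrow> Qform \<sigma> \<phi> < top"
proof -
  assume "fin_supp \<phi>"
  hence "finite {x. 2 * (\<phi> x)\<^sup>2 \<noteq> 0}" by (simp add: fin_supp_def)
  from nn_integral_fin_supp[OF this] show ?thesis
    by (intro le_less_trans[OF Qform_le_l2]) (simp add: ennreal_mult_less_top ktot_less_top)
qed

text \<open>A substitute for the triangle inequality with no square roots. A small
  \<open>\<eta>\<close> compares the energies of nearby functions up to a factor close to 1;
  \<open>\<eta> = 1\<close> gives finiteness.\<close>

lemma Qform_add_le:
  fixes f g :: "int ^ 'd \<Rightarrow> real"
  assumes "0 < \<eta>"
  shows "Qform \<sigma> (\<lambda>x. f x + g x) \<le> ennreal (1 + \<eta>) * Qform \<sigma> f + ennreal (1 + 1 / \<eta>) * Qform \<sigma> g"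
proof -
  have "Qform \<sigma> (\<lambda>x. f x + g x)
    \<le> (\<integral>\<^sup>+p. ennreal (1 + \<eta>) * ennreal (1/2 * k (fst p - snd p) * (f (fst p) - f (snd p))\<^sup>2)
        + ennreal (1 + 1 / \<eta>) * ennreal (1/2 * k (fst p - snd p) * (g (fst p) - g (snd p))\<^sup>2) \<partial>count_space UNIV)"
    unfolding Qform_nn
  proof (rule nn_integral_mono)
    fix p :: "(int ^ 'd) \<times> (int ^ 'd)"
    define a where "a = f (fst p) - f (snd p)"
    define b where "b = g (fst p) - g (snd p)"
    define c where "c = 1/2 * k (fst p - snd p)"
    have c: "0 \<le> c" using k_nonneg by (simp add: c_def)
    have "(a + b)\<^sup>2 \<le> (1 + \<eta>) * a\<^sup>2 + (1 + 1 / \<eta>) * b\<^sup>2"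
    proof -
      have "0 \<le> (\<eta> * a - b)\<^sup>2 / \<eta>" using assms by simp
      also have "(\<eta> * a - b)\<^sup>2 / \<eta> = \<eta> * a\<^sup>2 - 2 * a * b + b\<^sup>2 / \<eta>"
        using assms by (simp add: power2_eq_square field_simps)
      finally show ?thesis by (simp add: power2_eq_square algebra_simps)
    qed
    hence "c * (a + b)\<^sup>2 \<le> c * ((1 + \<eta>) * a\<^sup>2 + (1 + 1 / \<eta>) * b\<^sup>2)" using c by (rule mult_left_mono)
    also have "\<dots> = (1 + \<eta>) * (c * a\<^sup>2) + (1 + 1 / \<eta>) * (c * b\<^sup>2)" by (simp only: distrib_left mult_ac)
    finally have "ennreal (c * (a + b)\<^sup>2) \<le> ennreal ((1 + \<eta>) * (c * a\<^sup>2) + (1 + 1 / \<eta>) * (c * b\<^sup>2))"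
      by (rule ennreal_leI)
    also have "\<dots> = ennreal ((1 + \<eta>) * (c * a\<^sup>2)) + ennreal ((1 + 1 / \<eta>) * (c * b\<^sup>2))"
      using assms c by (intro ennreal_plus) auto
    also have "\<dots> = ennreal (1 + \<eta>) * ennreal (c * a\<^sup>2) + ennreal (1 + 1 / \<eta>) * ennreal (c * b\<^sup>2)"
      using assms c by (intro arg_cong2[of _ _ _ _ "(+)"] ennreal_mult) auto
    finally show "ennreal (1/2 * k (fst p - snd p) * (f (fst p) + g (fst p) - (f (snd p) + g (snd p)))\<^sup>2)
      \<le> ennreal (1 + \<eta>) * ennreal (1/2 * k (fst p - snd p) * (f (fst p) - f (snd p))\<^sup>2)
        + ennreal (1 + 1 / \<eta>) * ennreal (1/2 * k (fst p - snd p) * (g (fst p) - g (snd p))\<^sup>2)"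
      unfolding a_def b_def c_def by (simp only: add_diff_add)
  qed
  also have "\<dots> = ennreal (1 + \<eta>) * Qform \<sigma> f + ennreal (1 + 1 / \<eta>) * Qform \<sigma> g"
    unfolding Qform_nn by (subst nn_integral_add, simp, simp) (simp only: nn_integral_cmult borel_measurable_count_space)
  finally show ?thesis .
qed

lemma Qform_edge: "ennreal (1/2 * k (x - y) * (f x - f y)\<^sup>2) \<le> Qform \<sigma> f"
  unfolding Qform_nn
  using nn_integral_ge_point[of "(x, y)" UNIV "\<lambda>p. ennreal (1/2 * k (fst p - snd p) * (f (fst p) - f (snd p))\<^sup>2)"]
  by simp

text \<open>The ground state representation, with the energy of the quotient kept for the single pair \<open>(x0, y0)\<close>.\<close>

lemma hardy_supersolution:
  assumes s: "\<And>x. 0 < s x" and w: "\<And>x. 0 \<le> w x"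
    and super: "\<And>x. conv s x + ennreal (w x * s x) \<le> ktot \<sigma> TYPE('d) * ennreal (s x)"
    and \<phi>: "fin_supp \<phi>"
  shows "wsum w \<phi> + ennreal (1/2 * k (x0 - y0) * (s x0 * s y0 * (\<phi> x0 / s x0 - \<phi> y0 / s y0)\<^sup>2)) \<le> Qform \<sigma> \<phi>"
proof -
  let ?K = "ktot \<sigma> TYPE('d)"
  define G where "G x y = ennreal ((\<phi> x)\<^sup>2 / s x * s y)" for x y
  define E where "E x y = ennreal (1/2 * k (x - y) * (s x * s y * (\<phi> x / s x - \<phi> y / s y)\<^sup>2))" for x y
  define X where "X = (\<integral>\<^sup>+x. ennreal ((\<phi> x)\<^sup>2 / s x) * conv s x \<partial>count_space UNIV)"
  have pair: "ennreal (1/2 * k (x - y) * (\<phi> x - \<phi> y)\<^sup>2) + ennreal (1/2 * k (x - y)) * (G x y + G y x)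
     = ennreal (1/2 * k (x - y)) * (ennreal ((\<phi> x)\<^sup>2) + ennreal ((\<phi> y)\<^sup>2)) + E x y" for x y
  proof -
    define c where "c = 1/2 * k (x - y)"
    have c: "0 \<le> c" using k_nonneg by (simp add: c_def)
    have sx: "s x \<noteq> 0" "s y \<noteq> 0" using s[of x] s[of y] by auto
    \<comment> \<open>Picone's identity, with the terms that would be subtracted moved to the
      left.\<close>
    have id: "(\<phi> x - \<phi> y)\<^sup>2 + ((\<phi> x)\<^sup>2 / s x * s y + (\<phi> y)\<^sup>2 / s y * s x)
       = ((\<phi> x)\<^sup>2 + (\<phi> y)\<^sup>2) + s x * s y * (\<phi> x / s x - \<phi> y / s y)\<^sup>2"
      using sx by (simp add: power2_eq_square field_simps)
    have g: "0 \<le> (\<phi> x)\<^sup>2 / s x * s y" "0 \<le> (\<phi> y)\<^sup>2 / s y * s x" "0 \<le> s x * s y * (\<phi> x / s x - \<phi> y / s y)\<^sup>2"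
      using s[of x] s[of y] by (auto intro!: mult_nonneg_nonneg divide_nonneg_pos less_imp_le)
    have "ennreal (c * (\<phi> x - \<phi> y)\<^sup>2) + ennreal c * (G x y + G y x)
      = ennreal c * (ennreal ((\<phi> x - \<phi> y)\<^sup>2) + (G x y + G y x))"
      using c by (simp add: ennreal_mult distrib_left)
    also have "\<dots> = ennreal c * ennreal ((\<phi> x - \<phi> y)\<^sup>2 + ((\<phi> x)\<^sup>2 / s x * s y + (\<phi> y)\<^sup>2 / s y * s x))"
      unfolding G_def using g by simp
    also have "\<dots> = ennreal c * (ennreal ((\<phi> x)\<^sup>2) + ennreal ((\<phi> y)\<^sup>2) + ennreal (s x * s y * (\<phi> x / s x - \<phi> y / s y)\<^sup>2))"
      unfolding id using g by simp
    also have "\<dots> = ennreal c * (ennreal ((\<phi> x)\<^sup>2) + ennreal ((\<phi> y)\<^sup>2)) + E x y"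
      unfolding E_def c_def[symmetric] distrib_left[of "ennreal c" "_ + _" "ennreal (s x * s y * _)"]
      using c g by (simp only: ennreal_mult)
    finally show ?thesis unfolding c_def .
  qed
  have XG: "(\<integral>\<^sup>+x. \<integral>\<^sup>+y. ennreal (1/2 * k (x - y)) * (G x y + G y x) \<partial>count_space UNIV \<partial>count_space UNIV) = X"
  proof -
    have "(\<integral>\<^sup>+y. ennreal (k (x - y)) * G x y \<partial>count_space UNIV) = ennreal ((\<phi> x)\<^sup>2 / s x) * conv s x" for x
    proof -
      have "G x y = ennreal ((\<phi> x)\<^sup>2 / s x) * ennreal (s y)" for y
        unfolding G_def using s[of x] s[of y] by (intro ennreal_mult) (auto intro: divide_nonneg_pos less_imp_le)
      hence "(\<integral>\<^sup>+y. ennreal (k (x - y)) * G x y \<partial>count_space UNIV)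
        = (\<integral>\<^sup>+y. ennreal ((\<phi> x)\<^sup>2 / s x) * (ennreal (k (x - y)) * ennreal (s y)) \<partial>count_space UNIV)"
        by (simp only: mult_ac)
      also have "\<dots> = ennreal ((\<phi> x)\<^sup>2 / s x) * conv s x"
        unfolding conv_def by (rule nn_integral_cmult) simp
      finally show ?thesis .
    qed
    thus ?thesis unfolding symmetric_sum X_def by simp
  qed
  have "Qform \<sigma> \<phi> + X = (\<integral>\<^sup>+x. \<integral>\<^sup>+y. ennreal (1/2 * k (x - y) * (\<phi> x - \<phi> y)\<^sup>2)
      + ennreal (1/2 * k (x - y)) * (G x y + G y x) \<partial>count_space UNIV \<partial>count_space UNIV)"
    unfolding XG[symmetric] Qform_double by (simp add: nn_integral_add)
  also have "\<dots> = ?K * (\<integral>\<^sup>+x. ennreal ((\<phi> x)\<^sup>2) \<partial>count_space UNIV)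
     + (\<integral>\<^sup>+x. \<integral>\<^sup>+y. E x y \<partial>count_space UNIV \<partial>count_space UNIV)"
    unfolding pair symmetric_sum_diag[symmetric] by (simp add: nn_integral_add)
  finally have e1: "Qform \<sigma> \<phi> + X = ?K * (\<integral>\<^sup>+x. ennreal ((\<phi> x)\<^sup>2) \<partial>count_space UNIV)
     + (\<integral>\<^sup>+x. \<integral>\<^sup>+y. E x y \<partial>count_space UNIV \<partial>count_space UNIV)" .
  have e2: "X + wsum w \<phi> \<le> ?K * (\<integral>\<^sup>+x. ennreal ((\<phi> x)\<^sup>2) \<partial>count_space UNIV)"
  proof -
    have "X + wsum w \<phi> = (\<integral>\<^sup>+x. ennreal ((\<phi> x)\<^sup>2 / s x) * conv s x + ennreal (w x * (\<phi> x)\<^sup>2) \<partial>count_space UNIV)"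
      unfolding X_def wsum_nn by (rule nn_integral_add[symmetric]) auto
    also have "\<dots> \<le> (\<integral>\<^sup>+x. ?K * ennreal ((\<phi> x)\<^sup>2) \<partial>count_space UNIV)"
    proof (rule nn_integral_mono)
      fix x
      have p: "0 \<le> (\<phi> x)\<^sup>2 / s x" using s[of x] by (intro divide_nonneg_pos) auto
      have "w x * (\<phi> x)\<^sup>2 = (\<phi> x)\<^sup>2 / s x * (w x * s x)" using s[of x] by simp
      hence "ennreal (w x * (\<phi> x)\<^sup>2) = ennreal ((\<phi> x)\<^sup>2 / s x) * ennreal (w x * s x)"
        using p w[of x] s[of x] by (metis ennreal_mult less_imp_le mult_nonneg_nonneg)
      hence "ennreal ((\<phi> x)\<^sup>2 / s x) * conv s x + ennreal (w x * (\<phi> x)\<^sup>2)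
        = ennreal ((\<phi> x)\<^sup>2 / s x) * (conv s x + ennreal (w x * s x))" by (simp only: distrib_left)
      also have "\<dots> \<le> ennreal ((\<phi> x)\<^sup>2 / s x) * (?K * ennreal (s x))" by (rule mult_left_mono[OF super]) simp
      also have "\<dots> = ?K * (ennreal ((\<phi> x)\<^sup>2 / s x) * ennreal (s x))" by (simp only: mult_ac)
      also have "ennreal ((\<phi> x)\<^sup>2 / s x) * ennreal (s x) = ennreal ((\<phi> x)\<^sup>2)"
        using p s[of x] by (simp flip: ennreal_mult)
      finally show "ennreal ((\<phi> x)\<^sup>2 / s x) * conv s x + ennreal (w x * (\<phi> x)\<^sup>2) \<le> ?K * ennreal ((\<phi> x)\<^sup>2)" .
    qed
    also have "\<dots> = ?K * (\<integral>\<^sup>+x. ennreal ((\<phi> x)\<^sup>2) \<partial>count_space UNIV)" by (rule nn_integral_cmult) simp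
    finally show ?thesis .
  qed
  \<comment> \<open>Finite support of \<open>\<phi>\<close> makes \<open>X\<close> finite, so that
    it can be cancelled in the last step.\<close>
  have "finite {x. (\<phi> x)\<^sup>2 \<noteq> 0}" using \<phi> by (simp add: fin_supp_def)
  hence "?K * (\<integral>\<^sup>+x. ennreal ((\<phi> x)\<^sup>2) \<partial>count_space UNIV) < top"
    by (simp add: ennreal_mult_less_top ktot_less_top nn_integral_fin_supp)
  hence X: "X < top" using e2 by (metis add_increasing2 le_less_trans order_refl zero_le le_iff_add)
  have "E x0 y0 \<le> (\<integral>\<^sup>+y. E x0 y \<partial>count_space UNIV)" by (rule nn_integral_ge_point) simp
  also have "\<dots> \<le> (\<integral>\<^sup>+x. \<integral>\<^sup>+y. E x y \<partial>count_space UNIV \<partial>count_space UNIV)"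
    by (rule nn_integral_ge_point[of x0 UNIV "\<lambda>x. \<integral>\<^sup>+y. E x y \<partial>count_space UNIV"]) simp
  finally have "X + (wsum w \<phi> + E x0 y0) \<le> X + Qform \<sigma> \<phi>"
    using add_mono[OF e2] e1 by (simp only: add.assoc add.commute[of X "Qform \<sigma> \<phi>"])
  moreover have "X \<noteq> top" using X by auto
  ultimately show ?thesis unfolding E_def by (simp add: ennreal_add_left_cancel_le)
qed

lemma hardy_weight_supersolution:
  assumes "\<And>x. 0 < s x" "\<And>x. 0 \<le> w x"
    "\<And>x. conv s x + ennreal (w x * s x) \<le> ktot \<sigma> TYPE('d) * ennreal (s x)"
  shows "hardy_weight \<sigma> w"
  unfolding hardy_weight_def
proof (intro conjI allI impI assms(2))
  fix \<phi> :: "int ^ 'd \<Rightarrow> real" assume "fin_supp \<phi>"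
  from hardy_supersolution[OF assms this, of 0 0] show "wsum w \<phi> \<le> Qform \<sigma> \<phi>" by simp
qed

section \<open>Truncated solutions\<close>

text \<open>Lowering the function and taking the positive part gives finite support when
  \<open>u\<close> tends to 0 at infinity. Increments keep their sign and shrink in modulus, so the
  energy does not increase, which a spatial cutoff does not guarantee.\<close>

definition trunc :: "(int ^ 'd \<Rightarrow> real) \<Rightarrow> nat \<Rightarrow> int ^ 'd \<Rightarrow> real" where
  "trunc u n x = max 0 (u x - inverse (real (Suc n)))"

lemma trunc_nonneg: "0 \<le> trunc u n x"
  by (simp add: trunc_def)

lemma trunc_le: "0 \<le> u x \<Longrightarrow> trunc u n x \<le> u x"
  by (simp add: trunc_def)

lemma trunc_tendsto: "0 \<le> u x \<Longrightarrow> (\<lambda>n. trunc u n x) \<longlonglongrightarrow> u x"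
proof -
  assume u: "0 \<le> u x"
  have "(\<lambda>n. max 0 (u x - inverse (real (Suc n)))) \<longlonglongrightarrow> max 0 (u x - 0)"
    by (intro tendsto_intros LIMSEQ_inverse_real_of_nat)
  thus ?thesis using u by (simp add: trunc_def max_def)
qed

lemma trunc_mono: "m \<le> n \<Longrightarrow> trunc u m x \<le> trunc u n x"
proof -
  assume "m \<le> n"
  hence "inverse (real (Suc n)) \<le> inverse (real (Suc m))" by (intro le_imp_inverse_le) auto
  thus ?thesis unfolding trunc_def by (intro max.mono diff_left_mono order_refl)
qed

text \<open>As \<open>n\<close> grows the increments of the truncation grow in the direction of the
  increment of \<open>u\<close>, so the energy pairing with \<open>u\<close> is monotone in
  \<open>n\<close> and monotone convergence applies even to an infinite limit.\<close>

lemma trunc_diff_mono: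
  assumes "m \<le> n"
  shows "(u x - u y) * (trunc u m x - trunc u m y) \<le> (u x - u y) * (trunc u n x - trunc u n y)"
proof -
  have d: "inverse (real (Suc n)) \<le> inverse (real (Suc m))" using assms by (intro le_imp_inverse_le) auto
  have aux: "max 0 (a - c') - max 0 (b - c') \<le> max 0 (a - c) - max 0 (b - c)" if "b \<le> a" "c \<le> c'" for a b c c' :: real
    using that by (auto simp: max_def)
  show ?thesis
  proof (cases "u y \<le> u x")
    case True
    thus ?thesis unfolding trunc_def using aux[OF True d] by (intro mult_left_mono) auto
  next
    case False
    hence "u x \<le> u y" by simp
    from aux[OF this d] show ?thesis unfolding trunc_def using False by (intro mult_left_mono_neg) auto
  qed
qed

lemma trunc_sq_le: "(trunc u n x - trunc u n y)\<^sup>2 \<le> (u x - u y) * (trunc u n x - trunc u n y)"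
proof -
  have "0 \<le> ((u x - u y) - (trunc u n x - trunc u n y)) * (trunc u n x - trunc u n y)"
    by (cases "u y \<le> u x") (auto simp: trunc_def max_def zero_le_mult_iff)
  thus ?thesis by (simp add: power2_eq_square algebra_simps)
qed

lemma trunc_fin_supp:
  assumes "\<And>\<delta>. 0 < \<delta> \<Longrightarrow> finite {x. \<delta> < u x}"
  shows "fin_supp (trunc u n)"
proof -
  have "{x. trunc u n x \<noteq> 0} \<subseteq> {x. inverse (real (Suc n)) < u x}" by (auto simp: trunc_def)
  moreover have "finite {x. inverse (real (Suc n)) < u x}" by (rule assms) simp
  ultimately show ?thesis unfolding fin_supp_def by (rule finite_subset)
qed

text \<open>The equation tested against the truncated solution, a discrete Green formula. Finite
  support of the truncation makes the common term \<open>X\<close> finite, so it cancels.\<close>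

lemma trunc_pairing:
  assumes u: "\<And>x. 0 \<le> u x" and h: "\<And>x. 0 \<le> h x" and lim: "\<And>\<delta>. 0 < \<delta> \<Longrightarrow> finite {x. \<delta> < u x}"
    and eq: "\<And>x. ktot \<sigma> TYPE('d) * ennreal (u x) = conv u x + ennreal (h x)"
  shows "(\<integral>\<^sup>+x. \<integral>\<^sup>+y. ennreal (1/2 * k (x - y) * ((u x - u y) * (trunc u n x - trunc u n y))) \<partial>count_space UNIV \<partial>count_space UNIV)
     = (\<integral>\<^sup>+x. ennreal (h x * trunc u n x) \<partial>count_space UNIV)" (is "?B = ?H")
proof -
  let ?K = "ktot \<sigma> TYPE('d)" and ?\<phi> = "trunc u n"
  define G where "G x y = ennreal (?\<phi> x * u y)" for x y
  define X where "X = (\<integral>\<^sup>+x. ennreal (?\<phi> x) * conv u x \<partial>count_space UNIV)"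
  have pair: "ennreal (1/2 * k (x - y) * ((u x - u y) * (?\<phi> x - ?\<phi> y))) + ennreal (1/2 * k (x - y)) * (G x y + G y x)
     = ennreal (1/2 * k (x - y)) * (ennreal (?\<phi> x * u x) + ennreal (?\<phi> y * u y))" for x y
  proof -
    define c where "c = 1/2 * k (x - y)"
    have c: "0 \<le> c" using k_nonneg by (simp add: c_def)
    have p: "0 \<le> (u x - u y) * (?\<phi> x - ?\<phi> y)" using trunc_sq_le[of u n x y] by (rule order_trans[OF zero_le_power2])
    have n: "0 \<le> ?\<phi> x * u y" "0 \<le> ?\<phi> y * u x" "0 \<le> ?\<phi> x * u x" "0 \<le> ?\<phi> y * u y"
      using u trunc_nonneg by auto
    have "ennreal (c * ((u x - u y) * (?\<phi> x - ?\<phi> y))) + ennreal c * (G x y + G y x)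
       = ennreal c * (ennreal ((u x - u y) * (?\<phi> x - ?\<phi> y)) + (G x y + G y x))"
      using c p by (simp only: ennreal_mult distrib_left)
    also have "\<dots> = ennreal c * ennreal ((u x - u y) * (?\<phi> x - ?\<phi> y) + (?\<phi> x * u y + ?\<phi> y * u x))"
      unfolding G_def using p n by simp
    also have "(u x - u y) * (?\<phi> x - ?\<phi> y) + (?\<phi> x * u y + ?\<phi> y * u x) = ?\<phi> x * u x + ?\<phi> y * u y"
      by (simp add: algebra_simps)
    finally show ?thesis unfolding c_def using n by simp
  qed
  have XG: "(\<integral>\<^sup>+x. \<integral>\<^sup>+y. ennreal (1/2 * k (x - y)) * (G x y + G y x) \<partial>count_space UNIV \<partial>count_space UNIV) = X"
  proof -
    have "(\<integral>\<^sup>+y. ennreal (k (x - y)) * G x y \<partial>count_space UNIV) = ennreal (?\<phi> x) * conv u x" for x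
    proof -
      have "G x y = ennreal (?\<phi> x) * ennreal (u y)" for y
        unfolding G_def using u trunc_nonneg by (intro ennreal_mult) auto
      hence "(\<integral>\<^sup>+y. ennreal (k (x - y)) * G x y \<partial>count_space UNIV)
        = (\<integral>\<^sup>+y. ennreal (?\<phi> x) * (ennreal (k (x - y)) * ennreal (u y)) \<partial>count_space UNIV)"
        by (simp only: mult_ac)
      also have "\<dots> = ennreal (?\<phi> x) * conv u x"
        unfolding conv_def by (rule nn_integral_cmult) simp
      finally show ?thesis .
    qed
    thus ?thesis unfolding symmetric_sum X_def by simp
  qed
  have "?B + X = (\<integral>\<^sup>+x. \<integral>\<^sup>+y. ennreal (1/2 * k (x - y) * ((u x - u y) * (?\<phi> x - ?\<phi> y)))
      + ennreal (1/2 * k (x - y)) * (G x y + G y x) \<partial>count_space UNIV \<partial>count_space UNIV)"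
    unfolding XG[symmetric] by (simp add: nn_integral_add)
  also have "\<dots> = ?K * (\<integral>\<^sup>+x. ennreal (?\<phi> x * u x) \<partial>count_space UNIV)"
    unfolding pair by (rule symmetric_sum_diag)
  also have "\<dots> = (\<integral>\<^sup>+x. ?K * ennreal (?\<phi> x * u x) \<partial>count_space UNIV)"
    by (rule nn_integral_cmult[symmetric]) simp
  also have "\<dots> = (\<integral>\<^sup>+x. ennreal (h x * ?\<phi> x) + ennreal (?\<phi> x) * conv u x \<partial>count_space UNIV)"
  proof (rule nn_integral_cong)
    fix x
    have "?K * ennreal (?\<phi> x * u x) = ennreal (?\<phi> x) * (?K * ennreal (u x))"
      using u trunc_nonneg by (simp add: ennreal_mult mult_ac)
    also have "\<dots> = ennreal (h x) * ennreal (?\<phi> x) + ennreal (?\<phi> x) * conv u x"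
      unfolding eq by (simp only: distrib_left add.commute mult.commute)
    finally show "?K * ennreal (?\<phi> x * u x) = ennreal (h x * ?\<phi> x) + ennreal (?\<phi> x) * conv u x"
      using h trunc_nonneg by (simp add: ennreal_mult)
  qed
  also have "\<dots> = ?H + X" unfolding X_def by (rule nn_integral_add) auto
  finally have "X + ?B = X + ?H" by (simp only: add.commute)
  moreover have "X \<noteq> top"
  proof -
    have "finite {x. ?\<phi> x * u x \<noteq> 0}"
      using trunc_fin_supp[OF lim, of n] unfolding fin_supp_def by (rule finite_subset[rotated]) auto
    hence "?K * (\<integral>\<^sup>+x. ennreal (?\<phi> x * u x) \<partial>count_space UNIV) < top"
      by (simp add: ennreal_mult_less_top ktot_less_top nn_integral_fin_supp)
    moreover have "X \<le> ?K * (\<integral>\<^sup>+x. ennreal (?\<phi> x * u x) \<partial>count_space UNIV)"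
    proof -
      have "X \<le> (\<integral>\<^sup>+x. ?K * ennreal (?\<phi> x * u x) \<partial>count_space UNIV)"
        unfolding X_def
      proof (rule nn_integral_mono)
        fix x
        have "ennreal (?\<phi> x) * conv u x \<le> ennreal (?\<phi> x) * (?K * ennreal (u x))"
          unfolding eq by (intro mult_left_mono) auto
        also have "\<dots> = ?K * ennreal (?\<phi> x * u x)" using u trunc_nonneg by (simp add: ennreal_mult mult_ac)
        finally show "ennreal (?\<phi> x) * conv u x \<le> ?K * ennreal (?\<phi> x * u x)" .
      qed
      also have "\<dots> = ?K * (\<integral>\<^sup>+x. ennreal (?\<phi> x * u x) \<partial>count_space UNIV)" by (rule nn_integral_cmult) simp
      finally show ?thesis .
    qed
    ultimately show ?thesis by auto
  qed
  ultimately show ?thesis by (simp add: ennreal_add_left_cancel)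
qed

text \<open>The energy of the truncation is at most its pairing with \<open>u\<close>, and the
  pairing increases to \<open>Qform \<sigma> u\<close>; the first claim thus covers infinite energy
  as well. For the last claim the remainder \<open>u - trunc u n\<close> also has increments bounded
  by those of \<open>u\<close>, hence dominated convergence.\<close>

lemma trunc_energy_limit:
  assumes u: "\<And>x. 0 \<le> u x" and h: "\<And>x. 0 \<le> h x" and lim: "\<And>\<delta>. 0 < \<delta> \<Longrightarrow> finite {x. \<delta> < u x}"
    and eq: "\<And>x. ktot \<sigma> TYPE('d) * ennreal (u x) = conv u x + ennreal (h x)"
  shows "Qform \<sigma> u = (\<integral>\<^sup>+x. ennreal (h x * u x) \<partial>count_space UNIV)"
    and "hardy_weight \<sigma> w' \<Longrightarrow> wsum w' u \<le> (\<integral>\<^sup>+x. ennreal (h x * u x) \<partial>count_space UNIV)"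
    and "Qform \<sigma> u < top \<Longrightarrow> u \<in> D0 \<sigma>"
proof -
  let ?H = "\<integral>\<^sup>+x. ennreal (h x * u x) \<partial>count_space UNIV"
  define B where "B n p = ennreal (1/2 * k (fst p - snd p) * ((u (fst p) - u (snd p)) * (trunc u n (fst p) - trunc u n (snd p))))" for n p
  have B: "(\<integral>\<^sup>+p. B n p \<partial>count_space UNIV) = (\<integral>\<^sup>+x. ennreal (h x * trunc u n x) \<partial>count_space UNIV)" for n
  proof -
    have "(\<integral>\<^sup>+p. B n p \<partial>count_space UNIV) = (\<integral>\<^sup>+x. \<integral>\<^sup>+y. ennreal (1/2 * k (x - y) *
        ((u x - u y) * (trunc u n x - trunc u n y))) \<partial>count_space UNIV \<partial>count_space UNIV)"
      unfolding B_def by (rule nn_integral_count_space_pair)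
    also have "\<dots> = (\<integral>\<^sup>+x. ennreal (h x * trunc u n x) \<partial>count_space UNIV)"
      by (rule trunc_pairing[OF u h lim eq])
    finally show ?thesis .
  qed
  have H: "(\<lambda>n. \<integral>\<^sup>+x. ennreal (h x * trunc u n x) \<partial>count_space UNIV) \<longlonglongrightarrow> ?H"
  proof (rule nn_integral_LIMSEQ)
    show "incseq (\<lambda>n x. ennreal (h x * trunc u n x))"
      unfolding incseq_def le_fun_def using h trunc_mono by (auto intro!: ennreal_leI mult_left_mono)
    show "(\<lambda>n. ennreal (h x * trunc u n x)) \<longlonglongrightarrow> ennreal (h x * u x)" for x
      by (intro tendsto_intros trunc_tendsto u)
  qed auto
  have "(\<lambda>n. \<integral>\<^sup>+p. B n p \<partial>count_space UNIV) \<longlonglongrightarrow> Qform \<sigma> u"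
    unfolding Qform_nn
  proof (rule nn_integral_LIMSEQ)
    show "incseq B"
      unfolding incseq_def le_fun_def B_def using k_nonneg
      by (auto intro!: ennreal_leI mult_left_mono trunc_diff_mono)
    show "(\<lambda>n. B n p) \<longlonglongrightarrow> ennreal (1/2 * k (fst p - snd p) * (u (fst p) - u (snd p))\<^sup>2)" for p
      unfolding B_def power2_eq_square by (intro tendsto_intros trunc_tendsto u)
  qed auto
  thus Q: "Qform \<sigma> u = ?H" unfolding B using H by (rule LIMSEQ_unique)
  show "wsum w' u \<le> ?H" if w': "hardy_weight \<sigma> w'"
  proof -
    have w0: "0 \<le> w' x" for x using w' by (simp add: hardy_weight_def)
    have "(\<lambda>n. wsum w' (trunc u n)) \<longlonglongrightarrow> wsum w' u"
      unfolding wsum_nn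
    proof (rule nn_integral_LIMSEQ)
      show "incseq (\<lambda>n x. ennreal (w' x * (trunc u n x)\<^sup>2))"
        unfolding incseq_def le_fun_def using w0 trunc_mono trunc_nonneg
        by (auto intro!: ennreal_leI mult_left_mono power_mono)
      show "(\<lambda>n. ennreal (w' x * (trunc u n x)\<^sup>2)) \<longlonglongrightarrow> ennreal (w' x * (u x)\<^sup>2)" for x
        by (intro tendsto_intros trunc_tendsto u)
    qed auto
    moreover have "wsum w' (trunc u n) \<le> ?H" for n
    proof -
      have "wsum w' (trunc u n) \<le> Qform \<sigma> (trunc u n)"
        using w' trunc_fin_supp[OF lim] by (simp add: hardy_weight_def)
      also have "\<dots> \<le> (\<integral>\<^sup>+p. B n p \<partial>count_space UNIV)"
        unfolding Qform_nn B_def using k_nonneg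
        by (intro nn_integral_mono ennreal_leI mult_left_mono trunc_sq_le) auto
      also have "\<dots> \<le> ?H"
        unfolding B using h u by (intro nn_integral_mono ennreal_leI mult_left_mono trunc_le)
      finally show ?thesis .
    qed
    ultimately show ?thesis by (intro LIMSEQ_le_const2) auto
  qed
  show "u \<in> D0 \<sigma>" if fin: "Qform \<sigma> u < top"
    unfolding D0_def mem_Collect_eq
  proof (intro exI[of _ "trunc u"] conjI allI trunc_fin_supp lim)
    define g where "g n x = u x - trunc u n x" for n x
    have glim: "(\<lambda>n. g n x) \<longlonglongrightarrow> 0" for x
      using tendsto_diff[OF tendsto_const[of "u x"] trunc_tendsto[where u = u and x = x, OF u]] by (simp add: g_def)
    have gle: "\<bar>g n x - g n y\<bar> \<le> \<bar>u x - u y\<bar>" for n x y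
      by (auto simp: g_def trunc_def max_def abs_if)
    have "(\<lambda>n. Qform \<sigma> (g n)) \<longlonglongrightarrow> (\<integral>\<^sup>+p. 0 \<partial>count_space (UNIV :: ((int ^ 'd) \<times> (int ^ 'd)) set))"
      unfolding Qform_nn
    proof (rule nn_integral_dominated_convergence[where w = "\<lambda>p. ennreal (1/2 * k (fst p - snd p) * (u (fst p) - u (snd p))\<^sup>2)"])
      show "(\<integral>\<^sup>+p. ennreal (1/2 * k (fst p - snd p) * (u (fst p) - u (snd p))\<^sup>2) \<partial>count_space UNIV) < \<infinity>"
        using fin unfolding Qform_nn by simp
      show "AE p in count_space UNIV. ennreal (1/2 * k (fst p - snd p) * (g n (fst p) - g n (snd p))\<^sup>2)
         \<le> ennreal (1/2 * k (fst p - snd p) * (u (fst p) - u (snd p))\<^sup>2)" for n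
        using k_nonneg gle by (intro AE_I2 ennreal_leI mult_left_mono) (auto simp: abs_le_square_iff)
      show "AE p in count_space UNIV. (\<lambda>n. ennreal (1/2 * k (fst p - snd p) * (g n (fst p) - g n (snd p))\<^sup>2)) \<longlonglongrightarrow> 0"
      proof (rule AE_I2)
        fix p :: "(int ^ 'd) \<times> (int ^ 'd)"
        have "(\<lambda>n. ennreal (1/2 * k (fst p - snd p) * (g n (fst p) - g n (snd p))\<^sup>2)) \<longlonglongrightarrow> ennreal (1/2 * k (fst p - snd p) * (0 - 0)\<^sup>2)"
          by (intro tendsto_intros glim)
        thus "(\<lambda>n. ennreal (1/2 * k (fst p - snd p) * (g n (fst p) - g n (snd p))\<^sup>2)) \<longlonglongrightarrow> 0" by simp
      qed
    qed auto
    moreover have "(\<lambda>n. ennreal ((g n 0)\<^sup>2)) \<longlonglongrightarrow> ennreal (0\<^sup>2)" by (intro tendsto_intros glim)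
    ultimately have "(\<lambda>n. Qform \<sigma> (g n) + ennreal ((g n 0)\<^sup>2)) \<longlonglongrightarrow> 0 + 0"
      by (intro tendsto_add) auto
    thus "(\<lambda>n. Qform \<sigma> (\<lambda>x. u x - trunc u n x) + ennreal ((u 0 - trunc u n 0)\<^sup>2)) \<longlonglongrightarrow> 0"
      by (simp add: g_def[abs_def])
  qed
qed

section \<open>Uniqueness of the ground state\<close>

text \<open>The added term gives convergence at the origin, and each edge term of the energy
  transports it to a nearest neighbour.\<close>

lemma Qform_null_sequence:
  fixes g :: "nat \<Rightarrow> int ^ 'd \<Rightarrow> real"
  assumes "(\<lambda>n. Qform \<sigma> (g n) + ennreal ((g n 0)\<^sup>2)) \<longlonglongrightarrow> 0"
  shows "(\<lambda>n. g n x) \<longlonglongrightarrow> 0"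
proof (induction x rule: lattice_induct)
  case 1
  have "(\<lambda>n. ennreal ((g n 0)\<^sup>2)) \<longlonglongrightarrow> 0"
    by (rule tendsto_sandwich[OF _ _ tendsto_const assms]) (auto intro!: always_eventually)
  hence "(\<lambda>n. (g n 0)\<^sup>2) \<longlonglongrightarrow> 0" by (subst (asm) ennreal_0[symmetric], subst (asm) tendsto_ennreal_iff) auto
  thus ?case by simp
next
  case (2 x i)
  have step: "(\<lambda>n. g n y) \<longlonglongrightarrow> 0" if y: "k (x - y) > 0" for y
  proof -
    have "(\<lambda>n. ennreal (1/2 * k (x - y) * (g n x - g n y)\<^sup>2)) \<longlonglongrightarrow> 0"
    proof (rule tendsto_sandwich[OF _ _ tendsto_const assms])
      show "\<forall>\<^sub>F n in sequentially. ennreal (1/2 * k (x - y) * (g n x - g n y)\<^sup>2) \<le> Qform \<sigma> (g n) + ennreal ((g n 0)\<^sup>2)"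
        by (intro always_eventually allI order_trans[OF Qform_edge]) simp
    qed simp
    hence "(\<lambda>n. 1/2 * k (x - y) * (g n x - g n y)\<^sup>2) \<longlonglongrightarrow> 0"
      using y by (subst (asm) ennreal_0[symmetric], subst (asm) tendsto_ennreal_iff) auto
    hence "(\<lambda>n. (2 / k (x - y)) * (1/2 * k (x - y) * (g n x - g n y)\<^sup>2)) \<longlonglongrightarrow> (2 / k (x - y)) * 0"
      by (intro tendsto_mult_left)
    hence "(\<lambda>n. (g n x - g n y)\<^sup>2) \<longlonglongrightarrow> 0" using y by simp
    hence "(\<lambda>n. g n x - g n y) \<longlonglongrightarrow> 0" by simp
    from tendsto_diff[OF 2 this] show ?thesis by simp
  qed
  have e: "k (axis i 1) > 0" by (rule kappa_neighbour_pos[OF \<sigma>_pos \<sigma>_le_1])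
  have "k (x - (x + axis i 1)) > 0" "k (x - (x - axis i 1)) > 0"
    using e k_even[of "axis i 1"] by simp_all
  thus ?case using step by blast
qed

text \<open>Along finitely supported approximants Fatou's lemma keeps the edge term of
  \<open>hardy_supersolution\<close> in the limit. Since \<open>v\<close> attains equality, the edge
  term vanishes, so \<open>v / u\<close> agrees at the two ends of every edge and is
  constant.\<close>

lemma ground_state_unique:
  assumes u: "\<And>x. 0 < u x" and w: "\<And>x. 0 \<le> w x"
    and eq: "\<And>x. ktot \<sigma> TYPE('d) * ennreal (u x) = conv u x + ennreal (w x * u x)"
    and v: "v \<in> D0 \<sigma>" "Qform \<sigma> v = wsum w v"
  shows "Qform \<sigma> v < top \<and> v x = v 0 / u 0 * u x"
proof -
  obtain \<phi> where \<phi>: "\<And>n. fin_supp (\<phi> n)"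
    "(\<lambda>n. Qform \<sigma> (\<lambda>x. v x - \<phi> n x) + ennreal ((v 0 - \<phi> n 0)\<^sup>2)) \<longlonglongrightarrow> 0"
    using v(1) unfolding D0_def by blast
  have pt: "(\<lambda>n. \<phi> n x) \<longlonglongrightarrow> v x" for x
    using tendsto_diff[OF tendsto_const[of "v x"] Qform_null_sequence[OF \<phi>(2), of x]] by simp
  have Q0: "(\<lambda>n. Qform \<sigma> (\<lambda>x. v x - \<phi> n x)) \<longlonglongrightarrow> 0"
    by (rule tendsto_sandwich[OF _ _ tendsto_const \<phi>(2)]) (auto intro!: always_eventually)
  have fin: "Qform \<sigma> v < top"
  proof -
    have "\<forall>\<^sub>F n in sequentially. Qform \<sigma> (\<lambda>x. v x - \<phi> n x) < 1"
      by (rule order_tendstoD(2)[OF Q0]) simp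
    then obtain n where n: "Qform \<sigma> (\<lambda>x. v x - \<phi> n x) < 1" by (auto simp: eventually_sequentially)
    have "Qform \<sigma> v = Qform \<sigma> (\<lambda>x. (v x - \<phi> n x) + \<phi> n x)" by simp
    also have "\<dots> \<le> ennreal (1 + 1) * Qform \<sigma> (\<lambda>x. v x - \<phi> n x) + ennreal (1 + 1 / 1) * Qform \<sigma> (\<phi> n)"
      by (rule Qform_add_le) simp
    also have "\<dots> < top"
      using n Qform_fin_supp[OF \<phi>(1), of n] less_trans[OF n ennreal_one_less_top]
      by (simp add: ennreal_mult_less_top)
    finally show ?thesis .
  qed
  have edge: "v x / u x = v y / u y" if xy: "k (x - y) > 0" for x y
  proof -
    define e where "e f = ennreal (1/2 * k (x - y) * (u x * u y * (f x / u x - f y / u y)\<^sup>2))" for f :: "int ^ 'd \<Rightarrow> real"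
    \<comment> \<open>The edge term is placed as a point mass at the site \<open>x\<close>, so that
      Fatou's lemma treats it together with the weighted sum.\<close>
    define F where "F f z = ennreal (w z * (f z)\<^sup>2) + e f * indicator {x} z" for f :: "int ^ 'd \<Rightarrow> real" and z
    have F: "(\<integral>\<^sup>+z. F f z \<partial>count_space UNIV) = wsum w f + e f" for f
      unfolding F_def wsum_nn by (subst nn_integral_add) (auto simp: nn_integral_cmult_indicator)
    have hardy: "wsum w (\<phi> n) + e (\<phi> n) \<le> Qform \<sigma> (\<phi> n)" for n
      unfolding e_def by (rule hardy_supersolution[OF u w _ \<phi>(1)]) (simp add: eq)
    have "(\<lambda>n. F (\<phi> n) z) \<longlonglongrightarrow> F v z" for z
    proof -
      have "(\<lambda>n. e (\<phi> n)) \<longlonglongrightarrow> e v"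
        unfolding e_def by (intro tendsto_intros pt) (use u[of x] u[of y] in auto)
      hence "(\<lambda>n. e (\<phi> n) * indicator {x} z) \<longlonglongrightarrow> e v * indicator {x} z"
        by (cases "z = x") auto
      moreover have "(\<lambda>n. ennreal (w z * (\<phi> n z)\<^sup>2)) \<longlonglongrightarrow> ennreal (w z * (v z)\<^sup>2)" by (intro tendsto_intros pt)
      ultimately show ?thesis unfolding F_def by (intro tendsto_add)
    qed
    hence lF: "liminf (\<lambda>n. F (\<phi> n) z) = F v z" for z by (intro lim_imp_Liminf) auto
    \<comment> \<open>The factor \<open>1 + \<eta>\<close> is the loss in comparing the energies of
      the approximants with that of \<open>v\<close> through \<open>Qform_add_le\<close>; it is
      removed afterwards by letting \<open>\<eta>\<close> tend to 0.\<close>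
    have le: "wsum w v + e v \<le> ennreal (1 + \<eta>) * Qform \<sigma> v" if \<eta>: "0 < \<eta>" for \<eta>
    proof -
      have "wsum w v + e v = (\<integral>\<^sup>+z. liminf (\<lambda>n. F (\<phi> n) z) \<partial>count_space UNIV)" unfolding lF F ..
      also have "\<dots> \<le> liminf (\<lambda>n. \<integral>\<^sup>+z. F (\<phi> n) z \<partial>count_space UNIV)" by (rule nn_integral_liminf) simp
      also have "\<dots> \<le> liminf (\<lambda>n. ennreal (1 + \<eta>) * Qform \<sigma> v + ennreal (1 + 1 / \<eta>) * Qform \<sigma> (\<lambda>x. v x - \<phi> n x))"
      proof (intro Liminf_mono always_eventually allI)
        fix n
        have "Qform \<sigma> (\<phi> n) = Qform \<sigma> (\<lambda>x. v x + (\<phi> n x - v x))" by simp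
        also have "\<dots> \<le> ennreal (1 + \<eta>) * Qform \<sigma> v + ennreal (1 + 1 / \<eta>) * Qform \<sigma> (\<lambda>x. \<phi> n x - v x)"
          by (rule Qform_add_le[OF \<eta>])
        also have "Qform \<sigma> (\<lambda>x. \<phi> n x - v x) = Qform \<sigma> (\<lambda>x. v x - \<phi> n x)"
        proof -
          have "(\<phi> n a - v a - (\<phi> n b - v b))\<^sup>2 = (v a - \<phi> n a - (v b - \<phi> n b))\<^sup>2" for a b
            by (simp add: power2_eq_square algebra_simps)
          thus ?thesis unfolding Qform_nn by simp
        qed
        finally show "(\<integral>\<^sup>+z. F (\<phi> n) z \<partial>count_space UNIV)
          \<le> ennreal (1 + \<eta>) * Qform \<sigma> v + ennreal (1 + 1 / \<eta>) * Qform \<sigma> (\<lambda>x. v x - \<phi> n x)"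
          unfolding F using hardy[of n] by (rule order_trans[rotated])
      qed
      also have "\<dots> = ennreal (1 + \<eta>) * Qform \<sigma> v"
      proof (rule lim_imp_Liminf)
        have "(\<lambda>n. ennreal (1 + 1 / \<eta>) * Qform \<sigma> (\<lambda>x. v x - \<phi> n x)) \<longlonglongrightarrow> ennreal (1 + 1 / \<eta>) * 0"
          by (intro ennreal_tendsto_cmult Q0) simp
        from tendsto_add[OF tendsto_const[of "ennreal (1 + \<eta>) * Qform \<sigma> v"] this]
        show "(\<lambda>n. ennreal (1 + \<eta>) * Qform \<sigma> v + ennreal (1 + 1 / \<eta>) * Qform \<sigma> (\<lambda>x. v x - \<phi> n x))
           \<longlonglongrightarrow> ennreal (1 + \<eta>) * Qform \<sigma> v" by simp
      qed simp
      finally show ?thesis .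
    qed
    obtain q where q: "Qform \<sigma> v = ennreal q" "0 \<le> q" using fin by (cases "Qform \<sigma> v" rule: ennreal_cases) auto
    have "wsum w v + e v \<le> Qform \<sigma> v"
    proof (rule ennreal_le_epsilon)
      fix \<epsilon> :: real assume \<epsilon>: "0 < \<epsilon>"
      \<comment> \<open>The summand 1 in the denominator covers the case of zero energy.\<close>
      define \<eta> where "\<eta> = \<epsilon> / (q + 1)"
      have \<eta>: "0 < \<eta>" using \<epsilon> q by (simp add: \<eta>_def)
      have "\<eta> * q \<le> \<epsilon>" using \<epsilon> q by (simp add: \<eta>_def divide_le_eq)
      hence "(1 + \<eta>) * q \<le> q + \<epsilon>" by (simp add: distrib_right)
      hence "ennreal ((1 + \<eta>) * q) \<le> ennreal (q + \<epsilon>)" by (rule ennreal_leI)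
      moreover have "ennreal ((1 + \<eta>) * q) = ennreal (1 + \<eta>) * ennreal q" using \<eta> q by (intro ennreal_mult) auto
      ultimately show "wsum w v + e v \<le> Qform \<sigma> v + ennreal \<epsilon>"
        using le[OF \<eta>] q \<epsilon> by simp
    qed
    hence "wsum w v + e v \<le> wsum w v + 0" unfolding v(2) by simp
    moreover have "wsum w v < top" using fin v(2) by simp
    ultimately have "e v \<le> 0" by (simp only: ennreal_add_left_cancel_le) auto
    hence le0: "1/2 * k (x - y) * (u x * u y * (v x / u x - v y / u y)\<^sup>2) \<le> 0" unfolding e_def by (simp add: ennreal_eq_0_iff)
    show ?thesis
    proof (rule ccontr)
      assume "v x / u x \<noteq> v y / u y"
      hence "0 < (v x / u x - v y / u y)\<^sup>2" by simp
      hence "0 < 1/2 * k (x - y) * (u x * u y * (v x / u x - v y / u y)\<^sup>2)"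
        using xy u[of x] u[of y] by (intro mult_pos_pos) auto
      thus False using le0 by simp
    qed
  qed
  have "v x / u x = v 0 / u 0"
  proof (induction x rule: lattice_induct)
    case (2 x i)
    have e: "k (axis i 1) > 0" by (rule kappa_neighbour_pos[OF \<sigma>_pos \<sigma>_le_1])
    have "k (x - (x + axis i 1)) > 0" "k (x - (x - axis i 1)) > 0"
      using e k_even[of "axis i 1"] by simp_all
    thus ?case using edge 2 by metis
  qed simp
  thus ?thesis using fin u[of x] by (simp add: divide_eq_eq)
qed

end

section \<open>Inequalities for the Gamma function\<close>

text \<open>Logarithmic convexity of the Gamma function. It compares the constants in two moment
  identities of equal total order.\<close>

lemma Gamma_midpoint:
  assumes "0 < x" "0 < (y :: real)"
  shows "(Gamma ((x + y) / 2))\<^sup>2 \<le> Gamma x * Gamma y"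
proof -
  let ?z = "(x + y) / 2"
  have "(ln \<circ> Gamma) ((1 - 1/2) *\<^sub>R x + (1/2) *\<^sub>R y) \<le> (1 - 1/2) * (ln \<circ> Gamma) x + (1/2) * (ln \<circ> Gamma) y"
    by (rule convex_onD[OF log_convex_Gamma_real]) (use assms in auto)
  also have "(1 - 1/2) *\<^sub>R x + (1/2) *\<^sub>R y = ?z" unfolding real_scaleR_def by argo
  finally have "2 * ln (Gamma ?z) \<le> ln (Gamma x) + ln (Gamma y)" unfolding o_def by argo
  moreover have g: "Gamma x > 0" "Gamma y > 0" "Gamma ?z > 0" using assms by (auto intro!: Gamma_real_pos)
  ultimately have "ln ((Gamma ?z)\<^sup>2) \<le> ln (Gamma x * Gamma y)" by (simp add: ln_mult ln_realpow)
  thus ?thesis using g by (subst (asm) ln_le_cancel_iff) auto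
qed

text \<open>The factor produced when the operator lowers the order of a moment from \<open>a\<close>
  to \<open>a - \<sigma>\<close>.\<close>

definition gamma_ratio :: "real \<Rightarrow> real \<Rightarrow> real" where
  "gamma_ratio \<sigma> a = Gamma a / Gamma (a - \<sigma>)"

lemma gamma_ratio_pos: "0 < \<sigma> \<Longrightarrow> \<sigma> < a \<Longrightarrow> 0 < gamma_ratio \<sigma> a"
  unfolding gamma_ratio_def by (intro divide_pos_pos Gamma_real_pos) auto

lemma not_nonpos_Int: "0 < x \<Longrightarrow> (x :: real) \<notin> \<int>\<^sub>\<le>\<^sub>0"
  by (auto elim!: nonpos_Ints_cases)

lemma Digamma_increment_strict_antimono:
  fixes \<sigma> x y :: real
  assumes \<sigma>: "0 < \<sigma>" and xy: "\<sigma> < x" "x < y"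
  shows "Digamma y - Digamma (y - \<sigma>) < Digamma x - Digamma (x - \<sigma>)"
proof (rule DERIV_neg_imp_decreasing[where f = "\<lambda>a :: real. Digamma a - Digamma (a - \<sigma>)"])
  show "x < y" by (rule xy)
  fix a assume a: "x \<le> a" "a \<le> y"
  have P1: "Polygamma 1 a < Polygamma 1 (a - \<sigma>)"
    using a xy \<sigma> by (intro Polygamma_real_strict_antimono) auto
  have "((\<lambda>a. Digamma a - Digamma (a - \<sigma>)) has_real_derivative Polygamma 1 a - Polygamma 1 (a - \<sigma>)) (at a)"
    using a xy \<sigma> by (auto intro!: derivative_eq_intros not_nonpos_Int)
  thus "\<exists>l. ((\<lambda>a. Digamma a - Digamma (a - \<sigma>)) has_real_derivative l) (at a) \<and> l < 0"
    using P1 by (intro exI[of _ "Polygamma 1 a - Polygamma 1 (a - \<sigma>)"]) auto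
qed

text \<open>The logarithm has derivative \<open>Digamma a - Digamma (a - \<sigma>)\<close>, which is
  strictly decreasing; the mean value theorem on either side of \<open>c\<close> compares the two
  slopes.\<close>

lemma gamma_ratio_strict_log_concave:
  assumes \<sigma>: "0 < \<sigma>" and h: "0 < h" "\<sigma> < c - h"
  shows "gamma_ratio \<sigma> (c + h) * gamma_ratio \<sigma> (c - h) < (gamma_ratio \<sigma> c)\<^sup>2"
proof -
  define f where "f a = ln_Gamma a - ln_Gamma (a - \<sigma>)" for a :: real
  have f: "f a = ln (gamma_ratio \<sigma> a)" if "\<sigma> < a" for a
  proof -
    have "Gamma a > 0" "Gamma (a - \<sigma>) > 0" using that \<sigma> by (auto intro!: Gamma_real_pos)
    hence "ln (gamma_ratio \<sigma> a) = ln (Gamma a) - ln (Gamma (a - \<sigma>))" unfolding gamma_ratio_def by (intro ln_divide_pos)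
    thus ?thesis using that \<sigma> by (simp add: f_def ln_Gamma_real_pos)
  qed
  have D: "(f has_real_derivative Digamma a - Digamma (a - \<sigma>)) (at a)" if "\<sigma> < a" for a
    unfolding f_def[abs_def] using that \<sigma> by (auto intro!: derivative_eq_intros)
  obtain z1 where z1: "c < z1" "f (c + h) - f c = (c + h - c) * (Digamma z1 - Digamma (z1 - \<sigma>))"
    using MVT2[of c "c + h" f "\<lambda>a. Digamma a - Digamma (a - \<sigma>)"] D h by auto
  obtain z2 where z2: "c - h < z2" "z2 < c" "f c - f (c - h) = (c - (c - h)) * (Digamma z2 - Digamma (z2 - \<sigma>))"
    using MVT2[of "c - h" c f "\<lambda>a. Digamma a - Digamma (a - \<sigma>)"] D h by auto
  have "Digamma z1 - Digamma (z1 - \<sigma>) < Digamma z2 - Digamma (z2 - \<sigma>)"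
    using z1 z2 h \<sigma> by (intro Digamma_increment_strict_antimono) auto
  hence "h * (Digamma z1 - Digamma (z1 - \<sigma>)) < h * (Digamma z2 - Digamma (z2 - \<sigma>))" using h by simp
  moreover have "f (c + h) - f c = h * (Digamma z1 - Digamma (z1 - \<sigma>))"
    "f c - f (c - h) = h * (Digamma z2 - Digamma (z2 - \<sigma>))" using z1 z2 by simp_all
  ultimately have "f (c + h) + f (c - h) < 2 * f c" by linarith
  moreover have p: "gamma_ratio \<sigma> (c + h) > 0" "gamma_ratio \<sigma> (c - h) > 0" "gamma_ratio \<sigma> c > 0"
    using \<sigma> h by (auto intro!: gamma_ratio_pos)
  ultimately have "ln (gamma_ratio \<sigma> (c + h) * gamma_ratio \<sigma> (c - h)) < ln ((gamma_ratio \<sigma> c)\<^sup>2)"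
    using f[of "c + h"] f[of "c - h"] f[of c] h by (simp add: ln_mult ln_realpow)
  thus ?thesis using p by (subst (asm) ln_less_cancel_iff) auto
qed

section \<open>Interpolation between moments\<close>

lemma rmom_integrable:
  assumes "0 < a" "a < real CARD('d) / 2"
  shows "integrable lborel (\<lambda>t. indicator {0<..} t * (heat t (x :: int ^ 'd::finite) * t powr (a - 1)))"
proof (rule integrableI_nonneg)
  have "(\<lambda>t. ennreal (indicator {0<..} t * (heat t x * t powr (a - 1))))
     = (\<lambda>t. ennreal (heat t x * t powr (a - 1)) * indicator {0<..} t)"
    by (auto simp: indicator_def fun_eq_iff)
  thus "(\<integral>\<^sup>+t. ennreal (indicator {0<..} t * (heat t x * t powr (a - 1))) \<partial>lborel) < \<infinity>"
    using mom_finite[OF assms, of x] by (simp add: mom_def)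
qed (auto intro!: AE_I2 simp: indicator_def mult_nonneg_nonneg heat_nonneg)

lemma has_integral_rmom:
  assumes "0 < a" "a < real CARD('d) / 2"
  shows "has_bochner_integral lborel (\<lambda>t. indicator {0<..} t * (heat t (x :: int ^ 'd::finite) * t powr (a - 1))) (rmom a x)"
  using rmom_integrable[OF assms, of x] by (simp add: has_bochner_integral_iff rmom_eq_integral)

lemma has_bochner_integral_mono_real:
  fixes f g :: "'a \<Rightarrow> real"
  assumes "has_bochner_integral M f x" "has_bochner_integral M g y" "\<And>t. f t \<le> g t"
  shows "x \<le> y"
  using assms integral_mono[of M f g] by (simp add: has_bochner_integral_iff)

text \<open>The tangent at 1 lies below the convex function \<open>y powr (- p)\<close>.\<close>

lemma bernoulli_neg_powr:
  fixes y p :: real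
  assumes "0 < y" "0 \<le> p"
  shows "1 - p * (y - 1) \<le> y powr (- p)"
proof -
  have "p * ln y \<le> p * (y - 1)" using assms by (intro mult_left_mono ln_le_minus_one) auto
  hence "1 - p * (y - 1) \<le> 1 + - p * ln y" by simp
  also have "\<dots> \<le> exp (- p * ln y)" by (rule exp_ge_add_one_self)
  finally show ?thesis using assms by (simp add: powr_def)
qed

text \<open>The weighted inequality of arithmetic and geometric means for \<open>y\<close> and 1,
  with weights \<open>p\<close> and \<open>1 - p\<close>.\<close>

lemma powr_le_affine:
  fixes y p :: real
  assumes "0 < y" "0 \<le> p" "p \<le> 1"
  shows "y powr p \<le> 1 + p * (y - 1)"
proof -
  define m where "m = 1 + p * (y - 1)"
  have m: "0 < m"
  proof (cases "p = 1")
    case False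
    have "m = p * y + (1 - p)" by (simp add: m_def algebra_simps)
    thus ?thesis using assms False by (simp add: add_nonneg_pos)
  qed (use assms in \<open>simp add: m_def\<close>)
  have "p * ln (y / m) \<le> p * (y / m - 1)" using assms m by (intro mult_left_mono ln_le_minus_one) auto
  moreover have "(1 - p) * ln (1 / m) \<le> (1 - p) * (1 / m - 1)" using assms m by (intro mult_left_mono ln_le_minus_one) auto
  moreover have "p * (y / m - 1) + (1 - p) * (1 / m - 1) = 0"
  proof -
    have "p * (y / m - 1) + (1 - p) * (1 / m - 1) = (p * y + (1 - p)) / m - 1"
      using m by (simp add: field_simps)
    also have "p * y + (1 - p) = m" by (simp add: m_def algebra_simps)
    finally show ?thesis using m by simp
  qed
  ultimately have "p * ln (y / m) + (1 - p) * ln (1 / m) \<le> 0" by linarith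
  hence "p * (ln y - ln m) + (1 - p) * (- ln m) \<le> 0" using m assms by (simp add: ln_div)
  hence "p * ln y \<le> ln m" by (simp add: algebra_simps)
  hence "exp (p * ln y) \<le> m" using m by (simp add: ln_ge_iff)
  thus ?thesis using assms by (simp add: powr_def m_def)
qed

text \<open>\<open>\<tau> powr (- \<epsilon>)\<close> is the power
  \<open>p = 2 * \<epsilon> / \<delta>\<close> of \<open>\<tau> powr (- \<delta> / 2)\<close>, so
  the affine bounds from above and below show that it differs from 1 by at most \<open>p\<close>
  times \<open>\<tau> powr (\<delta> / 2) + \<tau> powr (- \<delta> / 2)\<close>. Squaring explains
  the half exponents and the constant 8.\<close>

lemma powr_difference_bound:
  fixes \<tau> \<epsilon> \<delta> :: real
  assumes "0 < \<tau>" "0 \<le> \<epsilon>" "2 * \<epsilon> \<le> \<delta>" "0 < \<delta>"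
  shows "(\<tau> powr (- \<epsilon>) - 1)\<^sup>2 \<le> 8 * (\<epsilon> / \<delta>)\<^sup>2 * (\<tau> powr \<delta> + \<tau> powr (- \<delta>))"
proof -
  define p where "p = 2 * \<epsilon> / \<delta>"
  have p: "0 \<le> p" "p \<le> 1" using assms by (auto simp: p_def)
  have pe: "\<delta> / 2 * p = \<epsilon>" using assms by (simp add: p_def)
  let ?A = "\<tau> powr (\<delta> / 2)" and ?B = "\<tau> powr (- \<delta> / 2)"
  have "?B powr p = \<tau> powr (- (\<delta> / 2 * p))" by (simp add: powr_powr)
  hence "\<tau> powr (- \<epsilon>) \<le> 1 + p * (?B - 1)" using powr_le_affine[of ?B p] p assms pe by simp
  moreover have "?A powr (- p) = \<tau> powr (- (\<delta> / 2 * p))" by (simp add: powr_powr)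
  hence "1 - p * (?A - 1) \<le> \<tau> powr (- \<epsilon>)" using bernoulli_neg_powr[of ?A p] p assms pe by simp
  moreover have "p * (?B - 1) \<le> p * (?A + ?B)" "p * (?A - 1) \<le> p * (?A + ?B)"
    using p by (auto intro!: mult_left_mono simp: add_increasing2 add_increasing)
  ultimately have "\<bar>\<tau> powr (- \<epsilon>) - 1\<bar> \<le> p * (?A + ?B)" by linarith
  hence "(\<tau> powr (- \<epsilon>) - 1)\<^sup>2 \<le> (p * (?A + ?B))\<^sup>2"
    by (metis abs_ge_zero power2_abs power_mono)
  also have "\<dots> = p\<^sup>2 * (?A + ?B)\<^sup>2" by (rule power_mult_distrib)
  also have "\<dots> \<le> p\<^sup>2 * (2 * (?A\<^sup>2 + ?B\<^sup>2))"
  proof (rule mult_left_mono)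
    have "0 \<le> (?A - ?B)\<^sup>2" by simp
    thus "(?A + ?B)\<^sup>2 \<le> 2 * (?A\<^sup>2 + ?B\<^sup>2)" by (simp add: power2_sum power2_diff)
  qed simp
  also have "?A\<^sup>2 = \<tau> powr \<delta>" by (simp add: power2_eq_square flip: powr_add)
  also have "?B\<^sup>2 = \<tau> powr (- \<delta>)" by (simp add: power2_eq_square flip: powr_add)
  also have "p\<^sup>2 * (2 * (\<tau> powr \<delta> + \<tau> powr (- \<delta>))) = 8 * (\<epsilon> / \<delta>)\<^sup>2 * (\<tau> powr \<delta> + \<tau> powr (- \<delta>))"
    by (simp add: p_def power2_eq_square)
  finally show ?thesis .
qed

text \<open>Jensen's inequality for the probability density proportional to \<open>heat t x * t powr (a - 1)\<close>.\<close>

lemma rmom_jensen: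
  fixes x :: "int ^ 'd::finite"
  assumes a: "0 < a - \<epsilon>" "0 \<le> \<epsilon>" "0 < \<delta>" "a + \<delta> < real CARD('d) / 2"
  shows "(rmom (a + \<delta>) x / rmom a x) powr (- \<epsilon> / \<delta>) * rmom a x \<le> rmom (a - \<epsilon>) x"
proof -
  have M: "rmom a x > 0" "rmom (a + \<delta>) x > 0" using a by (auto intro!: rmom_pos)
  define Y where "Y = rmom (a + \<delta>) x / rmom a x"
  \<comment> \<open>\<open>R\<close> is the time scale at which \<open>t powr \<delta>\<close>
    equals its mean \<open>Y\<close>; after rescaling by \<open>R\<close> that mean is 1.\<close>
  define R where "R = Y powr (1 / \<delta>)"
  have Y: "Y > 0" using M by (simp add: Y_def)
  have R: "R > 0" using Y by (simp add: R_def)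
  have RY: "R powr \<delta> = Y" "R powr (- \<epsilon>) = Y powr (- \<epsilon> / \<delta>)" using Y a by (simp_all add: R_def powr_powr)
  let ?I = "\<lambda>b t. indicator {0<..} t * (heat t x * t powr (b - 1)) :: real"
  have I: "has_bochner_integral lborel (?I b) (rmom b x)" if "b \<in> {a - \<epsilon>, a, a + \<delta>}" for b
    using that a by (intro has_integral_rmom) auto
  \<comment> \<open>This combination of the orders \<open>a\<close> and \<open>a + \<delta>\<close>
    is the integral of the tangent to the convex function at the mean; its slope term integrates to
    0, leaving \<open>R powr (- \<epsilon>) * rmom a x\<close>.\<close>
  have "has_bochner_integral lborel (\<lambda>t. R powr (- \<epsilon>) * (1 + \<epsilon> / \<delta>) * ?I a t - R powr (- \<epsilon>) * (\<epsilon> / \<delta> / Y) * ?I (a + \<delta>) t)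
     (R powr (- \<epsilon>) * (1 + \<epsilon> / \<delta>) * rmom a x - R powr (- \<epsilon>) * (\<epsilon> / \<delta> / Y) * rmom (a + \<delta>) x)"
    by (intro has_bochner_integral_diff has_bochner_integral_mult_right I) auto
  moreover have "R powr (- \<epsilon>) * (1 + \<epsilon> / \<delta>) * rmom a x - R powr (- \<epsilon>) * (\<epsilon> / \<delta> / Y) * rmom (a + \<delta>) x
     = R powr (- \<epsilon>) * rmom a x"
  proof -
    have "\<epsilon> / \<delta> / Y * rmom (a + \<delta>) x = \<epsilon> / \<delta> * rmom a x" using M by (simp add: Y_def)
    moreover have "q * (1 + s) * M' - q * r * N = q * M'" if "r * N = s * M'" for q s r M' N :: real
      using that by (simp add: algebra_simps)
    ultimately show ?thesis by blast
  qed
  ultimately have L: "has_bochner_integral lborel (\<lambda>t. R powr (- \<epsilon>) * (1 + \<epsilon> / \<delta>) * ?I a t - R powr (- \<epsilon>) * (\<epsilon> / \<delta> / Y) * ?I (a + \<delta>) t)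
     (R powr (- \<epsilon>) * rmom a x)" by simp
  have "R powr (- \<epsilon>) * rmom a x \<le> rmom (a - \<epsilon>) x"
  proof (rule has_bochner_integral_mono_real[OF L I])
    fix t :: real
    show "R powr (- \<epsilon>) * (1 + \<epsilon> / \<delta>) * ?I a t - R powr (- \<epsilon>) * (\<epsilon> / \<delta> / Y) * ?I (a + \<delta>) t \<le> ?I (a - \<epsilon>) t"
    proof (cases "t > 0")
      case t: True
      have "1 - \<epsilon> / \<delta> * ((t / R) powr \<delta> - 1) \<le> ((t / R) powr \<delta>) powr (- (\<epsilon> / \<delta>))"
        using t R a by (intro bernoulli_neg_powr) auto
      also have "\<dots> = (t / R) powr (- \<epsilon>)" using a by (simp add: powr_powr)
      finally have "R powr (- \<epsilon>) * (1 - \<epsilon> / \<delta> * ((t / R) powr \<delta> - 1)) \<le> R powr (- \<epsilon>) * (t / R) powr (- \<epsilon>)"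
        by (rule mult_left_mono) simp
      also have "R powr (- \<epsilon>) * (t / R) powr (- \<epsilon>) = t powr (- \<epsilon>)" using t R by (simp flip: powr_mult)
      also have "(t / R) powr \<delta> = t powr \<delta> / Y" using t R by (simp add: powr_divide RY)
      finally have le: "R powr (- \<epsilon>) * (1 - \<epsilon> / \<delta> * (t powr \<delta> / Y - 1)) \<le> t powr (- \<epsilon>)" .
      have "R powr (- \<epsilon>) * (1 + \<epsilon> / \<delta>) * (heat t x * t powr (a - 1)) - R powr (- \<epsilon>) * (\<epsilon> / \<delta> / Y) * (heat t x * t powr (a + \<delta> - 1))
        = heat t x * t powr (a - 1) * (R powr (- \<epsilon>) * (1 - \<epsilon> / \<delta> * (t powr \<delta> / Y - 1)))"
      proof -
        have "t powr (a + \<delta> - 1) = t powr (a - 1) * t powr \<delta>" by (subst powr_add[symmetric]) (simp add: algebra_simps)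
        thus ?thesis by (simp add: algebra_simps)
      qed
      also have "\<dots> \<le> heat t x * t powr (a - 1) * t powr (- \<epsilon>)"
        using t by (intro mult_left_mono[OF le] mult_nonneg_nonneg heat_nonneg) auto
      also have "\<dots> = heat t x * t powr (a - \<epsilon> - 1)"
        unfolding mult.assoc by (subst powr_add[symmetric]) (simp add: algebra_simps)
      finally show ?thesis using t by simp
    qed simp
  qed simp
  thus ?thesis unfolding RY Y_def .
qed

text \<open>The variance of \<open>t powr (- \<epsilon>)\<close> under the same density is of order \<open>\<epsilon>\<^sup>2\<close> times its second moment.\<close>

lemma rmom_variance:
  fixes x :: "int ^ 'd::finite"
  assumes a: "0 < a - \<delta>" "0 < \<epsilon>" "2 * \<epsilon> \<le> \<delta>" "a + \<delta> < real CARD('d) / 2"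
    and B: "rmom (a + \<delta>) x * rmom (a - \<delta>) x \<le> B * (rmom a x)\<^sup>2"
  shows "rmom (a - 2 * \<epsilon>) x * (1 - 8 * (1 + B) / \<delta>\<^sup>2 * \<epsilon>\<^sup>2) \<le> (rmom (a - \<epsilon>) x)\<^sup>2 / rmom a x"
proof -
  have \<delta>: "0 < \<delta>" using a by simp
  have M: "rmom a x > 0" "rmom (a + \<delta>) x > 0" "rmom (a - \<delta>) x > 0" using a \<delta> by (auto intro!: rmom_pos)
  define Y where "Y = rmom (a + \<delta>) x / rmom a x"
  define R where "R = Y powr (1 / \<delta>)"
  have Y: "Y > 0" using M by (simp add: Y_def)
  have R: "R > 0" using Y by (simp add: R_def)
  have RY: "R powr \<delta> = Y" "R powr (- \<delta>) = 1 / Y" using Y \<delta> by (simp_all add: R_def powr_powr powr_minus_divide)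
  \<comment> \<open>\<open>q\<close> replaces the mean of \<open>t powr (- \<epsilon>)\<close>,
    since the variance is at most the second moment about any point; this choice makes
    \<open>powr_difference_bound\<close> applicable after rescaling by \<open>R\<close>.\<close>
  define q where "q = R powr (- \<epsilon>)"
  have q: "q > 0" using R by (simp add: q_def)
  have q2: "q\<^sup>2 = Y powr (- (2 * \<epsilon>) / \<delta>)"
  proof -
    have "q\<^sup>2 = R powr (- (2 * \<epsilon>))" unfolding q_def power2_eq_square by (subst powr_add[symmetric]) simp
    thus ?thesis using Y \<delta> by (simp add: R_def powr_powr)
  qed
  let ?c = "8 * (\<epsilon> / \<delta>)\<^sup>2"
  let ?I = "\<lambda>b t. indicator {0<..} t * (heat t x * t powr (b - 1)) :: real"
  have I: "has_bochner_integral lborel (?I b) (rmom b x)" if "b \<in> {a - 2 * \<epsilon>, a - \<epsilon>, a, a + \<delta>, a - \<delta>}" for b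
    using that a \<delta> by (intro has_integral_rmom) auto
  have "has_bochner_integral lborel (\<lambda>t. ?I (a - 2 * \<epsilon>) t - 2 * q * ?I (a - \<epsilon>) t + q\<^sup>2 * ?I a t)
     (rmom (a - 2 * \<epsilon>) x - 2 * q * rmom (a - \<epsilon>) x + q\<^sup>2 * rmom a x)"
    by (intro has_bochner_integral_diff has_bochner_integral_add has_bochner_integral_mult_right I) auto
  moreover have "has_bochner_integral lborel (\<lambda>t. q\<^sup>2 * ?c * (1 / Y) * ?I (a + \<delta>) t + q\<^sup>2 * ?c * Y * ?I (a - \<delta>) t)
     (q\<^sup>2 * ?c * (1 / Y) * rmom (a + \<delta>) x + q\<^sup>2 * ?c * Y * rmom (a - \<delta>) x)"
    by (intro has_bochner_integral_add has_bochner_integral_mult_right I) auto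
  ultimately have "rmom (a - 2 * \<epsilon>) x - 2 * q * rmom (a - \<epsilon>) x + q\<^sup>2 * rmom a x
     \<le> q\<^sup>2 * ?c * (1 / Y) * rmom (a + \<delta>) x + q\<^sup>2 * ?c * Y * rmom (a - \<delta>) x"
  proof (rule has_bochner_integral_mono_real)
    fix t :: real
    show "?I (a - 2 * \<epsilon>) t - 2 * q * ?I (a - \<epsilon>) t + q\<^sup>2 * ?I a t
       \<le> q\<^sup>2 * ?c * (1 / Y) * ?I (a + \<delta>) t + q\<^sup>2 * ?c * Y * ?I (a - \<delta>) t"
    proof (cases "t > 0")
      case t: True
      define H where "H = heat t x * t powr (a - 1)"
      have H: "0 \<le> H" using t by (simp add: H_def heat_nonneg)
      have e: "heat t x * t powr (a + r - 1) = H * t powr r" for r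
        unfolding H_def mult.assoc by (subst powr_add[symmetric]) (simp add: algebra_simps)
      have te: "t powr (- \<epsilon>) = q * (t / R) powr (- \<epsilon>)" using t R by (simp add: q_def flip: powr_mult)
      have t2: "t powr (- 2 * \<epsilon>) = (t powr (- \<epsilon>))\<^sup>2"
        unfolding power2_eq_square by (subst powr_add[symmetric]) simp
      have td: "(t / R) powr \<delta> = t powr \<delta> / Y" "(t / R) powr (- \<delta>) = t powr (- \<delta>) * Y"
        using t R Y by (simp_all add: powr_divide RY)
      have "((t / R) powr (- \<epsilon>) - 1)\<^sup>2 \<le> ?c * ((t / R) powr \<delta> + (t / R) powr (- \<delta>))"
        using t R a \<delta> by (intro powr_difference_bound) auto
      hence "H * (q\<^sup>2 * ((t / R) powr (- \<epsilon>) - 1)\<^sup>2) \<le> H * (q\<^sup>2 * (?c * ((t / R) powr \<delta> + (t / R) powr (- \<delta>))))"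
        using H by (intro mult_left_mono) auto
      moreover have "H * (q\<^sup>2 * ((t / R) powr (- \<epsilon>) - 1)\<^sup>2)
         = H * t powr (- 2 * \<epsilon>) - 2 * q * (H * t powr (- \<epsilon>)) + q\<^sup>2 * H"
        unfolding t2 te by (simp add: power2_eq_square algebra_simps)
      moreover have "H * (q\<^sup>2 * (?c * ((t / R) powr \<delta> + (t / R) powr (- \<delta>))))
         = q\<^sup>2 * ?c * (1 / Y) * (H * t powr \<delta>) + q\<^sup>2 * ?c * Y * (H * t powr (- \<delta>))"
        unfolding td by (simp add: algebra_simps)
      ultimately have "H * t powr (- 2 * \<epsilon>) - 2 * q * (H * t powr (- \<epsilon>)) + q\<^sup>2 * H
         \<le> q\<^sup>2 * ?c * (1 / Y) * (H * t powr \<delta>) + q\<^sup>2 * ?c * Y * (H * t powr (- \<delta>))" by simp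
      moreover have "heat t x * t powr (a - 2 * \<epsilon> - 1) = H * t powr (- 2 * \<epsilon>)"
        "heat t x * t powr (a - \<epsilon> - 1) = H * t powr (- \<epsilon>)" "heat t x * t powr (a - 1) = H"
        "heat t x * t powr (a + \<delta> - 1) = H * t powr \<delta>" "heat t x * t powr (a - \<delta> - 1) = H * t powr (- \<delta>)"
        using e[of "- 2 * \<epsilon>"] e[of "- \<epsilon>"] e[of 0] e[of \<delta>] e[of "- \<delta>"] t by simp_all
      moreover have "indicator {0<..} t = (1 :: real)" using t by simp
      ultimately show ?thesis by (simp only: mult_1_left)
    qed simp
  qed
  also have "q\<^sup>2 * ?c * (1 / Y) * rmom (a + \<delta>) x + q\<^sup>2 * ?c * Y * rmom (a - \<delta>) x
     = q\<^sup>2 * ?c * (rmom a x + rmom (a + \<delta>) x * rmom (a - \<delta>) x / rmom a x)"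
  proof -
    have "K * (1 / (N / m)) * N + K * (N / m) * L = K * (m + N * L / m)" if "0 < m" "0 < N" for K m N L :: real
      using that by (simp add: distrib_left)
    from this[OF M(1,2)] show ?thesis unfolding Y_def .
  qed
  also have "\<dots> \<le> q\<^sup>2 * ?c * (rmom a x + B * rmom a x)"
  proof (intro mult_left_mono add_left_mono)
    show "rmom (a + \<delta>) x * rmom (a - \<delta>) x / rmom a x \<le> B * rmom a x"
      using B M by (simp add: pos_divide_le_eq power2_eq_square mult_ac)
  qed simp
  also have "\<dots> = 8 * (1 + B) / \<delta>\<^sup>2 * \<epsilon>\<^sup>2 * (q\<^sup>2 * rmom a x)"
    by (simp add: power_divide algebra_simps add_divide_distrib)
  \<comment> \<open>Jensen's inequality with \<open>2 * \<epsilon>\<close> makes the error relative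
    to the moment of order \<open>a - 2 * \<epsilon>\<close>, so that it becomes a factor on the
    left.\<close>
  also have "\<dots> \<le> 8 * (1 + B) / \<delta>\<^sup>2 * \<epsilon>\<^sup>2 * rmom (a - 2 * \<epsilon>) x"
  proof (rule mult_left_mono)
    show "q\<^sup>2 * rmom a x \<le> rmom (a - 2 * \<epsilon>) x"
      unfolding q2 Y_def using a \<delta> by (intro rmom_jensen) auto
    have "0 < B * (rmom a x)\<^sup>2" using B mult_pos_pos[OF M(2,3)] by linarith
    hence "0 < B" using M by (simp add: zero_less_mult_iff)
    thus "0 \<le> 8 * (1 + B) / \<delta>\<^sup>2 * \<epsilon>\<^sup>2" by simp
  qed
  finally have 1: "rmom (a - 2 * \<epsilon>) x - 2 * q * rmom (a - \<epsilon>) x + q\<^sup>2 * rmom a x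
     \<le> 8 * (1 + B) / \<delta>\<^sup>2 * \<epsilon>\<^sup>2 * rmom (a - 2 * \<epsilon>) x" .
  \<comment> \<open>Completing the square: the right side is the maximum of the left side over all
    \<open>q\<close>.\<close>
  have 2: "2 * q * rmom (a - \<epsilon>) x - q\<^sup>2 * rmom a x \<le> (rmom (a - \<epsilon>) x)\<^sup>2 / rmom a x"
  proof -
    have "0 \<le> (rmom (a - \<epsilon>) x - q * rmom a x)\<^sup>2" by simp
    hence "(2 * q * rmom (a - \<epsilon>) x - q\<^sup>2 * rmom a x) * rmom a x \<le> (rmom (a - \<epsilon>) x)\<^sup>2"
      by (simp add: power2_eq_square algebra_simps)
    thus ?thesis using M by (simp add: pos_le_divide_eq)
  qed
  have "rmom (a - 2 * \<epsilon>) x * (1 - 8 * (1 + B) / \<delta>\<^sup>2 * \<epsilon>\<^sup>2)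
     = rmom (a - 2 * \<epsilon>) x - 8 * (1 + B) / \<delta>\<^sup>2 * \<epsilon>\<^sup>2 * rmom (a - 2 * \<epsilon>) x"
    by (simp only: right_diff_distrib mult_1_right mult.commute)
  thus ?thesis using 1 2 by linarith
qed

section \<open>Consequences of the asymptotics\<close>

text \<open>The powers of \<open>lnorm x\<close> in the three asymptotic formulas cancel, so the
  quotient converges at infinity. The bound supplies the hypothesis of \<open>rmom_variance\<close>
  uniformly in the lattice point.\<close>

lemma rmom_ratio_bounded:
  assumes a: "0 < a - \<delta>" "0 < \<delta>" "a + \<delta> < real CARD('d) / 2"
  shows "\<exists>B. \<forall>x :: int ^ 'd::finite. rmom (a + \<delta>) x * rmom (a - \<delta>) x \<le> B * (rmom a x)\<^sup>2"
proof -
  obtain e :: "nat \<Rightarrow> int ^ 'd" where e: "bij e" "filterlim (\<lambda>n. lnorm (e n)) at_top sequentially"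
    by (rule lattice_enumeration)
  let ?A = "\<lambda>b n. lnorm (e n) powr (real CARD('d) - 2 * b) * rmom b (e n)"
  have A: "?A b \<longlonglongrightarrow> riesz_const b TYPE('d)" if "b \<in> {a - \<delta>, a, a + \<delta>}" for b
    using that a by (intro rmom_asymptotics e(2)) auto
  have c: "riesz_const a TYPE('d) \<noteq> 0" using riesz_const_pos[where 'd = 'd, of a] a by simp
  have "(\<lambda>n. ?A (a + \<delta>) n * ?A (a - \<delta>) n / (?A a n)\<^sup>2)
      \<longlonglongrightarrow> riesz_const (a + \<delta>) TYPE('d) * riesz_const (a - \<delta>) TYPE('d) / (riesz_const a TYPE('d))\<^sup>2"
    by (intro tendsto_intros A) (use c in auto)
  hence "Bseq (\<lambda>n. ?A (a + \<delta>) n * ?A (a - \<delta>) n / (?A a n)\<^sup>2)" by (intro convergent_imp_Bseq convergentI)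
  then obtain B where B: "\<And>n. \<bar>?A (a + \<delta>) n * ?A (a - \<delta>) n / (?A a n)\<^sup>2\<bar> \<le> B" unfolding Bseq_def by auto
  have B0: "0 \<le> B" using B[of 0] by (rule order_trans[OF abs_ge_zero])
  \<comment> \<open>The origin is treated separately: there the normalising powers of
    \<open>lnorm\<close> are 0 and the sequence bound carries no information.\<close>
  let ?q = "\<lambda>x :: int ^ 'd. rmom (a + \<delta>) x * rmom (a - \<delta>) x / (rmom a x)\<^sup>2"
  have "rmom (a + \<delta>) x * rmom (a - \<delta>) x \<le> max B (?q 0) * (rmom a x)\<^sup>2" for x :: "int ^ 'd"
  proof -
    have M: "0 < (rmom a x)\<^sup>2" using rmom_pos[of a x] a by simp
    have "?q x \<le> max B (?q 0)"
    proof (cases "x = 0")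
      case False
      obtain n where n: "x = e n" using e(1) by (metis bij_pointE)
      have "lnorm x \<noteq> 0"
      proof
        assume "lnorm x = 0"
        hence "(\<Sum>i\<in>UNIV. (real_of_int (x $ i))\<^sup>2) = 0" by (simp add: lnorm_def)
        hence "x = 0" by (simp add: sum_nonneg_eq_0_iff vec_eq_iff)
        thus False using False by simp
      qed
      hence l: "lnorm x > 0" using lnorm_nonneg[of x] by simp
      let ?l = "lnorm x powr (real CARD('d) - 2 * a)"
      have "lnorm x powr (real CARD('d) - 2 * (a + \<delta>)) * lnorm x powr (real CARD('d) - 2 * (a - \<delta>)) = ?l * ?l"
        by (simp add: powr_add[symmetric] algebra_simps)
      moreover have "(p * r) * (s * t) = (q * q) * (r * t)" if "p * s = q * q" for p q r s t :: real
        using that by (metis mult.commute mult.left_commute)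
      ultimately have "?A (a + \<delta>) n * ?A (a - \<delta>) n = (?l * ?l) * (rmom (a + \<delta>) x * rmom (a - \<delta>) x)"
        unfolding n[symmetric] by blast
      moreover have "(?A a n)\<^sup>2 = (?l * ?l) * (rmom a x)\<^sup>2" unfolding n[symmetric] by (subst power_mult_distrib) (simp only: power2_eq_square)
      moreover have "?l * ?l \<noteq> 0" using l by simp
      ultimately have "?A (a + \<delta>) n * ?A (a - \<delta>) n / (?A a n)\<^sup>2 = ?q x" by (simp only: mult_divide_mult_cancel_left simp_thms)
      thus ?thesis using B[of n] by (simp only: max.coboundedI1 abs_le_iff)
    qed simp
    thus ?thesis using M by (simp only: pos_divide_le_eq)
  qed
  thus ?thesis by blast
qed

text \<open>The moment decays like \<open>lnorm x powr (2 * a - CARD('d))\<close>; this is the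
  smallness at infinity that \<open>trunc\<close> requires.\<close>

lemma rmom_superlevel_finite:
  assumes a: "0 < a" "a < real CARD('d) / 2" and \<delta>: "0 < \<delta>"
  shows "finite {x :: int ^ 'd::finite. \<delta> < rmom a x}"
proof -
  obtain e :: "nat \<Rightarrow> int ^ 'd" where e: "bij e" "filterlim (\<lambda>n. lnorm (e n)) at_top sequentially"
    by (rule lattice_enumeration)
  let ?b = "real CARD('d) - 2 * a"
  have "((\<lambda>r. r powr (- ?b)) \<longlongrightarrow> 0) at_top" using a by (intro tendsto_neg_powr filterlim_ident) auto
  hence "(\<lambda>n. lnorm (e n) powr (- ?b)) \<longlonglongrightarrow> 0" by (rule filterlim_compose[OF _ e(2)])
  hence "(\<lambda>n. lnorm (e n) powr (- ?b) * (lnorm (e n) powr ?b * rmom a (e n))) \<longlonglongrightarrow> 0 * riesz_const a TYPE('d)"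
    by (intro tendsto_mult rmom_asymptotics e(2) a)
  hence lim: "(\<lambda>n. lnorm (e n) powr (- ?b) * (lnorm (e n) powr ?b * rmom a (e n))) \<longlonglongrightarrow> 0" by simp
  have ev: "\<forall>\<^sub>F n in sequentially. lnorm (e n) > 0" using e(2) by (simp add: filterlim_at_top_dense)
  have "\<forall>\<^sub>F n in sequentially. rmom a (e n) < \<delta>"
    using order_tendstoD(2)[OF lim \<delta>] ev
  proof eventually_elim
    case (elim n)
    have "lnorm (e n) powr (- b) * lnorm (e n) powr b = 1" for b
      using elim(2) by (simp add: powr_add[symmetric])
    hence "lnorm (e n) powr (- ?b) * (lnorm (e n) powr ?b * rmom a (e n)) = rmom a (e n)"
      by (simp only: mult.assoc[symmetric] mult_1_left)
    thus ?case using elim(1) by (simp only:)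
  qed
  hence "finite {n. \<not> rmom a (e n) < \<delta>}"
    by (simp add: cofinite_eq_sequentially[symmetric] eventually_cofinite)
  hence "finite (e ` {n. \<not> rmom a (e n) < \<delta>})" by simp
  moreover have "{x. \<delta> < rmom a x} \<subseteq> e ` {n. \<not> rmom a (e n) < \<delta>}"
  proof
    fix x :: "int ^ 'd" assume "x \<in> {x. \<delta> < rmom a x}"
    moreover obtain n where "x = e n" using e(1) by (metis bij_pointE)
    ultimately show "x \<in> e ` {n. \<not> rmom a (e n) < \<delta>}" by auto
  qed
  ultimately show ?thesis by (rule finite_subset[rotated])
qed

section \<open>Hardy weights from Riesz kernels\<close>

context jump_kernel
begin

lemma rmom_equation:
  assumes a: "\<sigma> < a" "a < real CARD('d) / 2"
  shows "ktot \<sigma> TYPE('d) * ennreal (rmom a x) = conv (rmom a) x + ennreal (gamma_ratio \<sigma> a * rmom (a - \<sigma>) x)"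
proof -
  have "ktot \<sigma> TYPE('d) * mom a x
     = (\<integral>\<^sup>+y. ennreal (kappa \<sigma> (x - y)) * mom a y \<partial>count_space UNIV)
       + ennreal (gamma_ratio \<sigma> a) * mom (a - \<sigma>) x"
    using kappa_equation_frac(2)[of \<sigma> a x] kappa_equation_1[of a x] a \<sigma>_pos \<sigma>_le_1
    by (cases "\<sigma> = 1") (simp_all add: ktot_def gamma_ratio_def)
  moreover have "ennreal (rmom a y) = mom a y" for y :: "int ^ 'd"
    using a \<sigma>_pos by (intro ennreal_rmom) auto
  moreover have "ennreal (gamma_ratio \<sigma> a * rmom (a - \<sigma>) x) = ennreal (gamma_ratio \<sigma> a) * mom (a - \<sigma>) x"
  proof -
    have "ennreal (rmom (a - \<sigma>) x) = mom (a - \<sigma>) x" using a \<sigma>_pos by (intro ennreal_rmom) auto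
    thus ?thesis using gamma_ratio_pos[OF \<sigma>_pos a(1)] by (subst ennreal_mult) (auto simp: rmom_def)
  qed
  ultimately show ?thesis by (simp add: conv_def)
qed

lemma wsa_eq:
  assumes a: "\<sigma> < a" "a < real CARD('d) / 2"
  shows "wsa \<sigma> a (x :: int ^ 'd) = gamma_ratio \<sigma> a * rmom (a - \<sigma>) x / rmom a x"
proof -
  have "kappa (- (a - \<sigma>)) x = rmom (a - \<sigma>) x / Gamma (a - \<sigma>)" "kappa (- a) x = rmom a x / Gamma a"
    using a \<sigma>_pos by (intro kappa_uminus; simp)+
  moreover have "Gamma a > 0" "Gamma (a - \<sigma>) > 0" using a \<sigma>_pos by (auto intro!: Gamma_real_pos)
  ultimately show ?thesis by (simp add: wsa_def gamma_ratio_def)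
qed

lemma wsa_nonneg:
  assumes a: "\<sigma> < a" "a < real CARD('d) / 2"
  shows "0 \<le> wsa \<sigma> a (x :: int ^ 'd)"
  using gamma_ratio_pos[OF \<sigma>_pos a(1)] by (simp add: wsa_eq[OF a] rmom_def)

lemma wsa_equation:
  assumes a: "\<sigma> < a" "a < real CARD('d) / 2"
  shows "ktot \<sigma> TYPE('d) * ennreal (rmom a x) = conv (rmom a) x + ennreal (wsa \<sigma> a x * rmom a x)"
  using rmom_equation[OF a, of x] rmom_pos[of a x] a \<sigma>_pos by (simp add: wsa_eq[OF a])

text \<open>One factor \<open>rmom a\<close> cancels against the denominator of the weight, leaving
  a product of two moments to which \<open>nn_integral_mom_mom\<close> applies.\<close>

lemma wsum_wsa:
  assumes a: "\<sigma> < a" "a < real CARD('d) / 2"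
  shows "wsum (wsa \<sigma> a) (rmom a :: int ^ 'd \<Rightarrow> real)
    = ennreal ((Gamma a)\<^sup>2 / Gamma (2 * a - \<sigma>)) * mom (2 * a - \<sigma>) (0 :: int ^ 'd)"
proof -
  have g: "0 < gamma_ratio \<sigma> a" by (rule gamma_ratio_pos[OF \<sigma>_pos a(1)])
  have "ennreal (wsa \<sigma> a x * (rmom a x)\<^sup>2) = ennreal (gamma_ratio \<sigma> a) * (mom (a - \<sigma>) x * mom a x)" for x :: "int ^ 'd"
  proof -
    have "wsa \<sigma> a x * (rmom a x)\<^sup>2 = gamma_ratio \<sigma> a * (rmom (a - \<sigma>) x * rmom a x)"
      using rmom_pos[of a x] a \<sigma>_pos by (simp add: wsa_eq[OF a] power2_eq_square)
    moreover have "ennreal (rmom a x) = mom a x" "ennreal (rmom (a - \<sigma>) x) = mom (a - \<sigma>) x"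
      using a \<sigma>_pos by (auto intro!: ennreal_rmom)
    ultimately show ?thesis using g by (simp add: ennreal_mult rmom_def)
  qed
  hence "wsum (wsa \<sigma> a) (rmom a :: int ^ 'd \<Rightarrow> real)
    = ennreal (gamma_ratio \<sigma> a) * (ennreal (Beta (a - \<sigma>) a) * mom (a - \<sigma> + a) (0 :: int ^ 'd))"
    using a \<sigma>_pos by (simp add: wsum_nn nn_integral_cmult nn_integral_mom_mom)
  moreover have "a - \<sigma> + a = 2 * a - \<sigma>" by simp
  moreover have "Gamma a > 0" "Gamma (a - \<sigma>) > 0" "Gamma (2 * a - \<sigma>) > 0"
    using a \<sigma>_pos by (auto intro!: Gamma_real_pos)
  hence "gamma_ratio \<sigma> a * Beta (a - \<sigma>) a = (Gamma a)\<^sup>2 / Gamma (2 * a - \<sigma>)" "0 \<le> Beta (a - \<sigma>) a"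
    by (auto simp: gamma_ratio_def Beta_def power2_eq_square)
  ultimately show ?thesis using g by (simp add: ennreal_mult[symmetric] mult.assoc[symmetric])
qed

lemma hardy_weight_wsa:
  assumes a: "\<sigma> < a" "a < real CARD('d) / 2"
  shows "hardy_weight \<sigma> (wsa \<sigma> a :: int ^ 'd \<Rightarrow> real)"
  using a \<sigma>_pos wsa_nonneg[OF a] wsa_equation[OF a]
  by (intro hardy_weight_supersolution[where s = "rmom a"]) (auto intro!: rmom_pos)

text \<open>The second claim tests an arbitrary Hardy weight on \<open>rmom a\<close>, although this
  function lacks finite support; it is the bound on a competing weight in
  \<open>critical_wsa\<close>.\<close>

lemma wsa_energy:
  assumes a: "\<sigma> < a" "a < real CARD('d) / 2"
  shows "Qform \<sigma> (rmom a :: int ^ 'd \<Rightarrow> real) = wsum (wsa \<sigma> a) (rmom a :: int ^ 'd \<Rightarrow> real)"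
    and "hardy_weight \<sigma> w' \<Longrightarrow> wsum w' (rmom a :: int ^ 'd \<Rightarrow> real) \<le> wsum (wsa \<sigma> a) (rmom a :: int ^ 'd \<Rightarrow> real)"
    and "Qform \<sigma> (rmom a :: int ^ 'd \<Rightarrow> real) < top \<Longrightarrow> (rmom a :: int ^ 'd \<Rightarrow> real) \<in> D0 \<sigma>"
proof -
  have W: "wsum (wsa \<sigma> a) (rmom a :: int ^ 'd \<Rightarrow> real) = (\<integral>\<^sup>+x. ennreal (wsa \<sigma> a x * rmom a x * rmom a x) \<partial>count_space (UNIV :: (int ^ 'd) set))"
    by (simp add: wsum_nn power2_eq_square mult.assoc)
  have u: "\<And>x :: int ^ 'd. 0 \<le> rmom a x" by (simp add: rmom_def)
  have h: "\<And>x :: int ^ 'd. 0 \<le> wsa \<sigma> a x * rmom a x" using u wsa_nonneg[OF a] by simp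
  have l: "\<And>\<delta>. 0 < \<delta> \<Longrightarrow> finite {x :: int ^ 'd. \<delta> < rmom a x}" using a \<sigma>_pos by (intro rmom_superlevel_finite) auto
  note * = trunc_energy_limit[of "rmom a" "\<lambda>x. wsa \<sigma> a x * rmom a x", OF u h l wsa_equation[OF a]]
  show "Qform \<sigma> (rmom a :: int ^ 'd \<Rightarrow> real) = wsum (wsa \<sigma> a) (rmom a :: int ^ 'd \<Rightarrow> real)"
    unfolding W by (rule *(1))
  show "hardy_weight \<sigma> w' \<Longrightarrow> wsum w' (rmom a :: int ^ 'd \<Rightarrow> real) \<le> wsum (wsa \<sigma> a) (rmom a :: int ^ 'd \<Rightarrow> real)"
    unfolding W by (rule *(2))
  show "Qform \<sigma> (rmom a :: int ^ 'd \<Rightarrow> real) < top \<Longrightarrow> (rmom a :: int ^ 'd \<Rightarrow> real) \<in> D0 \<sigma>"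
    by (rule *(3))
qed

text \<open>Attainment alone excludes null-criticality, so it is left open here whether the weight
  is critical.\<close>

lemma not_null_critical_below:
  assumes a: "\<sigma> < a" "a < ((real CARD('d) / 2) + \<sigma>) / 2"
  shows "\<not> null_critical \<sigma> (wsa \<sigma> a :: int ^ 'd \<Rightarrow> real)"
proof
  have a': "a < real CARD('d) / 2" "0 < 2 * a - \<sigma>" "2 * a - \<sigma> < real CARD('d) / 2" using a \<sigma>_pos by auto
  assume "null_critical \<sigma> (wsa \<sigma> a :: int ^ 'd \<Rightarrow> real)"
  hence n: "\<not> (\<exists>v\<in>D0 \<sigma>. v \<noteq> (\<lambda>x. 0) \<and> Qform \<sigma> v = wsum (wsa \<sigma> a) (v :: int ^ 'd \<Rightarrow> real))"
    unfolding null_critical_def positive_critical_def by blast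
  have "wsum (wsa \<sigma> a) (rmom a :: int ^ 'd \<Rightarrow> real) < top"
    unfolding wsum_wsa[OF a(1) a'(1)] using mom_finite[OF a'(2,3), of 0] by (simp add: ennreal_mult_less_top)
  hence "(rmom a :: int ^ 'd \<Rightarrow> real) \<in> D0 \<sigma>" using wsa_energy[OF a(1) a'(1)] by simp
  moreover have "(rmom a :: int ^ 'd \<Rightarrow> real) \<noteq> (\<lambda>x. 0)" using rmom_pos[of a "0 :: int ^ 'd"] a a' \<sigma>_pos by force
  ultimately show False using n wsa_energy(1)[OF a(1) a'(1)] by blast
qed

section \<open>Failure of criticality above the midpoint\<close>

lemma wsa_asymptotics:
  fixes e :: "nat \<Rightarrow> int ^ 'd"
  assumes e: "filterlim (\<lambda>n. lnorm (e n)) at_top sequentially" and a: "\<sigma> < a" "a < real CARD('d) / 2"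
  shows "(\<lambda>n. lnorm (e n) powr (2 * \<sigma>) * wsa \<sigma> a (e n))
    \<longlonglongrightarrow> 4 powr \<sigma> * (gamma_ratio \<sigma> a * gamma_ratio \<sigma> ((real CARD('d) / 2) + \<sigma> - a))"
proof -
  let ?A = "\<lambda>b n. lnorm (e n) powr (2 * (real CARD('d) / 2) - 2 * b) * rmom b (e n)"
  have A: "?A b \<longlonglongrightarrow> riesz_const b TYPE('d)" if "b \<in> {a - \<sigma>, a}" for b
  proof -
    have "2 * (real CARD('d) / 2) = real CARD('d)" by simp
    moreover have "(\<lambda>n. lnorm (e n) powr (real CARD('d) - 2 * b) * rmom b (e n)) \<longlonglongrightarrow> riesz_const b TYPE('d)"
      using that a \<sigma>_pos by (intro rmom_asymptotics e) auto
    ultimately show ?thesis by metis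
  qed
  have r: "riesz_const a TYPE('d) > 0" "riesz_const (a - \<sigma>) TYPE('d) > 0" using a \<sigma>_pos by (auto intro!: riesz_const_pos)
  have "(\<lambda>n. gamma_ratio \<sigma> a * ?A (a - \<sigma>) n / ?A a n) \<longlonglongrightarrow> gamma_ratio \<sigma> a * riesz_const (a - \<sigma>) TYPE('d) / riesz_const a TYPE('d)"
    by (intro tendsto_intros A) (use r in auto)
  \<comment> \<open>The quotient of the two Riesz constants is \<open>4 powr \<sigma>\<close> times
    \<open>gamma_ratio \<sigma>\<close> at the reflection of \<open>a\<close> in the
    midpoint.\<close>
  also have "gamma_ratio \<sigma> a * riesz_const (a - \<sigma>) TYPE('d) / riesz_const a TYPE('d)
     = 4 powr \<sigma> * (gamma_ratio \<sigma> a * gamma_ratio \<sigma> ((real CARD('d) / 2) + \<sigma> - a))"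
  proof -
    have "4 powr ((real CARD('d) / 2) - (a - \<sigma>)) = 4 powr \<sigma> * 4 powr ((real CARD('d) / 2) - a)"
      by (simp only: powr_add[symmetric]) (simp add: algebra_simps)
    moreover have "(real CARD('d) / 2) - (a - \<sigma>) = (real CARD('d) / 2) + \<sigma> - a" "(real CARD('d) / 2) + \<sigma> - a - \<sigma> = (real CARD('d) / 2) - a" by simp_all
    moreover have "Gamma ((real CARD('d) / 2) - a) > 0" using a by (intro Gamma_real_pos) simp
    moreover have "g * (s * p * G / S) / (p * H / S) = s * (g * (G / H))" if "p > 0" "S > 0" "H > 0" for g s p G S H :: real
      using that by (simp add: field_simps)
    moreover have "(2 * sqrt pi) ^ CARD('d) > 0" "4 powr ((real CARD('d) / 2) - a) > 0" by simp_all
    ultimately show ?thesis unfolding riesz_const_def gamma_ratio_def[of \<sigma> "(real CARD('d) / 2) + \<sigma> - a"] by metis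
  qed
  finally have L: "(\<lambda>n. gamma_ratio \<sigma> a * ?A (a - \<sigma>) n / ?A a n) \<longlonglongrightarrow>
      4 powr \<sigma> * (gamma_ratio \<sigma> a * gamma_ratio \<sigma> ((real CARD('d) / 2) + \<sigma> - a))" .
  have "\<forall>\<^sub>F n in sequentially. lnorm (e n) > 0" using e by (simp add: filterlim_at_top_dense)
  hence "\<forall>\<^sub>F n in sequentially. gamma_ratio \<sigma> a * ?A (a - \<sigma>) n / ?A a n = lnorm (e n) powr (2 * \<sigma>) * wsa \<sigma> a (e n)"
  proof eventually_elim
    case (elim n)
    have "lnorm (e n) powr (2 * (real CARD('d) / 2) - 2 * (a - \<sigma>)) = lnorm (e n) powr (2 * \<sigma>) * lnorm (e n) powr (2 * (real CARD('d) / 2) - 2 * a)"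
      by (simp only: powr_add[symmetric]) (simp add: algebra_simps)
    moreover have "lnorm (e n) powr (2 * (real CARD('d) / 2) - 2 * a) > 0" "rmom a (e n) > 0"
      using elim a \<sigma>_pos by (auto intro!: rmom_pos)
    moreover have "g * (s * p * G) / (p * H) = s * (g * G / H)" if "p > 0" "H > 0" for g s p G H :: real
      using that by (simp add: field_simps)
    ultimately show ?case unfolding wsa_eq[OF a] by metis
  qed
  from tendsto_cong[THEN iffD1, OF this L] show ?thesis .
qed

text \<open>A larger order means slower decay in space, so the quotient grows like
  \<open>lnorm x powr (2 * (a - b))\<close>. This provides a point at which the minimum in
  \<open>not_critical_above\<close> is taken by the other branch.\<close>

lemma rmom_quotient_unbounded:
  assumes ab: "0 < b" "b < a" "a < real CARD('d) / 2"
  shows "\<exists>x :: int ^ 'd. M * rmom b x < rmom a x"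
proof -
  obtain e :: "nat \<Rightarrow> int ^ 'd" where e: "bij e" "filterlim (\<lambda>n. lnorm (e n)) at_top sequentially"
    by (rule lattice_enumeration)
  let ?l = "\<lambda>n. lnorm (e n)"
  let ?A = "\<lambda>b n. ?l n powr (real CARD('d) - 2 * b) * rmom b (e n)"
  have A: "?A c \<longlonglongrightarrow> riesz_const c TYPE('d)" if "c \<in> {a, b}" for c
    using that ab by (intro rmom_asymptotics e) auto
  have r: "riesz_const a TYPE('d) > 0" using ab by (auto intro!: riesz_const_pos)
  have "((\<lambda>r. r powr (- (2 * (a - b)))) \<longlongrightarrow> 0) at_top" using ab by (intro tendsto_neg_powr filterlim_ident) auto
  hence "(\<lambda>n. ?l n powr (- (2 * (a - b)))) \<longlonglongrightarrow> 0" by (rule filterlim_compose[OF _ e(2)])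
  hence "(\<lambda>n. M * (?l n powr (- (2 * (a - b))) * ?A b n)) \<longlonglongrightarrow> M * (0 * riesz_const b TYPE('d))"
    by (intro tendsto_intros A) auto
  hence "(\<lambda>n. M * (?l n powr (- (2 * (a - b))) * ?A b n)) \<longlonglongrightarrow> 0" by simp
  from tendsto_diff[OF A[of a] this]
  have "(\<lambda>n. ?A a n - M * (?l n powr (- (2 * (a - b))) * ?A b n)) \<longlonglongrightarrow> riesz_const a TYPE('d)" by simp
  from order_tendstoD(1)[OF this r]
  obtain n where n: "0 < ?A a n - M * (?l n powr (- (2 * (a - b))) * ?A b n)"
    by (auto dest: eventually_happens)
  have "?l n powr (- (2 * (a - b))) * ?A b n = ?l n powr (real CARD('d) - 2 * a) * rmom b (e n)"
    unfolding mult.assoc[symmetric] by (subst powr_add[symmetric]) (simp add: algebra_simps)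
  hence "0 < ?l n powr (real CARD('d) - 2 * a) * (rmom a (e n) - M * rmom b (e n))"
    using n by (simp only: right_diff_distrib mult.left_commute)
  hence "M * rmom b (e n) < rmom a (e n)" by (simp add: zero_less_mult_iff)
  thus ?thesis by blast
qed

lemma conv_mono: "(\<And>y. s y \<le> t y) \<Longrightarrow> conv s x \<le> conv t x"
  unfolding conv_def by (intro nn_integral_mono mult_left_mono ennreal_leI) auto

lemma conv_cmult: "0 \<le> c \<Longrightarrow> (\<And>y. 0 \<le> s y) \<Longrightarrow> conv (\<lambda>y. c * s y) x = ennreal c * conv s x"
  unfolding conv_def by (subst nn_integral_cmult[symmetric]) (auto simp: ennreal_mult mult_ac)

text \<open>\<open>conv\<close> is monotone, so the minimum of two supersolutions satisfies at each
  point the inequality of the branch attained there. On the branch of \<open>rmom b\<close> the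
  admissible weight is \<open>wsa \<sigma> b\<close>, which exceeds \<open>wsa \<sigma> a\<close>
  off the finite set \<open>F\<close>.\<close>

lemma not_critical_above:
  assumes a: "((real CARD('d) / 2) + \<sigma>) / 2 < a" "a < real CARD('d) / 2"
  shows "\<not> critical \<sigma> (wsa \<sigma> a :: int ^ 'd \<Rightarrow> real)"
proof
  assume crit: "critical \<sigma> (wsa \<sigma> a :: int ^ 'd \<Rightarrow> real)"
  define b where "b = ((real CARD('d) / 2) + \<sigma>) / 2"
  have b: "\<sigma> < b" "b < a" "b < real CARD('d) / 2" and a': "\<sigma> < a" using a by (auto simp: b_def)
  obtain e :: "nat \<Rightarrow> int ^ 'd" where e: "bij e" "filterlim (\<lambda>n. lnorm (e n)) at_top sequentially"
    by (rule lattice_enumeration)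
  define F where "F = {x :: int ^ 'd. \<not> wsa \<sigma> a x < wsa \<sigma> b x}"
  have F: "finite F"
  proof -
    \<comment> \<open>\<open>b - (a - b)\<close> is the reflection of \<open>a\<close> in the
      midpoint, and it exceeds \<open>\<sigma>\<close> exactly because
      \<open>a < CARD('d) / 2\<close>.\<close>
    have "gamma_ratio \<sigma> (b + (a - b)) * gamma_ratio \<sigma> (b - (a - b)) < (gamma_ratio \<sigma> b)\<^sup>2"
      using a b \<sigma>_pos by (intro gamma_ratio_strict_log_concave) (auto simp: b_def field_simps)
    hence "4 powr \<sigma> * (gamma_ratio \<sigma> a * gamma_ratio \<sigma> ((real CARD('d) / 2) + \<sigma> - a))
         < 4 powr \<sigma> * (gamma_ratio \<sigma> b * gamma_ratio \<sigma> ((real CARD('d) / 2) + \<sigma> - b))"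
    proof -
      have "b + (a - b) = a" "b - (a - b) = (real CARD('d) / 2) + \<sigma> - a" "(real CARD('d) / 2) + \<sigma> - b = b" by (auto simp: b_def field_simps)
      thus ?thesis using \<open>gamma_ratio \<sigma> (b + (a - b)) * gamma_ratio \<sigma> (b - (a - b)) < (gamma_ratio \<sigma> b)\<^sup>2\<close>
        by (simp only: power2_eq_square) simp
    qed
    then obtain c where c: "4 powr \<sigma> * (gamma_ratio \<sigma> a * gamma_ratio \<sigma> ((real CARD('d) / 2) + \<sigma> - a)) < c"
      "c < 4 powr \<sigma> * (gamma_ratio \<sigma> b * gamma_ratio \<sigma> ((real CARD('d) / 2) + \<sigma> - b))" using dense by blast
    have "\<forall>\<^sub>F n in sequentially. wsa \<sigma> a (e n) < wsa \<sigma> b (e n)"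
      using order_tendstoD(2)[OF wsa_asymptotics[OF e(2) a' a(2)] c(1)]
        order_tendstoD(1)[OF wsa_asymptotics[OF e(2) b(1) b(3)] c(2)]
    proof eventually_elim
      case (elim n)
      hence "lnorm (e n) powr (2 * \<sigma>) * wsa \<sigma> a (e n) < lnorm (e n) powr (2 * \<sigma>) * wsa \<sigma> b (e n)" by linarith
      thus ?case by (simp add: mult_less_cancel_left)
    qed
    hence "finite {n. \<not> wsa \<sigma> a (e n) < wsa \<sigma> b (e n)}"
      by (simp add: cofinite_eq_sequentially[symmetric] eventually_cofinite)
    moreover have "F \<subseteq> e ` {n. \<not> wsa \<sigma> a (e n) < wsa \<sigma> b (e n)}"
    proof
      fix x assume "x \<in> F"
      moreover obtain n where "x = e n" using e(1) by (metis bij_pointE)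
      ultimately show "x \<in> e ` {n. \<not> wsa \<sigma> a (e n) < wsa \<sigma> b (e n)}" by (auto simp: F_def)
    qed
    ultimately show ?thesis by (meson finite_imageI finite_subset)
  qed
  have ua: "0 < rmom a x" and ub: "0 < rmom b x" for x :: "int ^ 'd" using a' a b \<sigma>_pos by (auto intro!: rmom_pos)
  \<comment> \<open>The sum bounds every quotient on \<open>F\<close>, so on \<open>F\<close> the
    minimum is \<open>rmom a\<close>; the summand 1 keeps \<open>M\<close> positive when
    \<open>F\<close> is empty.\<close>
  define M where "M = 1 + (\<Sum>x\<in>F. rmom a x / rmom b x)"
  have M: "0 < M" unfolding M_def using ua ub by (intro add_pos_nonneg sum_nonneg) (auto intro: less_imp_le)
  have MF: "rmom a x \<le> M * rmom b x" if "x \<in> F" for x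
  proof -
    have "rmom a x / rmom b x \<le> (\<Sum>x\<in>F. rmom a x / rmom b x)"
      using F that ua ub by (intro member_le_sum) (auto intro: less_imp_le divide_nonneg_nonneg)
    hence "rmom a x / rmom b x \<le> M" by (simp add: M_def)
    thus ?thesis using ub[of x] by (simp add: pos_divide_le_eq)
  qed
  obtain x1 :: "int ^ 'd" where x1: "M * rmom b x1 < rmom a x1"
    using rmom_quotient_unbounded[of b a M] a b \<sigma>_pos by auto
  have x1F: "wsa \<sigma> a x1 < wsa \<sigma> b x1" using MF[of x1] x1 by (force simp: F_def)
  define s where "s x = min (rmom a x) (M * rmom b x)" for x :: "int ^ 'd"
  \<comment> \<open>Raising the weight at a single point is enough to contradict
    criticality.\<close>
  define w' where "w' = (wsa \<sigma> a :: int ^ 'd \<Rightarrow> real)(x1 := wsa \<sigma> b x1)"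
  have "hardy_weight \<sigma> w'"
  proof (rule hardy_weight_supersolution[of s])
    show "0 < s x" for x using ua[of x] ub[of x] M by (simp add: s_def)
    show "0 \<le> w' x" for x using wsa_nonneg[OF a' a(2)] wsa_nonneg[OF b(1,3)] by (simp add: w'_def)
    show "conv s x + ennreal (w' x * s x) \<le> ktot \<sigma> TYPE('d) * ennreal (s x)" for x
    proof (cases "rmom a x \<le> M * rmom b x")
      case True
      hence "s x = rmom a x" "w' x = wsa \<sigma> a x" using x1 by (auto simp: s_def w'_def)
      moreover have "conv s x \<le> conv (rmom a) x" by (rule conv_mono) (simp add: s_def)
      ultimately show ?thesis by (simp add: wsa_equation[OF a' a(2)] add_right_mono)
    next
      case False
      hence sx: "s x = M * rmom b x" by (simp add: s_def)
      have "x \<notin> F" using MF[of x] False by blast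
      hence "w' x \<le> wsa \<sigma> b x" by (auto simp: w'_def F_def)
      hence "w' x * s x \<le> M * (wsa \<sigma> b x * rmom b x)" unfolding sx using M ub[of x] by (simp add: mult_ac)
      hence "conv s x + ennreal (w' x * s x) \<le> conv (\<lambda>y. M * rmom b y) x + ennreal (M * (wsa \<sigma> b x * rmom b x))"
        by (intro add_mono conv_mono ennreal_leI) (simp_all add: s_def)
      also have "conv (\<lambda>y. M * rmom b y) x = ennreal M * conv (rmom b) x"
        using M ub by (intro conv_cmult) (auto intro: less_imp_le)
      also have "ennreal M * conv (rmom b) x + ennreal (M * (wsa \<sigma> b x * rmom b x)) = ennreal M * (ktot \<sigma> TYPE('d) * ennreal (rmom b x))"
        using M ub[of x] wsa_nonneg[OF b(1,3), of x] by (simp add: wsa_equation[OF b(1,3)] ennreal_mult distrib_left)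
      also have "\<dots> = ktot \<sigma> TYPE('d) * ennreal (s x)" unfolding sx using M ub[of x] by (simp add: ennreal_mult mult_ac)
      finally show ?thesis .
    qed
  qed
  moreover have "wsa \<sigma> a x \<le> w' x" for x using x1F by (simp add: w'_def)
  ultimately have "w' = wsa \<sigma> a" using crit unfolding critical_def by blast
  hence "w' x1 = wsa \<sigma> a x1" by simp
  thus False using x1F by (simp add: w'_def)
qed

end

section \<open>Criticality and absence of a ground state of finite energy at the midpoint\<close>

lemma wsum_increase_at:
  assumes w: "\<And>y. 0 \<le> w y" "\<And>y. w y \<le> w' y"
  shows "wsum w f + ennreal ((w' x - w x) * (f x)\<^sup>2) \<le> wsum w' (f :: int ^ 'd::finite \<Rightarrow> real)"
proof -
  let ?c = "ennreal ((w' x - w x) * (f x)\<^sup>2)"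
  have "wsum w f + ?c = (\<integral>\<^sup>+y. ennreal (w y * (f y)\<^sup>2) \<partial>count_space UNIV) + (\<integral>\<^sup>+y. ?c * indicator {x} y \<partial>count_space UNIV)"
    by (simp add: wsum_nn nn_integral_cmult_indicator)
  also have "\<dots> = (\<integral>\<^sup>+y. ennreal (w y * (f y)\<^sup>2) + ?c * indicator {x} y \<partial>count_space UNIV)"
    by (rule nn_integral_add[symmetric]) auto
  also have "\<dots> \<le> (\<integral>\<^sup>+y. ennreal (w' y * (f y)\<^sup>2) \<partial>count_space UNIV)"
  proof (rule nn_integral_mono)
    fix y
    show "ennreal (w y * (f y)\<^sup>2) + ?c * indicator {x} y \<le> ennreal (w' y * (f y)\<^sup>2)"
    proof (cases "y = x")
      case True
      have "ennreal (w x * (f x)\<^sup>2) + ?c = ennreal (w x * (f x)\<^sup>2 + (w' x - w x) * (f x)\<^sup>2)"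
        using w[of x] by (intro ennreal_plus[symmetric]) auto
      thus ?thesis using True by (simp add: left_diff_distrib)
    qed (use w[of y] in \<open>auto intro!: ennreal_leI mult_right_mono\<close>)
  qed
  finally show ?thesis by (simp add: wsum_nn)
qed

context jump_kernel
begin

text \<open>Pointwise, \<open>rmom_variance\<close> bounds
  \<open>(rmom (b - \<epsilon>) x)\<^sup>2 / rmom b x\<close> from below by nearly
  \<open>rmom (b - 2 * \<epsilon>) x\<close>. The resulting product of orders
  \<open>b - \<sigma>\<close> and \<open>b - 2 * \<epsilon>\<close> has the same total order
  \<open>CARD('d) / 2 - 2 * \<epsilon>\<close> as the energy of
  \<open>rmom (b - \<epsilon>)\<close>, so both sums are multiples of one moment at the origin, and
  \<open>Gamma_midpoint\<close> compares the multiples.\<close>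

lemma wsum_wsa_lower:
  assumes \<sigma>: "\<sigma> < real CARD('d) / 2" and b: "b = (real CARD('d) / 2 + \<sigma>) / 2"
    and \<delta>: "\<sigma> < b - \<delta>" "b + \<delta> < real CARD('d) / 2" and \<epsilon>: "0 < \<epsilon>" "2 * \<epsilon> \<le> \<delta>"
    and B: "\<And>x :: int ^ 'd. rmom (b + \<delta>) x * rmom (b - \<delta>) x \<le> B * (rmom b x)\<^sup>2"
    and K: "0 \<le> 1 - 8 * (1 + B) / \<delta>\<^sup>2 * \<epsilon>\<^sup>2"
  shows "ennreal (1 - 8 * (1 + B) / \<delta>\<^sup>2 * \<epsilon>\<^sup>2) * wsum (wsa \<sigma> (b - \<epsilon>)) (rmom (b - \<epsilon>) :: int ^ 'd \<Rightarrow> real)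
    \<le> wsum (wsa \<sigma> b) (rmom (b - \<epsilon>) :: int ^ 'd \<Rightarrow> real)"
proof -
  let ?K = "1 - 8 * (1 + B) / \<delta>\<^sup>2 * \<epsilon>\<^sup>2" and ?d = "real CARD('d) / 2"
  have b2: "2 * b = ?d + \<sigma>" by (simp add: b)
  have r: "\<sigma> < b" "b < ?d" "\<sigma> < b - \<epsilon>" "b - \<epsilon> < ?d" "0 < b - 2 * \<epsilon>" "b - 2 * \<epsilon> < ?d" "0 < b - \<sigma>" "b - \<sigma> < ?d"
    "0 < ?d - 2 * \<epsilon>" "0 < b"
    using \<sigma> \<delta> \<epsilon> \<sigma>_pos b2 by auto
  have s: "2 * (b - \<epsilon>) - \<sigma> = ?d - 2 * \<epsilon>" "b - \<sigma> + (b - 2 * \<epsilon>) = ?d - 2 * \<epsilon>" by (auto simp: b field_simps)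
  have G: "Gamma b > 0" "Gamma (b - \<sigma>) > 0" "Gamma (?d - 2 * \<epsilon>) > 0" "Gamma (b - 2 * \<epsilon>) > 0"
    using r by (simp_all only: Gamma_real_pos)
  have g: "0 < gamma_ratio \<sigma> b" by (rule gamma_ratio_pos[OF \<sigma>_pos r(1)])
  have pt: "ennreal ?K * (ennreal (gamma_ratio \<sigma> b) * (mom (b - \<sigma>) x * mom (b - 2 * \<epsilon>) x))
     \<le> ennreal (wsa \<sigma> b x * (rmom (b - \<epsilon>) x)\<^sup>2)" for x :: "int ^ 'd"
  proof -
    have "rmom (b - 2 * \<epsilon>) x * ?K \<le> (rmom (b - \<epsilon>) x)\<^sup>2 / rmom b x"
      using \<delta> \<epsilon> \<sigma>_pos by (intro rmom_variance B) auto
    hence "gamma_ratio \<sigma> b * rmom (b - \<sigma>) x * (rmom (b - 2 * \<epsilon>) x * ?K)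
        \<le> gamma_ratio \<sigma> b * rmom (b - \<sigma>) x * ((rmom (b - \<epsilon>) x)\<^sup>2 / rmom b x)"
      using g by (intro mult_left_mono) (auto simp: rmom_def)
    also have "\<dots> = wsa \<sigma> b x * (rmom (b - \<epsilon>) x)\<^sup>2" by (simp add: wsa_eq[OF r(1,2)])
    finally have "ennreal (gamma_ratio \<sigma> b * rmom (b - \<sigma>) x * (rmom (b - 2 * \<epsilon>) x * ?K))
       \<le> ennreal (wsa \<sigma> b x * (rmom (b - \<epsilon>) x)\<^sup>2)" by (rule ennreal_leI)
    moreover have "ennreal (gamma_ratio \<sigma> b * rmom (b - \<sigma>) x * (rmom (b - 2 * \<epsilon>) x * ?K))
       = ennreal ?K * (ennreal (gamma_ratio \<sigma> b) * (mom (b - \<sigma>) x * mom (b - 2 * \<epsilon>) x))"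
    proof -
      have "ennreal (gamma_ratio \<sigma> b * rmom (b - \<sigma>) x * (rmom (b - 2 * \<epsilon>) x * ?K))
         = ennreal (gamma_ratio \<sigma> b) * ennreal (rmom (b - \<sigma>) x) * (ennreal (rmom (b - 2 * \<epsilon>) x) * ennreal ?K)"
        using g K by (simp add: ennreal_mult rmom_def)
      moreover have "ennreal (rmom (b - \<sigma>) x) = mom (b - \<sigma>) x" "ennreal (rmom (b - 2 * \<epsilon>) x) = mom (b - 2 * \<epsilon>) x"
        using r by (auto intro!: ennreal_rmom)
      ultimately show ?thesis by (simp only: mult_ac)
    qed
    ultimately show ?thesis by simp
  qed
  have "(Gamma (b - \<epsilon>))\<^sup>2 \<le> Gamma b * Gamma (b - 2 * \<epsilon>)"
  proof -
    have "(Gamma ((b + (b - 2 * \<epsilon>)) / 2))\<^sup>2 \<le> Gamma b * Gamma (b - 2 * \<epsilon>)"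
      using r \<sigma>_pos by (intro Gamma_midpoint) auto
    moreover have "(b + (b - 2 * \<epsilon>)) / 2 = b - \<epsilon>" by simp
    ultimately show ?thesis by (simp only:)
  qed
  hence "(Gamma (b - \<epsilon>))\<^sup>2 / Gamma (?d - 2 * \<epsilon>) \<le> Gamma b * Gamma (b - 2 * \<epsilon>) / Gamma (?d - 2 * \<epsilon>)"
    using G by (intro divide_right_mono) auto
  also have "\<dots> = gamma_ratio \<sigma> b * Beta (b - \<sigma>) (b - 2 * \<epsilon>)"
    using G unfolding gamma_ratio_def Beta_def s by simp
  finally have "ennreal ((Gamma (b - \<epsilon>))\<^sup>2 / Gamma (?d - 2 * \<epsilon>)) \<le> ennreal (gamma_ratio \<sigma> b) * ennreal (Beta (b - \<sigma>) (b - 2 * \<epsilon>))"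
    using g by (simp add: ennreal_mult'[symmetric] ennreal_leI)
  hence "wsum (wsa \<sigma> (b - \<epsilon>)) (rmom (b - \<epsilon>) :: int ^ 'd \<Rightarrow> real)
     \<le> ennreal (gamma_ratio \<sigma> b) * ennreal (Beta (b - \<sigma>) (b - 2 * \<epsilon>)) * mom (?d - 2 * \<epsilon>) (0 :: int ^ 'd)"
    unfolding wsum_wsa[OF r(3,4)] s by (intro mult_right_mono) auto
  also have "\<dots> = (\<integral>\<^sup>+x. ennreal (gamma_ratio \<sigma> b) * (mom (b - \<sigma>) x * mom (b - 2 * \<epsilon>) x) \<partial>count_space (UNIV :: (int ^ 'd) set))"
    using r by (simp add: nn_integral_cmult nn_integral_mom_mom s mult.assoc)
  finally have "ennreal ?K * wsum (wsa \<sigma> (b - \<epsilon>)) (rmom (b - \<epsilon>) :: int ^ 'd \<Rightarrow> real)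
     \<le> ennreal ?K * (\<integral>\<^sup>+x. ennreal (gamma_ratio \<sigma> b) * (mom (b - \<sigma>) x * mom (b - 2 * \<epsilon>) x) \<partial>count_space (UNIV :: (int ^ 'd) set))"
    by (intro mult_left_mono) auto
  also have "\<dots> = (\<integral>\<^sup>+x. ennreal ?K * (ennreal (gamma_ratio \<sigma> b) * (mom (b - \<sigma>) x * mom (b - 2 * \<epsilon>) x)) \<partial>count_space (UNIV :: (int ^ 'd) set))"
    by (rule nn_integral_cmult[symmetric]) simp
  also have "\<dots> \<le> wsum (wsa \<sigma> b) (rmom (b - \<epsilon>) :: int ^ 'd \<Rightarrow> real)"
    unfolding wsum_nn by (intro nn_integral_mono pt)
  finally show ?thesis .
qed

text \<open>A larger Hardy weight gains at a point at most the deficit between the energy and the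
  weighted sum of \<open>rmom (b - \<epsilon>)\<close>. The deficit is at most
  \<open>K * \<epsilon>\<^sup>2\<close> times an energy that \<open>mom_0_bound\<close> bounds by a
  multiple of \<open>1 / \<epsilon>\<close>, hence vanishes in the limit.\<close>

lemma critical_wsa:
  assumes \<sigma>: "\<sigma> < real CARD('d) / 2" and b: "b = (real CARD('d) / 2 + \<sigma>) / 2"
  shows "critical \<sigma> (wsa \<sigma> b :: int ^ 'd \<Rightarrow> real)"
  unfolding critical_def
proof (intro conjI allI impI)
  let ?d = "real CARD('d) / 2"
  have r: "\<sigma> < b" "b < ?d" using \<sigma> by (auto simp: b)
  show "hardy_weight \<sigma> (wsa \<sigma> b :: int ^ 'd \<Rightarrow> real)" by (rule hardy_weight_wsa[OF r])
  fix w' :: "int ^ 'd \<Rightarrow> real" assume "hardy_weight \<sigma> w' \<and> (\<forall>x. wsa \<sigma> b x \<le> w' x)"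
  hence w': "hardy_weight \<sigma> w'" "\<And>x. wsa \<sigma> b x \<le> w' x" by auto
  \<comment> \<open>\<open>b\<close> lies at distance \<open>(?d - \<sigma>) / 2\<close> from both
    \<open>\<sigma>\<close> and \<open>?d\<close>; half of this leaves room for the moments of
    orders \<open>b - \<delta>\<close> and \<open>b + \<delta>\<close>.\<close>
  define \<delta> where "\<delta> = (?d - \<sigma>) / 4"
  have \<delta>: "0 < \<delta>" "\<sigma> < b - \<delta>" "b + \<delta> < ?d" using \<sigma> by (auto simp: b \<delta>_def field_simps)
  obtain B where B: "\<And>x :: int ^ 'd. rmom (b + \<delta>) x * rmom (b - \<delta>) x \<le> B * (rmom b x)\<^sup>2"
    using rmom_ratio_bounded[of b \<delta>, where 'd = 'd] \<delta> \<sigma>_pos by auto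
  obtain C where C: "1 \<le> C" "\<And>a. 0 < a \<Longrightarrow> a < ?d \<Longrightarrow> mom a (0 :: int ^ 'd) \<le> ennreal (1 / a + C / (?d - a))"
    using mom_0_bound[where 'd = 'd] by blast
  define K where "K = 8 * (1 + B) / \<delta>\<^sup>2"
  \<comment> \<open>An upper bound for the energy of \<open>rmom (b - \<epsilon>)\<close>, from
    \<open>wsum_wsa\<close> and \<open>mom_0_bound\<close> at order
    \<open>?d - 2 * \<epsilon>\<close>.\<close>
  define t where "t \<epsilon> = (Gamma (b - \<epsilon>))\<^sup>2 / Gamma (?d - 2 * \<epsilon>) * (1 / (?d - 2 * \<epsilon>) + C / (2 * \<epsilon>))" for \<epsilon>
  have main: "(w' x - wsa \<sigma> b x) * (rmom (b - \<epsilon>) x)\<^sup>2 \<le> K * \<epsilon>\<^sup>2 * t \<epsilon>"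
    if \<epsilon>: "0 < \<epsilon>" "2 * \<epsilon> \<le> \<delta>" "K * \<epsilon>\<^sup>2 \<le> 1" for \<epsilon> x
  proof -
    let ?u = "rmom (b - \<epsilon>) :: int ^ 'd \<Rightarrow> real"
    let ?T = "wsum (wsa \<sigma> (b - \<epsilon>)) ?u" and ?D = "(w' x - wsa \<sigma> b x) * (rmom (b - \<epsilon>) x)\<^sup>2"
    have r': "\<sigma> < b - \<epsilon>" "b - \<epsilon> < ?d" "0 < ?d - 2 * \<epsilon>" "?d - 2 * \<epsilon> < ?d" using r \<epsilon> \<delta> \<sigma>_pos by auto
    have s: "2 * (b - \<epsilon>) - \<sigma> = ?d - 2 * \<epsilon>" by (simp add: b field_simps)
    have G: "0 < Gamma (?d - 2 * \<epsilon>)" using r' by (intro Gamma_real_pos)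
    have "?T \<le> ennreal ((Gamma (b - \<epsilon>))\<^sup>2 / Gamma (?d - 2 * \<epsilon>)) * ennreal (1 / (?d - 2 * \<epsilon>) + C / (?d - (?d - 2 * \<epsilon>)))"
      unfolding wsum_wsa[OF r'(1,2)] s by (intro mult_left_mono C r') auto
    also have "\<dots> = ennreal (t \<epsilon>)"
      unfolding t_def using G r' \<epsilon> C(1) by (subst ennreal_mult) auto
    finally have Tt: "?T \<le> ennreal (t \<epsilon>)" .
    then obtain T where T: "?T = ennreal T" "0 \<le> T"
      by (cases ?T) (auto simp: top_unique)
    have t0: "0 \<le> t \<epsilon>" unfolding t_def using G r' \<epsilon> C(1) by (intro mult_nonneg_nonneg add_nonneg_nonneg) auto
    have "ennreal (1 - K * \<epsilon>\<^sup>2) * ?T \<le> wsum (wsa \<sigma> b) ?u"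
      unfolding K_def using \<epsilon> \<delta> B by (intro wsum_wsa_lower \<sigma> b) (auto simp: K_def)
    hence "ennreal (1 - K * \<epsilon>\<^sup>2) * ?T + ennreal ?D \<le> wsum (wsa \<sigma> b) ?u + ennreal ?D" by (rule add_right_mono)
    also have "\<dots> \<le> wsum w' ?u" by (intro wsum_increase_at w' wsa_nonneg r)
    also have "\<dots> \<le> ?T" by (rule wsa_energy(2)[OF r'(1,2) w'(1)])
    finally have "ennreal ((1 - K * \<epsilon>\<^sup>2) * T + ?D) \<le> ennreal T"
      unfolding T using \<epsilon> T w'(2)[of x] by (simp add: ennreal_mult)
    hence "(1 - K * \<epsilon>\<^sup>2) * T + ?D \<le> T" using T by simp
    hence 1: "?D \<le> K * \<epsilon>\<^sup>2 * T" by (simp add: left_diff_distrib)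
    have "0 \<le> B * (rmom b (0 :: int ^ 'd))\<^sup>2" by (rule order_trans[OF _ B[of 0]]) (simp add: rmom_def)
    hence "0 \<le> B" using rmom_pos[of b "0 :: int ^ 'd"] r \<sigma>_pos by (simp add: zero_le_mult_iff)
    hence "0 \<le> K" by (simp add: K_def)
    moreover have "T \<le> t \<epsilon>" using Tt T t0 by simp
    ultimately have "K * \<epsilon>\<^sup>2 * T \<le> K * \<epsilon>\<^sup>2 * t \<epsilon>" by (intro mult_left_mono) auto
    thus ?thesis using 1 by linarith
  qed
  have "w' x \<le> wsa \<sigma> b x" for x
  proof -
    \<comment> \<open>Jensen's inequality bounds \<open>rmom (b - \<epsilon>) x\<close> below by a
      quantity converging to \<open>rmom b x\<close>; this takes the place of continuity of the
      moment in its order.\<close>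
    define Y where "Y = rmom (b + \<delta>) x / rmom b x"
    have ub: "0 < rmom b x" "0 < rmom (b + \<delta>) x" using r \<delta> \<sigma>_pos by (auto intro!: rmom_pos)
    have Y: "0 < Y" using ub by (simp add: Y_def)
    have "((\<lambda>\<epsilon>. (w' x - wsa \<sigma> b x) * (Y powr (- \<epsilon> / \<delta>) * rmom b x)\<^sup>2)
      \<longlongrightarrow> (w' x - wsa \<sigma> b x) * (Y powr (- 0 / \<delta>) * rmom b x)\<^sup>2) (at_right 0)"
      using Y \<delta> by (intro tendsto_intros) auto
    hence lim1: "((\<lambda>\<epsilon>. (w' x - wsa \<sigma> b x) * (Y powr (- \<epsilon> / \<delta>) * rmom b x)\<^sup>2)
      \<longlongrightarrow> (w' x - wsa \<sigma> b x) * (rmom b x)\<^sup>2) (at_right 0)" using Y by simp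
    have "((\<lambda>\<epsilon>. K * (Gamma (b - \<epsilon>))\<^sup>2 / Gamma (?d - 2 * \<epsilon>) * (\<epsilon>\<^sup>2 / (?d - 2 * \<epsilon>) + C * \<epsilon> / 2))
      \<longlongrightarrow> K * (Gamma (b - 0))\<^sup>2 / Gamma (?d - 2 * 0) * (0\<^sup>2 / (?d - 2 * 0) + C * 0 / 2)) (at_right 0)"
      using r \<sigma>_pos Gamma_real_pos[of ?d] by (intro tendsto_intros) (auto intro!: not_nonpos_Int simp del: Gamma_real_pos)
    hence lim2: "((\<lambda>\<epsilon>. K * (Gamma (b - \<epsilon>))\<^sup>2 / Gamma (?d - 2 * \<epsilon>) * (\<epsilon>\<^sup>2 / (?d - 2 * \<epsilon>) + C * \<epsilon> / 2)) \<longlongrightarrow> 0) (at_right 0)"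
      by simp
    have "((\<lambda>\<epsilon>. K * \<epsilon>\<^sup>2) \<longlongrightarrow> K * 0\<^sup>2) (at_right 0)" by (intro tendsto_intros)
    hence "((\<lambda>\<epsilon>. K * \<epsilon>\<^sup>2) \<longlongrightarrow> 0) (at_right 0)" by simp
    hence "\<forall>\<^sub>F \<epsilon> in at_right 0. K * \<epsilon>\<^sup>2 < 1" by (rule order_tendstoD) simp
    moreover have "\<forall>\<^sub>F \<epsilon> in at_right 0. \<epsilon> < \<delta> / 2" using \<delta> by (intro order_tendstoD(2)[OF tendsto_ident_at]) auto
    moreover have "\<forall>\<^sub>F \<epsilon> in at_right 0. 0 < (\<epsilon> :: real)" by (rule eventually_at_right_less)
    ultimately have "\<forall>\<^sub>F \<epsilon> in at_right 0. (w' x - wsa \<sigma> b x) * (Y powr (- \<epsilon> / \<delta>) * rmom b x)\<^sup>2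
       \<le> K * (Gamma (b - \<epsilon>))\<^sup>2 / Gamma (?d - 2 * \<epsilon>) * (\<epsilon>\<^sup>2 / (?d - 2 * \<epsilon>) + C * \<epsilon> / 2)"
    proof eventually_elim
      case (elim \<epsilon>)
      have "Y powr (- \<epsilon> / \<delta>) * rmom b x \<le> rmom (b - \<epsilon>) x"
        unfolding Y_def using elim \<delta> \<sigma>_pos by (intro rmom_jensen) auto
      hence "(w' x - wsa \<sigma> b x) * (Y powr (- \<epsilon> / \<delta>) * rmom b x)\<^sup>2 \<le> (w' x - wsa \<sigma> b x) * (rmom (b - \<epsilon>) x)\<^sup>2"
        using w'(2)[of x] ub by (intro mult_left_mono power_mono) auto
      also have "\<dots> \<le> K * \<epsilon>\<^sup>2 * t \<epsilon>" using elim by (intro main) auto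
      also have "\<dots> = K * (Gamma (b - \<epsilon>))\<^sup>2 / Gamma (?d - 2 * \<epsilon>) * (\<epsilon>\<^sup>2 / (?d - 2 * \<epsilon>) + C * \<epsilon> / 2)"
      proof -
        have "K * \<epsilon>\<^sup>2 * (g / h * (1 / s + C / (2 * \<epsilon>))) = K * g / h * (\<epsilon>\<^sup>2 / s + C * \<epsilon> / 2)" for g h s
          using elim(3) by (simp add: distrib_left power2_eq_square mult_ac)
        thus ?thesis unfolding t_def .
      qed
      finally show ?case .
    qed
    from tendsto_le[OF _ lim2 lim1 this]
    have "(w' x - wsa \<sigma> b x) * (rmom b x)\<^sup>2 \<le> 0" by simp
    thus ?thesis using ub by (simp add: mult_le_0_iff)
  qed
  thus "w' = wsa \<sigma> b" using w'(2) by (intro ext antisym)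
qed

lemma not_positive_critical_wsa:
  assumes \<sigma>: "\<sigma> < real CARD('d) / 2" and b: "b = (real CARD('d) / 2 + \<sigma>) / 2"
  shows "\<not> positive_critical \<sigma> (wsa \<sigma> b :: int ^ 'd \<Rightarrow> real)"
proof
  have r: "\<sigma> < b" "b < real CARD('d) / 2" using \<sigma> by (auto simp: b)
  assume "positive_critical \<sigma> (wsa \<sigma> b :: int ^ 'd \<Rightarrow> real)"
  then obtain v where v: "v \<in> D0 \<sigma>" "v \<noteq> (\<lambda>x. 0)" "Qform \<sigma> v = wsum (wsa \<sigma> b) (v :: int ^ 'd \<Rightarrow> real)"
    unfolding positive_critical_def by blast
  define c where "c = v 0 / rmom b (0 :: int ^ 'd)"
  have u: "\<And>x :: int ^ 'd. 0 < rmom b x" using r \<sigma>_pos by (auto intro!: rmom_pos)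
  have *: "Qform \<sigma> v < top \<and> v x = c * rmom b x" for x
    unfolding c_def using ground_state_unique[OF u wsa_nonneg[OF r] wsa_equation[OF r] v(1,3)] .
  hence "c \<noteq> 0" using v(2) by (auto simp: fun_eq_iff)
  have "wsum (wsa \<sigma> b) v = (\<integral>\<^sup>+x. ennreal (c\<^sup>2) * ennreal (wsa \<sigma> b x * (rmom b x)\<^sup>2) \<partial>count_space (UNIV :: (int ^ 'd) set))"
    unfolding wsum_nn
  proof (rule nn_integral_cong)
    fix x :: "int ^ 'd"
    have "v x = c * rmom b x" using * by blast
    hence "wsa \<sigma> b x * (v x)\<^sup>2 = c\<^sup>2 * (wsa \<sigma> b x * (rmom b x)\<^sup>2)" by (simp add: power_mult_distrib)
    thus "ennreal (wsa \<sigma> b x * (v x)\<^sup>2) = ennreal (c\<^sup>2) * ennreal (wsa \<sigma> b x * (rmom b x)\<^sup>2)"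
      by (simp only: ennreal_mult' zero_le_power2)
  qed
  also have "\<dots> = ennreal (c\<^sup>2) * wsum (wsa \<sigma> b) (rmom b :: int ^ 'd \<Rightarrow> real)"
    unfolding wsum_nn by (rule nn_integral_cmult) simp
  also have "\<dots> = top"
  proof -
    have s: "2 * b - \<sigma> = real CARD('d) / 2" by (simp add: b field_simps)
    define p where "p = (Gamma b)\<^sup>2 / Gamma (real CARD('d) / 2)"
    have "0 < p" unfolding p_def using r \<sigma>_pos by (intro divide_pos_pos zero_less_power Gamma_real_pos) auto
    thus ?thesis unfolding wsum_wsa[OF r] s mom_critical_infinite p_def[symmetric]
      using \<open>c \<noteq> 0\<close> by (simp add: ennreal_mult_top)
  qed
  finally show False using * v(3) by simp
qed

end

theorem theorem3p4:
  fixes \<sigma> \<alpha> :: real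
  assumes "0 < \<sigma>" and "\<sigma> \<le> 1"
    and "CARD('d::finite) \<in> {1, 2} \<longrightarrow> \<sigma> < real CARD('d) / 2"
    and "\<sigma> < \<alpha>" and "\<alpha> < real CARD('d) / 2"
  shows "null_critical \<sigma> (wsa \<sigma> \<alpha> :: int ^ 'd \<Rightarrow> real)
         \<longleftrightarrow> \<alpha> = (real CARD('d) / 2 + \<sigma>) / 2"
proof -
  interpret jump_kernel \<sigma> "TYPE('d)"
    using assms ktot_finite[of \<sigma> \<alpha>, where 'd = 'd] by unfold_locales auto
  have \<sigma>: "\<sigma> < real CARD('d) / 2" using assms by simp
  consider "\<alpha> < (real CARD('d) / 2 + \<sigma>) / 2" | "\<alpha> = (real CARD('d) / 2 + \<sigma>) / 2" | "(real CARD('d) / 2 + \<sigma>) / 2 < \<alpha>"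
    by linarith
  thus ?thesis
  proof cases
    case 1
    thus ?thesis using not_null_critical_below[OF assms(4)] by blast
  next
    case 2
    thus ?thesis using critical_wsa[OF \<sigma>] not_positive_critical_wsa[OF \<sigma>] unfolding null_critical_def by blast
  next
    case 3
    thus ?thesis using not_critical_above[OF _ assms(5)] unfolding null_critical_def by blast
  qed
qed

end
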